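(* Let $\mathcal V$ be a closed symmetric monoidal Grothendieck category, let $\mathcal C$ be a small $\mathcal V$-category and let $\mathcal A$ be a full $\mathcal V$-subcategory of $\mathcal C$. Define the localizing subcategory $\mathcal S_{\mathcal A}:=\{Y\in[\mathcal C,\mathcal V]\mid Y(a)=0\text{ for all }a\in\mathcal A\}\subset[\mathcal C,\mathcal V]$. Then there is a recollement of the Abelian category $[\mathcal C,\mathcal V]$ by the Abelian categories $\mathcal S_{\mathcal A}$ and $[\mathcal A,\mathcal V]$, $$\mathcal S_{\mathcal A}\xrightarrow{\ i\ }[\mathcal C,\mathcal V]\xrightarrow{\ r\ }[\mathcal A,\mathcal V],$$ with adjoint triples $i_L\dashv i\dashv i_R$ and $r_L\dashv r\dashv r_R$, where $i$ is the canonical inclusion, $r$ is the restriction functor $X\mapsto X|_{\mathcal A}$, the functors $r_L$ and $r_R$ are respectively the enriched left and right Kan extension along the inclusion $\mathcal A\hookrightarrow\mathcal C$, and $i_R$ is the torsion functor associated with the localizing subcategory $\mathcal S_{\mathcal A}$.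
   Context: $\mathcal V$ is a Grothendieck category with a closed symmetric monoidal structure $(\otimes,[-,-],e)$. For a small $\mathcal V$-category $\mathcal C$ with hom-objects $\mathcal V_{\mathcal C}(a,b)\in\mathcal V$, $[\mathcal C,\mathcal V]$ denotes the category of $\mathcal V$-functors $\mathcal C\to\mathcal V$ and $\mathcal V$-natural transformations; it is a Grothendieck category with limits and colimits computed pointwise. For $X\in[\mathcal C,\mathcal V]$ and $v\in\mathcal V$, $X\oslash v$ is the $\mathcal V$-functor $c\mapsto X(c)\otimes v$. A full $\mathcal V$-subcategory $\mathcal A\subset\mathcal C$ is given by a subcollection of the objects of $\mathcal C$ with $\mathcal V_{\mathcal A}(a,b)=\mathcal V_{\mathcal C}(a,b)$. The enriched Kan extensions are $r_L(F)=\int^{a\in\mathcal A}\mathcal V_{\mathcal C}(a,-)\oslash F(a)$ and $r_R(H)=\int_{b\in\mathcal A}[\mathcal V_{\mathcal C}(-,b),H(b)]$. A localizing (Serre) subcategory of a Grothendieck category is a full subcategory closed under subobjects, quotient objects, extensions and arbitrary direct sums. Its torsion functor sends an object to its largest subobject belonging to the subcategory. A recollement of an Abelian category $\mathcal M$ by Abelian categories $\mathcal B$ and $\mathcal N$ consists of additive functors $i:\mathcal B\to\mathcal M$, $i_L,i_R:\mathcal M\to\mathcal B$, $r:\mathcal M\to\mathcal N$, $r_L,r_R:\mathcal N\to\mathcal M$ such that $i_L\dashv i\dashv i_R$ and $r_L\dashv r\dashv r_R$ are adjoint triples (each functor left adjoint to the next), $i,r_L,r_R$ are fully faithful, and $\operatorname{Im}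 i=\operatorname{Ker} r$. *)

theory Defs
  imports "HOL-Library.FuncSet"
begin

unbundle cardinal_syntax

section \<open>Smallness\<close>

text \<open>
  A set counts as small if its cardinality is below a fixed infinite, regular, strong limit cardinal
  \<open>\<kappa>\<close>; for uncountable \<open>\<kappa>\<close> this is membership, up to bijection, in a Grothendieck universe.  The
  countable case is not excluded, since HOL does not prove that inaccessible cardinals exist.
\<close>

definition universe :: "'k rel \<Rightarrow> bool" where
  "universe \<kappa> \<longleftrightarrow> Card_order \<kappa> \<and> cinfinite \<kappa> \<and> regularCard \<kappa> \<and>
     (\<forall>X \<subseteq> Field \<kappa>. |X| <o \<kappa> \<longrightarrow> |Pow X| <o \<kappa>)"

definition small :: "'k rel \<Rightarrow> 'a set \<Rightarrow> bool" where
  "small \<kappa> X \<longleftrightarrow> |X| <o \<kappa>"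


section \<open>Categories, functors, adjunctions\<close>

record ('o, 'm) cat =
  Obj :: "'o set"
  Arr :: "'m set"
  Dom :: "'m \<Rightarrow> 'o"
  Cod :: "'m \<Rightarrow> 'o"
  Idn :: "'o \<Rightarrow> 'm"
  Comp :: "'m \<Rightarrow> 'm \<Rightarrow> 'm" (infixr "\<cdot>\<index>" 70)

definition Hom :: "('o, 'm, 'z) cat_scheme \<Rightarrow> 'o \<Rightarrow> 'o \<Rightarrow> 'm set" where
  "Hom C x y = {f \<in> Arr C. Dom C f = x \<and> Cod C f = y}"

definition category :: "('o, 'm, 'z) cat_scheme \<Rightarrow> bool" where
  "category C \<longleftrightarrow>
     (\<forall>f \<in> Arr C. Dom C f \<in> Obj C \<and> Cod C f \<in> Obj C) \<and>
     (\<forall>x \<in> Obj C. Idn C x \<in> Hom C x x) \<and>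
     (\<forall>f \<in> Arr C. \<forall>g \<in> Arr C. Cod C f = Dom C g \<longrightarrow>
        g \<cdot>\<^bsub>C\<^esub> f \<in> Hom C (Dom C f) (Cod C g)) \<and>
     (\<forall>f \<in> Arr C. f \<cdot>\<^bsub>C\<^esub> Idn C (Dom C f) = f \<and> Idn C (Cod C f) \<cdot>\<^bsub>C\<^esub> f = f) \<and>
     (\<forall>f \<in> Arr C. \<forall>g \<in> Arr C. \<forall>h \<in> Arr C. Cod C f = Dom C g \<and> Cod C g = Dom C h \<longrightarrow>
        (h \<cdot>\<^bsub>C\<^esub> g) \<cdot>\<^bsub>C\<^esub> f = h \<cdot>\<^bsub>C\<^esub> (g \<cdot>\<^bsub>C\<^esub> f))"

definition mono_arr :: "('o, 'm, 'z) cat_scheme \<Rightarrow> 'm \<Rightarrow> bool" where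
  "mono_arr C m \<longleftrightarrow> m \<in> Arr C \<and>
     (\<forall>x \<in> Obj C. \<forall>f \<in> Hom C x (Dom C m). \<forall>g \<in> Hom C x (Dom C m).
        m \<cdot>\<^bsub>C\<^esub> f = m \<cdot>\<^bsub>C\<^esub> g \<longrightarrow> f = g)"

definition epi_arr :: "('o, 'm, 'z) cat_scheme \<Rightarrow> 'm \<Rightarrow> bool" where
  "epi_arr C e \<longleftrightarrow> e \<in> Arr C \<and>
     (\<forall>x \<in> Obj C. \<forall>f \<in> Hom C (Cod C e) x. \<forall>g \<in> Hom C (Cod C e) x.
        f \<cdot>\<^bsub>C\<^esub> e = g \<cdot>\<^bsub>C\<^esub> e \<longrightarrow> f = g)"

definition inverse_arrs :: "('o, 'm, 'z) cat_scheme \<Rightarrow> 'm \<Rightarrow> 'm \<Rightarrow> bool" where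
  "inverse_arrs C f g \<longleftrightarrow> f \<in> Arr C \<and> g \<in> Hom C (Cod C f) (Dom C f) \<and>
     g \<cdot>\<^bsub>C\<^esub> f = Idn C (Dom C f) \<and> f \<cdot>\<^bsub>C\<^esub> g = Idn C (Cod C f)"

definition iso_arr :: "('o, 'm, 'z) cat_scheme \<Rightarrow> 'm \<Rightarrow> bool" where
  "iso_arr C f \<longleftrightarrow> (\<exists>g. inverse_arrs C f g)"

definition inv_arr :: "('o, 'm, 'z) cat_scheme \<Rightarrow> 'm \<Rightarrow> 'm" where
  "inv_arr C f = (THE g. inverse_arrs C f g)"

definition isomorphic :: "('o, 'm, 'z) cat_scheme \<Rightarrow> 'o \<Rightarrow> 'o \<Rightarrow> bool" where
  "isomorphic C x y \<longleftrightarrow> (\<exists>f \<in> Hom C x y. iso_arr C f)"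

definition zero_object :: "('o, 'm, 'z) cat_scheme \<Rightarrow> 'o \<Rightarrow> bool" where
  "zero_object C z \<longleftrightarrow> z \<in> Obj C \<and>
     (\<forall>x \<in> Obj C. (\<exists>!f. f \<in> Hom C x z) \<and> (\<exists>!f. f \<in> Hom C z x))"

definition full_subcat :: "('o, 'm, 'z) cat_scheme \<Rightarrow> 'o set \<Rightarrow> ('o, 'm, 'z) cat_scheme" where
  "full_subcat C S =
     C\<lparr>Obj := Obj C \<inter> S, Arr := {f \<in> Arr C. Dom C f \<in> S \<and> Cod C f \<in> S}\<rparr>"

record ('o1, 'm1, 'o2, 'm2) cfunctor =
  FObj :: "'o1 \<Rightarrow> 'o2"
  FArr :: "'m1 \<Rightarrow> 'm2"

definition is_functor ::
  "('o1, 'm1, 'y) cat_scheme \<Rightarrow> ('o2, 'm2, 'z) cat_scheme \<Rightarrow>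
   ('o1, 'm1, 'o2, 'm2) cfunctor \<Rightarrow> bool" where
  "is_functor C D F \<longleftrightarrow>
     (\<forall>x \<in> Obj C. FObj F x \<in> Obj D) \<and>
     (\<forall>f \<in> Arr C. FArr F f \<in> Hom D (FObj F (Dom C f)) (FObj F (Cod C f))) \<and>
     (\<forall>x \<in> Obj C. FArr F (Idn C x) = Idn D (FObj F x)) \<and>
     (\<forall>f \<in> Arr C. \<forall>g \<in> Arr C. Cod C f = Dom C g \<longrightarrow>
        FArr F (g \<cdot>\<^bsub>C\<^esub> f) = FArr F g \<cdot>\<^bsub>D\<^esub> FArr F f)"

definition natural_transformation ::
  "('o1, 'm1, 'y) cat_scheme \<Rightarrow> ('o2, 'm2, 'z) cat_scheme \<Rightarrow>
   ('o1, 'm1, 'o2, 'm2) cfunctor \<Rightarrow> ('o1, 'm1, 'o2, 'm2) cfunctor \<Rightarrow> ('o1 \<Rightarrow> 'm2) \<Rightarrow> bool" where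
  "natural_transformation C D F G t \<longleftrightarrow>
     (\<forall>x \<in> Obj C. t x \<in> Hom D (FObj F x) (FObj G x)) \<and>
     (\<forall>f \<in> Arr C. t (Cod C f) \<cdot>\<^bsub>D\<^esub> FArr F f = FArr G f \<cdot>\<^bsub>D\<^esub> t (Dom C f))"

definition fully_faithful ::
  "('o1, 'm1, 'y) cat_scheme \<Rightarrow> ('o2, 'm2, 'z) cat_scheme \<Rightarrow>
   ('o1, 'm1, 'o2, 'm2) cfunctor \<Rightarrow> bool" where
  "fully_faithful C D F \<longleftrightarrow>
     (\<forall>x \<in> Obj C. \<forall>y \<in> Obj C. bij_betw (FArr F) (Hom C x y) (Hom D (FObj F x) (FObj F y)))"

definition inclusion_functor :: "('o, 'm, 'o, 'm) cfunctor" where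
  "inclusion_functor = \<lparr>FObj = (\<lambda>x. x), FArr = (\<lambda>f. f)\<rparr>"

definition left_adjoint ::
  "('o1, 'm1, 'y) cat_scheme \<Rightarrow> ('o2, 'm2, 'z) cat_scheme \<Rightarrow>
   ('o1, 'm1, 'o2, 'm2) cfunctor \<Rightarrow> ('o2, 'm2, 'o1, 'm1) cfunctor \<Rightarrow> bool" where
  "left_adjoint C D F G \<longleftrightarrow> is_functor C D F \<and> is_functor D C G \<and>
     (\<exists>\<phi>. (\<forall>x \<in> Obj C. \<forall>y \<in> Obj D.
              bij_betw (\<phi> x y) (Hom D (FObj F x) y) (Hom C x (FObj G y))) \<and>
           (\<forall>x \<in> Obj C. \<forall>x' \<in> Obj C. \<forall>y \<in> Obj D. \<forall>y' \<in> Obj D.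
            \<forall>f \<in> Hom C x' x. \<forall>g \<in> Hom D (FObj F x) y. \<forall>h \<in> Hom D y y'.
              \<phi> x' y' (h \<cdot>\<^bsub>D\<^esub> g \<cdot>\<^bsub>D\<^esub> FArr F f) = FArr G h \<cdot>\<^bsub>C\<^esub> \<phi> x y g \<cdot>\<^bsub>C\<^esub> f))"


section \<open>Limits and colimits\<close>

definition is_binary_product ::
  "('o, 'm, 'z) cat_scheme \<Rightarrow> 'o \<Rightarrow> 'o \<Rightarrow> 'o \<Rightarrow> 'm \<Rightarrow> 'm \<Rightarrow> bool" where
  "is_binary_product C x y p \<pi>1 \<pi>2 \<longleftrightarrow> p \<in> Obj C \<and> \<pi>1 \<in> Hom C p x \<and> \<pi>2 \<in> Hom C p y \<and>
     (\<forall>w \<in> Obj C. \<forall>f \<in> Hom C w x. \<forall>g \<in> Hom C w y.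
        \<exists>!u. u \<in> Hom C w p \<and> \<pi>1 \<cdot>\<^bsub>C\<^esub> u = f \<and> \<pi>2 \<cdot>\<^bsub>C\<^esub> u = g)"

definition is_coproduct ::
  "('o, 'm, 'z) cat_scheme \<Rightarrow> 'i set \<Rightarrow> ('i \<Rightarrow> 'o) \<Rightarrow> 'o \<Rightarrow> ('i \<Rightarrow> 'm) \<Rightarrow> bool" where
  "is_coproduct C I X P \<iota> \<longleftrightarrow> P \<in> Obj C \<and> (\<forall>i \<in> I. \<iota> i \<in> Hom C (X i) P) \<and>
     (\<forall>w \<in> Obj C. \<forall>f. (\<forall>i \<in> I. f i \<in> Hom C (X i) w) \<longrightarrow>
        (\<exists>!u. u \<in> Hom C P w \<and> (\<forall>i \<in> I. u \<cdot>\<^bsub>C\<^esub> \<iota> i = f i)))"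

definition is_cocone ::
  "('j, 'n, 'y) cat_scheme \<Rightarrow> ('o, 'm, 'z) cat_scheme \<Rightarrow> ('j, 'n, 'o, 'm) cfunctor \<Rightarrow>
   'o \<Rightarrow> ('j \<Rightarrow> 'm) \<Rightarrow> bool" where
  "is_cocone J C D w \<iota> \<longleftrightarrow> w \<in> Obj C \<and> (\<forall>j \<in> Obj J. \<iota> j \<in> Hom C (FObj D j) w) \<and>
     (\<forall>u \<in> Arr J. \<iota> (Cod J u) \<cdot>\<^bsub>C\<^esub> FArr D u = \<iota> (Dom J u))"

definition is_colimit ::
  "('j, 'n, 'y) cat_scheme \<Rightarrow> ('o, 'm, 'z) cat_scheme \<Rightarrow> ('j, 'n, 'o, 'm) cfunctor \<Rightarrow>
   'o \<Rightarrow> ('j \<Rightarrow> 'm) \<Rightarrow> bool" where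
  "is_colimit J C D x \<iota> \<longleftrightarrow> is_cocone J C D x \<iota> \<and>
     (\<forall>w f. is_cocone J C D w f \<longrightarrow>
        (\<exists>!u. u \<in> Hom C x w \<and> (\<forall>j \<in> Obj J. u \<cdot>\<^bsub>C\<^esub> \<iota> j = f j)))"

definition filtered :: "('o, 'm, 'z) cat_scheme \<Rightarrow> bool" where
  "filtered J \<longleftrightarrow> Obj J \<noteq> {} \<and>
     (\<forall>x \<in> Obj J. \<forall>y \<in> Obj J. \<exists>z \<in> Obj J. Hom J x z \<noteq> {} \<and> Hom J y z \<noteq> {}) \<and>
     (\<forall>x \<in> Obj J. \<forall>y \<in> Obj J. \<forall>f \<in> Hom J x y. \<forall>g \<in> Hom J x y.
        \<exists>z \<in> Obj J. \<exists>h \<in> Hom J y z. h \<cdot>\<^bsub>J\<^esub> f = h \<cdot>\<^bsub>J\<^esub> g)"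


section \<open>Abelian and Grothendieck categories\<close>

record ('o, 'm) addcat = "('o, 'm) cat" +
  Add :: "'m \<Rightarrow> 'm \<Rightarrow> 'm" (infixl "\<oplus>\<index>" 65)

definition preadditive :: "('o, 'm, 'z) addcat_scheme \<Rightarrow> bool" where
  "preadditive C \<longleftrightarrow> category C \<and>
     (\<forall>x \<in> Obj C. \<forall>y \<in> Obj C.
        (\<forall>f \<in> Hom C x y. \<forall>g \<in> Hom C x y. f \<oplus>\<^bsub>C\<^esub> g \<in> Hom C x y \<and> f \<oplus>\<^bsub>C\<^esub> g = g \<oplus>\<^bsub>C\<^esub> f) \<and>
        (\<forall>f \<in> Hom C x y. \<forall>g \<in> Hom C x y. \<forall>h \<in> Hom C x y.
           f \<oplus>\<^bsub>C\<^esub> g \<oplus>\<^bsub>C\<^esub> h = f \<oplus>\<^bsub>C\<^esub> (g \<oplus>\<^bsub>C\<^esub> h)) \<and>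
        (\<exists>z \<in> Hom C x y. \<forall>f \<in> Hom C x y.
           f \<oplus>\<^bsub>C\<^esub> z = f \<and> (\<exists>g \<in> Hom C x y. f \<oplus>\<^bsub>C\<^esub> g = z))) \<and>
     (\<forall>x \<in> Obj C. \<forall>y \<in> Obj C. \<forall>z \<in> Obj C.
        (\<forall>f \<in> Hom C x y. \<forall>g \<in> Hom C y z. \<forall>h \<in> Hom C y z.
           (g \<oplus>\<^bsub>C\<^esub> h) \<cdot>\<^bsub>C\<^esub> f = (g \<cdot>\<^bsub>C\<^esub> f) \<oplus>\<^bsub>C\<^esub> (h \<cdot>\<^bsub>C\<^esub> f)) \<and>
        (\<forall>f \<in> Hom C x y. \<forall>g \<in> Hom C x y. \<forall>h \<in> Hom C y z.
           h \<cdot>\<^bsub>C\<^esub> (f \<oplus>\<^bsub>C\<^esub> g) = (h \<cdot>\<^bsub>C\<^esub> f) \<oplus>\<^bsub>C\<^esub> (h \<cdot>\<^bsub>C\<^esub> g)))"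

definition zero_arr :: "('o, 'm, 'z) addcat_scheme \<Rightarrow> 'o \<Rightarrow> 'o \<Rightarrow> 'm" where
  "zero_arr C x y = (THE z. z \<in> Hom C x y \<and> (\<forall>f \<in> Hom C x y. f \<oplus>\<^bsub>C\<^esub> z = f))"

definition is_kernel :: "('o, 'm, 'z) addcat_scheme \<Rightarrow> 'm \<Rightarrow> 'm \<Rightarrow> bool" where
  "is_kernel C f k \<longleftrightarrow> f \<in> Arr C \<and> k \<in> Arr C \<and> Cod C k = Dom C f \<and>
     f \<cdot>\<^bsub>C\<^esub> k = zero_arr C (Dom C k) (Cod C f) \<and>
     (\<forall>h \<in> Arr C. Cod C h = Dom C f \<and> f \<cdot>\<^bsub>C\<^esub> h = zero_arr C (Dom C h) (Cod C f) \<longrightarrow>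
        (\<exists>!u. u \<in> Hom C (Dom C h) (Dom C k) \<and> k \<cdot>\<^bsub>C\<^esub> u = h))"

definition is_cokernel :: "('o, 'm, 'z) addcat_scheme \<Rightarrow> 'm \<Rightarrow> 'm \<Rightarrow> bool" where
  "is_cokernel C f q \<longleftrightarrow> f \<in> Arr C \<and> q \<in> Arr C \<and> Dom C q = Cod C f \<and>
     q \<cdot>\<^bsub>C\<^esub> f = zero_arr C (Dom C f) (Cod C q) \<and>
     (\<forall>h \<in> Arr C. Dom C h = Cod C f \<and> h \<cdot>\<^bsub>C\<^esub> f = zero_arr C (Dom C f) (Cod C h) \<longrightarrow>
        (\<exists>!u. u \<in> Hom C (Cod C q) (Cod C h) \<and> u \<cdot>\<^bsub>C\<^esub> q = h))"

definition abelian :: "('o, 'm, 'z) addcat_scheme \<Rightarrow> bool" where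
  "abelian C \<longleftrightarrow> preadditive C \<and>
     (\<exists>z. zero_object C z) \<and>
     (\<forall>x \<in> Obj C. \<forall>y \<in> Obj C. \<exists>p \<pi>1 \<pi>2. is_binary_product C x y p \<pi>1 \<pi>2) \<and>
     (\<forall>f \<in> Arr C. (\<exists>k. is_kernel C f k) \<and> (\<exists>q. is_cokernel C f q)) \<and>
     (\<forall>m. mono_arr C m \<longrightarrow> (\<exists>f. is_kernel C f m)) \<and>
     (\<forall>e. epi_arr C e \<longrightarrow> (\<exists>f. is_cokernel C f e))"

definition short_exact :: "('o, 'm, 'z) addcat_scheme \<Rightarrow> 'm \<Rightarrow> 'm \<Rightarrow> bool" where
  "short_exact C f g \<longleftrightarrow> is_kernel C g f \<and> is_cokernel C f g"

definition additive_functor ::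
  "('o1, 'm1, 'y) addcat_scheme \<Rightarrow> ('o2, 'm2, 'z) addcat_scheme \<Rightarrow>
   ('o1, 'm1, 'o2, 'm2) cfunctor \<Rightarrow> bool" where
  "additive_functor C D F \<longleftrightarrow> is_functor C D F \<and>
     (\<forall>x \<in> Obj C. \<forall>y \<in> Obj C. \<forall>f \<in> Hom C x y. \<forall>g \<in> Hom C x y.
        FArr F (f \<oplus>\<^bsub>C\<^esub> g) = FArr F f \<oplus>\<^bsub>D\<^esub> FArr F g)"

definition is_generator :: "('o, 'm, 'z) cat_scheme \<Rightarrow> 'o \<Rightarrow> bool" where
  "is_generator C u \<longleftrightarrow> u \<in> Obj C \<and>
     (\<forall>x \<in> Obj C. \<forall>y \<in> Obj C. \<forall>f \<in> Hom C x y. \<forall>g \<in> Hom C x y.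
        (\<forall>h \<in> Hom C u x. f \<cdot>\<^bsub>C\<^esub> h = g \<cdot>\<^bsub>C\<^esub> h) \<longrightarrow> f = g)"

text \<open>
  Every small index set or index category has an isomorphic copy with underlying type \<open>'k\<close>,
  so it suffices to quantify over index sets and categories of that type.
\<close>

definition exact_filtered_colimits :: "'k rel \<Rightarrow> ('o, 'm, 'z) addcat_scheme \<Rightarrow> bool" where
  "exact_filtered_colimits \<kappa> C \<longleftrightarrow>
     (\<forall>J :: ('k, 'k) cat. category J \<and> small \<kappa> (Arr J) \<and> filtered J \<longrightarrow>
       (\<forall>X Y Z f g x y z \<iota>x \<iota>y \<iota>z f' g'.
          is_functor J C X \<and> is_functor J C Y \<and> is_functor J C Z \<and>
          natural_transformation J C X Y f \<and> natural_transformation J C Y Z g \<and>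
          (\<forall>j \<in> Obj J. short_exact C (f j) (g j)) \<and>
          is_colimit J C X x \<iota>x \<and> is_colimit J C Y y \<iota>y \<and> is_colimit J C Z z \<iota>z \<and>
          f' \<in> Hom C x y \<and> (\<forall>j \<in> Obj J. f' \<cdot>\<^bsub>C\<^esub> \<iota>x j = \<iota>y j \<cdot>\<^bsub>C\<^esub> f j) \<and>
          g' \<in> Hom C y z \<and> (\<forall>j \<in> Obj J. g' \<cdot>\<^bsub>C\<^esub> \<iota>y j = \<iota>z j \<cdot>\<^bsub>C\<^esub> g j)
          \<longrightarrow> short_exact C f' g'))"

definition grothendieck :: "'k rel \<Rightarrow> ('o, 'm, 'z) addcat_scheme \<Rightarrow> bool" where
  "grothendieck \<kappa> C \<longleftrightarrow> abelian C \<and>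
     (\<forall>x \<in> Obj C. \<forall>y \<in> Obj C. small \<kappa> (Hom C x y)) \<and>
     (\<forall>(I :: 'k set) X. small \<kappa> I \<and> (\<forall>i \<in> I. X i \<in> Obj C) \<longrightarrow> (\<exists>P \<iota>. is_coproduct C I X P \<iota>)) \<and>
     exact_filtered_colimits \<kappa> C \<and>
     (\<exists>u. is_generator C u)"

definition localizing :: "'k rel \<Rightarrow> ('o, 'm, 'z) addcat_scheme \<Rightarrow> 'o set \<Rightarrow> bool" where
  "localizing \<kappa> M S \<longleftrightarrow> S \<subseteq> Obj M \<and>
     (\<forall>m. mono_arr M m \<and> Cod M m \<in> S \<longrightarrow> Dom M m \<in> S) \<and>
     (\<forall>e. epi_arr M e \<and> Dom M e \<in> S \<longrightarrow> Cod M e \<in> S) \<and>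
     (\<forall>f g. short_exact M f g \<and> Dom M f \<in> S \<and> Cod M g \<in> S \<longrightarrow> Cod M f \<in> S) \<and>
     (\<forall>(I :: 'k set) X P \<iota>. small \<kappa> I \<and> (\<forall>i \<in> I. X i \<in> S) \<and> is_coproduct M I X P \<iota> \<longrightarrow> P \<in> S)"

definition is_largest_subobject_in ::
  "('o, 'm, 'z) cat_scheme \<Rightarrow> 'o set \<Rightarrow> 'o \<Rightarrow> 'o \<Rightarrow> 'm \<Rightarrow> bool" where
  "is_largest_subobject_in M S x t \<tau> \<longleftrightarrow> t \<in> S \<and> \<tau> \<in> Hom M t x \<and> mono_arr M \<tau> \<and>
     (\<forall>m. mono_arr M m \<and> Cod M m = x \<and> Dom M m \<in> S \<longrightarrow>
        (\<exists>u \<in> Hom M (Dom M m) t. \<tau> \<cdot>\<^bsub>M\<^esub> u = m))"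

definition is_torsion_functor ::
  "('o, 'm, 'z) cat_scheme \<Rightarrow> 'o set \<Rightarrow> ('o, 'm, 'o, 'm) cfunctor \<Rightarrow> bool" where
  "is_torsion_functor M S T \<longleftrightarrow> is_functor M (full_subcat M S) T \<and>
     (\<exists>\<tau>. (\<forall>x \<in> Obj M. is_largest_subobject_in M S x (FObj T x) (\<tau> x)) \<and>
           (\<forall>f \<in> Arr M. \<tau> (Cod M f) \<cdot>\<^bsub>M\<^esub> FArr T f = f \<cdot>\<^bsub>M\<^esub> \<tau> (Dom M f)))"

text \<open>
  The image of the fully faithful functor \<open>i\<close> is its essential image, i.e. it is closed under
  isomorphism.
\<close>

definition recollement ::
  "('o, 'm, 'x) addcat_scheme \<Rightarrow> ('p, 'b, 'y) addcat_scheme \<Rightarrow> ('q, 'n, 'z) addcat_scheme \<Rightarrow>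
   ('p, 'b, 'o, 'm) cfunctor \<Rightarrow> ('o, 'm, 'p, 'b) cfunctor \<Rightarrow> ('o, 'm, 'p, 'b) cfunctor \<Rightarrow>
   ('o, 'm, 'q, 'n) cfunctor \<Rightarrow> ('q, 'n, 'o, 'm) cfunctor \<Rightarrow> ('q, 'n, 'o, 'm) cfunctor \<Rightarrow> bool"
where
  "recollement M B N i iL iR r rL rR \<longleftrightarrow>
     abelian M \<and> abelian B \<and> abelian N \<and>
     additive_functor B M i \<and> additive_functor M B iL \<and> additive_functor M B iR \<and>
     additive_functor M N r \<and> additive_functor N M rL \<and> additive_functor N M rR \<and>
     left_adjoint M B iL i \<and> left_adjoint B M i iR \<and>
     left_adjoint N M rL r \<and> left_adjoint M N r rR \<and>
     fully_faithful B M i \<and> fully_faithful N M rL \<and> fully_faithful N M rR \<and>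
     {x \<in> Obj M. \<exists>b \<in> Obj B. isomorphic M (FObj i b) x} = {x \<in> Obj M. zero_object N (FObj r x)}"


section \<open>Closed symmetric monoidal categories\<close>

record ('o, 'm) csmcat = "('o, 'm) addcat" +
  TenO :: "'o \<Rightarrow> 'o \<Rightarrow> 'o" (infixr "\<otimes>\<index>" 75)
  TenA :: "'m \<Rightarrow> 'm \<Rightarrow> 'm" (infixr "\<boxtimes>\<index>" 75)
  Unit :: 'o
  Assoc :: "'o \<Rightarrow> 'o \<Rightarrow> 'o \<Rightarrow> 'm"
  LUnit :: "'o \<Rightarrow> 'm"
  RUnit :: "'o \<Rightarrow> 'm"
  Sym :: "'o \<Rightarrow> 'o \<Rightarrow> 'm"
  IHom :: "'o \<Rightarrow> 'o \<Rightarrow> 'o"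
  Eval :: "'o \<Rightarrow> 'o \<Rightarrow> 'm"

definition monoidal :: "('o, 'm, 'z) csmcat_scheme \<Rightarrow> bool" where
  "monoidal V \<longleftrightarrow> category V \<and> Unit V \<in> Obj V \<and>
     (\<forall>x \<in> Obj V. \<forall>y \<in> Obj V. x \<otimes>\<^bsub>V\<^esub> y \<in> Obj V \<and> Idn V x \<boxtimes>\<^bsub>V\<^esub> Idn V y = Idn V (x \<otimes>\<^bsub>V\<^esub> y)) \<and>
     (\<forall>f \<in> Arr V. \<forall>g \<in> Arr V.
        f \<boxtimes>\<^bsub>V\<^esub> g \<in> Hom V (Dom V f \<otimes>\<^bsub>V\<^esub> Dom V g) (Cod V f \<otimes>\<^bsub>V\<^esub> Cod V g)) \<and>
     (\<forall>f \<in> Arr V. \<forall>f' \<in> Arr V. \<forall>g \<in> Arr V. \<forall>g' \<in> Arr V. Cod V f = Dom V f' \<and> Cod V g = Dom V g' \<longrightarrow>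
        (f' \<cdot>\<^bsub>V\<^esub> f) \<boxtimes>\<^bsub>V\<^esub> (g' \<cdot>\<^bsub>V\<^esub> g) = (f' \<boxtimes>\<^bsub>V\<^esub> g') \<cdot>\<^bsub>V\<^esub> (f \<boxtimes>\<^bsub>V\<^esub> g)) \<and>
     (\<forall>x \<in> Obj V. \<forall>y \<in> Obj V. \<forall>z \<in> Obj V.
        Assoc V x y z \<in> Hom V ((x \<otimes>\<^bsub>V\<^esub> y) \<otimes>\<^bsub>V\<^esub> z) (x \<otimes>\<^bsub>V\<^esub> (y \<otimes>\<^bsub>V\<^esub> z)) \<and>
        iso_arr V (Assoc V x y z)) \<and>
     (\<forall>f \<in> Arr V. \<forall>g \<in> Arr V. \<forall>h \<in> Arr V.
        Assoc V (Cod V f) (Cod V g) (Cod V h) \<cdot>\<^bsub>V\<^esub> ((f \<boxtimes>\<^bsub>V\<^esub> g) \<boxtimes>\<^bsub>V\<^esub> h) =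
        (f \<boxtimes>\<^bsub>V\<^esub> (g \<boxtimes>\<^bsub>V\<^esub> h)) \<cdot>\<^bsub>V\<^esub> Assoc V (Dom V f) (Dom V g) (Dom V h)) \<and>
     (\<forall>x \<in> Obj V.
        LUnit V x \<in> Hom V (Unit V \<otimes>\<^bsub>V\<^esub> x) x \<and> iso_arr V (LUnit V x) \<and>
        RUnit V x \<in> Hom V (x \<otimes>\<^bsub>V\<^esub> Unit V) x \<and> iso_arr V (RUnit V x)) \<and>
     (\<forall>f \<in> Arr V.
        LUnit V (Cod V f) \<cdot>\<^bsub>V\<^esub> (Idn V (Unit V) \<boxtimes>\<^bsub>V\<^esub> f) = f \<cdot>\<^bsub>V\<^esub> LUnit V (Dom V f) \<and>
        RUnit V (Cod V f) \<cdot>\<^bsub>V\<^esub> (f \<boxtimes>\<^bsub>V\<^esub> Idn V (Unit V)) = f \<cdot>\<^bsub>V\<^esub> RUnit V (Dom V f)) \<and>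
     (\<forall>w \<in> Obj V. \<forall>x \<in> Obj V. \<forall>y \<in> Obj V. \<forall>z \<in> Obj V.
        Assoc V w x (y \<otimes>\<^bsub>V\<^esub> z) \<cdot>\<^bsub>V\<^esub> Assoc V (w \<otimes>\<^bsub>V\<^esub> x) y z =
        (Idn V w \<boxtimes>\<^bsub>V\<^esub> Assoc V x y z) \<cdot>\<^bsub>V\<^esub> Assoc V w (x \<otimes>\<^bsub>V\<^esub> y) z \<cdot>\<^bsub>V\<^esub>
          (Assoc V w x y \<boxtimes>\<^bsub>V\<^esub> Idn V z)) \<and>
     (\<forall>x \<in> Obj V. \<forall>y \<in> Obj V.
        (Idn V x \<boxtimes>\<^bsub>V\<^esub> LUnit V y) \<cdot>\<^bsub>V\<^esub> Assoc V x (Unit V) y = RUnit V x \<boxtimes>\<^bsub>V\<^esub> Idn V y)"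

definition symmetric_monoidal :: "('o, 'm, 'z) csmcat_scheme \<Rightarrow> bool" where
  "symmetric_monoidal V \<longleftrightarrow> monoidal V \<and>
     (\<forall>x \<in> Obj V. \<forall>y \<in> Obj V. Sym V x y \<in> Hom V (x \<otimes>\<^bsub>V\<^esub> y) (y \<otimes>\<^bsub>V\<^esub> x) \<and>
        Sym V y x \<cdot>\<^bsub>V\<^esub> Sym V x y = Idn V (x \<otimes>\<^bsub>V\<^esub> y)) \<and>
     (\<forall>f \<in> Arr V. \<forall>g \<in> Arr V.
        Sym V (Cod V f) (Cod V g) \<cdot>\<^bsub>V\<^esub> (f \<boxtimes>\<^bsub>V\<^esub> g) = (g \<boxtimes>\<^bsub>V\<^esub> f) \<cdot>\<^bsub>V\<^esub> Sym V (Dom V f) (Dom V g)) \<and>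
     (\<forall>x \<in> Obj V. \<forall>y \<in> Obj V. \<forall>z \<in> Obj V.
        Assoc V y z x \<cdot>\<^bsub>V\<^esub> Sym V x (y \<otimes>\<^bsub>V\<^esub> z) \<cdot>\<^bsub>V\<^esub> Assoc V x y z =
        (Idn V y \<boxtimes>\<^bsub>V\<^esub> Sym V x z) \<cdot>\<^bsub>V\<^esub> Assoc V y x z \<cdot>\<^bsub>V\<^esub> (Sym V x y \<boxtimes>\<^bsub>V\<^esub> Idn V z)) \<and>
     (\<forall>x \<in> Obj V. LUnit V x \<cdot>\<^bsub>V\<^esub> Sym V x (Unit V) = RUnit V x)"

definition uncurry_arr :: "('o, 'm, 'z) csmcat_scheme \<Rightarrow> 'o \<Rightarrow> 'o \<Rightarrow> 'm \<Rightarrow> 'm" where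
  "uncurry_arr V y z g = Eval V y z \<cdot>\<^bsub>V\<^esub> (g \<boxtimes>\<^bsub>V\<^esub> Idn V y)"

definition closed_symmetric_monoidal :: "('o, 'm, 'z) csmcat_scheme \<Rightarrow> bool" where
  "closed_symmetric_monoidal V \<longleftrightarrow> symmetric_monoidal V \<and>
     (\<forall>y \<in> Obj V. \<forall>z \<in> Obj V. IHom V y z \<in> Obj V \<and> Eval V y z \<in> Hom V (IHom V y z \<otimes>\<^bsub>V\<^esub> y) z) \<and>
     (\<forall>x \<in> Obj V. \<forall>y \<in> Obj V. \<forall>z \<in> Obj V. \<forall>f \<in> Hom V (x \<otimes>\<^bsub>V\<^esub> y) z.
        \<exists>!g. g \<in> Hom V x (IHom V y z) \<and> uncurry_arr V y z g = f)"

definition curry_arr :: "('o, 'm, 'z) csmcat_scheme \<Rightarrow> 'o \<Rightarrow> 'o \<Rightarrow> 'o \<Rightarrow> 'm \<Rightarrow> 'm" where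
  "curry_arr V x y z f = (THE g. g \<in> Hom V x (IHom V y z) \<and> uncurry_arr V y z g = f)"

definition IHomA :: "('o, 'm, 'z) csmcat_scheme \<Rightarrow> 'm \<Rightarrow> 'm \<Rightarrow> 'm" where
  "IHomA V f g = curry_arr V (IHom V (Cod V f) (Dom V g)) (Dom V f) (Cod V g)
     (g \<cdot>\<^bsub>V\<^esub> Eval V (Cod V f) (Dom V g) \<cdot>\<^bsub>V\<^esub> (Idn V (IHom V (Cod V f) (Dom V g)) \<boxtimes>\<^bsub>V\<^esub> f))"


section \<open>Enriched categories and functors\<close>

record ('c, 'o, 'm) vcat =
  VObj :: "'c set"
  VHom :: "'c \<Rightarrow> 'c \<Rightarrow> 'o"
  VComp :: "'c \<Rightarrow> 'c \<Rightarrow> 'c \<Rightarrow> 'm"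
  VId :: "'c \<Rightarrow> 'm"

text \<open>The composition \<open>VComp C a b c\<close> is an arrow \<open>C(b,c) \<otimes> C(a,b) \<rightarrow> C(a,c)\<close>.\<close>

definition vcategory :: "('o, 'm, 'z) csmcat_scheme \<Rightarrow> ('c, 'o, 'm) vcat \<Rightarrow> bool" where
  "vcategory V C \<longleftrightarrow>
     (\<forall>a \<in> VObj C. \<forall>b \<in> VObj C. VHom C a b \<in> Obj V) \<and>
     (\<forall>a \<in> VObj C. VId C a \<in> Hom V (Unit V) (VHom C a a)) \<and>
     (\<forall>a \<in> VObj C. \<forall>b \<in> VObj C. \<forall>c \<in> VObj C.
        VComp C a b c \<in> Hom V (VHom C b c \<otimes>\<^bsub>V\<^esub> VHom C a b) (VHom C a c)) \<and>
     (\<forall>a \<in> VObj C. \<forall>b \<in> VObj C. \<forall>c \<in> VObj C. \<forall>d \<in> VObj C.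
        VComp C a b d \<cdot>\<^bsub>V\<^esub> (VComp C b c d \<boxtimes>\<^bsub>V\<^esub> Idn V (VHom C a b)) =
        VComp C a c d \<cdot>\<^bsub>V\<^esub> (Idn V (VHom C c d) \<boxtimes>\<^bsub>V\<^esub> VComp C a b c) \<cdot>\<^bsub>V\<^esub>
          Assoc V (VHom C c d) (VHom C b c) (VHom C a b)) \<and>
     (\<forall>a \<in> VObj C. \<forall>b \<in> VObj C.
        VComp C a b b \<cdot>\<^bsub>V\<^esub> (VId C b \<boxtimes>\<^bsub>V\<^esub> Idn V (VHom C a b)) = LUnit V (VHom C a b) \<and>
        VComp C a a b \<cdot>\<^bsub>V\<^esub> (Idn V (VHom C a b) \<boxtimes>\<^bsub>V\<^esub> VId C a) = RUnit V (VHom C a b))"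

definition full_vsubcat :: "('c, 'o, 'm) vcat \<Rightarrow> 'c set \<Rightarrow> ('c, 'o, 'm) vcat" where
  "full_vsubcat C A = C\<lparr>VObj := A\<rparr>"

definition self_vcat :: "('o, 'm, 'z) csmcat_scheme \<Rightarrow> ('o, 'o, 'm) vcat" where
  "self_vcat V =
     \<lparr>VObj = Obj V,
      VHom = IHom V,
      VComp = (\<lambda>x y z. curry_arr V (IHom V y z \<otimes>\<^bsub>V\<^esub> IHom V x y) x z
        (Eval V y z \<cdot>\<^bsub>V\<^esub> (Idn V (IHom V y z) \<boxtimes>\<^bsub>V\<^esub> Eval V x y) \<cdot>\<^bsub>V\<^esub>
           Assoc V (IHom V y z) (IHom V x y) x)),
      VId = (\<lambda>x. curry_arr V (Unit V) x x (LUnit V x))\<rparr>"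

record ('c, 'd, 'm) vfun =
  VMap :: "'c \<Rightarrow> 'd"
  VAct :: "'c \<Rightarrow> 'c \<Rightarrow> 'm"

text \<open>
  Enriched functors (and below enriched natural transformations) are extensional, i.e. undefined
  outside the objects of the source, so that equality in HOL is the intended equality.
\<close>

definition vfunctor ::
  "('o, 'm, 'z) csmcat_scheme \<Rightarrow> ('c, 'o, 'm) vcat \<Rightarrow> ('d, 'o, 'm) vcat \<Rightarrow>
   ('c, 'd, 'm) vfun \<Rightarrow> bool" where
  "vfunctor V C D F \<longleftrightarrow>
     VMap F \<in> extensional (VObj C) \<and> VAct F \<in> extensional (VObj C) \<and>
     (\<forall>a \<in> VObj C. VAct F a \<in> extensional (VObj C)) \<and>
     (\<forall>a \<in> VObj C. VMap F a \<in> VObj D) \<and>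
     (\<forall>a \<in> VObj C. \<forall>b \<in> VObj C. VAct F a b \<in> Hom V (VHom C a b) (VHom D (VMap F a) (VMap F b))) \<and>
     (\<forall>a \<in> VObj C. \<forall>b \<in> VObj C. \<forall>c \<in> VObj C.
        VAct F a c \<cdot>\<^bsub>V\<^esub> VComp C a b c =
        VComp D (VMap F a) (VMap F b) (VMap F c) \<cdot>\<^bsub>V\<^esub> (VAct F b c \<boxtimes>\<^bsub>V\<^esub> VAct F a b)) \<and>
     (\<forall>a \<in> VObj C. VAct F a a \<cdot>\<^bsub>V\<^esub> VId C a = VId D (VMap F a))"

record ('c, 'o, 'm) vnt =
  NDom :: "('c, 'o, 'm) vfun"
  NCod :: "('c, 'o, 'm) vfun"
  NMap :: "'c \<Rightarrow> 'm"

text \<open>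
  For \<open>V\<close>-valued functors, \<open>V\<close>-naturality is the equality of the two arrows
  \<open>C(a,b) \<rightarrow> [F a, G b]\<close>.
\<close>

definition vnatural ::
  "('o, 'm, 'z) csmcat_scheme \<Rightarrow> ('c, 'o, 'm) vcat \<Rightarrow> ('c, 'o, 'm) vnt \<Rightarrow> bool" where
  "vnatural V C t \<longleftrightarrow>
     vfunctor V C (self_vcat V) (NDom t) \<and> vfunctor V C (self_vcat V) (NCod t) \<and>
     NMap t \<in> extensional (VObj C) \<and>
     (\<forall>a \<in> VObj C. NMap t a \<in> Hom V (VMap (NDom t) a) (VMap (NCod t) a)) \<and>
     (\<forall>a \<in> VObj C. \<forall>b \<in> VObj C.
        IHomA V (Idn V (VMap (NDom t) a)) (NMap t b) \<cdot>\<^bsub>V\<^esub> VAct (NDom t) a b =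
        IHomA V (NMap t a) (Idn V (VMap (NCod t) b)) \<cdot>\<^bsub>V\<^esub> VAct (NCod t) a b)"

definition vfun_cat ::
  "('o, 'm, 'z) csmcat_scheme \<Rightarrow> ('c, 'o, 'm) vcat \<Rightarrow>
   (('c, 'o, 'm) vfun, ('c, 'o, 'm) vnt) addcat" where
  "vfun_cat V C =
     \<lparr>Obj = {F. vfunctor V C (self_vcat V) F},
      Arr = {t. vnatural V C t},
      Dom = NDom,
      Cod = NCod,
      Idn = (\<lambda>F. \<lparr>NDom = F, NCod = F, NMap = (\<lambda>a \<in> VObj C. Idn V (VMap F a))\<rparr>),
      Comp = (\<lambda>s t. \<lparr>NDom = NDom t, NCod = NCod s, NMap = (\<lambda>a \<in> VObj C. NMap s a \<cdot>\<^bsub>V\<^esub> NMap t a)\<rparr>),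
      Add = (\<lambda>s t. \<lparr>NDom = NDom s, NCod = NCod s, NMap = (\<lambda>a \<in> VObj C. NMap s a \<oplus>\<^bsub>V\<^esub> NMap t a)\<rparr>)\<rparr>"

definition vanishing ::
  "('o, 'm, 'z) csmcat_scheme \<Rightarrow> ('c, 'o, 'm) vcat \<Rightarrow> 'c set \<Rightarrow> ('c, 'o, 'm) vfun set" where
  "vanishing V C A = {Y \<in> Obj (vfun_cat V C). \<forall>a \<in> A. zero_object V (VMap Y a)}"

definition restrict_vfun :: "'c set \<Rightarrow> ('c, 'd, 'm) vfun \<Rightarrow> ('c, 'd, 'm) vfun" where
  "restrict_vfun A F = \<lparr>VMap = restrict (VMap F) A, VAct = (\<lambda>a \<in> A. restrict (VAct F a) A)\<rparr>"

definition restriction_functor ::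
  "'c set \<Rightarrow> (('c, 'o, 'm) vfun, ('c, 'o, 'm) vnt, ('c, 'o, 'm) vfun, ('c, 'o, 'm) vnt) cfunctor"
where
  "restriction_functor A =
     \<lparr>FObj = restrict_vfun A,
      FArr = (\<lambda>t. \<lparr>NDom = restrict_vfun A (NDom t), NCod = restrict_vfun A (NCod t),
                   NMap = restrict (NMap t) A\<rparr>)\<rparr>"


section \<open>Enriched Kan extensions\<close>

text \<open>The representable functor \<open>C(a,-)\<close>.\<close>

definition vrep ::
  "('o, 'm, 'z) csmcat_scheme \<Rightarrow> ('c, 'o, 'm) vcat \<Rightarrow> 'c \<Rightarrow> ('c, 'o, 'm) vfun" where
  "vrep V C a =
     \<lparr>VMap = (\<lambda>c \<in> VObj C. VHom C a c),
      VAct = (\<lambda>c \<in> VObj C. \<lambda>d \<in> VObj C.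
        curry_arr V (VHom C c d) (VHom C a c) (VHom C a d) (VComp C a c d))\<rparr>"

text \<open>The functor \<open>X \<oslash> v\<close>.\<close>

definition vtensor ::
  "('o, 'm, 'z) csmcat_scheme \<Rightarrow> ('c, 'o, 'm) vcat \<Rightarrow> ('c, 'o, 'm) vfun \<Rightarrow> 'o \<Rightarrow>
   ('c, 'o, 'm) vfun" where
  "vtensor V C X v =
     \<lparr>VMap = (\<lambda>c \<in> VObj C. VMap X c \<otimes>\<^bsub>V\<^esub> v),
      VAct = (\<lambda>c \<in> VObj C. \<lambda>d \<in> VObj C.
        curry_arr V (VHom C c d) (VMap X c \<otimes>\<^bsub>V\<^esub> v) (VMap X d \<otimes>\<^bsub>V\<^esub> v)
          ((uncurry_arr V (VMap X c) (VMap X d) (VAct X c d) \<boxtimes>\<^bsub>V\<^esub> Idn V v) \<cdot>\<^bsub>V\<^esub>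
             inv_arr V (Assoc V (VHom C c d) (VMap X c) v)))\<rparr>"

definition vtensor_arr ::
  "('o, 'm, 'z) csmcat_scheme \<Rightarrow> ('c, 'o, 'm) vcat \<Rightarrow> ('c, 'o, 'm) vfun \<Rightarrow> 'm \<Rightarrow>
   ('c, 'o, 'm) vnt" where
  "vtensor_arr V C X f =
     \<lparr>NDom = vtensor V C X (Dom V f), NCod = vtensor V C X (Cod V f),
      NMap = (\<lambda>c \<in> VObj C. Idn V (VMap X c) \<boxtimes>\<^bsub>V\<^esub> f)\<rparr>"

text \<open>The functor \<open>[v, X(-)]\<close>.\<close>

definition vcotensor ::
  "('o, 'm, 'z) csmcat_scheme \<Rightarrow> ('c, 'o, 'm) vcat \<Rightarrow> 'o \<Rightarrow> ('c, 'o, 'm) vfun \<Rightarrow>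
   ('c, 'o, 'm) vfun" where
  "vcotensor V C v X =
     \<lparr>VMap = (\<lambda>c \<in> VObj C. IHom V v (VMap X c)),
      VAct = (\<lambda>c \<in> VObj C. \<lambda>d \<in> VObj C.
        curry_arr V (VHom C c d) (IHom V v (VMap X c)) (IHom V v (VMap X d))
          (curry_arr V (VHom C c d \<otimes>\<^bsub>V\<^esub> IHom V v (VMap X c)) v (VMap X d)
             (uncurry_arr V (VMap X c) (VMap X d) (VAct X c d) \<cdot>\<^bsub>V\<^esub>
                (Idn V (VHom C c d) \<boxtimes>\<^bsub>V\<^esub> Eval V v (VMap X c)) \<cdot>\<^bsub>V\<^esub>
                Assoc V (VHom C c d) (IHom V v (VMap X c)) v)))\<rparr>"

text \<open>
  The functor \<open>[C(-,b), v]\<close>; its action is adjunct to the arrow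
  \<open>(C(c,d) \<otimes> [C(c,b), v]) \<otimes> C(d,b) \<rightarrow> v\<close>, informally \<open>((f, \<phi>), g) \<mapsto> \<phi> (g f)\<close>.
\<close>

definition vcorep ::
  "('o, 'm, 'z) csmcat_scheme \<Rightarrow> ('c, 'o, 'm) vcat \<Rightarrow> 'c \<Rightarrow> 'o \<Rightarrow> ('c, 'o, 'm) vfun" where
  "vcorep V C b v =
     \<lparr>VMap = (\<lambda>c \<in> VObj C. IHom V (VHom C c b) v),
      VAct = (\<lambda>c \<in> VObj C. \<lambda>d \<in> VObj C.
        curry_arr V (VHom C c d) (IHom V (VHom C c b) v) (IHom V (VHom C d b) v)
          (curry_arr V (VHom C c d \<otimes>\<^bsub>V\<^esub> IHom V (VHom C c b) v) (VHom C d b) v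
             (Eval V (VHom C c b) v \<cdot>\<^bsub>V\<^esub>
                (Idn V (IHom V (VHom C c b) v) \<boxtimes>\<^bsub>V\<^esub>
                   (VComp C c d b \<cdot>\<^bsub>V\<^esub> Sym V (VHom C c d) (VHom C d b))) \<cdot>\<^bsub>V\<^esub>
                Assoc V (IHom V (VHom C c b) v) (VHom C c d) (VHom C d b) \<cdot>\<^bsub>V\<^esub>
                (Sym V (VHom C c d) (IHom V (VHom C c b) v) \<boxtimes>\<^bsub>V\<^esub> Idn V (VHom C d b)))))\<rparr>"

definition vcorep_arr ::
  "('o, 'm, 'z) csmcat_scheme \<Rightarrow> ('c, 'o, 'm) vcat \<Rightarrow> 'c \<Rightarrow> 'm \<Rightarrow> ('c, 'o, 'm) vnt" where
  "vcorep_arr V C b f =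
     \<lparr>NDom = vcorep V C b (Dom V f), NCod = vcorep V C b (Cod V f),
      NMap = (\<lambda>c \<in> VObj C. IHomA V (Idn V (VHom C c b)) f)\<rparr>"

text \<open>
  The coend of an enriched bifunctor \<open>T\<close>, contravariant in its first argument, is the coequalizer
  of the two arrows \<open>l, r : \<Coprod>\<^sub>a\<^sub>,\<^sub>b T(b,a) \<oslash> A(a,b) \<rightarrow> \<Coprod>\<^sub>a T(a,a)\<close> whose \<open>(a,b)\<close> components are
  \<open>l a b : T(b,a) \<oslash> A(a,b) \<rightarrow> T(a,a)\<close> and \<open>r a b : T(b,a) \<oslash> A(a,b) \<rightarrow> T(b,b)\<close>.  Dually, the end
  is the equalizer of \<open>l, r : \<Prod>\<^sub>a T(a,a) \<rightarrow> \<Prod>\<^sub>a\<^sub>,\<^sub>b [A(a,b), T(a,b)]\<close> whose \<open>(a,b)\<close> components are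
  \<open>l a b : T(a,a) \<rightarrow> [A(a,b), T(a,b)]\<close> and \<open>r a b : T(b,b) \<rightarrow> [A(a,b), T(a,b)]\<close>.  The argument \<open>D\<close>
  is the diagonal \<open>a \<mapsto> T(a,a)\<close>.
\<close>

definition is_cowedge ::
  "('o, 'm, 'z) cat_scheme \<Rightarrow> 'c set \<Rightarrow> ('c \<Rightarrow> 'o) \<Rightarrow> ('c \<Rightarrow> 'c \<Rightarrow> 'm) \<Rightarrow> ('c \<Rightarrow> 'c \<Rightarrow> 'm) \<Rightarrow>
   'o \<Rightarrow> ('c \<Rightarrow> 'm) \<Rightarrow> bool" where
  "is_cowedge M A D l r w \<omega> \<longleftrightarrow> w \<in> Obj M \<and> (\<forall>a \<in> A. \<omega> a \<in> Hom M (D a) w) \<and>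
     (\<forall>a \<in> A. \<forall>b \<in> A. \<omega> a \<cdot>\<^bsub>M\<^esub> l a b = \<omega> b \<cdot>\<^bsub>M\<^esub> r a b)"

definition is_coend ::
  "('o, 'm, 'z) cat_scheme \<Rightarrow> 'c set \<Rightarrow> ('c \<Rightarrow> 'o) \<Rightarrow> ('c \<Rightarrow> 'c \<Rightarrow> 'm) \<Rightarrow> ('c \<Rightarrow> 'c \<Rightarrow> 'm) \<Rightarrow>
   'o \<Rightarrow> ('c \<Rightarrow> 'm) \<Rightarrow> bool" where
  "is_coend M A D l r x \<omega> \<longleftrightarrow> is_cowedge M A D l r x \<omega> \<and>
     (\<forall>w \<psi>. is_cowedge M A D l r w \<psi> \<longrightarrow>
        (\<exists>!u. u \<in> Hom M x w \<and> (\<forall>a \<in> A. u \<cdot>\<^bsub>M\<^esub> \<omega> a = \<psi> a)))"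

definition is_wedge ::
  "('o, 'm, 'z) cat_scheme \<Rightarrow> 'c set \<Rightarrow> ('c \<Rightarrow> 'o) \<Rightarrow> ('c \<Rightarrow> 'c \<Rightarrow> 'm) \<Rightarrow> ('c \<Rightarrow> 'c \<Rightarrow> 'm) \<Rightarrow>
   'o \<Rightarrow> ('c \<Rightarrow> 'm) \<Rightarrow> bool" where
  "is_wedge M A D l r w \<omega> \<longleftrightarrow> w \<in> Obj M \<and> (\<forall>a \<in> A. \<omega> a \<in> Hom M w (D a)) \<and>
     (\<forall>a \<in> A. \<forall>b \<in> A. l a b \<cdot>\<^bsub>M\<^esub> \<omega> a = r a b \<cdot>\<^bsub>M\<^esub> \<omega> b)"

definition is_end ::
  "('o, 'm, 'z) cat_scheme \<Rightarrow> 'c set \<Rightarrow> ('c \<Rightarrow> 'o) \<Rightarrow> ('c \<Rightarrow> 'c \<Rightarrow> 'm) \<Rightarrow> ('c \<Rightarrow> 'c \<Rightarrow> 'm) \<Rightarrow>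
   'o \<Rightarrow> ('c \<Rightarrow> 'm) \<Rightarrow> bool" where
  "is_end M A D l r x \<omega> \<longleftrightarrow> is_wedge M A D l r x \<omega> \<and>
     (\<forall>w \<psi>. is_wedge M A D l r w \<psi> \<longrightarrow>
        (\<exists>!u. u \<in> Hom M w x \<and> (\<forall>a \<in> A. \<omega> a \<cdot>\<^bsub>M\<^esub> u = \<psi> a)))"

text \<open>
  For the left Kan extension \<open>T(b,a) = C(b,-) \<oslash> F a\<close>, and \<open>T(b,a) \<oslash> C(a,b)\<close> is written in the
  isomorphic form \<open>C(b,-) \<oslash> (C(a,b) \<otimes> F a)\<close>.  The first arrow composes \<open>C(b,-)\<close> with \<open>C(a,b)\<close>,
  the second one lets \<open>C(a,b)\<close> act on \<open>F a\<close>.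
\<close>

definition lan_left ::
  "('o, 'm, 'z) csmcat_scheme \<Rightarrow> ('c, 'o, 'm) vcat \<Rightarrow> ('c, 'o, 'm) vfun \<Rightarrow> 'c \<Rightarrow> 'c \<Rightarrow>
   ('c, 'o, 'm) vnt" where
  "lan_left V C F a b =
     \<lparr>NDom = vtensor V C (vrep V C b) (VHom C a b \<otimes>\<^bsub>V\<^esub> VMap F a),
      NCod = vtensor V C (vrep V C a) (VMap F a),
      NMap = (\<lambda>c \<in> VObj C. (VComp C a b c \<boxtimes>\<^bsub>V\<^esub> Idn V (VMap F a)) \<cdot>\<^bsub>V\<^esub>
        inv_arr V (Assoc V (VHom C b c) (VHom C a b) (VMap F a)))\<rparr>"

definition lan_right ::
  "('o, 'm, 'z) csmcat_scheme \<Rightarrow> ('c, 'o, 'm) vcat \<Rightarrow> ('c, 'o, 'm) vfun \<Rightarrow> 'c \<Rightarrow> 'c \<Rightarrow>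
   ('c, 'o, 'm) vnt" where
  "lan_right V C F a b =
     \<lparr>NDom = vtensor V C (vrep V C b) (VHom C a b \<otimes>\<^bsub>V\<^esub> VMap F a),
      NCod = vtensor V C (vrep V C b) (VMap F b),
      NMap = (\<lambda>c \<in> VObj C.
        Idn V (VHom C b c) \<boxtimes>\<^bsub>V\<^esub> uncurry_arr V (VMap F a) (VMap F b) (VAct F a b))\<rparr>"

definition is_left_kan_extension ::
  "('o, 'm, 'z) csmcat_scheme \<Rightarrow> ('c, 'o, 'm) vcat \<Rightarrow> 'c set \<Rightarrow>
   (('c, 'o, 'm) vfun, ('c, 'o, 'm) vnt, ('c, 'o, 'm) vfun, ('c, 'o, 'm) vnt) cfunctor \<Rightarrow> bool"
where
  "is_left_kan_extension V C A L \<longleftrightarrow>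
     is_functor (vfun_cat V (full_vsubcat C A)) (vfun_cat V C) L \<and>
     (\<exists>\<omega>. (\<forall>F \<in> Obj (vfun_cat V (full_vsubcat C A)).
              is_coend (vfun_cat V C) A (\<lambda>a. vtensor V C (vrep V C a) (VMap F a))
                (lan_left V C F) (lan_right V C F) (FObj L F) (\<omega> F)) \<and>
           (\<forall>t \<in> Arr (vfun_cat V (full_vsubcat C A)). \<forall>a \<in> A.
              FArr L t \<cdot>\<^bsub>vfun_cat V C\<^esub> \<omega> (NDom t) a =
              \<omega> (NCod t) a \<cdot>\<^bsub>vfun_cat V C\<^esub> vtensor_arr V C (vrep V C a) (NMap t a)))"

text \<open>
  For the right Kan extension \<open>T(a,b) = [C(-,a), H b]\<close>.  The two arrows into
  \<open>[C(a,b), [C(c,a), H b]]\<close> are adjunct to arrows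
  \<open>([C(c,a), H a] \<otimes> C(a,b)) \<otimes> C(c,a) \<rightarrow> H b\<close>, informally \<open>((\<phi>, f), g) \<mapsto> f (\<phi> g)\<close>, and
  \<open>([C(c,b), H b] \<otimes> C(a,b)) \<otimes> C(c,a) \<rightarrow> H b\<close>, informally \<open>((\<phi>, f), g) \<mapsto> \<phi> (f g)\<close>.
\<close>

definition ran_left ::
  "('o, 'm, 'z) csmcat_scheme \<Rightarrow> ('c, 'o, 'm) vcat \<Rightarrow> ('c, 'o, 'm) vfun \<Rightarrow> 'c \<Rightarrow> 'c \<Rightarrow>
   ('c, 'o, 'm) vnt" where
  "ran_left V C H a b =
     \<lparr>NDom = vcorep V C a (VMap H a),
      NCod = vcotensor V C (VHom C a b) (vcorep V C a (VMap H b)),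
      NMap = (\<lambda>c \<in> VObj C.
        curry_arr V (IHom V (VHom C c a) (VMap H a)) (VHom C a b) (IHom V (VHom C c a) (VMap H b))
          (curry_arr V (IHom V (VHom C c a) (VMap H a) \<otimes>\<^bsub>V\<^esub> VHom C a b) (VHom C c a) (VMap H b)
             (uncurry_arr V (VMap H a) (VMap H b) (VAct H a b) \<cdot>\<^bsub>V\<^esub>
                (Idn V (VHom C a b) \<boxtimes>\<^bsub>V\<^esub> Eval V (VHom C c a) (VMap H a)) \<cdot>\<^bsub>V\<^esub>
                Assoc V (VHom C a b) (IHom V (VHom C c a) (VMap H a)) (VHom C c a) \<cdot>\<^bsub>V\<^esub>
                (Sym V (IHom V (VHom C c a) (VMap H a)) (VHom C a b) \<boxtimes>\<^bsub>V\<^esub> Idn V (VHom C c a)))))\<rparr>"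

definition ran_right ::
  "('o, 'm, 'z) csmcat_scheme \<Rightarrow> ('c, 'o, 'm) vcat \<Rightarrow> ('c, 'o, 'm) vfun \<Rightarrow> 'c \<Rightarrow> 'c \<Rightarrow>
   ('c, 'o, 'm) vnt" where
  "ran_right V C H a b =
     \<lparr>NDom = vcorep V C b (VMap H b),
      NCod = vcotensor V C (VHom C a b) (vcorep V C a (VMap H b)),
      NMap = (\<lambda>c \<in> VObj C.
        curry_arr V (IHom V (VHom C c b) (VMap H b)) (VHom C a b) (IHom V (VHom C c a) (VMap H b))
          (curry_arr V (IHom V (VHom C c b) (VMap H b) \<otimes>\<^bsub>V\<^esub> VHom C a b) (VHom C c a) (VMap H b)
             (Eval V (VHom C c b) (VMap H b) \<cdot>\<^bsub>V\<^esub>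
                (Idn V (IHom V (VHom C c b) (VMap H b)) \<boxtimes>\<^bsub>V\<^esub> VComp C c a b) \<cdot>\<^bsub>V\<^esub>
                Assoc V (IHom V (VHom C c b) (VMap H b)) (VHom C a b) (VHom C c a))))\<rparr>"

definition is_right_kan_extension ::
  "('o, 'm, 'z) csmcat_scheme \<Rightarrow> ('c, 'o, 'm) vcat \<Rightarrow> 'c set \<Rightarrow>
   (('c, 'o, 'm) vfun, ('c, 'o, 'm) vnt, ('c, 'o, 'm) vfun, ('c, 'o, 'm) vnt) cfunctor \<Rightarrow> bool"
where
  "is_right_kan_extension V C A R \<longleftrightarrow>
     is_functor (vfun_cat V (full_vsubcat C A)) (vfun_cat V C) R \<and>
     (\<exists>\<omega>. (\<forall>H \<in> Obj (vfun_cat V (full_vsubcat C A)).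
              is_end (vfun_cat V C) A (\<lambda>b. vcorep V C b (VMap H b))
                (ran_left V C H) (ran_right V C H) (FObj R H) (\<omega> H)) \<and>
           (\<forall>t \<in> Arr (vfun_cat V (full_vsubcat C A)). \<forall>b \<in> A.
              \<omega> (NCod t) b \<cdot>\<^bsub>vfun_cat V C\<^esub> FArr R t =
              vcorep_arr V C b (NMap t b) \<cdot>\<^bsub>vfun_cat V C\<^esub> \<omega> (NDom t) b))"

end

theory Submission
  imports Defs
begin

text \<open>
  A \<open>V\<close>-functor is a module over \<open>C\<close>, given by actions \<open>C(a,b) \<otimes> X a \<rightarrow> X b\<close>.  The free modules
  \<open>C(a,-) \<oslash> v\<close> represent \<open>X \<mapsto> Hom(v, X a)\<close> and the cofree modules \<open>[C(-,b), v]\<close> corepresent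
  \<open>X \<mapsto> Hom(X b, v)\<close>.  Testing with them shows that monos, epis and vanishing on \<open>A\<close> are pointwise,
  that \<open>[C,V]\<close> is a cocomplete abelian category with a generator, and that wedges and cowedges of
  the Kan extensions are natural transformations over \<open>A\<close>.  The left adjoint of restriction is thus
  the coend of free modules, while the right one exists by the special adjoint functor theorem and
  satisfies the universal property of the end.  On \<open>a \<in> A\<close> the free modules restrict to free
  modules, so the counit of the right adjunction is invertible, and hence so is the unit of the left
  one.  The cokernel of \<open>r\<^sub>L r Y \<rightarrow> Y\<close> and the kernel of \<open>Y \<rightarrow> r\<^sub>R r Y\<close> are the two adjoints of the
  inclusion.
\<close>

section \<open>Categories\<close>

text \<open>The Grothendieck axioms supply small coproducts, kernels, cokernels, binary products and
  a generator, but infinite products are not among them, so the end cannot be written down at once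
  as an equalizer of products. This causes the asymmetry between the two Kan extensions: the right
  one is recognized as an end only after it exists, by matching wedges with transformations out of
  restrictions. Its values on \<open>A\<close> are therefore not read off a formula but from its
  universal property and the Yoneda lemma, and the coend on the left is never evaluated on
  \<open>A\<close> at all. A second obstacle is that no axiom relates the tensor product to sums,
  zero arrows or epis. All such facts, and the actions on pointwise cokernels and coproducts, have
  one source: \<open>c \<otimes> -\<close> is a left adjoint, so it preserves jointly epic families.
  Size enters through the index sets of coproducts: the objects of \<open>C\<close> for the
  generator, \<open>A\<close> and \<open>A \<times> A\<close> for the coend, and hom sets in the
  adjoint functor theorem.\<close>

lemma Hom_iff [simp]: "f \<in> Hom C x y \<longleftrightarrow> f \<in> Arr C \<and> Dom C f = x \<and> Cod C f = y"
  by (simp add: Hom_def)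

locale Category =
  fixes C :: "('o, 'm, 'z) cat_scheme" (structure)
  assumes category: "category C"
begin

lemma Dom_Obj [simp]: "f \<in> Arr C \<Longrightarrow> Dom C f \<in> Obj C"
  and Cod_Obj [simp]: "f \<in> Arr C \<Longrightarrow> Cod C f \<in> Obj C"
  using category by (simp_all add: category_def)

lemma Idn_Arr [simp]: "x \<in> Obj C \<Longrightarrow> Idn C x \<in> Arr C"
  and Dom_Idn [simp]: "x \<in> Obj C \<Longrightarrow> Dom C (Idn C x) = x"
  and Cod_Idn [simp]: "x \<in> Obj C \<Longrightarrow> Cod C (Idn C x) = x"
  using category by (simp_all add: category_def)

lemma comp_Arr [simp]: "\<lbrakk>f \<in> Arr C; g \<in> Arr C; Cod C f = Dom C g\<rbrakk> \<Longrightarrow> g \<cdot> f \<in> Arr C"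
  and Dom_comp [simp]: "\<lbrakk>f \<in> Arr C; g \<in> Arr C; Cod C f = Dom C g\<rbrakk> \<Longrightarrow> Dom C (g \<cdot> f) = Dom C f"
  and Cod_comp [simp]: "\<lbrakk>f \<in> Arr C; g \<in> Arr C; Cod C f = Dom C g\<rbrakk> \<Longrightarrow> Cod C (g \<cdot> f) = Cod C g"
  using category by (simp_all add: category_def)

lemma comp_Idn [simp]: "\<lbrakk>f \<in> Arr C; Dom C f = x\<rbrakk> \<Longrightarrow> f \<cdot> Idn C x = f"
  and Idn_comp [simp]: "\<lbrakk>f \<in> Arr C; Cod C f = x\<rbrakk> \<Longrightarrow> Idn C x \<cdot> f = f"
  using category by (auto simp: category_def)

lemma comp_assoc [simp]:
  "\<lbrakk>f \<in> Arr C; g \<in> Arr C; h \<in> Arr C; Cod C f = Dom C g; Cod C g = Dom C h\<rbrakk> \<Longrightarrow>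
     (h \<cdot> g) \<cdot> f = h \<cdot> g \<cdot> f"
  using category by (simp add: category_def)

text \<open>With \<open>comp_assoc\<close> as a simp rule every composite is nested to the right,
  and an equation for \<open>g \<cdot> f\<close> no longer matches inside a longer chain. This is
  its form for the head of a chain.\<close>

lemma comp_reassoc:
  "\<lbrakk>g \<cdot> f = h; f \<in> Arr C; g \<in> Arr C; Cod C f = Dom C g; k \<in> Arr C; Cod C k = Dom C f\<rbrakk> \<Longrightarrow>
     g \<cdot> f \<cdot> k = h \<cdot> k"
  by (metis comp_assoc)

lemma mono_ArrD: "mono_arr C m \<Longrightarrow> m \<in> Arr C"
  and epi_ArrD: "epi_arr C m \<Longrightarrow> m \<in> Arr C"
  by (simp_all add: mono_arr_def epi_arr_def)

lemma mono_cancel: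
  "\<lbrakk>mono_arr C m; m \<cdot> f = m \<cdot> g; f \<in> Arr C; g \<in> Arr C; Dom C f = Dom C g;
    Cod C f = Dom C m; Cod C g = Dom C m\<rbrakk> \<Longrightarrow> f = g"
  unfolding mono_arr_def by (metis Hom_iff Dom_Obj)

lemma epi_cancel:
  "\<lbrakk>epi_arr C e; f \<cdot> e = g \<cdot> e; f \<in> Arr C; g \<in> Arr C; Cod C f = Cod C g;
    Dom C f = Cod C e; Dom C g = Cod C e\<rbrakk> \<Longrightarrow> f = g"
  unfolding epi_arr_def by (metis Hom_iff Cod_Obj)

lemma inverse_arrs_unique:
  assumes "inverse_arrs C f g" "inverse_arrs C f h"
  shows "g = h"
proof -
  have "g = (h \<cdot> f) \<cdot> g" using assms by (simp add: inverse_arrs_def)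
  also have "\<dots> = h \<cdot> f \<cdot> g" using assms by (intro comp_assoc) (auto simp: inverse_arrs_def)
  also have "\<dots> = h" using assms by (simp add: inverse_arrs_def)
  finally show ?thesis .
qed

lemma inv_arr:
  assumes "iso_arr C f"
  shows "inverse_arrs C f (inv_arr C f)"
  using assms inverse_arrs_unique unfolding iso_arr_def inv_arr_def by (metis theI)

lemma inv_arr_simps:
  assumes "iso_arr C f"
  shows "f \<in> Arr C" "inv_arr C f \<in> Arr C"
    "Dom C (inv_arr C f) = Cod C f" "Cod C (inv_arr C f) = Dom C f"
    "inv_arr C f \<cdot> f = Idn C (Dom C f)" "f \<cdot> inv_arr C f = Idn C (Cod C f)"
  using inv_arr[OF assms] by (simp_all add: inverse_arrs_def)

lemma iso_arrI:
  "\<lbrakk>f \<in> Arr C; g \<in> Arr C; Dom C g = Cod C f; Cod C g = Dom C f; g \<cdot> f = Idn C (Dom C f);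
    f \<cdot> g = Idn C (Cod C f)\<rbrakk> \<Longrightarrow> iso_arr C f"
  by (auto simp: iso_arr_def inverse_arrs_def)

lemma iso_mono: assumes "iso_arr C f" shows "mono_arr C f"
  unfolding mono_arr_def
proof (intro conjI ballI impI)
  note i = inv_arr_simps[OF assms]
  show "f \<in> Arr C" by (rule i)
  fix x g h
  assume gh: "g \<in> Hom C x (Dom C f)" "h \<in> Hom C x (Dom C f)" and eq: "f \<cdot> g = f \<cdot> h"
  have "inv_arr C f \<cdot> f \<cdot> g = inv_arr C f \<cdot> f \<cdot> h" by (simp only: eq)
  then show "g = h" using gh i comp_reassoc[OF i(5)] by simp
qed

lemma iso_epi: assumes "iso_arr C f" shows "epi_arr C f"
  unfolding epi_arr_def
proof (intro conjI ballI impI)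
  note i = inv_arr_simps[OF assms]
  show "f \<in> Arr C" by (rule i)
  fix x g h
  assume gh: "g \<in> Hom C (Cod C f) x" "h \<in> Hom C (Cod C f) x" and eq: "g \<cdot> f = h \<cdot> f"
  have "(g \<cdot> f) \<cdot> inv_arr C f = (h \<cdot> f) \<cdot> inv_arr C f" by (simp only: eq)
  then show "g = h" using gh i by simp
qed

end

lemma FObj_in [simp]: "is_functor C D F \<Longrightarrow> x \<in> Obj C \<Longrightarrow> FObj F x \<in> Obj D"
  and FArr_in [simp]: "is_functor C D F \<Longrightarrow> f \<in> Arr C \<Longrightarrow> FArr F f \<in> Arr D"
  and Dom_FArr [simp]: "is_functor C D F \<Longrightarrow> f \<in> Arr C \<Longrightarrow> Dom D (FArr F f) = FObj F (Dom C f)"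
  and Cod_FArr [simp]: "is_functor C D F \<Longrightarrow> f \<in> Arr C \<Longrightarrow> Cod D (FArr F f) = FObj F (Cod C f)"
  and FArr_Idn [simp]: "is_functor C D F \<Longrightarrow> x \<in> Obj C \<Longrightarrow> FArr F (Idn C x) = Idn D (FObj F x)"
  and FArr_comp: "is_functor C D F \<Longrightarrow> f \<in> Arr C \<Longrightarrow> g \<in> Arr C \<Longrightarrow> Cod C f = Dom C g \<Longrightarrow>
        FArr F (g \<cdot>\<^bsub>C\<^esub> f) = FArr F g \<cdot>\<^bsub>D\<^esub> FArr F f"
  by (simp_all add: is_functor_def)


section \<open>Preadditive and abelian categories\<close>

locale Preadditive = Category C for C :: "('o, 'm, 'z) addcat_scheme" (structure) +
  assumes preadditive: "preadditive C"

lemma PreadditiveI: "preadditive C \<Longrightarrow> Preadditive C"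
  by unfold_locales (unfold preadditive_def, blast+)

context Preadditive
begin

lemmas Hom_group =
  preadditive[unfolded preadditive_def, THEN conjunct2, THEN conjunct1, THEN bspec, THEN bspec]

lemmas comp_distrib =
  preadditive[unfolded preadditive_def, THEN conjunct2, THEN conjunct2, THEN bspec, THEN bspec, THEN bspec]

lemma add_closed:
  assumes "f \<in> Arr C" "g \<in> Arr C" "Dom C f = Dom C g" "Cod C f = Cod C g"
  shows add_Arr [simp]: "f \<oplus> g \<in> Arr C"
    and Dom_add [simp]: "Dom C (f \<oplus> g) = Dom C f"
    and Cod_add [simp]: "Cod C (f \<oplus> g) = Cod C f"
    and add_commute: "f \<oplus> g = g \<oplus> f"
proof -
  have "\<forall>a \<in> Hom C (Dom C g) (Cod C g). \<forall>b \<in> Hom C (Dom C g) (Cod C g).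
      a \<oplus> b \<in> Hom C (Dom C g) (Cod C g) \<and> a \<oplus> b = b \<oplus> a"
    using Hom_group[OF Dom_Obj[OF assms(2)] Cod_Obj[OF assms(2)]] by (elim conjE)
  then have "f \<oplus> g \<in> Hom C (Dom C g) (Cod C g) \<and> f \<oplus> g = g \<oplus> f" using assms by simp
  then show "f \<oplus> g \<in> Arr C" "Dom C (f \<oplus> g) = Dom C f" "Cod C (f \<oplus> g) = Cod C f"
    "f \<oplus> g = g \<oplus> f"
    using assms by auto
qed

lemma add_assoc:
  assumes "f \<in> Arr C" "g \<in> Arr C" "h \<in> Arr C" "Dom C f = Dom C g" "Cod C f = Cod C g"
    "Dom C h = Dom C g" "Cod C h = Cod C g"
  shows "f \<oplus> g \<oplus> h = f \<oplus> (g \<oplus> h)"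
proof -
  have "\<forall>a \<in> Hom C (Dom C g) (Cod C g). \<forall>b \<in> Hom C (Dom C g) (Cod C g).
    \<forall>c \<in> Hom C (Dom C g) (Cod C g). a \<oplus> b \<oplus> c = a \<oplus> (b \<oplus> c)"
    using Hom_group[OF Dom_Obj[OF assms(2)] Cod_Obj[OF assms(2)]] by (elim conjE)
  then show ?thesis using assms by simp
qed

text \<open>\<open>zero_arr\<close> is a definite description, while the axioms only assert that
  some neutral element exists; commutativity makes any two of them equal.\<close>

lemma zero_ex1:
  assumes "x \<in> Obj C" "y \<in> Obj C"
  shows "\<exists>!z. z \<in> Hom C x y \<and> (\<forall>f \<in> Hom C x y. f \<oplus> z = f)"
proof -
  obtain z where z: "z \<in> Hom C x y" "\<forall>f \<in> Hom C x y. f \<oplus> z = f"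
    using Hom_group[OF assms] by (elim conjE) blast
  have "z' = z" if z': "z' \<in> Hom C x y" "\<forall>f \<in> Hom C x y. f \<oplus> z' = f" for z'
  proof -
    have "z' = z' \<oplus> z" using z z'(1) by simp
    also have "\<dots> = z \<oplus> z'" using z(1) z'(1) by (intro add_commute) auto
    also have "\<dots> = z" using z(1) z' by simp
    finally show ?thesis .
  qed
  then show ?thesis using z by blast
qed

lemma zero_arr_prop:
  assumes "x \<in> Obj C" "y \<in> Obj C"
  shows "zero_arr C x y \<in> Hom C x y \<and> (\<forall>f \<in> Hom C x y. f \<oplus> zero_arr C x y = f)"
  unfolding zero_arr_def by (rule theI'[OF zero_ex1[OF assms]])

lemma zero_Arr [simp]: "\<lbrakk>x \<in> Obj C; y \<in> Obj C\<rbrakk> \<Longrightarrow> zero_arr C x y \<in> Arr C"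
  and Dom_zero [simp]: "\<lbrakk>x \<in> Obj C; y \<in> Obj C\<rbrakk> \<Longrightarrow> Dom C (zero_arr C x y) = x"
  and Cod_zero [simp]: "\<lbrakk>x \<in> Obj C; y \<in> Obj C\<rbrakk> \<Longrightarrow> Cod C (zero_arr C x y) = y"
  and add_zero [simp]: "\<lbrakk>f \<in> Arr C; Dom C f = x; Cod C f = y\<rbrakk> \<Longrightarrow> f \<oplus> zero_arr C x y = f"
  using zero_arr_prop by auto

lemma zero_add [simp]: "\<lbrakk>f \<in> Arr C; Dom C f = x; Cod C f = y\<rbrakk> \<Longrightarrow> zero_arr C x y \<oplus> f = f"
  by (metis Dom_Obj Cod_Obj add_commute add_zero zero_Arr Dom_zero Cod_zero)

lemma ex_neg:
  assumes "f \<in> Arr C"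
  shows "\<exists>g. g \<in> Arr C \<and> Dom C g = Dom C f \<and> Cod C g = Cod C f \<and>
    f \<oplus> g = zero_arr C (Dom C f) (Cod C f)"
proof -
  let ?x = "Dom C f" and ?y = "Cod C f"
  obtain z where z: "z \<in> Hom C ?x ?y" "\<forall>f \<in> Hom C ?x ?y. f \<oplus> z = f \<and> (\<exists>g \<in> Hom C ?x ?y. f \<oplus> g = z)"
    using Hom_group[OF Dom_Obj[OF assms] Cod_Obj[OF assms]] by (elim conjE bexE) blast
  \<comment> \<open>The axioms give inverses relative to some neutral element; it has to be the one
    that \<open>zero_arr\<close> picks.\<close>
  have "z = zero_arr C ?x ?y"
    using z ex1E[OF zero_ex1[OF Dom_Obj[OF assms] Cod_Obj[OF assms]]]
      zero_arr_prop[OF Dom_Obj[OF assms] Cod_Obj[OF assms]] by blast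
  then show ?thesis using z(2) assms by (metis Hom_iff)
qed

text \<open>The record stores addition only, so negatives are chosen; \<open>neg_unique\<close>
  later identifies the choice.\<close>

definition neg where
  "neg f = (SOME g. g \<in> Arr C \<and> Dom C g = Dom C f \<and> Cod C g = Cod C f \<and>
     f \<oplus> g = zero_arr C (Dom C f) (Cod C f))"

lemma neg_Arr [simp]: "f \<in> Arr C \<Longrightarrow> neg f \<in> Arr C"
  and Dom_neg [simp]: "f \<in> Arr C \<Longrightarrow> Dom C (neg f) = Dom C f"
  and Cod_neg [simp]: "f \<in> Arr C \<Longrightarrow> Cod C (neg f) = Cod C f"
  and add_neg [simp]: "f \<in> Arr C \<Longrightarrow> f \<oplus> neg f = zero_arr C (Dom C f) (Cod C f)"
  using someI_ex[OF ex_neg] unfolding neg_def by auto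

lemma add_left_cancel:
  assumes "f \<in> Arr C" "g \<in> Arr C" "h \<in> Arr C" "Dom C g = Dom C f" "Cod C g = Cod C f"
    "Dom C h = Dom C f" "Cod C h = Cod C f" "f \<oplus> g = f \<oplus> h"
  shows "g = h"
proof -
  have "(neg f \<oplus> f) \<oplus> g = (neg f \<oplus> f) \<oplus> h"
    using assms add_assoc[of "neg f" f g] add_assoc[of "neg f" f h] by simp
  then show ?thesis using assms add_commute[of "neg f" f] by simp
qed

lemma eq_iff_diff_zero:
  assumes "f \<in> Arr C" "g \<in> Arr C" "Dom C g = Dom C f" "Cod C g = Cod C f"
  shows "f \<oplus> neg g = zero_arr C (Dom C f) (Cod C f) \<longleftrightarrow> f = g"
proof
  assume eq: "f \<oplus> neg g = zero_arr C (Dom C f) (Cod C f)"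
  have "neg g \<oplus> f = neg g \<oplus> g"
    using eq assms add_neg[of g] add_commute[of f "neg g"] add_commute[of g "neg g"] by simp
  then show "f = g" by (rule add_left_cancel[rotated -1]) (use assms in simp_all)
qed (use assms in simp)

lemma comp_add_left:
  assumes "f \<in> Arr C" "g \<in> Arr C" "h \<in> Arr C" "Dom C g = Cod C f" "Dom C h = Cod C f"
    "Cod C h = Cod C g"
  shows "(g \<oplus> h) \<cdot> f = (g \<cdot> f) \<oplus> (h \<cdot> f)"
proof -
  have "\<forall>a \<in> Hom C (Dom C f) (Cod C f). \<forall>b \<in> Hom C (Cod C f) (Cod C g).
      \<forall>c \<in> Hom C (Cod C f) (Cod C g). (b \<oplus> c) \<cdot> a = (b \<cdot> a) \<oplus> (c \<cdot> a)"
    using comp_distrib[OF Dom_Obj[OF assms(1)] Cod_Obj[OF assms(1)] Cod_Obj[OF assms(2)]] by (elim conjE)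
  then show ?thesis using assms by simp
qed

lemma comp_add_right:
  assumes "f \<in> Arr C" "g \<in> Arr C" "h \<in> Arr C" "Dom C f = Dom C g" "Cod C f = Cod C g"
    "Dom C h = Cod C g"
  shows "h \<cdot> (f \<oplus> g) = (h \<cdot> f) \<oplus> (h \<cdot> g)"
proof -
  have "\<forall>a \<in> Hom C (Dom C g) (Cod C g). \<forall>b \<in> Hom C (Dom C g) (Cod C g).
      \<forall>c \<in> Hom C (Cod C g) (Cod C h). c \<cdot> (a \<oplus> b) = (c \<cdot> a) \<oplus> (c \<cdot> b)"
    using comp_distrib[OF Dom_Obj[OF assms(2)] Cod_Obj[OF assms(2)] Cod_Obj[OF assms(3)]]
    by (elim conjE)
  then show ?thesis using assms by simp
qed

text \<open>Cancellation in the hom group. It is how composition and additive functors are shown to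
  preserve zero, since such maps send zero to an element equal to its own double.\<close>

lemma self_add_zero:
  assumes "f \<in> Arr C" "f \<oplus> f = f" shows "f = zero_arr C (Dom C f) (Cod C f)"
  by (rule add_left_cancel[of f]) (use assms in simp_all)

lemma zero_comp [simp]:
  assumes "f \<in> Arr C" "Cod C f = x" "y \<in> Obj C"
  shows "zero_arr C x y \<cdot> f = zero_arr C (Dom C f) y"
proof -
  let ?z = "zero_arr C x y"
  have x: "x \<in> Obj C" using assms by auto
  have "(?z \<cdot> f) \<oplus> (?z \<cdot> f) = ?z \<cdot> f"
    using comp_add_left[of f ?z ?z, symmetric] assms x by simp
  then show ?thesis using self_add_zero[of "?z \<cdot> f"] assms x by simp
qed

lemma comp_zero [simp]:
  assumes "f \<in> Arr C" "Dom C f = y" "x \<in> Obj C"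
  shows "f \<cdot> zero_arr C x y = zero_arr C x (Cod C f)"
proof -
  let ?z = "zero_arr C x y"
  have y: "y \<in> Obj C" using assms by auto
  have "(f \<cdot> ?z) \<oplus> (f \<cdot> ?z) = f \<cdot> ?z"
    using comp_add_right[of ?z ?z f, symmetric] assms y by simp
  then show ?thesis using self_add_zero[of "f \<cdot> ?z"] assms y by simp
qed

lemma neg_unique:
  assumes "f \<in> Arr C" "g \<in> Arr C" "Dom C g = Dom C f" "Cod C g = Cod C f"
    "f \<oplus> g = zero_arr C (Dom C f) (Cod C f)"
  shows "neg f = g"
  by (rule add_left_cancel[of f]) (use assms in simp_all)

lemma comp_neg:
  assumes f: "f \<in> Arr C" and g: "g \<in> Arr C" and fg: "Cod C f = Dom C g"
  shows "g \<cdot> neg f = neg (g \<cdot> f)"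
proof (rule neg_unique[symmetric])
  have "(g \<cdot> f) \<oplus> (g \<cdot> neg f) = g \<cdot> (f \<oplus> neg f)"
    by (rule comp_add_right[symmetric]) (simp_all add: f g fg)
  then show "(g \<cdot> f) \<oplus> (g \<cdot> neg f) = zero_arr C (Dom C (g \<cdot> f)) (Cod C (g \<cdot> f))"
    by (simp add: f g fg)
qed (simp_all add: f g fg)

lemma neg_comp:
  assumes f: "f \<in> Arr C" and g: "g \<in> Arr C" and fg: "Cod C f = Dom C g"
  shows "neg g \<cdot> f = neg (g \<cdot> f)"
proof (rule neg_unique[symmetric])
  have "(g \<cdot> f) \<oplus> (neg g \<cdot> f) = (g \<oplus> neg g) \<cdot> f"
    by (rule comp_add_left[symmetric]) (simp_all add: f g fg)
  then show "(g \<cdot> f) \<oplus> (neg g \<cdot> f) = zero_arr C (Dom C (g \<cdot> f)) (Cod C (g \<cdot> f))"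
    by (simp add: f g fg)
qed (simp_all add: f g fg)

text \<open>Replaces unique existence statements by one equation of arrows, which can be compared
  object by object in a functor category.\<close>

lemma zero_object_iff:
  "zero_object C x \<longleftrightarrow> x \<in> Obj C \<and> Idn C x = zero_arr C x x"
proof
  assume z: "zero_object C x"
  then have x: "x \<in> Obj C" by (simp add: zero_object_def)
  then have "\<exists>!f. f \<in> Hom C x x" using z by (simp add: zero_object_def)
  then show "x \<in> Obj C \<and> Idn C x = zero_arr C x x"
    using x by (metis Hom_iff Idn_Arr Dom_Idn Cod_Idn zero_Arr Dom_zero Cod_zero)
next
  assume *: "x \<in> Obj C \<and> Idn C x = zero_arr C x x"
  have "f = zero_arr C y x" if "f \<in> Hom C y x" "y \<in> Obj C" for f y
    using * that Idn_comp[of f x] by (metis zero_comp Hom_iff)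
  moreover have "f = zero_arr C x y" if "f \<in> Hom C x y" "y \<in> Obj C" for f y
    using * that comp_Idn[of f x] by (metis comp_zero Hom_iff)
  ultimately show "zero_object C x"
    unfolding zero_object_def using * by (metis Hom_iff zero_Arr Dom_zero Cod_zero)
qed

lemma to_zero_object:
  "\<lbrakk>zero_object C x; f \<in> Arr C; Cod C f = x\<rbrakk> \<Longrightarrow> f = zero_arr C (Dom C f) x"
  using Idn_comp[of f x] by (metis zero_object_iff zero_comp)

lemma from_zero_object:
  "\<lbrakk>zero_object C x; f \<in> Arr C; Dom C f = x\<rbrakk> \<Longrightarrow> f = zero_arr C x (Cod C f)"
  using comp_Idn[of f x] by (metis zero_object_iff comp_zero)

text \<open>Applied to the difference of two arrows, so that monos are tested against zero
  only.\<close>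

lemma mono_arrI:
  assumes m: "m \<in> Arr C"
    and "\<And>h. \<lbrakk>h \<in> Arr C; Cod C h = Dom C m; m \<cdot> h = zero_arr C (Dom C h) (Cod C m)\<rbrakk>
           \<Longrightarrow> h = zero_arr C (Dom C h) (Dom C m)"
  shows "mono_arr C m"
  unfolding mono_arr_def
proof (intro conjI ballI impI m)
  fix x f g assume fg: "f \<in> Hom C x (Dom C m)" "g \<in> Hom C x (Dom C m)" and eq: "m \<cdot> f = m \<cdot> g"
  have "m \<cdot> (f \<oplus> neg g) = zero_arr C x (Cod C m)"
    using fg m eq by (simp add: comp_add_right comp_neg)
  then have "f \<oplus> neg g = zero_arr C x (Dom C m)"
    using assms(2)[of "f \<oplus> neg g"] fg m by simp
  then show "f = g" using fg by (subst eq_iff_diff_zero[symmetric]) simp_all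
qed

lemma epi_arrI:
  assumes m: "m \<in> Arr C"
    and "\<And>h. \<lbrakk>h \<in> Arr C; Dom C h = Cod C m; h \<cdot> m = zero_arr C (Dom C m) (Cod C h)\<rbrakk>
           \<Longrightarrow> h = zero_arr C (Cod C m) (Cod C h)"
  shows "epi_arr C m"
  unfolding epi_arr_def
proof (intro conjI ballI impI m)
  fix x f g assume fg: "f \<in> Hom C (Cod C m) x" "g \<in> Hom C (Cod C m) x" and eq: "f \<cdot> m = g \<cdot> m"
  have "(f \<oplus> neg g) \<cdot> m = zero_arr C (Dom C m) x"
    using fg m eq by (simp add: comp_add_left neg_comp)
  then have "f \<oplus> neg g = zero_arr C (Cod C m) x"
    using assms(2)[of "f \<oplus> neg g"] fg m by simp
  then show "f = g" using fg by (subst eq_iff_diff_zero[symmetric]) simp_all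
qed

lemma mono_zero:
  "\<lbrakk>mono_arr C m; h \<in> Arr C; Cod C h = Dom C m; m \<cdot> h = zero_arr C (Dom C h) (Cod C m)\<rbrakk> \<Longrightarrow>
     h = zero_arr C (Dom C h) (Dom C m)"
  by (rule mono_cancel[of m]) (auto dest: mono_ArrD)

lemma epi_zero:
  "\<lbrakk>epi_arr C m; h \<in> Arr C; Dom C h = Cod C m; h \<cdot> m = zero_arr C (Dom C m) (Cod C h)\<rbrakk> \<Longrightarrow>
     h = zero_arr C (Cod C m) (Cod C h)"
  by (rule epi_cancel[of m]) (auto dest: epi_ArrD)

lemma kernel_ex1:
  "\<lbrakk>is_kernel C f k; h \<in> Arr C; Cod C h = Dom C f; f \<cdot> h = zero_arr C (Dom C h) (Cod C f)\<rbrakk> \<Longrightarrow>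
     \<exists>!u. u \<in> Hom C (Dom C h) (Dom C k) \<and> k \<cdot> u = h"
  unfolding is_kernel_def by blast

lemma cokernel_ex1:
  "\<lbrakk>is_cokernel C f q; h \<in> Arr C; Dom C h = Cod C f; h \<cdot> f = zero_arr C (Dom C f) (Cod C h)\<rbrakk> \<Longrightarrow>
     \<exists>!u. u \<in> Hom C (Cod C q) (Cod C h) \<and> u \<cdot> q = h"
  unfolding is_cokernel_def by blast

lemma kernel_mono: "is_kernel C f k \<Longrightarrow> mono_arr C k"
  unfolding mono_arr_def
proof (intro conjI ballI impI)
  assume k: "is_kernel C f k"
  then show "k \<in> Arr C" by (simp add: is_kernel_def)
  fix x g h assume gh: "g \<in> Hom C x (Dom C k)" "h \<in> Hom C x (Dom C k)" and eq: "k \<cdot> g = k \<cdot> h"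
  have [simp]: "f \<in> Arr C" "k \<in> Arr C" "Cod C k = Dom C f" using k by (simp_all add: is_kernel_def)
  have "f \<cdot> k \<cdot> g = zero_arr C x (Cod C f)"
    using k gh by (subst comp_reassoc[of f k "zero_arr C (Dom C k) (Cod C f)"]) (auto simp: is_kernel_def)
  then have "\<exists>!u. u \<in> Hom C x (Dom C k) \<and> k \<cdot> u = k \<cdot> g"
    using kernel_ex1[OF k, of "k \<cdot> g"] gh by simp
  then show "g = h" using gh eq by metis
qed

lemma cokernel_epi: "is_cokernel C f q \<Longrightarrow> epi_arr C q"
  unfolding epi_arr_def
proof (intro conjI ballI impI)
  assume k: "is_cokernel C f q"
  then show "q \<in> Arr C" by (simp add: is_cokernel_def)
  fix x g h assume gh: "g \<in> Hom C (Cod C q) x" "h \<in> Hom C (Cod C q) x" and eq: "g \<cdot> q = h \<cdot> q"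
  have [simp]: "f \<in> Arr C" "q \<in> Arr C" "Dom C q = Cod C f" "q \<cdot> f = zero_arr C (Dom C f) (Cod C q)"
    using k by (simp_all add: is_cokernel_def)
  have "(g \<cdot> q) \<cdot> f = zero_arr C (Dom C f) x" using gh by simp
  then have "\<exists>!u. u \<in> Hom C (Cod C q) x \<and> u \<cdot> q = g \<cdot> q"
    using cokernel_ex1[OF k, of "g \<cdot> q"] gh by simp
  then show "g = h" using gh eq by metis
qed

lemma kernel_factor:
  assumes "is_kernel C f k" "h \<in> Arr C" "Cod C h = Dom C f"
    "f \<cdot> h = zero_arr C (Dom C h) (Cod C f)"
  obtains u where "u \<in> Arr C" "Dom C u = Dom C h" "Cod C u = Dom C k" "k \<cdot> u = h"
  using kernel_ex1[OF assms] by auto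

lemma cokernel_factor:
  assumes "is_cokernel C f q" "h \<in> Arr C" "Dom C h = Cod C f"
    "h \<cdot> f = zero_arr C (Dom C f) (Cod C h)"
  obtains u where "u \<in> Arr C" "Dom C u = Cod C q" "Cod C u = Cod C h" "u \<cdot> q = h"
  using cokernel_ex1[OF assms] by auto

text \<open>A factorization through a mono is unique, so existence is all that is left of the
  universal property.\<close>

lemma kernelI:
  assumes "f \<in> Arr C" "mono_arr C k" "Cod C k = Dom C f"
    "f \<cdot> k = zero_arr C (Dom C k) (Cod C f)"
    "\<And>h. \<lbrakk>h \<in> Arr C; Cod C h = Dom C f; f \<cdot> h = zero_arr C (Dom C h) (Cod C f)\<rbrakk>
       \<Longrightarrow> \<exists>u. u \<in> Arr C \<and> Dom C u = Dom C h \<and> Cod C u = Dom C k \<and> k \<cdot> u = h"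
  shows "is_kernel C f k"
  unfolding is_kernel_def
proof (intro conjI ballI impI)
  fix h assume "h \<in> Arr C" "Cod C h = Dom C f \<and> f \<cdot> h = zero_arr C (Dom C h) (Cod C f)"
  then obtain u where "u \<in> Arr C \<and> Dom C u = Dom C h \<and> Cod C u = Dom C k \<and> k \<cdot> u = h"
    using assms(5) by blast
  then show "\<exists>!u. u \<in> Hom C (Dom C h) (Dom C k) \<and> k \<cdot> u = h"
    by (intro ex1I[of _ u]) (use mono_cancel[OF assms(2)] in auto)
qed (use assms mono_ArrD in auto)

lemma cokernelI:
  assumes "f \<in> Arr C" "epi_arr C q" "Dom C q = Cod C f"
    "q \<cdot> f = zero_arr C (Dom C f) (Cod C q)"
    "\<And>h. \<lbrakk>h \<in> Arr C; Dom C h = Cod C f; h \<cdot> f = zero_arr C (Dom C f) (Cod C h)\<rbrakk>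
       \<Longrightarrow> \<exists>u. u \<in> Arr C \<and> Dom C u = Cod C q \<and> Cod C u = Cod C h \<and> u \<cdot> q = h"
  shows "is_cokernel C f q"
  unfolding is_cokernel_def
proof (intro conjI ballI impI)
  fix h assume "h \<in> Arr C" "Dom C h = Cod C f \<and> h \<cdot> f = zero_arr C (Dom C f) (Cod C h)"
  then obtain u where "u \<in> Arr C \<and> Dom C u = Cod C q \<and> Cod C u = Cod C h \<and> u \<cdot> q = h"
    using assms(5) by blast
  then show "\<exists>!u. u \<in> Hom C (Cod C q) (Cod C h) \<and> u \<cdot> q = h"
    by (intro ex1I[of _ u]) (use epi_cancel[OF assms(2)] in auto)
qed (use assms epi_ArrD in auto)

end

section \<open>Abelian categories\<close>

locale Abelian = Preadditive C for C :: "('o, 'm, 'z) addcat_scheme" (structure) +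
  assumes abelian: "abelian C"

lemma AbelianI: "abelian C \<Longrightarrow> Abelian C"
  by (intro Abelian.intro PreadditiveI Abelian_axioms.intro) (simp_all add: abelian_def)

context Preadditive
begin

lemma neg_eq_zeroD:
  assumes "f \<in> Arr C" "neg f = zero_arr C (Dom C f) (Cod C f)"
  shows "f = zero_arr C (Dom C f) (Cod C f)"
  using add_neg[OF assms(1)] assms by simp

end

context Abelian
begin

lemma kernel_exists: "f \<in> Arr C \<Longrightarrow> \<exists>k. is_kernel C f k"
  and cokernel_exists: "f \<in> Arr C \<Longrightarrow> \<exists>q. is_cokernel C f q"
  using abelian by (simp_all add: abelian_def)

text \<open>The axiom only makes \<open>m\<close> a kernel of some \<open>f\<close>. Such an
  \<open>f\<close> factors through the cokernel \<open>q\<close>, so whatever \<open>q\<close> kills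
  is killed by \<open>f\<close> and hence factors through \<open>m\<close>.\<close>

lemma mono_kernel_of_cokernel:
  assumes m: "mono_arr C m" and q: "is_cokernel C m q"
  shows "is_kernel C q m"
proof -
  obtain f where f: "is_kernel C f m" using abelian m unfolding abelian_def by blast
  have A [simp]: "m \<in> Arr C" "q \<in> Arr C" "f \<in> Arr C" "Dom C q = Cod C m" "Dom C f = Cod C m"
    and z: "q \<cdot> m = zero_arr C (Dom C m) (Cod C q)" "f \<cdot> m = zero_arr C (Dom C m) (Cod C f)"
    using f q by (auto simp: is_kernel_def is_cokernel_def)
  obtain u where u: "u \<in> Arr C" "Dom C u = Cod C q" "Cod C u = Cod C f" "u \<cdot> q = f"
    by (rule cokernel_factor[OF q, of f]) (use z in auto)
  show ?thesis
  proof (rule kernelI)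
    fix h assume h: "h \<in> Arr C" "Cod C h = Dom C q" "q \<cdot> h = zero_arr C (Dom C h) (Cod C q)"
    have "f \<cdot> h = u \<cdot> q \<cdot> h" using u h by (subst comp_assoc[symmetric]) auto
    then have "f \<cdot> h = zero_arr C (Dom C h) (Cod C f)" using u h by simp
    then show "\<exists>u. u \<in> Arr C \<and> Dom C u = Dom C h \<and> Cod C u = Dom C m \<and> m \<cdot> u = h"
      using kernel_factor[OF f, of h] h by auto
  qed (use m z in auto)
qed

lemma epi_cokernel_of_kernel:
  assumes e: "epi_arr C e" and k: "is_kernel C e k"
  shows "is_cokernel C k e"
proof -
  obtain f where f: "is_cokernel C f e" using abelian e unfolding abelian_def by blast
  have A [simp]: "e \<in> Arr C" "k \<in> Arr C" "f \<in> Arr C" "Cod C k = Dom C e" "Cod C f = Dom C e"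
    and z: "e \<cdot> k = zero_arr C (Dom C k) (Cod C e)" "e \<cdot> f = zero_arr C (Dom C f) (Cod C e)"
    using f k by (auto simp: is_kernel_def is_cokernel_def)
  obtain u where u: "u \<in> Arr C" "Dom C u = Dom C f" "Cod C u = Dom C k" "k \<cdot> u = f"
    by (rule kernel_factor[OF k, of f]) (use z in auto)
  show ?thesis
  proof (rule cokernelI)
    fix h assume h: "h \<in> Arr C" "Dom C h = Cod C k" "h \<cdot> k = zero_arr C (Dom C k) (Cod C h)"
    have "h \<cdot> f = (h \<cdot> k) \<cdot> u" using u h by (subst comp_assoc) auto
    then have "h \<cdot> f = zero_arr C (Dom C f) (Cod C h)" using u h by simp
    then show "\<exists>u. u \<in> Arr C \<and> Dom C u = Cod C e \<and> Cod C u = Cod C h \<and> u \<cdot> e = h"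
      using cokernel_factor[OF f, of h] h by auto
  qed (use e z in auto)
qed

text \<open>Only products are postulated. The injections come from the universal property applied to
  identities and zeros, and the last identity holds because both sides have the same two
  projections.\<close>

lemma biproduct:
  assumes x: "x \<in> Obj C" and y: "y \<in> Obj C"
  obtains p \<pi>1 \<pi>2 \<iota>1 \<iota>2 where "is_binary_product C x y p \<pi>1 \<pi>2"
    "p \<in> Obj C" "\<pi>1 \<in> Hom C p x" "\<pi>2 \<in> Hom C p y" "\<iota>1 \<in> Hom C x p" "\<iota>2 \<in> Hom C y p"
    "\<pi>1 \<cdot> \<iota>1 = Idn C x" "\<pi>2 \<cdot> \<iota>2 = Idn C y" "\<pi>2 \<cdot> \<iota>1 = zero_arr C x y" "\<pi>1 \<cdot> \<iota>2 = zero_arr C y x"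
    "(\<iota>1 \<cdot> \<pi>1) \<oplus> (\<iota>2 \<cdot> \<pi>2) = Idn C p"
proof -
  obtain p \<pi>1 \<pi>2 where P: "is_binary_product C x y p \<pi>1 \<pi>2"
    using abelian x y unfolding abelian_def by blast
  have [simp]: "p \<in> Obj C" "\<pi>1 \<in> Arr C" "Dom C \<pi>1 = p" "Cod C \<pi>1 = x"
    "\<pi>2 \<in> Arr C" "Dom C \<pi>2 = p" "Cod C \<pi>2 = y"
    using P by (simp_all add: is_binary_product_def)
  have univ: "\<exists>!u. u \<in> Hom C w p \<and> \<pi>1 \<cdot> u = f \<and> \<pi>2 \<cdot> u = g"
    if "w \<in> Obj C" "f \<in> Hom C w x" "g \<in> Hom C w y" for w f g
    using P that unfolding is_binary_product_def by blast
  obtain \<iota>1 where i1: "\<iota>1 \<in> Hom C x p" "\<pi>1 \<cdot> \<iota>1 = Idn C x" "\<pi>2 \<cdot> \<iota>1 = zero_arr C x y"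
    using univ[of x "Idn C x" "zero_arr C x y"] x y by auto
  obtain \<iota>2 where i2: "\<iota>2 \<in> Hom C y p" "\<pi>1 \<cdot> \<iota>2 = zero_arr C y x" "\<pi>2 \<cdot> \<iota>2 = Idn C y"
    using univ[of y "zero_arr C y x" "Idn C y"] x y by auto
  let ?s = "(\<iota>1 \<cdot> \<pi>1) \<oplus> (\<iota>2 \<cdot> \<pi>2)"
  have "\<pi>1 \<cdot> ?s = \<pi>1" "\<pi>2 \<cdot> ?s = \<pi>2"
    using i1 i2 x y by (simp_all add: comp_add_right comp_reassoc)
  moreover have "?s \<in> Hom C p p" using i1 i2 by simp
  moreover have "Idn C p \<in> Hom C p p \<and> \<pi>1 \<cdot> Idn C p = \<pi>1 \<and> \<pi>2 \<cdot> Idn C p = \<pi>2" by simp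
  moreover have "\<exists>!u. u \<in> Hom C p p \<and> \<pi>1 \<cdot> u = \<pi>1 \<and> \<pi>2 \<cdot> u = \<pi>2"
    by (rule univ) simp_all
  ultimately have "?s = Idn C p" by (elim ex1E) metis
  show ?thesis
    by (rule that[OF P _ _ _ _ _ i1(2) i2(3) i1(3) i2(2) \<open>?s = Idn C p\<close>]) (use i1 i2 in auto)
qed

text \<open>The pullback is taken as the kernel \<open>k\<close> of the difference \<open>d\<close>
  of the two composites on the biproduct. Since \<open>q\<close> is epi, so is \<open>d\<close>,
  hence \<open>d\<close> is the cokernel of \<open>k\<close>. If \<open>h\<close> kills the first
  leg, then \<open>h \<cdot> \<pi>1\<close> factors through \<open>d\<close> by some
  \<open>c\<close>; restricting to the second summand gives \<open>c = 0\<close>, and then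
  \<open>h = 0\<close>.\<close>

lemma epi_pullback:
  assumes f: "f \<in> Arr C" and q: "epi_arr C q" and fq: "Cod C f = Cod C q"
  obtains p1 p2 where "p1 \<in> Arr C" "p2 \<in> Arr C" "Dom C p1 = Dom C p2" "Cod C p1 = Dom C f"
    "Cod C p2 = Dom C q" "f \<cdot> p1 = q \<cdot> p2" "epi_arr C p1"
proof -
  have Aq [simp]: "q \<in> Arr C" using q by (rule epi_ArrD)
  obtain p \<pi>1 \<pi>2 \<iota>1 \<iota>2 where
    B: "p \<in> Obj C" "\<pi>1 \<in> Hom C p (Dom C f)" "\<pi>2 \<in> Hom C p (Dom C q)"
      "\<iota>1 \<in> Hom C (Dom C f) p" "\<iota>2 \<in> Hom C (Dom C q) p"
    and eqs: "\<pi>1 \<cdot> \<iota>1 = Idn C (Dom C f)" "\<pi>2 \<cdot> \<iota>2 = Idn C (Dom C q)"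
      "\<pi>2 \<cdot> \<iota>1 = zero_arr C (Dom C f) (Dom C q)" "\<pi>1 \<cdot> \<iota>2 = zero_arr C (Dom C q) (Dom C f)"
    using biproduct[of "Dom C f" "Dom C q"] f Aq by (metis Dom_Obj)
  define d where "d = (f \<cdot> \<pi>1) \<oplus> neg (q \<cdot> \<pi>2)"
  have d [simp]: "d \<in> Arr C" "Dom C d = p" "Cod C d = Cod C q"
    using B f fq by (simp_all add: d_def)
  have d2: "d \<cdot> \<iota>2 = neg q"
    using B f fq eqs by (simp add: d_def comp_add_left neg_comp)
  \<comment> \<open>On the second summand \<open>d\<close> is \<open>neg q\<close>, so an arrow out
    of the codomain that vanishes there is zero because \<open>q\<close> is epi.\<close>
  have zq: "c = zero_arr C (Cod C q) (Cod C c)"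
    if c: "c \<in> Arr C" "Dom C c = Cod C q" "c \<cdot> d \<cdot> \<iota>2 = zero_arr C (Dom C q) (Cod C c)" for c
  proof -
    have "neg (c \<cdot> q) = zero_arr C (Dom C q) (Cod C c)" using c d2 by (simp add: comp_neg)
    then have "c \<cdot> q = zero_arr C (Dom C q) (Cod C c)" using neg_eq_zeroD[of "c \<cdot> q"] c by simp
    then show ?thesis using epi_zero[OF q, of c] c by simp
  qed
  have ed: "epi_arr C d"
  proof (rule epi_arrI)
    fix h assume h: "h \<in> Arr C" "Dom C h = Cod C d" "h \<cdot> d = zero_arr C (Dom C d) (Cod C h)"
    have "h \<cdot> d \<cdot> \<iota>2 = (h \<cdot> d) \<cdot> \<iota>2" using B h by (subst comp_assoc) auto
    then have "h \<cdot> d \<cdot> \<iota>2 = zero_arr C (Dom C q) (Cod C h)"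
      using B h by (simp del: comp_assoc)
    then show "h = zero_arr C (Cod C d) (Cod C h)" using zq[of h] h by simp
  qed simp
  obtain k where k: "is_kernel C d k" using kernel_exists[OF d(1)] by blast
  have kA [simp]: "k \<in> Arr C" "Cod C k = p" and dk: "d \<cdot> k = zero_arr C (Dom C k) (Cod C q)"
    using k by (simp_all add: is_kernel_def)
  note ck = epi_cokernel_of_kernel[OF ed k]
  show ?thesis
  proof (rule that[of "\<pi>1 \<cdot> k" "\<pi>2 \<cdot> k"])
    have "(f \<cdot> \<pi>1 \<cdot> k) \<oplus> neg (q \<cdot> \<pi>2 \<cdot> k) = zero_arr C (Dom C k) (Cod C q)"
      using dk B f fq by (simp add: d_def comp_add_left neg_comp)
    then show "f \<cdot> \<pi>1 \<cdot> k = q \<cdot> \<pi>2 \<cdot> k"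
      using B f fq by (subst eq_iff_diff_zero[symmetric]) simp_all
    show "epi_arr C (\<pi>1 \<cdot> k)"
    proof (rule epi_arrI)
      fix h assume h: "h \<in> Arr C" "Dom C h = Cod C (\<pi>1 \<cdot> k)"
        "h \<cdot> \<pi>1 \<cdot> k = zero_arr C (Dom C (\<pi>1 \<cdot> k)) (Cod C h)"
      obtain c where c: "c \<in> Arr C" "Dom C c = Cod C d" "Cod C c = Cod C h" "c \<cdot> d = h \<cdot> \<pi>1"
        using cokernel_factor[OF ck, of "h \<cdot> \<pi>1"] h B by auto
      have "c \<cdot> d \<cdot> \<iota>2 = (h \<cdot> \<pi>1) \<cdot> \<iota>2" using B c by (subst comp_assoc[symmetric]) auto
      also have "\<dots> = zero_arr C (Dom C q) (Cod C c)" using B h c eqs f by simp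
      finally have "c = zero_arr C (Cod C q) (Cod C c)" using zq[of c] c by simp
      then have "h \<cdot> \<pi>1 = zero_arr C p (Cod C h)" using c by (metis d zero_comp Cod_Obj)
      then have "(h \<cdot> \<pi>1) \<cdot> \<iota>1 = zero_arr C (Dom C f) (Cod C h)" using B h by (simp del: comp_assoc)
      then show "h = zero_arr C (Cod C (\<pi>1 \<cdot> k)) (Cod C h)" using B h eqs by simp
    qed (use B in simp)
  qed (use B in auto)
qed

end


section \<open>Full subcategories\<close>

lemma full_subcat_simps [simp]:
  "Obj (full_subcat C S) = Obj C \<inter> S" "Dom (full_subcat C S) = Dom C"
  "Cod (full_subcat C S) = Cod C" "Idn (full_subcat C S) = Idn C"
  "Comp (full_subcat C S) = Comp C"
  "f \<in> Arr (full_subcat C S) \<longleftrightarrow> f \<in> Arr C \<and> Dom C f \<in> S \<and> Cod C f \<in> S"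
  by (simp_all add: full_subcat_def)

lemma Add_full_subcat [simp]: "Add (full_subcat C S) = Add (C :: ('o, 'm, 'z) addcat_scheme)"
  by (simp add: full_subcat_def)

lemma Hom_full_subcat: "x \<in> S \<Longrightarrow> y \<in> S \<Longrightarrow> Hom (full_subcat C S) x y = Hom C x y"
  by (auto simp del: Hom_iff simp: Hom_def)

lemma (in Category) category_full_subcat: "category (full_subcat C S)"
  by (auto simp: category_def)

context Preadditive
begin

lemma preadditive_full_subcat: "preadditive (full_subcat C S)"
  unfolding preadditive_def
proof (intro conjI ballI category_full_subcat)
  fix x y assume "x \<in> Obj (full_subcat C S)" "y \<in> Obj (full_subcat C S)"
  then have xy: "x \<in> Obj C" "y \<in> Obj C" "x \<in> S" "y \<in> S" by simp_all
  note H = Hom_full_subcat[OF xy(3,4)] and G = Hom_group[OF xy(1,2)]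
  show "\<exists>z\<in>Hom (full_subcat C S) x y. \<forall>f\<in>Hom (full_subcat C S) x y.
      f \<oplus>\<^bsub>full_subcat C S\<^esub> z = f \<and> (\<exists>g\<in>Hom (full_subcat C S) x y. f \<oplus>\<^bsub>full_subcat C S\<^esub> g = z)"
    unfolding H Add_full_subcat using G by (elim conjE)
qed (auto simp: add_assoc comp_add_left comp_add_right intro: add_commute)

lemma zero_full_subcat:
  "x \<in> S \<Longrightarrow> y \<in> S \<Longrightarrow> zero_arr (full_subcat C S) x y = zero_arr C x y"
  unfolding zero_arr_def by (simp only: Hom_full_subcat Add_full_subcat)

lemma kernel_full_subcat:
  assumes "is_kernel C f k" "Dom C f \<in> S" "Cod C f \<in> S" "Dom C k \<in> S"
  shows "is_kernel (full_subcat C S) f k"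
  unfolding is_kernel_def
proof (intro conjI ballI impI)
  fix h assume "h \<in> Arr (full_subcat C S)"
    "Cod (full_subcat C S) h = Dom (full_subcat C S) f \<and>
      f \<cdot>\<^bsub>full_subcat C S\<^esub> h = zero_arr (full_subcat C S) (Dom (full_subcat C S) h) (Cod (full_subcat C S) f)"
  then show "\<exists>!u. u \<in> Hom (full_subcat C S) (Dom (full_subcat C S) h) (Dom (full_subcat C S) k) \<and>
      k \<cdot>\<^bsub>full_subcat C S\<^esub> u = h"
    using kernel_ex1[OF assms(1), of h] assms(2-4)
    by (simp add: Hom_full_subcat zero_full_subcat del: Hom_iff)
qed (use assms in \<open>auto simp: is_kernel_def zero_full_subcat\<close>)

lemma cokernel_full_subcat:
  assumes "is_cokernel C f k" "Dom C f \<in> S" "Cod C f \<in> S" "Cod C k \<in> S"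
  shows "is_cokernel (full_subcat C S) f k"
  unfolding is_cokernel_def
proof (intro conjI ballI impI)
  fix h assume "h \<in> Arr (full_subcat C S)"
    "Dom (full_subcat C S) h = Cod (full_subcat C S) f \<and>
      h \<cdot>\<^bsub>full_subcat C S\<^esub> f = zero_arr (full_subcat C S) (Dom (full_subcat C S) f) (Cod (full_subcat C S) h)"
  then show "\<exists>!u. u \<in> Hom (full_subcat C S) (Cod (full_subcat C S) k) (Cod (full_subcat C S) h) \<and>
      u \<cdot>\<^bsub>full_subcat C S\<^esub> k = h"
    using cokernel_ex1[OF assms(1), of h] assms(2-4)
    by (simp add: Hom_full_subcat zero_full_subcat del: Hom_iff)
qed (use assms in \<open>auto simp: is_cokernel_def zero_full_subcat\<close>)

end

text \<open>The point is that monos and epis do not change: the kernel in \<open>C\<close> of a mono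
  of the subcategory is a subobject of an object of \<open>S\<close>, so it is available inside and
  has to vanish. Kernels and cokernels themselves are inherited through \<open>sub\<close> and
  \<open>quot\<close>.\<close>

lemma (in Abelian) abelian_full_subcat:
  assumes zero: "zero_object C z" "z \<in> S"
    and sub: "\<And>m. \<lbrakk>mono_arr C m; Cod C m \<in> S\<rbrakk> \<Longrightarrow> Dom C m \<in> S"
    and quot: "\<And>e. \<lbrakk>epi_arr C e; Dom C e \<in> S\<rbrakk> \<Longrightarrow> Cod C e \<in> S"
    and prod: "\<And>x y p \<pi>1 \<pi>2. \<lbrakk>x \<in> S; y \<in> S; is_binary_product C x y p \<pi>1 \<pi>2\<rbrakk> \<Longrightarrow> p \<in> S"
  shows "abelian (full_subcat C S)"
  unfolding abelian_def
proof (intro conjI preadditive_full_subcat ballI allI impI)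
  let ?B = "full_subcat C S"
  show "\<exists>z. zero_object ?B z"
    using zero by (intro exI[of _ z]) (simp add: zero_object_def Hom_full_subcat del: Hom_iff)
  fix x y assume "x \<in> Obj ?B" "y \<in> Obj ?B"
  then have xy: "x \<in> Obj C" "y \<in> Obj C" "x \<in> S" "y \<in> S" by simp_all
  obtain p \<pi>1 \<pi>2 where P: "is_binary_product C x y p \<pi>1 \<pi>2"
    using abelian xy unfolding abelian_def by blast
  then have "is_binary_product ?B x y p \<pi>1 \<pi>2"
    using prod[OF xy(3,4) P] xy unfolding is_binary_product_def
    by (simp add: Hom_full_subcat del: Hom_iff)
  then show "\<exists>p \<pi>1 \<pi>2. is_binary_product ?B x y p \<pi>1 \<pi>2" by blast
next
  let ?B = "full_subcat C S"
  fix f assume f: "f \<in> Arr ?B"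
  obtain k where k: "is_kernel C f k" using kernel_exists f by auto
  then have "Dom C k \<in> S" using sub[OF kernel_mono[OF k]] f by (simp add: is_kernel_def)
  then show "\<exists>k. is_kernel ?B f k" using kernel_full_subcat[OF k] f by auto
  obtain q where q: "is_cokernel C f q" using cokernel_exists f by auto
  then have "Cod C q \<in> S" using quot[OF cokernel_epi[OF q]] f by (simp add: is_cokernel_def)
  then show "\<exists>q. is_cokernel ?B f q" using cokernel_full_subcat[OF q] f by auto
next
  let ?B = "full_subcat C S"
  fix m assume m: "mono_arr ?B m"
  interpret B: Preadditive ?B by (rule PreadditiveI[OF preadditive_full_subcat])
  have mA: "m \<in> Arr C" "Dom C m \<in> S" "Cod C m \<in> S" using B.mono_ArrD[OF m] by simp_all
  obtain k where k: "is_kernel C m k" using kernel_exists mA by auto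
  have kA: "k \<in> Arr C" "Cod C k = Dom C m" "m \<cdot> k = zero_arr C (Dom C k) (Cod C m)"
    using k by (simp_all add: is_kernel_def)
  have kS: "Dom C k \<in> S" using sub[OF kernel_mono[OF k]] mA kA by simp
  have kz: "k = zero_arr C (Dom C k) (Dom C m)"
    using B.mono_zero[OF m, of k] kA kS mA by (simp add: zero_full_subcat)
  have mono: "mono_arr C m"
  proof (rule mono_arrI[OF mA(1)])
    fix h assume h: "h \<in> Arr C" "Cod C h = Dom C m" "m \<cdot> h = zero_arr C (Dom C h) (Cod C m)"
    obtain u where "u \<in> Arr C" "Dom C u = Dom C h" "Cod C u = Dom C k" "k \<cdot> u = h"
      by (rule kernel_factor[OF k h])
    then show "h = zero_arr C (Dom C h) (Dom C m)"
      using kz mA by (metis zero_comp Dom_Obj)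
  qed
  obtain q where q: "is_cokernel C m q" using cokernel_exists mA by auto
  have qA: "q \<in> Arr C" "Dom C q = Cod C m" using q by (simp_all add: is_cokernel_def)
  have "Cod C q \<in> S" using quot[OF cokernel_epi[OF q]] mA qA by simp
  then show "\<exists>f. is_kernel ?B f m"
    using kernel_full_subcat[OF mono_kernel_of_cokernel[OF mono q]] mA qA by auto
next
  let ?B = "full_subcat C S"
  fix m assume m: "epi_arr ?B m"
  interpret B: Preadditive ?B by (rule PreadditiveI[OF preadditive_full_subcat])
  have mA: "m \<in> Arr C" "Dom C m \<in> S" "Cod C m \<in> S" using B.epi_ArrD[OF m] by simp_all
  obtain k where k: "is_cokernel C m k" using cokernel_exists mA by auto
  have kA: "k \<in> Arr C" "Dom C k = Cod C m" "k \<cdot> m = zero_arr C (Dom C m) (Cod C k)"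
    using k by (simp_all add: is_cokernel_def)
  have kS: "Cod C k \<in> S" using quot[OF cokernel_epi[OF k]] mA kA by simp
  have kz: "k = zero_arr C (Cod C m) (Cod C k)"
    using B.epi_zero[OF m, of k] kA kS mA by (simp add: zero_full_subcat)
  have epi: "epi_arr C m"
  proof (rule epi_arrI[OF mA(1)])
    fix h assume h: "h \<in> Arr C" "Dom C h = Cod C m" "h \<cdot> m = zero_arr C (Dom C m) (Cod C h)"
    obtain u where "u \<in> Arr C" "Dom C u = Cod C k" "Cod C u = Cod C h" "u \<cdot> k = h"
      by (rule cokernel_factor[OF k h])
    then show "h = zero_arr C (Cod C m) (Cod C h)"
      using kz mA by (metis comp_zero Cod_Obj)
  qed
  obtain q where q: "is_kernel C m q" using kernel_exists mA by auto
  have qA: "q \<in> Arr C" "Cod C q = Dom C m" using q by (simp_all add: is_kernel_def)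
  have "Dom C q \<in> S" using sub[OF kernel_mono[OF q]] mA qA by simp
  then show "\<exists>f. is_cokernel ?B f m"
    using cokernel_full_subcat[OF epi_cokernel_of_kernel[OF epi q]] mA qA by auto
qed

lemma ex1_eqD: "\<lbrakk>\<exists>!x. P x; P a; P b\<rbrakk> \<Longrightarrow> a = b"
  by blast

section \<open>Adjoint functors from universal arrows\<close>

text \<open>A universal arrow at every object determines a left adjoint. The locale serves both the
  left Kan extension and the left adjoint of the inclusion.\<close>

locale Universal_from = N: Category N + M: Category M
  for N :: "('p, 'n, 'y) cat_scheme" and M :: "('o, 'm, 'z) cat_scheme" +
  fixes r :: "('o, 'm, 'p, 'n) cfunctor" and L :: "'p \<Rightarrow> 'o" and \<eta> :: "'p \<Rightarrow> 'n"
  assumes functor_r: "is_functor M N r"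
    and L_Obj: "F \<in> Obj N \<Longrightarrow> L F \<in> Obj M"
    and unit_Hom: "F \<in> Obj N \<Longrightarrow> \<eta> F \<in> Hom N F (FObj r (L F))"
    and universal: "\<lbrakk>F \<in> Obj N; Y \<in> Obj M; f \<in> Hom N F (FObj r Y)\<rbrakk> \<Longrightarrow>
      \<exists>!g. g \<in> Hom M (L F) Y \<and> FArr r g \<cdot>\<^bsub>N\<^esub> \<eta> F = f"
begin

lemmas r_simps [simp] = FObj_in[OF functor_r] FArr_in[OF functor_r] Dom_FArr[OF functor_r]
  Cod_FArr[OF functor_r] FArr_Idn[OF functor_r] FArr_comp[OF functor_r]

declare L_Obj [simp]

lemma unit_simps [simp]:
  "F \<in> Obj N \<Longrightarrow> \<eta> F \<in> Arr N" "F \<in> Obj N \<Longrightarrow> Dom N (\<eta> F) = F"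
  "F \<in> Obj N \<Longrightarrow> Cod N (\<eta> F) = FObj r (L F)"
  using unit_Hom by simp_all

definition lift where
  "lift F Y f = (THE g. g \<in> Hom M (L F) Y \<and> FArr r g \<cdot>\<^bsub>N\<^esub> \<eta> F = f)"

lemma lift:
  assumes "F \<in> Obj N" "Y \<in> Obj M" "f \<in> Hom N F (FObj r Y)"
  shows "lift F Y f \<in> Hom M (L F) Y \<and> FArr r (lift F Y f) \<cdot>\<^bsub>N\<^esub> \<eta> F = f"
  unfolding lift_def by (rule theI'[OF universal[OF assms]])

lemma lift_simps [simp]:
  assumes "F \<in> Obj N" "f \<in> Arr N" "Dom N f = F" "Cod N f = FObj r Y" "Y \<in> Obj M"
  shows "lift F Y f \<in> Arr M" "Dom M (lift F Y f) = L F" "Cod M (lift F Y f) = Y"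
    "FArr r (lift F Y f) \<cdot>\<^bsub>N\<^esub> \<eta> F = f"
  using lift[of F Y f] assms by auto

text \<open>The uniqueness half of the universal property; later equations between arrows out of
  \<open>L F\<close> are checked after applying \<open>r\<close> and composing with the
  unit.\<close>

lemma unit_cancel:
  assumes "g \<in> Arr M" "h \<in> Arr M" "Dom M g = L F" "Dom M h = L F" "Cod M g = Cod M h" "F \<in> Obj N"
    "FArr r g \<cdot>\<^bsub>N\<^esub> \<eta> F = FArr r h \<cdot>\<^bsub>N\<^esub> \<eta> F"
  shows "g = h"
proof -
  have "\<exists>!k. k \<in> Hom M (L F) (Cod M h) \<and> FArr r k \<cdot>\<^bsub>N\<^esub> \<eta> F = FArr r h \<cdot>\<^bsub>N\<^esub> \<eta> F"
    by (rule universal) (use assms in auto)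
  then show ?thesis by (rule ex1_eqD) (use assms in auto)
qed

definition ladj :: "('p, 'n, 'o, 'm) cfunctor" where
  "ladj = \<lparr>FObj = L, FArr = (\<lambda>t. lift (Dom N t) (L (Cod N t)) (\<eta> (Cod N t) \<cdot>\<^bsub>N\<^esub> t))\<rparr>"

lemma FObj_ladj [simp]: "FObj ladj = L"
  by (simp add: ladj_def)

lemma ladj_arr [simp]:
  assumes "t \<in> Arr N"
  shows "FArr ladj t \<in> Arr M" "Dom M (FArr ladj t) = L (Dom N t)"
    "Cod M (FArr ladj t) = L (Cod N t)"
    "FArr r (FArr ladj t) \<cdot>\<^bsub>N\<^esub> \<eta> (Dom N t) = \<eta> (Cod N t) \<cdot>\<^bsub>N\<^esub> t"
  using assms by (simp_all add: ladj_def)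

lemma unit_natural:
  "\<lbrakk>t \<in> Arr N; k \<in> Arr N; Cod N k = Dom N t; F = Dom N t\<rbrakk> \<Longrightarrow>
     FArr r (FArr ladj t) \<cdot>\<^bsub>N\<^esub> \<eta> F \<cdot>\<^bsub>N\<^esub> k = \<eta> (Cod N t) \<cdot>\<^bsub>N\<^esub> t \<cdot>\<^bsub>N\<^esub> k"
  using N.comp_reassoc[OF ladj_arr(4)[of t], of k] by simp

lemma functor_ladj: "is_functor N M ladj"
  unfolding is_functor_def
proof (intro conjI ballI impI)
  fix F assume F: "F \<in> Obj N"
  show "FArr ladj (Idn N F) = Idn M (FObj ladj F)"
    by (rule unit_cancel[of _ _ F]) (use F ladj_arr(4)[of "Idn N F"] in auto)
next
  fix f g assume fg: "f \<in> Arr N" "g \<in> Arr N" "Cod N f = Dom N g"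
  show "FArr ladj (g \<cdot>\<^bsub>N\<^esub> f) = FArr ladj g \<cdot>\<^bsub>M\<^esub> FArr ladj f"
    by (rule unit_cancel[of _ _ "Dom N f"])
      (use fg ladj_arr(4)[of "g \<cdot>\<^bsub>N\<^esub> f"] in \<open>auto simp: unit_natural\<close>)
qed auto

lemma left_adjoint_ladj: "left_adjoint N M ladj r"
  unfolding left_adjoint_def
proof (intro conjI functor_ladj functor_r exI[of _ "\<lambda>F Y g. FArr r g \<cdot>\<^bsub>N\<^esub> \<eta> F"] ballI)
  fix F Y assume FY: "F \<in> Obj N" "Y \<in> Obj M"
  show "bij_betw (\<lambda>g. FArr r g \<cdot>\<^bsub>N\<^esub> \<eta> F) (Hom M (FObj ladj F) Y) (Hom N F (FObj r Y))"
  proof (rule bij_betwI[where g = "lift F Y"])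
    fix g assume "g \<in> Hom M (FObj ladj F) Y"
    then show "lift F Y (FArr r g \<cdot>\<^bsub>N\<^esub> \<eta> F) = g"
      using FY by (intro unit_cancel[of _ _ F]) auto
  qed (use FY in auto)
next
  fix F F' Y Y' f g h
  assume *: "F \<in> Obj N" "F' \<in> Obj N" "Y \<in> Obj M" "Y' \<in> Obj M" "f \<in> Hom N F' F"
    "g \<in> Hom M (FObj ladj F) Y" "h \<in> Hom M Y Y'"
  then show "FArr r (h \<cdot>\<^bsub>M\<^esub> g \<cdot>\<^bsub>M\<^esub> FArr ladj f) \<cdot>\<^bsub>N\<^esub> \<eta> F' = FArr r h \<cdot>\<^bsub>N\<^esub> (FArr r g \<cdot>\<^bsub>N\<^esub> \<eta> F) \<cdot>\<^bsub>N\<^esub> f"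
    by auto
qed

lemma fully_faithful_ladj:
  assumes iso: "\<And>F. F \<in> Obj N \<Longrightarrow> iso_arr N (\<eta> F)"
  shows "fully_faithful N M ladj"
  unfolding fully_faithful_def
proof (intro ballI)
  fix F G assume FG: "F \<in> Obj N" "G \<in> Obj N"
  note iG = N.inv_arr_simps[OF iso[OF FG(2)]]
  show "bij_betw (FArr ladj) (Hom N F G) (Hom M (FObj ladj F) (FObj ladj G))"
  \<comment> \<open>Naturality of the unit reads
    \<open>r (L t) \<cdot> \<eta> F = \<eta> G \<cdot> t\<close>; solving it for \<open>t\<close>
    gives the inverse.\<close>
  proof (rule bij_betwI[where g = "\<lambda>g. inv_arr N (\<eta> G) \<cdot>\<^bsub>N\<^esub> FArr r g \<cdot>\<^bsub>N\<^esub> \<eta> F"])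
    fix t assume t: "t \<in> Hom N F G"
    then show "inv_arr N (\<eta> G) \<cdot>\<^bsub>N\<^esub> FArr r (FArr ladj t) \<cdot>\<^bsub>N\<^esub> \<eta> F = t"
      using FG iG ladj_arr(4)[of t] N.comp_reassoc[OF iG(5), of t] by simp
  next
    fix g assume g: "g \<in> Hom M (FObj ladj F) (FObj ladj G)"
    let ?t = "inv_arr N (\<eta> G) \<cdot>\<^bsub>N\<^esub> FArr r g \<cdot>\<^bsub>N\<^esub> \<eta> F"
    have t: "?t \<in> Hom N F G" using FG iG g by simp
    show "FArr ladj ?t = g"
      by (rule unit_cancel[of _ _ F])
        (use FG iG g t ladj_arr(4)[of ?t] N.comp_reassoc[OF iG(6), of "FArr r g \<cdot>\<^bsub>N\<^esub> \<eta> F"] in auto)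
  qed (use FG iG in auto)
qed

end

text \<open>Dual of \<open>Universal_from\<close>, for the right Kan extension and the torsion
  functor.\<close>

locale Universal_to = N: Category N + M: Category M
  for N :: "('p, 'n, 'y) cat_scheme" and M :: "('o, 'm, 'z) cat_scheme" +
  fixes r :: "('o, 'm, 'p, 'n) cfunctor" and R :: "'p \<Rightarrow> 'o" and \<epsilon> :: "'p \<Rightarrow> 'n"
  assumes functor_r: "is_functor M N r"
    and R_Obj: "F \<in> Obj N \<Longrightarrow> R F \<in> Obj M"
    and counit_Hom: "F \<in> Obj N \<Longrightarrow> \<epsilon> F \<in> Hom N (FObj r (R F)) F"
    and universal: "\<lbrakk>F \<in> Obj N; Y \<in> Obj M; f \<in> Hom N (FObj r Y) F\<rbrakk> \<Longrightarrow>
      \<exists>!g. g \<in> Hom M Y (R F) \<and> \<epsilon> F \<cdot>\<^bsub>N\<^esub> FArr r g = f"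
begin

lemmas r_simps [simp] = FObj_in[OF functor_r] FArr_in[OF functor_r] Dom_FArr[OF functor_r]
  Cod_FArr[OF functor_r] FArr_Idn[OF functor_r] FArr_comp[OF functor_r]

declare R_Obj [simp]

lemma counit_simps [simp]:
  "F \<in> Obj N \<Longrightarrow> \<epsilon> F \<in> Arr N" "F \<in> Obj N \<Longrightarrow> Dom N (\<epsilon> F) = FObj r (R F)"
  "F \<in> Obj N \<Longrightarrow> Cod N (\<epsilon> F) = F"
  using counit_Hom by simp_all

definition colift where
  "colift F Y f = (THE g. g \<in> Hom M Y (R F) \<and> \<epsilon> F \<cdot>\<^bsub>N\<^esub> FArr r g = f)"

lemma colift:
  assumes "F \<in> Obj N" "Y \<in> Obj M" "f \<in> Hom N (FObj r Y) F"
  shows "colift F Y f \<in> Hom M Y (R F) \<and> \<epsilon> F \<cdot>\<^bsub>N\<^esub> FArr r (colift F Y f) = f"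
  unfolding colift_def by (rule theI'[OF universal[OF assms]])

lemma colift_simps [simp]:
  assumes "F \<in> Obj N" "f \<in> Arr N" "Cod N f = F" "Dom N f = FObj r Y" "Y \<in> Obj M"
  shows "colift F Y f \<in> Arr M" "Dom M (colift F Y f) = Y" "Cod M (colift F Y f) = R F"
    "\<epsilon> F \<cdot>\<^bsub>N\<^esub> FArr r (colift F Y f) = f"
  using colift[of F Y f] assms by auto

lemma counit_cancel:
  assumes "g \<in> Arr M" "h \<in> Arr M" "Cod M g = R F" "Cod M h = R F" "Dom M g = Dom M h" "F \<in> Obj N"
    "\<epsilon> F \<cdot>\<^bsub>N\<^esub> FArr r g = \<epsilon> F \<cdot>\<^bsub>N\<^esub> FArr r h"
  shows "g = h"
proof -
  have "\<exists>!k. k \<in> Hom M (Dom M h) (R F) \<and> \<epsilon> F \<cdot>\<^bsub>N\<^esub> FArr r k = \<epsilon> F \<cdot>\<^bsub>N\<^esub> FArr r h"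
    by (rule universal) (use assms in auto)
  then show ?thesis by (rule ex1_eqD) (use assms in auto)
qed

definition radj :: "('p, 'n, 'o, 'm) cfunctor" where
  "radj = \<lparr>FObj = R, FArr = (\<lambda>t. colift (Cod N t) (R (Dom N t)) (t \<cdot>\<^bsub>N\<^esub> \<epsilon> (Dom N t)))\<rparr>"

lemma FObj_radj [simp]: "FObj radj = R"
  by (simp add: radj_def)

lemma radj_arr [simp]:
  assumes "t \<in> Arr N"
  shows "FArr radj t \<in> Arr M" "Dom M (FArr radj t) = R (Dom N t)"
    "Cod M (FArr radj t) = R (Cod N t)"
    "\<epsilon> (Cod N t) \<cdot>\<^bsub>N\<^esub> FArr r (FArr radj t) = t \<cdot>\<^bsub>N\<^esub> \<epsilon> (Dom N t)"
  using assms by (simp_all add: radj_def)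

lemma counit_natural:
  "\<lbrakk>t \<in> Arr N; k \<in> Arr N; Cod N k = FObj r (R (Dom N t)); F = Cod N t\<rbrakk> \<Longrightarrow>
     \<epsilon> F \<cdot>\<^bsub>N\<^esub> FArr r (FArr radj t) \<cdot>\<^bsub>N\<^esub> k = t \<cdot>\<^bsub>N\<^esub> \<epsilon> (Dom N t) \<cdot>\<^bsub>N\<^esub> k"
  using N.comp_reassoc[OF radj_arr(4)[of t], of k] by simp

lemma functor_radj: "is_functor N M radj"
  unfolding is_functor_def
proof (intro conjI ballI impI)
  fix F assume F: "F \<in> Obj N"
  show "FArr radj (Idn N F) = Idn M (FObj radj F)"
    by (rule counit_cancel[of _ _ F]) (use F radj_arr(4)[of "Idn N F"] in auto)
next
  fix f g assume fg: "f \<in> Arr N" "g \<in> Arr N" "Cod N f = Dom N g"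
  show "FArr radj (g \<cdot>\<^bsub>N\<^esub> f) = FArr radj g \<cdot>\<^bsub>M\<^esub> FArr radj f"
    by (rule counit_cancel[of _ _ "Cod N g"])
      (use fg radj_arr(4)[of "g \<cdot>\<^bsub>N\<^esub> f"] radj_arr(4)[of f] in \<open>auto simp: counit_natural\<close>)
qed auto

lemma left_adjoint_radj: "left_adjoint M N r radj"
  unfolding left_adjoint_def
\<comment> \<open>\<open>left_adjoint\<close> fixes the direction from \<open>Hom (r Y) F\<close> to
  \<open>Hom Y (R F)\<close>, so here the bijection is \<open>colift\<close> itself and composition
  with the counit is its inverse.\<close>
proof (intro conjI functor_radj functor_r exI[of _ "\<lambda>Y F. colift F Y"] ballI)
  fix Y F assume FY: "Y \<in> Obj M" "F \<in> Obj N"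
  show "bij_betw (colift F Y) (Hom N (FObj r Y) F) (Hom M Y (FObj radj F))"
  proof (rule bij_betwI[where g = "\<lambda>g. \<epsilon> F \<cdot>\<^bsub>N\<^esub> FArr r g"])
    fix g assume "g \<in> Hom M Y (FObj radj F)"
    then show "colift F Y (\<epsilon> F \<cdot>\<^bsub>N\<^esub> FArr r g) = g"
      using FY by (intro counit_cancel[of _ _ F]) auto
  qed (use FY in auto)
next
  fix Y Y' F F' f g h
  assume *: "Y \<in> Obj M" "Y' \<in> Obj M" "F \<in> Obj N" "F' \<in> Obj N" "f \<in> Hom M Y' Y"
    "g \<in> Hom N (FObj r Y) F" "h \<in> Hom N F F'"
  have "\<epsilon> F \<cdot>\<^bsub>N\<^esub> FArr r (colift F Y g) \<cdot>\<^bsub>N\<^esub> FArr r f = g \<cdot>\<^bsub>N\<^esub> FArr r f"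
    using * by (intro N.comp_reassoc) auto
  then show "colift F' Y' (h \<cdot>\<^bsub>N\<^esub> g \<cdot>\<^bsub>N\<^esub> FArr r f) = FArr radj h \<cdot>\<^bsub>M\<^esub> colift F Y g \<cdot>\<^bsub>M\<^esub> f"
    by (intro counit_cancel[of _ _ F']) (use * in \<open>auto simp: counit_natural\<close>)
qed

lemma fully_faithful_radj:
  assumes iso: "\<And>F. F \<in> Obj N \<Longrightarrow> iso_arr N (\<epsilon> F)"
  shows "fully_faithful N M radj"
  unfolding fully_faithful_def
proof (intro ballI)
  fix F G assume FG: "F \<in> Obj N" "G \<in> Obj N"
  note iF = N.inv_arr_simps[OF iso[OF FG(1)]]
  show "bij_betw (FArr radj) (Hom N F G) (Hom M (FObj radj F) (FObj radj G))"
  proof (rule bij_betwI[where g = "\<lambda>g. \<epsilon> G \<cdot>\<^bsub>N\<^esub> FArr r g \<cdot>\<^bsub>N\<^esub> inv_arr N (\<epsilon> F)"])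
    fix t assume t: "t \<in> Hom N F G"
    then show "\<epsilon> G \<cdot>\<^bsub>N\<^esub> FArr r (FArr radj t) \<cdot>\<^bsub>N\<^esub> inv_arr N (\<epsilon> F) = t"
      using FG iF counit_natural[of t "inv_arr N (\<epsilon> F)" G] by simp
  next
    fix g assume g: "g \<in> Hom M (FObj radj F) (FObj radj G)"
    let ?t = "\<epsilon> G \<cdot>\<^bsub>N\<^esub> FArr r g \<cdot>\<^bsub>N\<^esub> inv_arr N (\<epsilon> F)"
    have t: "?t \<in> Hom N F G" using FG iF g by simp
    show "FArr radj ?t = g"
      by (rule counit_cancel[of _ _ G]) (use FG iF g t radj_arr(4)[of ?t] in auto)
  qed (use FG iF in auto)
qed

end

text \<open>
  Both composites \<open>Hom(rLF,H) \<cong> Hom(LF,RH) \<cong> Hom(F,rRH)\<close> and \<open>Hom(F,rRH) \<cong> Hom(F,H)\<close> are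
  bijective, hence so is composition with \<open>\<eta> F\<close>.
\<close>

lemma unit_iso_of_counit_iso:
  assumes "Universal_from N M r L \<eta>" "Universal_to N M r R \<epsilon>"
    and iso: "\<And>H. H \<in> Obj N \<Longrightarrow> iso_arr N (\<epsilon> H)" and F: "F \<in> Obj N"
  shows "iso_arr N (\<eta> F)"
proof -
  interpret U: Universal_from N M r L \<eta> by fact
  interpret W: Universal_to N M r R \<epsilon> by fact
  let ?G = "FObj r (L F)"
  have G: "?G \<in> Obj N" using F by simp
  \<comment> \<open>Transpose \<open>f\<close> and \<open>g\<close> along the right adjunction. The
    transposes agree after the unit because the counit at their target is mono, so they are equal by
    the left universal property.\<close>
  have inj: "f = g"
    if "f \<in> Arr N" "g \<in> Arr N" "Dom N f = ?G" "Dom N g = ?G" "Cod N f = Cod N g"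
      "f \<cdot>\<^bsub>N\<^esub> \<eta> F = g \<cdot>\<^bsub>N\<^esub> \<eta> F" for f g
  proof -
    let ?H = "Cod N g"
    let ?f = "W.colift ?H (L F) f" and ?g = "W.colift ?H (L F) g"
    have ff: "\<epsilon> ?H \<cdot>\<^bsub>N\<^esub> FArr r ?f = f" "\<epsilon> ?H \<cdot>\<^bsub>N\<^esub> FArr r ?g = g" using that F by simp_all
    have eq: "\<epsilon> ?H \<cdot>\<^bsub>N\<^esub> FArr r ?f \<cdot>\<^bsub>N\<^esub> \<eta> F = \<epsilon> ?H \<cdot>\<^bsub>N\<^esub> FArr r ?g \<cdot>\<^bsub>N\<^esub> \<eta> F"
      using that F U.N.comp_reassoc[OF ff(1), of "\<eta> F"] U.N.comp_reassoc[OF ff(2), of "\<eta> F"] by simp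
    have "FArr r ?f \<cdot>\<^bsub>N\<^esub> \<eta> F = FArr r ?g \<cdot>\<^bsub>N\<^esub> \<eta> F"
      by (intro U.N.mono_cancel[OF U.N.iso_mono[OF iso[of ?H]] eq]) (use that F in auto)
    then have "?f = ?g" using that F by (intro U.unit_cancel[of _ _ F]) auto
    then show ?thesis using ff by simp
  qed
  note i = U.N.inv_arr_simps[OF iso[OF F]]
  \<comment> \<open>The inverse of the counit is an arrow from \<open>F\<close> to
    \<open>r (R F)\<close>; its lift to \<open>L F\<close>, restricted and followed by the counit,
    is the candidate inverse of \<open>\<eta> F\<close>.\<close>
  let ?g = "U.lift F (R F) (inv_arr N (\<epsilon> F))"
  let ?s = "\<epsilon> F \<cdot>\<^bsub>N\<^esub> FArr r ?g"
  have s: "?s \<in> Hom N ?G F" "?s \<cdot>\<^bsub>N\<^esub> \<eta> F = Idn N F"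
    using F i by simp_all
  moreover have "\<eta> F \<cdot>\<^bsub>N\<^esub> ?s = Idn N ?G"
    by (rule inj) (use s F G in \<open>auto simp del: U.lift_simps W.colift_simps\<close>)
  ultimately show ?thesis using F by (intro U.N.iso_arrI[of _ ?s]) auto
qed

text \<open>Applying \<open>r\<close> and composing with the unit is additive and injective on
  arrows out of \<open>L F\<close>, so additivity of \<open>r\<close> is inherited.\<close>

lemma additive_ladj:
  assumes "Universal_from N M r L \<eta>" "Preadditive N" "Preadditive M"
    and add: "additive_functor M N r"
  shows "additive_functor N M (Universal_from.ladj N M r L \<eta>)"
proof -
  interpret Universal_from N M r L \<eta> by fact
  show ?thesis
    unfolding additive_functor_def
  proof (intro conjI functor_ladj ballI)
    interpret PN: Preadditive N by fact
    interpret PM: Preadditive M by fact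
    fix F G f g assume *: "F \<in> Obj N" "G \<in> Obj N" "f \<in> Hom N F G" "g \<in> Hom N F G"
    have "FArr r (FArr ladj f \<oplus>\<^bsub>M\<^esub> FArr ladj g) = FArr r (FArr ladj f) \<oplus>\<^bsub>N\<^esub> FArr r (FArr ladj g)"
      using add * unfolding additive_functor_def by (metis Hom_iff L_Obj ladj_arr(1-3))
    then show "FArr ladj (f \<oplus>\<^bsub>N\<^esub> g) = FArr ladj f \<oplus>\<^bsub>M\<^esub> FArr ladj g"
      using * ladj_arr(4)[of "f \<oplus>\<^bsub>N\<^esub> g"] ladj_arr(4)[of f] ladj_arr(4)[of g]
      by (intro unit_cancel[of _ _ F]) (auto simp: PN.comp_add_left PN.comp_add_right)
  qed
qed

lemma additive_radj:
  assumes "Universal_to N M r R \<epsilon>" "Preadditive N" "Preadditive M"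
    and add: "additive_functor M N r"
  shows "additive_functor N M (Universal_to.radj N M r R \<epsilon>)"
proof -
  interpret Universal_to N M r R \<epsilon> by fact
  show ?thesis
    unfolding additive_functor_def
  proof (intro conjI functor_radj ballI)
    interpret PN: Preadditive N by fact
    interpret PM: Preadditive M by fact
    fix F G f g assume *: "F \<in> Obj N" "G \<in> Obj N" "f \<in> Hom N F G" "g \<in> Hom N F G"
    have "FArr r (FArr radj f \<oplus>\<^bsub>M\<^esub> FArr radj g) = FArr r (FArr radj f) \<oplus>\<^bsub>N\<^esub> FArr r (FArr radj g)"
      using add * unfolding additive_functor_def by (metis Hom_iff R_Obj radj_arr(1-3))
    then show "FArr radj (f \<oplus>\<^bsub>N\<^esub> g) = FArr radj f \<oplus>\<^bsub>M\<^esub> FArr radj g"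
      using * radj_arr(4)[of "f \<oplus>\<^bsub>N\<^esub> g"] radj_arr(4)[of f] radj_arr(4)[of g]
      by (intro counit_cancel[of _ _ G]) (auto simp: PN.comp_add_left PN.comp_add_right)
  qed
qed

section \<open>Small sets and the special adjoint functor theorem\<close>

lemma small_inj_on:
  assumes "inj_on f X" "f ` X \<subseteq> Y" "small \<kappa> Y"
  shows "small \<kappa> X"
  using assms card_of_ordLeqI[of f X Y] unfolding small_def
  by (meson image_subset_iff ordLeq_ordLess_trans)

lemma small_subset: "X \<subseteq> Y \<Longrightarrow> small \<kappa> Y \<Longrightarrow> small \<kappa> X"
  by (rule small_inj_on[of "\<lambda>x. x"]) auto

lemma small_image: "small \<kappa> X \<Longrightarrow> small \<kappa> (f ` X)"
  unfolding small_def using card_of_image ordLeq_ordLess_trans by blast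

text \<open>The Grothendieck axioms quantify only over index sets in \<open>'k\<close>; this moves
  an arbitrary small set there.\<close>

lemma small_ex_index:
  assumes "universe \<kappa>" "small \<kappa> (X :: 'a set)"
  shows "\<exists>e :: 'a \<Rightarrow> 'k. inj_on e X \<and> e ` X \<subseteq> Field (\<kappa> :: 'k rel)"
proof -
  have "|X| \<le>o \<kappa>" using assms(2) by (simp add: small_def ordLess_imp_ordLeq)
  moreover have "\<kappa> =o |Field \<kappa>|"
    using assms(1) card_of_Field_ordIso ordIso_symmetric unfolding universe_def by blast
  ultimately have "|X| \<le>o |Field \<kappa>|" using ordLeq_ordIso_trans by blast
  then show ?thesis using card_of_ordLeq[of X "Field \<kappa>"] by blast
qed

text \<open>The strong limit clause of \<open>universe\<close> speaks of subsets of
  \<open>Field \<kappa>\<close> only, so the power set is taken after embedding \<open>X\<close>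
  there.\<close>

lemma small_Pow:
  assumes "universe \<kappa>" "small \<kappa> X"
  shows "small \<kappa> (Pow X)"
proof -
  obtain e where e: "inj_on e X" "e ` X \<subseteq> Field \<kappa>" using small_ex_index[OF assms] by blast
  have "small \<kappa> (Pow (e ` X))"
    using assms(1) e(2) small_image[OF assms(2), of e] unfolding universe_def small_def by blast
  moreover have "inj_on (image e) (Pow X)"
    using e(1) by (auto simp: inj_on_def) blast+
  ultimately show ?thesis by (rule small_inj_on[rotated 2, of _ "Pow (e ` X)"]) auto
qed

text \<open>Regularity of the cardinal, in the form of stability, bounds small sums of small
  sets.\<close>

lemma small_Times:
  assumes "universe \<kappa>" "small \<kappa> X" "small \<kappa> Y"
  shows "small \<kappa> (X \<times> Y)"
  using assms regularCard_stable[of \<kappa>] stable_elim[of \<kappa> X "\<lambda>_. Y"]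
  unfolding universe_def small_def cinfinite_def by blast

lemma small_UNION:
  assumes "universe \<kappa>" "small \<kappa> I" "\<And>i. i \<in> I \<Longrightarrow> small \<kappa> (B i)"
  shows "small \<kappa> (\<Union>i\<in>I. B i)"
  using assms regularCard_stable[of \<kappa>] stable_UNION[of \<kappa> I B]
  unfolding universe_def small_def cinfinite_def by blast

text \<open>A function on \<open>I\<close> is determined by its graph, a subset of a small product;
  members of \<open>Pi\<^sub>E\<close> are extensional, which is why the graph over \<open>I\<close>
  suffices.\<close>

lemma small_PiE:
  assumes "universe \<kappa>" "small \<kappa> I" "\<And>i. i \<in> I \<Longrightarrow> small \<kappa> (B i)"
  shows "small \<kappa> (Pi\<^sub>E I B)"
proof (rule small_inj_on[of "\<lambda>f. (\<lambda>i. (i, f i)) ` I" _ "Pow (I \<times> (\<Union>i\<in>I. B i))"])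
  show "inj_on (\<lambda>f. (\<lambda>i. (i, f i)) ` I) (Pi\<^sub>E I B)"
  proof (rule inj_onI)
    fix f g assume fg: "f \<in> Pi\<^sub>E I B" "g \<in> Pi\<^sub>E I B" "(\<lambda>i. (i, f i)) ` I = (\<lambda>i. (i, g i)) ` I"
    have "f i = g i" if "i \<in> I" for i using fg(3) that by blast
    then show "f = g" by (rule PiE_ext[OF fg(1,2)])
  qed
  show "small \<kappa> (Pow (I \<times> (\<Union>i\<in>I. B i)))"
    using assms by (intro small_Pow small_Times small_UNION)
qed (auto simp: PiE_def Pi_def)

section \<open>Coproducts over small index sets\<close>

lemma coproduct_lift:
  assumes "is_coproduct C I X P \<iota>" "w \<in> Obj C" "\<And>i. i \<in> I \<Longrightarrow> f i \<in> Hom C (X i) w"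
  obtains u where "u \<in> Arr C" "Dom C u = P" "Cod C u = w" "\<And>i. i \<in> I \<Longrightarrow> u \<cdot>\<^bsub>C\<^esub> \<iota> i = f i"
proof -
  have "\<exists>!u. u \<in> Hom C P w \<and> (\<forall>i \<in> I. u \<cdot>\<^bsub>C\<^esub> \<iota> i = f i)"
    using assms unfolding is_coproduct_def by blast
  then show ?thesis using that by auto
qed

lemma coproduct_simps:
  assumes "is_coproduct C I X P \<iota>"
  shows "P \<in> Obj C" "\<And>i. i \<in> I \<Longrightarrow> \<iota> i \<in> Arr C" "\<And>i. i \<in> I \<Longrightarrow> Dom C (\<iota> i) = X i"
    "\<And>i. i \<in> I \<Longrightarrow> Cod C (\<iota> i) = P"
  using assms unfolding is_coproduct_def by auto

lemma (in Category) coproduct_cancel: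
  assumes P: "is_coproduct C I X P \<iota>"
    and "u \<in> Arr C" "v \<in> Arr C" "Dom C u = P" "Dom C v = P" "Cod C u = Cod C v"
    and eq: "\<And>i. i \<in> I \<Longrightarrow> u \<cdot> \<iota> i = v \<cdot> \<iota> i"
  shows "u = v"
proof -
  have "\<exists>!w. w \<in> Hom C P (Cod C v) \<and> (\<forall>i\<in>I. w \<cdot> \<iota> i = v \<cdot> \<iota> i)"
    using P Cod_Obj[OF assms(3)] assms(3,5) coproduct_simps[OF P] unfolding is_coproduct_def
    by (elim conjE allE[of _ "Cod C v"] ballE[of _ _ "Cod C v"]) simp_all
  then show ?thesis by (rule ex1_eqD) (use assms in auto)
qed

lemma coproduct_reindex:
  assumes P: "is_coproduct C (e ` I) (\<lambda>k. X (inv_into I e k)) P \<iota>" and e: "inj_on e I"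
  shows "is_coproduct C I X P (\<lambda>i. \<iota> (e i))"
  unfolding is_coproduct_def
proof (intro conjI ballI allI impI)
  note s = coproduct_simps[OF P]
  show "P \<in> Obj C" by (rule s)
  show "\<iota> (e i) \<in> Hom C (X i) P" if "i \<in> I" for i using s that e by simp
  fix w f assume w: "w \<in> Obj C" and f: "\<forall>i\<in>I. f i \<in> Hom C (X i) w"
  have "\<exists>!u. u \<in> Hom C P w \<and> (\<forall>k\<in>e ` I. u \<cdot>\<^bsub>C\<^esub> \<iota> k = f (inv_into I e k))"
    using P w f e unfolding is_coproduct_def
    by (elim conjE ballE[of _ _ w] allE[of _ "\<lambda>k. f (inv_into I e k)"]) simp_all
  then show "\<exists>!u. u \<in> Hom C P w \<and> (\<forall>i\<in>I. u \<cdot>\<^bsub>C\<^esub> \<iota> (e i) = f i)"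
    using e by simp
qed

text \<open>Hom sets, objects of \<open>C\<close> and pairs of objects serve as index sets below;
  they are relabelled by elements of \<open>'k\<close>.\<close>

lemma coproducts_any_index:
  fixes \<kappa> :: "'k rel" and I :: "'i set"
  assumes "universe \<kappa>"
    and cop: "\<And>(I :: 'k set) X. small \<kappa> I \<Longrightarrow> \<forall>i \<in> I. X i \<in> Obj C \<Longrightarrow> \<exists>P \<iota>. is_coproduct C I X P \<iota>"
    and I: "small \<kappa> I" "\<forall>i \<in> I. X i \<in> Obj C"
  shows "\<exists>P \<iota>. is_coproduct C I X P \<iota>"
proof -
  obtain e :: "'i \<Rightarrow> 'k" where e: "inj_on e I" using small_ex_index[OF assms(1) I(1)] by blast
  have "\<exists>P \<iota>. is_coproduct C (e ` I) (\<lambda>k. X (inv_into I e k)) P \<iota>"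
    by (rule cop) (use I small_image inv_into_into in \<open>auto simp: e\<close>)
  then obtain P \<iota> where "is_coproduct C (e ` I) (\<lambda>k. X (inv_into I e k)) P \<iota>" by blast
  from coproduct_reindex[OF this e] show ?thesis by blast
qed

text \<open>
  With a generator \<open>U\<close>, the quotient of a coproduct of copies of \<open>U\<close> over all \<open>s : rU \<rightarrow> H\<close> by the
  part annihilated in \<open>H\<close> represents \<open>Y \<mapsto> Hom(rY, H)\<close>.
\<close>

theorem special_adjoint_functor_theorem:
  fixes M :: "('o, 'm, 'z) addcat_scheme" and N :: "('p, 'm, 'y) addcat_scheme"
    and r :: "('o, 'm, 'p, 'm) cfunctor"
  assumes "Abelian M" "Preadditive N" and add: "additive_functor M N r"
    and smallM: "\<And>x y. x \<in> Obj M \<Longrightarrow> y \<in> Obj M \<Longrightarrow> small \<kappa> (Hom M x y)"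
    and smallN: "\<And>x y. x \<in> Obj N \<Longrightarrow> y \<in> Obj N \<Longrightarrow> small \<kappa> (Hom N x y)"
    and cop: "\<And>(I :: 'm set) X. small \<kappa> I \<Longrightarrow> \<forall>i \<in> I. X i \<in> Obj M \<Longrightarrow>
      \<exists>P \<iota>. is_coproduct M I X P \<iota> \<and>
        is_coproduct N I (\<lambda>i. FObj r (X i)) (FObj r P) (\<lambda>i. FArr r (\<iota> i))"
    and coker: "\<And>f. f \<in> Arr M \<Longrightarrow> \<exists>q. is_cokernel M f q \<and> is_cokernel N (FArr r f) (FArr r q)"
    and epi: "\<And>e. epi_arr M e \<Longrightarrow> epi_arr N (FArr r e)"
    and U: "is_generator M U" and H: "H \<in> Obj N"
  shows "\<exists>R \<epsilon>. R \<in> Obj M \<and> \<epsilon> \<in> Hom N (FObj r R) H \<and>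
    (\<forall>Y \<in> Obj M. \<forall>f \<in> Hom N (FObj r Y) H. \<exists>!g. g \<in> Hom M Y R \<and> \<epsilon> \<cdot>\<^bsub>N\<^esub> FArr r g = f)"
proof -
  interpret M: Abelian M by fact
  interpret N: Preadditive N by fact
  have fr: "is_functor M N r" using add by (simp add: additive_functor_def)
  note [simp] = FObj_in[OF fr] FArr_in[OF fr] Dom_FArr[OF fr] Cod_FArr[OF fr] FArr_Idn[OF fr]
    FArr_comp[OF fr]
  have r_add: "FArr r (f \<oplus>\<^bsub>M\<^esub> g) = FArr r f \<oplus>\<^bsub>N\<^esub> FArr r g"
    if "f \<in> Arr M" "g \<in> Arr M" "Dom M f = Dom M g" "Cod M f = Cod M g" for f g
    using add that unfolding additive_functor_def by (metis Hom_iff M.Dom_Obj M.Cod_Obj)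
  have r_zero [simp]: "FArr r (zero_arr M x y) = zero_arr N (FObj r x) (FObj r y)"
    if "x \<in> Obj M" "y \<in> Obj M" for x y
    using N.self_add_zero[of "FArr r (zero_arr M x y)"]
      r_add[of "zero_arr M x y" "zero_arr M x y", symmetric] that by simp
  have UO [simp]: "U \<in> Obj M" using U by (simp add: is_generator_def)
  have gen: "f = g" if "f \<in> Arr M" "g \<in> Arr M" "Dom M f = Dom M g" "Cod M f = Cod M g"
    "\<And>h. \<lbrakk>h \<in> Arr M; Dom M h = U; Cod M h = Dom M g\<rbrakk> \<Longrightarrow> f \<cdot>\<^bsub>M\<^esub> h = g \<cdot>\<^bsub>M\<^esub> h" for f g
    using U that unfolding is_generator_def by (metis Hom_iff M.Dom_Obj M.Cod_Obj)
  \<comment> \<open>The sought object \<open>R\<close> must satisfy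
    \<open>Hom U R \<cong> Hom (r U) H\<close>, so it is generated by one copy of \<open>U\<close>
    for each element of the right hand side.\<close>
  let ?S = "Hom N (FObj r U) H"
  obtain G \<iota> where G: "is_coproduct M ?S (\<lambda>_. U) G \<iota>"
    "is_coproduct N ?S (\<lambda>_. FObj r U) (FObj r G) (\<lambda>i. FArr r (\<iota> i))"
    using cop[of ?S "\<lambda>_. U"] smallN[of "FObj r U" H] H by auto
  note Gs [simp] = coproduct_simps[OF G(1)]
  obtain p where p [simp]: "p \<in> Arr N" "Dom N p = FObj r G" "Cod N p = H"
    and pi: "\<And>s. s \<in> ?S \<Longrightarrow> p \<cdot>\<^bsub>N\<^esub> FArr r (\<iota> s) = s"
    using coproduct_lift[OF G(2) H, of "\<lambda>s. s"] by metis
  \<comment> \<open>The relations: all arrows from \<open>U\<close> to \<open>G\<close> that become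
    zero in \<open>H\<close>. They are gathered into one arrow \<open>d\<close>, whose cokernel is
    the representing object.\<close>
  let ?T = "{h \<in> Hom M U G. p \<cdot>\<^bsub>N\<^esub> FArr r h = zero_arr N (FObj r U) H}"
  have "small \<kappa> ?T" by (rule small_subset[OF _ smallM[of U G]]) auto
  then obtain E j where E: "is_coproduct M ?T (\<lambda>_. U) E j"
    "is_coproduct N ?T (\<lambda>_. FObj r U) (FObj r E) (\<lambda>i. FArr r (j i))"
    using cop[of ?T "\<lambda>_. U"] by auto
  note Es = coproduct_simps[OF E(1)]
  obtain d where d [simp]: "d \<in> Arr M" "Dom M d = E" "Cod M d = G"
    and dj: "\<And>h. h \<in> ?T \<Longrightarrow> d \<cdot>\<^bsub>M\<^esub> j h = h"
    using coproduct_lift[OF E(1), of G "\<lambda>h. h"] by auto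
  obtain q where q: "is_cokernel M d q" "is_cokernel N (FArr r d) (FArr r q)"
    using coker[of d] by auto
  have qA [simp]: "q \<in> Arr M" "Dom M q = G" and qd: "q \<cdot>\<^bsub>M\<^esub> d = zero_arr M E (Cod M q)"
    using q by (simp_all add: is_cokernel_def)
  let ?R = "Cod M q"
  have pd: "p \<cdot>\<^bsub>N\<^esub> FArr r d = zero_arr N (FObj r E) H"
  proof (rule N.coproduct_cancel[OF E(2)])
    fix h assume h: "h \<in> ?T"
    have "(p \<cdot>\<^bsub>N\<^esub> FArr r d) \<cdot>\<^bsub>N\<^esub> FArr r (j h) = p \<cdot>\<^bsub>N\<^esub> FArr r (d \<cdot>\<^bsub>M\<^esub> j h)" using h Es by simp
    also have "\<dots> = zero_arr N (FObj r U) H" using dj[OF h] h by simp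
    also have "\<dots> = zero_arr N (FObj r E) H \<cdot>\<^bsub>N\<^esub> FArr r (j h)" using h Es H by simp
    finally show "(p \<cdot>\<^bsub>N\<^esub> FArr r d) \<cdot>\<^bsub>N\<^esub> FArr r (j h) = zero_arr N (FObj r E) H \<cdot>\<^bsub>N\<^esub> FArr r (j h)" .
  qed (use H Es in auto)
  obtain \<epsilon> where e [simp]: "\<epsilon> \<in> Arr N" "Dom N \<epsilon> = FObj r ?R" "Cod N \<epsilon> = H"
    and eq: "\<epsilon> \<cdot>\<^bsub>N\<^esub> FArr r q = p"
    using N.cokernel_factor[OF q(2), of p] pd by auto
  \<comment> \<open>Transposition is injective. Since \<open>y\<close> need not lift to
    \<open>G\<close>, it is pulled back along the epi \<open>q\<close> first. Preceded by an arrow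
    from \<open>U\<close>, the lift is killed in \<open>H\<close>, so it belongs to
    \<open>?T\<close> and dies in the cokernel.\<close>
  have mono: "y = zero_arr M (Dom M y) ?R"
    if y: "y \<in> Arr M" "Cod M y = ?R" "\<epsilon> \<cdot>\<^bsub>N\<^esub> FArr r y = zero_arr N (FObj r (Dom M y)) H" for y
  proof -
    obtain p1 p2 where P [simp]: "p1 \<in> Arr M" "p2 \<in> Arr M" "Dom M p1 = Dom M p2"
      "Cod M p1 = Dom M y" "Cod M p2 = G" and yp: "y \<cdot>\<^bsub>M\<^esub> p1 = q \<cdot>\<^bsub>M\<^esub> p2" and ep: "epi_arr M p1"
      by (rule M.epi_pullback[OF y(1) M.cokernel_epi[OF q(1)] y(2)]) auto
    have "q \<cdot>\<^bsub>M\<^esub> p2 = zero_arr M (Dom M p2) ?R"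
    proof (rule gen)
      fix h assume h: "h \<in> Arr M" "Dom M h = U" "Cod M h = Dom M (zero_arr M (Dom M p2) ?R)"
      then have h' [simp]: "Cod M h = Dom M p2" by simp
      have "p \<cdot>\<^bsub>N\<^esub> FArr r (p2 \<cdot>\<^bsub>M\<^esub> h) = \<epsilon> \<cdot>\<^bsub>N\<^esub> FArr r (q \<cdot>\<^bsub>M\<^esub> p2 \<cdot>\<^bsub>M\<^esub> h)"
        using h by (simp add: eq[symmetric])
      also have "q \<cdot>\<^bsub>M\<^esub> p2 \<cdot>\<^bsub>M\<^esub> h = y \<cdot>\<^bsub>M\<^esub> p1 \<cdot>\<^bsub>M\<^esub> h"
        using h y(1,2) M.comp_reassoc[OF yp, of h] by simp
      also have "\<epsilon> \<cdot>\<^bsub>N\<^esub> FArr r (y \<cdot>\<^bsub>M\<^esub> p1 \<cdot>\<^bsub>M\<^esub> h) = (\<epsilon> \<cdot>\<^bsub>N\<^esub> FArr r y) \<cdot>\<^bsub>N\<^esub> FArr r (p1 \<cdot>\<^bsub>M\<^esub> h)"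
        using h y(1,2) by simp
      also have "\<dots> = zero_arr N (FObj r U) H" unfolding y(3) using h H y(1) by simp
      finally have "p2 \<cdot>\<^bsub>M\<^esub> h \<in> ?T" using h by simp
      then have "q \<cdot>\<^bsub>M\<^esub> p2 \<cdot>\<^bsub>M\<^esub> h = (q \<cdot>\<^bsub>M\<^esub> d) \<cdot>\<^bsub>M\<^esub> j (p2 \<cdot>\<^bsub>M\<^esub> h)"
        using dj[of "p2 \<cdot>\<^bsub>M\<^esub> h"] Es by simp
      also have "\<dots> = zero_arr M U ?R"
        unfolding qd using \<open>p2 \<cdot>\<^bsub>M\<^esub> h \<in> ?T\<close> Es by simp
      finally show "(q \<cdot>\<^bsub>M\<^esub> p2) \<cdot>\<^bsub>M\<^esub> h = zero_arr M (Dom M p2) ?R \<cdot>\<^bsub>M\<^esub> h" using h by simp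
    qed (use y in auto)
    then have "y \<cdot>\<^bsub>M\<^esub> p1 = zero_arr M (Dom M p1) (Cod M y)" using yp y by simp
    then show ?thesis using M.epi_zero[OF ep y(1)] y by simp
  qed
  show ?thesis
  proof (intro exI[of _ ?R] exI[of _ \<epsilon>] conjI ballI)
    fix Y f assume Y: "Y \<in> Obj M" and f: "f \<in> Hom N (FObj r Y) H"
    \<comment> \<open>Present \<open>Y\<close> as a quotient of copies of \<open>U\<close>, on which
      an arrow to the representing object can be prescribed summand by summand.\<close>
    let ?I = "Hom M U Y"
    obtain W k where W: "is_coproduct M ?I (\<lambda>_. U) W k"
      "is_coproduct N ?I (\<lambda>_. FObj r U) (FObj r W) (\<lambda>i. FArr r (k i))"
      using cop[of ?I "\<lambda>_. U"] smallM[of U Y] Y by auto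
    note Ws = coproduct_simps[OF W(1)]
    obtain e where e [simp]: "e \<in> Arr M" "Dom M e = W" "Cod M e = Y"
      and ek: "\<And>h. h \<in> ?I \<Longrightarrow> e \<cdot>\<^bsub>M\<^esub> k h = h"
      using coproduct_lift[OF W(1) Y, of "\<lambda>h. h"] by metis
    have ee: "epi_arr M e"
    proof (rule M.epi_arrI)
      fix h assume h: "h \<in> Arr M" "Dom M h = Cod M e" "h \<cdot>\<^bsub>M\<^esub> e = zero_arr M (Dom M e) (Cod M h)"
      show "h = zero_arr M (Cod M e) (Cod M h)"
      proof (rule gen)
        fix x assume x: "x \<in> Arr M" "Dom M x = U" "Cod M x = Dom M (zero_arr M (Cod M e) (Cod M h))"
        then have x': "x \<in> ?I" using h Y by simp
        have "h \<cdot>\<^bsub>M\<^esub> x = h \<cdot>\<^bsub>M\<^esub> e \<cdot>\<^bsub>M\<^esub> k x" unfolding ek[OF x'] ..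
        also have "\<dots> = (h \<cdot>\<^bsub>M\<^esub> e) \<cdot>\<^bsub>M\<^esub> k x" using x' h(1,2) Ws Y by simp
        also have "\<dots> = zero_arr M U (Cod M h)" unfolding h(3) using x' Ws h by simp
        finally show "h \<cdot>\<^bsub>M\<^esub> x = zero_arr M (Cod M e) (Cod M h) \<cdot>\<^bsub>M\<^esub> x" using x' h Y by simp
      qed (use h Y in auto)
    qed simp
    obtain l where l: "is_kernel M e l" using M.kernel_exists[OF e(1)] by blast
    have lA [simp]: "l \<in> Arr M" "Cod M l = W" and el: "e \<cdot>\<^bsub>M\<^esub> l = zero_arr M (Dom M l) Y"
      using l by (simp_all add: is_kernel_def)
    have fS: "f \<cdot>\<^bsub>N\<^esub> FArr r h \<in> ?S" if "h \<in> ?I" for h using that f by simp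
    \<comment> \<open>The summand labelled \<open>h\<close> goes to the copy of \<open>U\<close> in
      \<open>G\<close> labelled by \<open>f \<cdot> r h\<close>.\<close>
    obtain m where m [simp]: "m \<in> Arr M" "Dom M m = W" "Cod M m = ?R"
      and mk: "\<And>h. h \<in> ?I \<Longrightarrow> m \<cdot>\<^bsub>M\<^esub> k h = q \<cdot>\<^bsub>M\<^esub> \<iota> (f \<cdot>\<^bsub>N\<^esub> FArr r h)"
      using coproduct_lift[OF W(1), of ?R "\<lambda>h. q \<cdot>\<^bsub>M\<^esub> \<iota> (f \<cdot>\<^bsub>N\<^esub> FArr r h)"] fS Gs qA
      by (metis (no_types, lifting) Hom_iff M.Cod_Obj M.comp_Arr M.Dom_comp M.Cod_comp)
    have fm: "\<epsilon> \<cdot>\<^bsub>N\<^esub> FArr r m = f \<cdot>\<^bsub>N\<^esub> FArr r e"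
    proof (rule N.coproduct_cancel[OF W(2)])
      fix h assume h: "h \<in> ?I"
      have "(\<epsilon> \<cdot>\<^bsub>N\<^esub> FArr r m) \<cdot>\<^bsub>N\<^esub> FArr r (k h) = \<epsilon> \<cdot>\<^bsub>N\<^esub> FArr r (m \<cdot>\<^bsub>M\<^esub> k h)" using h Ws by simp
      also have "\<dots> = (\<epsilon> \<cdot>\<^bsub>N\<^esub> FArr r q) \<cdot>\<^bsub>N\<^esub> FArr r (\<iota> (f \<cdot>\<^bsub>N\<^esub> FArr r h))"
        unfolding mk[OF h] using h fS[OF h] Gs(2-4)[OF fS[OF h]] by simp
      also have "\<dots> = f \<cdot>\<^bsub>N\<^esub> FArr r h" unfolding eq using pi[OF fS[OF h]] by simp
      also have "\<dots> = f \<cdot>\<^bsub>N\<^esub> FArr r (e \<cdot>\<^bsub>M\<^esub> k h)" unfolding ek[OF h] ..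
      also have "\<dots> = (f \<cdot>\<^bsub>N\<^esub> FArr r e) \<cdot>\<^bsub>N\<^esub> FArr r (k h)" using h f Ws by simp
      finally show "(\<epsilon> \<cdot>\<^bsub>N\<^esub> FArr r m) \<cdot>\<^bsub>N\<^esub> FArr r (k h) = (f \<cdot>\<^bsub>N\<^esub> FArr r e) \<cdot>\<^bsub>N\<^esub> FArr r (k h)" .
    qed (use f in auto)
    \<comment> \<open>To descend along \<open>e\<close>, the arrow \<open>m\<close> must kill the
      kernel of \<open>e\<close>; by \<open>mono\<close> this may be checked after the counit, where
      \<open>m\<close> agrees with \<open>f \<cdot> r e\<close>.\<close>
    have "\<epsilon> \<cdot>\<^bsub>N\<^esub> FArr r (m \<cdot>\<^bsub>M\<^esub> l) = (\<epsilon> \<cdot>\<^bsub>N\<^esub> FArr r m) \<cdot>\<^bsub>N\<^esub> FArr r l" by simp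
    also have "\<dots> = f \<cdot>\<^bsub>N\<^esub> FArr r (e \<cdot>\<^bsub>M\<^esub> l)" unfolding fm using f by simp
    also have "\<dots> = zero_arr N (FObj r (Dom M l)) H" unfolding el using f Y by simp
    finally have "m \<cdot>\<^bsub>M\<^esub> l = zero_arr M (Dom M l) ?R" using mono[of "m \<cdot>\<^bsub>M\<^esub> l"] by simp
    then obtain g where g: "g \<in> Arr M" "Dom M g = Y" "Cod M g = ?R" "g \<cdot>\<^bsub>M\<^esub> e = m"
      using M.cokernel_factor[OF M.epi_cokernel_of_kernel[OF ee l], of m] by auto
    have gf: "\<epsilon> \<cdot>\<^bsub>N\<^esub> FArr r g = f"
    proof (rule N.epi_cancel[OF epi[OF ee]])
      show "(\<epsilon> \<cdot>\<^bsub>N\<^esub> FArr r g) \<cdot>\<^bsub>N\<^esub> FArr r e = f \<cdot>\<^bsub>N\<^esub> FArr r e"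
        using g fm FArr_comp[OF fr, of e g] by simp
    qed (use g f Y in auto)
    have uniq: "g' = g"
      if g': "g' \<in> Hom M Y ?R" "\<epsilon> \<cdot>\<^bsub>N\<^esub> FArr r g' = f" for g'
    proof -
      let ?y = "g' \<oplus>\<^bsub>M\<^esub> M.neg g"
      have "\<epsilon> \<cdot>\<^bsub>N\<^esub> FArr r ?y = (\<epsilon> \<cdot>\<^bsub>N\<^esub> FArr r g') \<oplus>\<^bsub>N\<^esub> (\<epsilon> \<cdot>\<^bsub>N\<^esub> FArr r (M.neg g))"
        using g g' by (simp add: r_add N.comp_add_right)
      also have "\<dots> = (\<epsilon> \<cdot>\<^bsub>N\<^esub> FArr r g) \<oplus>\<^bsub>N\<^esub> (\<epsilon> \<cdot>\<^bsub>N\<^esub> FArr r (M.neg g))"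
        using g'(2) gf by simp
      also have "\<dots> = \<epsilon> \<cdot>\<^bsub>N\<^esub> FArr r (g \<oplus>\<^bsub>M\<^esub> M.neg g)"
        using g by (simp add: r_add N.comp_add_right del: M.add_neg)
      also have "\<dots> = zero_arr N (FObj r Y) H" using g Y by simp
      finally have "?y = zero_arr M Y ?R" using mono[of ?y] g g' by simp
      then show ?thesis using g g' by (subst M.eq_iff_diff_zero[symmetric]) auto
    qed
    show "\<exists>!g. g \<in> Hom M Y ?R \<and> \<epsilon> \<cdot>\<^bsub>N\<^esub> FArr r g = f"
    proof (rule ex1I[of _ g])
      show "g \<in> Hom M Y ?R \<and> \<epsilon> \<cdot>\<^bsub>N\<^esub> FArr r g = f" using g gf by simp
    qed (use uniq in blast)
  qed simp_all
qed

section \<open>Closed symmetric monoidal categories\<close>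

locale Closed_monoidal = Category V for V :: "('o, 'm, 'z) csmcat_scheme" (structure) +
  assumes closed: "closed_symmetric_monoidal V"
begin

lemma symmetric: "symmetric_monoidal V"
  using closed by (simp only: closed_symmetric_monoidal_def)

lemma monoidal: "monoidal V"
  using symmetric by (simp only: symmetric_monoidal_def)



abbreviation assoc_inv ("\<alpha>''") where "\<alpha>' x y z \<equiv> inv_arr V (Assoc V x y z)"

abbreviation whisker_left (infixr "\<lhd>" 75) where "x \<lhd> f \<equiv> Idn V x \<boxtimes> f"

abbreviation whisker_right (infixl "\<rhd>" 76) where "f \<rhd> x \<equiv> f \<boxtimes> Idn V x"

lemma Unit_Obj [simp]: "Unit V \<in> Obj V"
  using monoidal unfolding monoidal_def by (elim conjE)

lemma ten_Obj [simp]: "\<lbrakk>x \<in> Obj V; y \<in> Obj V\<rbrakk> \<Longrightarrow> x \<otimes> y \<in> Obj V"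
  using monoidal by (simp add: monoidal_def)

lemma ten_Idn [simp]: "\<lbrakk>x \<in> Obj V; y \<in> Obj V\<rbrakk> \<Longrightarrow> Idn V x \<boxtimes> Idn V y = Idn V (x \<otimes> y)"
  using monoidal by (simp add: monoidal_def)

lemma ten_Hom: "\<lbrakk>f \<in> Arr V; g \<in> Arr V\<rbrakk> \<Longrightarrow>
    f \<boxtimes> g \<in> Hom V (Dom V f \<otimes> Dom V g) (Cod V f \<otimes> Cod V g)"
  using monoidal by (simp add: monoidal_def)

lemma ten_Arr [simp]: "\<lbrakk>f \<in> Arr V; g \<in> Arr V\<rbrakk> \<Longrightarrow> f \<boxtimes> g \<in> Arr V"
  and Dom_ten [simp]: "\<lbrakk>f \<in> Arr V; g \<in> Arr V\<rbrakk> \<Longrightarrow> Dom V (f \<boxtimes> g) = Dom V f \<otimes> Dom V g"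
  and Cod_ten [simp]: "\<lbrakk>f \<in> Arr V; g \<in> Arr V\<rbrakk> \<Longrightarrow> Cod V (f \<boxtimes> g) = Cod V f \<otimes> Cod V g"
  using ten_Hom by auto

lemma ten_comp:
  "\<lbrakk>f \<in> Arr V; f' \<in> Arr V; g \<in> Arr V; g' \<in> Arr V; Cod V f = Dom V f'; Cod V g = Dom V g'\<rbrakk> \<Longrightarrow>
     (f' \<boxtimes> g') \<cdot> (f \<boxtimes> g) = (f' \<cdot> f) \<boxtimes> (g' \<cdot> g)"
  using monoidal by (simp add: monoidal_def)

lemmas ten_comp_r = comp_reassoc[OF ten_comp]

lemma assoc_Hom: "\<lbrakk>x \<in> Obj V; y \<in> Obj V; z \<in> Obj V\<rbrakk> \<Longrightarrow>
    Assoc V x y z \<in> Hom V ((x \<otimes> y) \<otimes> z) (x \<otimes> (y \<otimes> z)) \<and> iso_arr V (Assoc V x y z)"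
  using monoidal by (simp add: monoidal_def)

lemma assoc_simps [simp]:
  assumes "x \<in> Obj V" "y \<in> Obj V" "z \<in> Obj V"
  shows "Assoc V x y z \<in> Arr V" "Dom V (Assoc V x y z) = (x \<otimes> y) \<otimes> z"
    "Cod V (Assoc V x y z) = x \<otimes> (y \<otimes> z)" "\<alpha>' x y z \<in> Arr V" "Dom V (\<alpha>' x y z) = x \<otimes> (y \<otimes> z)"
    "Cod V (\<alpha>' x y z) = (x \<otimes> y) \<otimes> z" "\<alpha>' x y z \<cdot> Assoc V x y z = Idn V ((x \<otimes> y) \<otimes> z)"
    "Assoc V x y z \<cdot> \<alpha>' x y z = Idn V (x \<otimes> (y \<otimes> z))"
  using assoc_Hom[OF assms] inv_arr_simps[of "Assoc V x y z"] by simp_all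

lemma assoc_cancel [simp]:
  assumes "x \<in> Obj V" "y \<in> Obj V" "z \<in> Obj V" "f \<in> Arr V"
  shows "Cod V f = (x \<otimes> y) \<otimes> z \<Longrightarrow> \<alpha>' x y z \<cdot> Assoc V x y z \<cdot> f = f"
    "Cod V f = x \<otimes> (y \<otimes> z) \<Longrightarrow> Assoc V x y z \<cdot> \<alpha>' x y z \<cdot> f = f"
  using assms by (simp_all add: comp_reassoc[OF assoc_simps(7)] comp_reassoc[OF assoc_simps(8)])

lemma assoc_natural_raw: "\<lbrakk>f \<in> Arr V; g \<in> Arr V; h \<in> Arr V\<rbrakk> \<Longrightarrow>
     Assoc V (Cod V f) (Cod V g) (Cod V h) \<cdot> ((f \<boxtimes> g) \<boxtimes> h) =
     (f \<boxtimes> (g \<boxtimes> h)) \<cdot> Assoc V (Dom V f) (Dom V g) (Dom V h)"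
  using monoidal by (simp add: monoidal_def)

lemma assoc_natural:
  "\<lbrakk>f \<in> Arr V; g \<in> Arr V; h \<in> Arr V; Cod V f = x; Cod V g = y; Cod V h = z\<rbrakk> \<Longrightarrow>
     Assoc V x y z \<cdot> ((f \<boxtimes> g) \<boxtimes> h) = (f \<boxtimes> (g \<boxtimes> h)) \<cdot> Assoc V (Dom V f) (Dom V g) (Dom V h)"
  using assoc_natural_raw by blast

lemma assoc_inv_natural:
  assumes "f \<in> Arr V" "g \<in> Arr V" "h \<in> Arr V" "Cod V f = x" "Cod V g = y" "Cod V h = z"
  shows "\<alpha>' x y z \<cdot> (f \<boxtimes> (g \<boxtimes> h)) = ((f \<boxtimes> g) \<boxtimes> h) \<cdot> \<alpha>' (Dom V f) (Dom V g) (Dom V h)"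
proof -
  have O: "x \<in> Obj V" "y \<in> Obj V" "z \<in> Obj V" using assms by auto
  have "\<alpha>' x y z \<cdot> (f \<boxtimes> (g \<boxtimes> h)) =
      \<alpha>' x y z \<cdot> ((f \<boxtimes> (g \<boxtimes> h)) \<cdot> Assoc V (Dom V f) (Dom V g) (Dom V h)) \<cdot> \<alpha>' (Dom V f) (Dom V g) (Dom V h)"
    using assms O by simp
  also have "\<dots> = \<alpha>' x y z \<cdot> (Assoc V x y z \<cdot> ((f \<boxtimes> g) \<boxtimes> h)) \<cdot> \<alpha>' (Dom V f) (Dom V g) (Dom V h)"
    using assms by (simp only: assoc_natural)
  also have "\<dots> = ((f \<boxtimes> g) \<boxtimes> h) \<cdot> \<alpha>' (Dom V f) (Dom V g) (Dom V h)"
    using assms O by simp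
  finally show ?thesis .
qed

text \<open>Special cases in which a tensor product of identities has been simplified.\<close>

lemma assoc_inv_natural_left:
  "\<lbrakk>f \<in> Arr V; Cod V f = x; y \<in> Obj V; z \<in> Obj V\<rbrakk> \<Longrightarrow>
     \<alpha>' x y z \<cdot> (f \<rhd> (y \<otimes> z)) = ((f \<rhd> y) \<rhd> z) \<cdot> \<alpha>' (Dom V f) y z"
  using assoc_inv_natural[of f "Idn V y" "Idn V z" x y z] by simp

lemma assoc_natural_right:
  "\<lbrakk>h \<in> Arr V; Cod V h = z; x \<in> Obj V; y \<in> Obj V\<rbrakk> \<Longrightarrow>
     Assoc V x y z \<cdot> ((x \<otimes> y) \<lhd> h) = (x \<lhd> (y \<lhd> h)) \<cdot> Assoc V x y (Dom V h)"
  using assoc_natural[of "Idn V x" "Idn V y" h x y z] by simp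

lemmas assoc_natural_r = comp_reassoc[OF assoc_natural]

lemma pentagon:
  "\<lbrakk>w \<in> Obj V; x \<in> Obj V; y \<in> Obj V; z \<in> Obj V\<rbrakk> \<Longrightarrow>
     Assoc V w x (y \<otimes> z) \<cdot> Assoc V (w \<otimes> x) y z =
     (w \<lhd> Assoc V x y z) \<cdot> Assoc V w (x \<otimes> y) z \<cdot> (Assoc V w x y \<rhd> z)"
  using monoidal by (simp add: monoidal_def)

text \<open>The pentagon with inverted associators, in the form in which it occurs when an action is
  extended to \<open>X \<oslash> v\<close>.\<close>

lemma pentagon_inv:
  assumes [simp]: "w \<in> Obj V" "x \<in> Obj V" "y \<in> Obj V" "z \<in> Obj V"
  shows "(Assoc V w x y \<rhd> z) \<cdot> \<alpha>' (w \<otimes> x) y z =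
    \<alpha>' w (x \<otimes> y) z \<cdot> (w \<lhd> \<alpha>' x y z) \<cdot> Assoc V w x (y \<otimes> z)"
proof -
  have "\<alpha>' w (x \<otimes> y) z \<cdot> (w \<lhd> \<alpha>' x y z) \<cdot> Assoc V w x (y \<otimes> z) =
     \<alpha>' w (x \<otimes> y) z \<cdot> (w \<lhd> \<alpha>' x y z) \<cdot> (Assoc V w x (y \<otimes> z) \<cdot> Assoc V (w \<otimes> x) y z) \<cdot> \<alpha>' (w \<otimes> x) y z"
    by simp
  also have "\<dots> = (Assoc V w x y \<rhd> z) \<cdot> \<alpha>' (w \<otimes> x) y z"
    unfolding pentagon[OF assms] by (simp add: ten_comp_r)
  finally show ?thesis ..
qed

lemma pentagon_inv':
  assumes [simp]: "w \<in> Obj V" "x \<in> Obj V" "y \<in> Obj V" "z \<in> Obj V"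
  shows "(Assoc V w x y \<rhd> z) \<cdot> \<alpha>' (w \<otimes> x) y z \<cdot> \<alpha>' w x (y \<otimes> z) \<cdot> (w \<lhd> Assoc V x y z) =
    \<alpha>' w (x \<otimes> y) z"
  by (subst comp_reassoc[OF pentagon_inv]) (simp_all add: ten_comp)

lemma unit_Hom: "x \<in> Obj V \<Longrightarrow> LUnit V x \<in> Hom V (Unit V \<otimes> x) x \<and> iso_arr V (LUnit V x) \<and>
    RUnit V x \<in> Hom V (x \<otimes> Unit V) x \<and> iso_arr V (RUnit V x)"
  using monoidal by (simp add: monoidal_def)

abbreviation LUnit_inv where "LUnit_inv x \<equiv> inv_arr V (LUnit V x)"

lemma unit_simps [simp]:
  assumes "x \<in> Obj V"
  shows "LUnit V x \<in> Arr V" "Dom V (LUnit V x) = Unit V \<otimes> x" "Cod V (LUnit V x) = x"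
    "RUnit V x \<in> Arr V" "Dom V (RUnit V x) = x \<otimes> Unit V" "Cod V (RUnit V x) = x"
    "LUnit_inv x \<in> Arr V" "Dom V (LUnit_inv x) = x" "Cod V (LUnit_inv x) = Unit V \<otimes> x"
    "LUnit V x \<cdot> LUnit_inv x = Idn V x" "LUnit_inv x \<cdot> LUnit V x = Idn V (Unit V \<otimes> x)"
  using unit_Hom[OF assms] inv_arr_simps[of "LUnit V x"] by simp_all

lemma LUnit_natural_raw: "f \<in> Arr V \<Longrightarrow> LUnit V (Cod V f) \<cdot> (Unit V \<lhd> f) = f \<cdot> LUnit V (Dom V f)"
  using monoidal by (simp add: monoidal_def)

lemma LUnit_natural:
  "\<lbrakk>f \<in> Arr V; Cod V f = x\<rbrakk> \<Longrightarrow> LUnit V x \<cdot> (Unit V \<lhd> f) = f \<cdot> LUnit V (Dom V f)"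
  using LUnit_natural_raw by blast

lemma LUnit_inv_natural:
  assumes "f \<in> Arr V" "Cod V f = x"
  shows "LUnit_inv x \<cdot> f = (Unit V \<lhd> f) \<cdot> LUnit_inv (Dom V f)"
proof -
  have x: "x \<in> Obj V" using assms by auto
  have "LUnit_inv x \<cdot> f = LUnit_inv x \<cdot> (f \<cdot> LUnit V (Dom V f)) \<cdot> LUnit_inv (Dom V f)"
    using assms x by simp
  also have "\<dots> = (LUnit_inv x \<cdot> LUnit V x) \<cdot> (Unit V \<lhd> f) \<cdot> LUnit_inv (Dom V f)"
    using assms x by (simp only: LUnit_natural[symmetric]) (simp del: unit_simps(10,11))
  finally show ?thesis using assms x by simp
qed

lemma triangle:
  "\<lbrakk>x \<in> Obj V; y \<in> Obj V\<rbrakk> \<Longrightarrow> (x \<lhd> LUnit V y) \<cdot> Assoc V x (Unit V) y = RUnit V x \<rhd> y"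
  using monoidal by (simp add: monoidal_def)

lemma triangle_inv:
  assumes [simp]: "x \<in> Obj V" "y \<in> Obj V"
  shows "(RUnit V x \<rhd> y) \<cdot> \<alpha>' x (Unit V) y = x \<lhd> LUnit V y"
  by (simp add: triangle[symmetric])

text \<open>The left unitor is a natural isomorphism, so tensoring with the unit is faithful. This
  is what reduces \<open>LUnit_ten\<close> to the pentagon and the triangle.\<close>

lemma unit_ten_inj:
  assumes "f \<in> Arr V" "g \<in> Arr V" "Dom V f = Dom V g" "Cod V f = Cod V g"
    and eq: "Unit V \<lhd> f = Unit V \<lhd> g"
  shows "f = g"
proof -
  have "f \<cdot> LUnit V (Dom V f) = g \<cdot> LUnit V (Dom V g)"
    using LUnit_natural_raw[OF assms(1)] LUnit_natural_raw[OF assms(2)] assms(4) eq by simp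
  then have "(f \<cdot> LUnit V (Dom V f)) \<cdot> LUnit_inv (Dom V f) = (g \<cdot> LUnit V (Dom V g)) \<cdot> LUnit_inv (Dom V g)"
    using assms(3) by simp
  then show ?thesis using assms(1-4) by simp
qed

text \<open>Kelly's argument: both sides agree after tensoring with the unit on the left.\<close>

lemma LUnit_ten:
  assumes [simp]: "x \<in> Obj V" "y \<in> Obj V"
  shows "LUnit V (x \<otimes> y) \<cdot> Assoc V (Unit V) x y = LUnit V x \<rhd> y"
proof (rule unit_ten_inj)
  let ?e = "Unit V"
  \<comment> \<open>Both sides are compared after precomposing with \<open>?i\<close>, where the
    pentagon and the triangle apply; its right inverse \<open>?j\<close> removes it again.\<close>
  let ?i = "Assoc V ?e (?e \<otimes> x) y \<cdot> (Assoc V ?e ?e x \<rhd> y)"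
  let ?j = "(\<alpha>' ?e ?e x \<rhd> y) \<cdot> \<alpha>' ?e (?e \<otimes> x) y"
  have ij: "?i \<cdot> ?j = Idn V (?e \<otimes> ((?e \<otimes> x) \<otimes> y))" by (simp add: ten_comp_r)
  have "(?e \<lhd> (LUnit V (x \<otimes> y) \<cdot> Assoc V ?e x y)) \<cdot> ?i =
      (?e \<lhd> LUnit V (x \<otimes> y)) \<cdot> (?e \<lhd> Assoc V ?e x y) \<cdot> ?i"
    using ten_comp[of "Idn V ?e" "Idn V ?e" "Assoc V ?e x y" "LUnit V (x \<otimes> y)", symmetric] by simp
  also have "\<dots> = ((?e \<lhd> LUnit V (x \<otimes> y)) \<cdot> Assoc V ?e ?e (x \<otimes> y)) \<cdot> Assoc V (?e \<otimes> ?e) x y"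
    using pentagon[of ?e ?e x y] by simp
  also have "\<dots> = (RUnit V ?e \<rhd> (x \<otimes> y)) \<cdot> Assoc V (?e \<otimes> ?e) x y"
    by (simp only: triangle assms Unit_Obj ten_Obj)
  also have "\<dots> = Assoc V ?e x y \<cdot> ((RUnit V ?e \<rhd> x) \<rhd> y)"
    using assoc_natural[of "RUnit V ?e" "Idn V x" "Idn V y" ?e x y] by simp
  also have "\<dots> = Assoc V ?e x y \<cdot> (((?e \<lhd> LUnit V x) \<rhd> y) \<cdot> (Assoc V ?e ?e x \<rhd> y))"
    by (simp add: ten_comp triangle)
  also have "\<dots> = (?e \<lhd> (LUnit V x \<rhd> y)) \<cdot> ?i"
    using assoc_natural_r[of "Idn V ?e" "LUnit V x" "Idn V y" ?e x y "Assoc V ?e ?e x \<rhd> y"] by simp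
  finally have "((?e \<lhd> (LUnit V (x \<otimes> y) \<cdot> Assoc V ?e x y)) \<cdot> ?i) \<cdot> ?j = ((?e \<lhd> (LUnit V x \<rhd> y)) \<cdot> ?i) \<cdot> ?j"
    by (simp only:)
  then have "(?e \<lhd> (LUnit V (x \<otimes> y) \<cdot> Assoc V ?e x y)) \<cdot> ?i \<cdot> ?j = (?e \<lhd> (LUnit V x \<rhd> y)) \<cdot> ?i \<cdot> ?j"
    by simp
  then show "?e \<lhd> (LUnit V (x \<otimes> y) \<cdot> Assoc V ?e x y) = ?e \<lhd> (LUnit V x \<rhd> y)"
    unfolding ij by simp
qed simp_all

lemma LUnit_ten_inv:
  assumes [simp]: "x \<in> Obj V" "y \<in> Obj V"
  shows "(LUnit V x \<rhd> y) \<cdot> \<alpha>' (Unit V) x y = LUnit V (x \<otimes> y)"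
  by (simp add: LUnit_ten[symmetric])

lemma sym_Hom: "\<lbrakk>x \<in> Obj V; y \<in> Obj V\<rbrakk> \<Longrightarrow> Sym V x y \<in> Hom V (x \<otimes> y) (y \<otimes> x) \<and>
    Sym V y x \<cdot> Sym V x y = Idn V (x \<otimes> y)"
  using symmetric by (simp add: symmetric_monoidal_def)

lemma sym_simps [simp]:
  assumes "x \<in> Obj V" "y \<in> Obj V"
  shows "Sym V x y \<in> Arr V" "Dom V (Sym V x y) = x \<otimes> y" "Cod V (Sym V x y) = y \<otimes> x"
    "Sym V y x \<cdot> Sym V x y = Idn V (x \<otimes> y)"
  using sym_Hom[OF assms] by simp_all

lemma sym_cancel [simp]:
  "\<lbrakk>x \<in> Obj V; y \<in> Obj V; f \<in> Arr V; Cod V f = x \<otimes> y\<rbrakk> \<Longrightarrow> Sym V y x \<cdot> Sym V x y \<cdot> f = f"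
  by (simp add: comp_reassoc[OF sym_simps(4)])

lemma sym_natural_raw: "\<lbrakk>f \<in> Arr V; g \<in> Arr V\<rbrakk> \<Longrightarrow>
    Sym V (Cod V f) (Cod V g) \<cdot> (f \<boxtimes> g) = (g \<boxtimes> f) \<cdot> Sym V (Dom V f) (Dom V g)"
  using symmetric by (simp add: symmetric_monoidal_def)

lemma sym_natural: "\<lbrakk>f \<in> Arr V; g \<in> Arr V; Cod V f = x; Cod V g = y\<rbrakk> \<Longrightarrow>
    Sym V x y \<cdot> (f \<boxtimes> g) = (g \<boxtimes> f) \<cdot> Sym V (Dom V f) (Dom V g)"
  using sym_natural_raw by blast


lemma hexagon:
  "\<lbrakk>x \<in> Obj V; y \<in> Obj V; z \<in> Obj V\<rbrakk> \<Longrightarrow>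
     Assoc V y z x \<cdot> Sym V x (y \<otimes> z) \<cdot> Assoc V x y z =
     (y \<lhd> Sym V x z) \<cdot> Assoc V y x z \<cdot> (Sym V x y \<rhd> z)"
  using symmetric by (simp add: symmetric_monoidal_def)

text \<open>Only one hexagon is an axiom. As the symmetry is involutive, both sides here are inverse
  to the same composite \<open>?p\<close>, one side of an instance of that hexagon.\<close>

lemma hexagon_inv:
  assumes [simp]: "x \<in> Obj V" "y \<in> Obj V" "z \<in> Obj V"
  shows "\<alpha>' z x y \<cdot> Sym V (x \<otimes> y) z \<cdot> \<alpha>' x y z = (Sym V x z \<rhd> y) \<cdot> \<alpha>' x z y \<cdot> (x \<lhd> Sym V y z)"
proof -
  let ?p = "Assoc V x y z \<cdot> Sym V z (x \<otimes> y) \<cdot> Assoc V z x y"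
  let ?q = "\<alpha>' z x y \<cdot> Sym V (x \<otimes> y) z \<cdot> \<alpha>' x y z"
  let ?q' = "(Sym V x z \<rhd> y) \<cdot> \<alpha>' x z y \<cdot> (x \<lhd> Sym V y z)"
  have "?q' \<cdot> ?p = Idn V ((z \<otimes> x) \<otimes> y)"
    unfolding hexagon[OF assms(3) assms(1) assms(2)] by (simp add: ten_comp ten_comp_r)
  then have "(?q' \<cdot> ?p) \<cdot> ?q = ?q" by simp
  moreover have "?p \<cdot> ?q = Idn V (x \<otimes> (y \<otimes> z))" by simp
  then have "?q' \<cdot> ?p \<cdot> ?q = ?q'" by (simp del: comp_assoc)
  ultimately show ?thesis by simp
qed

text \<open>Needed to move the action in the definition of \<open>vcorep\<close> to left evaluation.\<close>

lemma sym_rotate: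
  assumes [simp]: "x \<in> Obj V" "y \<in> Obj V" "z \<in> Obj V"
  shows "(z \<lhd> Sym V y x) \<cdot> Assoc V z y x \<cdot> (Sym V y z \<rhd> x) \<cdot> Sym V x (y \<otimes> z) =
    Sym V (x \<otimes> y) z \<cdot> \<alpha>' x y z"
proof -
  have "(z \<lhd> Sym V y x) \<cdot> Assoc V z y x \<cdot> (Sym V y z \<rhd> x) \<cdot> Sym V x (y \<otimes> z) =
    (z \<lhd> Sym V y x) \<cdot> Assoc V z y x \<cdot> Sym V x (z \<otimes> y) \<cdot> (x \<lhd> Sym V y z)"
    using sym_natural[of "Idn V x" "Sym V y z" x "z \<otimes> y"] by simp
  also have "\<dots> = (z \<lhd> Sym V y x) \<cdot> (Assoc V z y x \<cdot> Sym V x (z \<otimes> y) \<cdot> Assoc V x z y) \<cdot> \<alpha>' x z y \<cdot> (x \<lhd> Sym V y z)"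
    by simp
  also have "\<dots> = Assoc V z x y \<cdot> (Sym V x z \<rhd> y) \<cdot> \<alpha>' x z y \<cdot> (x \<lhd> Sym V y z)"
    unfolding hexagon[OF assms(1,3,2)] by (simp add: ten_comp_r)
  also have "\<dots> = Sym V (x \<otimes> y) z \<cdot> \<alpha>' x y z"
    unfolding hexagon_inv[OF assms, symmetric] by simp
  finally show ?thesis .
qed

section \<open>Internal homs and transposition\<close>

lemma IHom_Obj [simp]: "\<lbrakk>y \<in> Obj V; z \<in> Obj V\<rbrakk> \<Longrightarrow> IHom V y z \<in> Obj V"
  using closed by (simp add: closed_symmetric_monoidal_def)

lemma Eval_Hom: "\<lbrakk>y \<in> Obj V; z \<in> Obj V\<rbrakk> \<Longrightarrow> Eval V y z \<in> Hom V (IHom V y z \<otimes> y) z"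
  using closed by (simp add: closed_symmetric_monoidal_def)

lemma Eval_simps [simp]:
  assumes "y \<in> Obj V" "z \<in> Obj V"
  shows "Eval V y z \<in> Arr V" "Dom V (Eval V y z) = IHom V y z \<otimes> y" "Cod V (Eval V y z) = z"
  using Eval_Hom[OF assms] by simp_all

lemma curry_ex1:
  assumes "x \<in> Obj V" "y \<in> Obj V" "z \<in> Obj V" "f \<in> Hom V (x \<otimes> y) z"
  shows "\<exists>!g. g \<in> Hom V x (IHom V y z) \<and> uncurry_arr V y z g = f"
  using closed assms by (simp add: closed_symmetric_monoidal_def)

lemma curry_simps [simp]:
  assumes "x \<in> Obj V" "y \<in> Obj V" "z \<in> Obj V" "f \<in> Arr V" "Dom V f = x \<otimes> y" "Cod V f = z"
  shows "curry_arr V x y z f \<in> Arr V" "Dom V (curry_arr V x y z f) = x"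
    "Cod V (curry_arr V x y z f) = IHom V y z" "uncurry_arr V y z (curry_arr V x y z f) = f"
  using theI'[OF curry_ex1[OF assms(1-3), of f]] assms(4-6) unfolding curry_arr_def by simp_all

lemma uncurry_simps [simp]:
  assumes "g \<in> Arr V" "Cod V g = IHom V y z" "y \<in> Obj V" "z \<in> Obj V"
  shows "uncurry_arr V y z g \<in> Arr V" "Dom V (uncurry_arr V y z g) = Dom V g \<otimes> y"
    "Cod V (uncurry_arr V y z g) = z"
  using assms by (simp_all add: uncurry_arr_def)

lemma uncurry_inject:
  assumes "f \<in> Arr V" "g \<in> Arr V" "Dom V f = Dom V g" "Cod V f = IHom V y z" "Cod V g = IHom V y z"
    "y \<in> Obj V" "z \<in> Obj V" "uncurry_arr V y z f = uncurry_arr V y z g"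
  shows "f = g"
proof -
  have "\<exists>!h. h \<in> Hom V (Dom V g) (IHom V y z) \<and> uncurry_arr V y z h = uncurry_arr V y z g"
    by (rule curry_ex1) (use assms in auto)
  then show ?thesis by (rule ex1_eqD) (use assms in auto)
qed

lemma uncurry_comp:
  assumes "g \<in> Arr V" "f \<in> Arr V" "Cod V f = Dom V g" "Cod V g = IHom V y z" "y \<in> Obj V" "z \<in> Obj V"
  shows "uncurry_arr V y z (g \<cdot> f) = uncurry_arr V y z g \<cdot> (f \<rhd> y)"
  using assms by (simp add: uncurry_arr_def ten_comp)

lemma uncurry_ten:
  assumes "g \<in> Arr V" "f \<in> Arr V" "Cod V f = y" "Cod V g = IHom V y z" "z \<in> Obj V"
  shows "Eval V y z \<cdot> (g \<boxtimes> f) = uncurry_arr V y z g \<cdot> (Dom V g \<lhd> f)"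
proof -
  have "y \<in> Obj V" using assms by auto
  then show ?thesis using assms by (simp add: uncurry_arr_def ten_comp)
qed

text \<open>Actions carry the hom object on the left, so transposing it away needs the adjunction
  between \<open>y \<otimes> -\<close> and \<open>[y, -]\<close>; the symmetry turns the given
  evaluation into its counit.\<close>

definition leval where "leval y z = Eval V y z \<cdot> Sym V y (IHom V y z)"

definition lcurry where "lcurry x y z f = curry_arr V x y z (f \<cdot> Sym V x y)"

lemma leval_simps [simp]:
  assumes "y \<in> Obj V" "z \<in> Obj V"
  shows "leval y z \<in> Arr V" "Dom V (leval y z) = y \<otimes> IHom V y z" "Cod V (leval y z) = z"
  using assms by (simp_all add: leval_def)

lemma leval_uncurry:
  assumes "g \<in> Arr V" "Cod V g = IHom V y z" "y \<in> Obj V" "z \<in> Obj V"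
  shows "leval y z \<cdot> (y \<lhd> g) = uncurry_arr V y z g \<cdot> Sym V y (Dom V g)"
  using assms by (simp add: leval_def uncurry_arr_def sym_natural)

lemma uncurry_leval:
  assumes "g \<in> Arr V" "Cod V g = IHom V y z" "y \<in> Obj V" "z \<in> Obj V"
  shows "uncurry_arr V y z g = leval y z \<cdot> (y \<lhd> g) \<cdot> Sym V (Dom V g) y"
proof -
  have "(leval y z \<cdot> (y \<lhd> g)) \<cdot> Sym V (Dom V g) y = uncurry_arr V y z g"
    unfolding leval_uncurry[OF assms] using assms by simp
  then show ?thesis using assms by simp
qed

lemma lcurry_simps [simp]:
  assumes "x \<in> Obj V" "y \<in> Obj V" "z \<in> Obj V" "f \<in> Arr V" "Dom V f = y \<otimes> x" "Cod V f = z"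
  shows "lcurry x y z f \<in> Arr V" "Dom V (lcurry x y z f) = x"
    "Cod V (lcurry x y z f) = IHom V y z" "leval y z \<cdot> (y \<lhd> lcurry x y z f) = f"
  using assms by (simp_all add: lcurry_def leval_uncurry)

lemma leval_inject:
  assumes "f \<in> Arr V" "g \<in> Arr V" "Dom V f = Dom V g" "Cod V f = IHom V y z" "Cod V g = IHom V y z"
    "y \<in> Obj V" "z \<in> Obj V" "leval y z \<cdot> (y \<lhd> f) = leval y z \<cdot> (y \<lhd> g)"
  shows "f = g"
proof (rule uncurry_inject[of f g y z])
  have *: "uncurry_arr V y z h = (leval y z \<cdot> (y \<lhd> h)) \<cdot> Sym V (Dom V h) y"
    if "h \<in> Arr V" "Cod V h = IHom V y z" for h
    using that assms(6,7) by (simp add: uncurry_leval)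
  show "uncurry_arr V y z f = uncurry_arr V y z g"
    unfolding *[OF assms(1,4)] *[OF assms(2,5)] assms(3,8) ..
qed (use assms in auto)

lemma lcurry_comp:
  assumes "x \<in> Obj V" "y \<in> Obj V" "z \<in> Obj V" "f \<in> Arr V" "Dom V f = y \<otimes> x" "Cod V f = z"
    "g \<in> Arr V" "Cod V g = x"
  shows "lcurry x y z f \<cdot> g = lcurry (Dom V g) y z (f \<cdot> (y \<lhd> g))"
proof (rule leval_inject[of _ _ y z])
  have "leval y z \<cdot> (y \<lhd> (lcurry x y z f \<cdot> g)) = (leval y z \<cdot> (y \<lhd> lcurry x y z f)) \<cdot> (y \<lhd> g)"
    using assms by (simp add: ten_comp del: lcurry_simps(4))
  then show "leval y z \<cdot> (y \<lhd> (lcurry x y z f \<cdot> g)) = leval y z \<cdot> (y \<lhd> lcurry (Dom V g) y z (f \<cdot> (y \<lhd> g)))"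
    using assms by simp
qed (use assms in auto)

text \<open>By transposition along the adjunction between \<open>c \<otimes> -\<close> and \<open>[c, -]\<close>.\<close>

lemma whisker_jointly_epi:
  assumes joint: "\<And>u v. \<lbrakk>u \<in> Arr V; v \<in> Arr V; Dom V u = Q; Dom V v = Q; Cod V u = Cod V v;
      \<And>i. i \<in> I \<Longrightarrow> u \<cdot> q i = v \<cdot> q i\<rbrakk> \<Longrightarrow> u = v"
    and q: "\<And>i. i \<in> I \<Longrightarrow> q i \<in> Arr V" "\<And>i. i \<in> I \<Longrightarrow> Cod V (q i) = Q"
    and c: "c \<in> Obj V" "Q \<in> Obj V"
    and uv: "u \<in> Arr V" "v \<in> Arr V" "Dom V u = c \<otimes> Q" "Dom V v = c \<otimes> Q" "Cod V u = Cod V v"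
    and eq: "\<And>i. i \<in> I \<Longrightarrow> u \<cdot> (c \<lhd> q i) = v \<cdot> (c \<lhd> q i)"
  shows "u = v"
proof -
  let ?w = "Cod V v"
  have w: "?w \<in> Obj V" using uv by simp
  have "lcurry Q c ?w u = lcurry Q c ?w v"
  proof (rule joint)
    fix i assume "i \<in> I"
    then show "lcurry Q c ?w u \<cdot> q i = lcurry Q c ?w v \<cdot> q i"
      using q uv c w eq by (simp add: lcurry_comp)
  qed (use uv c w in auto)
  then have "leval c ?w \<cdot> (c \<lhd> lcurry Q c ?w u) = leval c ?w \<cdot> (c \<lhd> lcurry Q c ?w v)" by simp
  then show ?thesis using uv c w by simp
qed

text \<open>Converts a factorization of the transpose through \<open>q\<close> into one of
  \<open>f\<close> through \<open>c \<lhd> q\<close>; this is how an action descends to a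
  quotient.\<close>

lemma whisker_factor:
  assumes f: "f \<in> Arr V" "Dom V f = c \<otimes> x" and c: "c \<in> Obj V" "x \<in> Obj V"
    and u: "u \<in> Arr V" "Cod V u = IHom V c (Cod V f)" "q \<in> Arr V" "Dom V q = x" "Cod V q = Dom V u"
    and eq: "u \<cdot> q = lcurry x c (Cod V f) f"
  shows "(leval c (Cod V f) \<cdot> (c \<lhd> u)) \<cdot> (c \<lhd> q) = f"
proof -
  have "(leval c (Cod V f) \<cdot> (c \<lhd> u)) \<cdot> (c \<lhd> q) = leval c (Cod V f) \<cdot> (c \<lhd> (u \<cdot> q))"
    using f c u by (simp add: ten_comp)
  then show ?thesis unfolding eq using f c by simp
qed

end

lemma (in Closed_monoidal) uncurry_eq_iff:
  assumes "f \<in> Arr V" "g \<in> Arr V" "Dom V f = Dom V g" "Cod V f = IHom V y z" "Cod V g = IHom V y z"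
    "y \<in> Obj V" "z \<in> Obj V"
  shows "f = g \<longleftrightarrow> uncurry_arr V y z f = uncurry_arr V y z g"
  using uncurry_inject[OF assms] by blast

locale Closed_abelian = Closed_monoidal V + Abelian V for V :: "('o, 'm, 'z) csmcat_scheme" (structure)
begin

text \<open>A zero arrow factors through a zero object \<open>z\<close>, and any two parallel arrows
  out of \<open>c \<otimes> z\<close> agree, since the empty family into \<open>z\<close> is jointly
  epic and stays so after tensoring.\<close>

lemma whisker_zero [simp]:
  assumes [simp]: "c \<in> Obj V" "x \<in> Obj V" "y \<in> Obj V"
  shows "c \<lhd> zero_arr V x y = zero_arr V (c \<otimes> x) (c \<otimes> y)"
proof -
  obtain z where z: "zero_object V z" using abelian unfolding abelian_def by blast
  have [simp]: "z \<in> Obj V" using z by (simp add: zero_object_def)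
  have "c \<lhd> zero_arr V z y = zero_arr V (c \<otimes> z) (c \<otimes> y)"
  proof (rule whisker_jointly_epi[where I = "{}" and Q = z and c = c])
    fix u v assume uv: "u \<in> Arr V" "v \<in> Arr V" "Dom V u = z" "Dom V v = z" "Cod V u = Cod V v"
    show "u = v"
      using from_zero_object[OF z uv(1,3)] from_zero_object[OF z uv(2,4)] uv(5) by simp
  qed simp_all
  moreover have "c \<lhd> (zero_arr V z y \<cdot> zero_arr V x z) = (c \<lhd> zero_arr V z y) \<cdot> (c \<lhd> zero_arr V x z)"
    using ten_comp[of "Idn V c" "Idn V c" "zero_arr V x z" "zero_arr V z y"]
    by (simp del: zero_comp comp_zero)
  ultimately show ?thesis by simp
qed

lemma lcurry_zero [simp]:
  assumes "x \<in> Obj V" "y \<in> Obj V" "z \<in> Obj V"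
  shows "lcurry x y z (zero_arr V (y \<otimes> x) z) = zero_arr V x (IHom V y z)"
  by (rule leval_inject[of _ _ y z]) (use assms in auto)

text \<open>
  Biadditivity of the tensor product is not an axiom; it holds because \<open>c \<otimes> -\<close> preserves biproducts.
\<close>

lemma whisker_add:
  assumes c [simp]: "c \<in> Obj V"
    and fg [simp]: "f \<in> Arr V" "g \<in> Arr V" "Dom V g = Dom V f" "Cod V g = Cod V f"
  shows "c \<lhd> (f \<oplus> g) = (c \<lhd> f) \<oplus> (c \<lhd> g)"
proof -
  let ?x = "Dom V f" and ?y = "Cod V f"
  have x: "?x \<in> Obj V" by simp
  obtain p \<pi>1 \<pi>2 \<iota>1 \<iota>2 where
    B: "p \<in> Obj V" "\<pi>1 \<in> Hom V p ?x" "\<pi>2 \<in> Hom V p ?x" "\<iota>1 \<in> Hom V ?x p" "\<iota>2 \<in> Hom V ?x p"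
    and eqs: "\<pi>1 \<cdot> \<iota>1 = Idn V ?x" "\<pi>2 \<cdot> \<iota>2 = Idn V ?x" "\<pi>2 \<cdot> \<iota>1 = zero_arr V ?x ?x"
      "\<pi>1 \<cdot> \<iota>2 = zero_arr V ?x ?x" and sum: "(\<iota>1 \<cdot> \<pi>1) \<oplus> (\<iota>2 \<cdot> \<pi>2) = Idn V p"
    using biproduct[OF x x] by metis
  have [simp]: "p \<in> Obj V" "\<pi>1 \<in> Arr V" "Dom V \<pi>1 = p" "Cod V \<pi>1 = ?x"
    "\<pi>2 \<in> Arr V" "Dom V \<pi>2 = p" "Cod V \<pi>2 = ?x" "\<iota>1 \<in> Arr V" "Dom V \<iota>1 = ?x" "Cod V \<iota>1 = p"
    "\<iota>2 \<in> Arr V" "Dom V \<iota>2 = ?x" "Cod V \<iota>2 = p" using B by simp_all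
  \<comment> \<open>The copairing of \<open>f\<close> and \<open>g\<close>, and the diagonal: the
    sum \<open>f \<oplus> g\<close> is \<open>?s \<cdot> ?d\<close>.\<close>
  let ?s = "(f \<cdot> \<pi>1) \<oplus> (g \<cdot> \<pi>2)" and ?d = "\<iota>1 \<oplus> \<iota>2"
  have s1: "?s \<cdot> \<iota>1 = f" and s2: "?s \<cdot> \<iota>2 = g" by (simp_all add: comp_add_left eqs)
  have d1: "\<pi>1 \<cdot> ?d = Idn V ?x" and d2: "\<pi>2 \<cdot> ?d = Idn V ?x"
    by (simp_all add: comp_add_right eqs)
  have T: "c \<lhd> (h \<cdot> k) = (c \<lhd> h) \<cdot> (c \<lhd> k)" if "h \<in> Arr V" "k \<in> Arr V" "Cod V k = Dom V h" for h k
    using that by (simp add: ten_comp)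
  let ?S = "((c \<lhd> f) \<cdot> (c \<lhd> \<pi>1)) \<oplus> ((c \<lhd> g) \<cdot> (c \<lhd> \<pi>2))"
  have "c \<lhd> ?s = ?S"
  \<comment> \<open>The two injections, indexed by truth values, are jointly epic because
    \<open>sum\<close> writes the identity of \<open>p\<close> through them.\<close>
  proof (rule whisker_jointly_epi[where I = UNIV and q = "\<lambda>i. if i then \<iota>1 else \<iota>2" and Q = p and c = c])
    fix u v assume uv: "u \<in> Arr V" "v \<in> Arr V" "Dom V u = p" "Dom V v = p" "Cod V u = Cod V v"
      "\<And>i. i \<in> UNIV \<Longrightarrow> u \<cdot> (if i then \<iota>1 else \<iota>2) = v \<cdot> (if i then \<iota>1 else \<iota>2)"
    have e: "u \<cdot> \<iota>1 = v \<cdot> \<iota>1" "u \<cdot> \<iota>2 = v \<cdot> \<iota>2" using uv(6)[of True] uv(6)[of False] by simp_all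
    have "u \<cdot> \<iota>1 \<cdot> \<pi>1 = v \<cdot> \<iota>1 \<cdot> \<pi>1" "u \<cdot> \<iota>2 \<cdot> \<pi>2 = v \<cdot> \<iota>2 \<cdot> \<pi>2"
      using uv(1-5) comp_reassoc[OF e(1), of \<pi>1] comp_reassoc[OF e(2), of \<pi>2] by simp_all
    then have "u \<cdot> ((\<iota>1 \<cdot> \<pi>1) \<oplus> (\<iota>2 \<cdot> \<pi>2)) = v \<cdot> ((\<iota>1 \<cdot> \<pi>1) \<oplus> (\<iota>2 \<cdot> \<pi>2))"
      using uv(1-5) by (simp add: comp_add_right)
    then show "u = v" unfolding sum using uv(1-5) by simp
  next
    fix i :: bool
    show "(c \<lhd> ?s) \<cdot> (c \<lhd> (if i then \<iota>1 else \<iota>2)) = ?S \<cdot> (c \<lhd> (if i then \<iota>1 else \<iota>2))"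
      by (simp add: ten_comp comp_add_left eqs)
  qed simp_all
  moreover have "f \<oplus> g = ?s \<cdot> ?d"
    by (simp add: comp_add_right s1 s2)
  ultimately have "c \<lhd> (f \<oplus> g) = ?S \<cdot> (c \<lhd> ?d)" by (simp add: T)
  also have "\<dots> = (c \<lhd> f) \<oplus> (c \<lhd> g)"
    by (simp add: comp_add_left ten_comp d1 d2)
  finally show ?thesis .
qed

end


section \<open>Enriched functors as modules\<close>

locale Enriched = Closed_abelian V for V :: "('o, 'm, 'z) csmcat_scheme" (structure) +
  fixes C :: "('c, 'o, 'm) vcat"
  assumes vcategory: "vcategory V C"
begin

abbreviation Ob where "Ob \<equiv> VObj C"

abbreviation H where "H \<equiv> VHom C"

abbreviation m where "m \<equiv> VComp C"

abbreviation M where "M \<equiv> vfun_cat V C"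

lemma vcat_simps [simp]:
  "\<lbrakk>a \<in> Ob; b \<in> Ob\<rbrakk> \<Longrightarrow> H a b \<in> Obj V"
  "a \<in> Ob \<Longrightarrow> VId C a \<in> Arr V" "a \<in> Ob \<Longrightarrow> Dom V (VId C a) = Unit V" "a \<in> Ob \<Longrightarrow> Cod V (VId C a) = H a a"
  "\<lbrakk>a \<in> Ob; b \<in> Ob; c \<in> Ob\<rbrakk> \<Longrightarrow> m a b c \<in> Arr V"
  "\<lbrakk>a \<in> Ob; b \<in> Ob; c \<in> Ob\<rbrakk> \<Longrightarrow> Dom V (m a b c) = H b c \<otimes> H a b"
  "\<lbrakk>a \<in> Ob; b \<in> Ob; c \<in> Ob\<rbrakk> \<Longrightarrow> Cod V (m a b c) = H a c"
  using vcategory by (simp_all add: vcategory_def)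

lemma m_assoc:
  "\<lbrakk>a \<in> Ob; b \<in> Ob; c \<in> Ob; d \<in> Ob\<rbrakk> \<Longrightarrow> m a b d \<cdot> (m b c d \<rhd> H a b) =
     m a c d \<cdot> (H c d \<lhd> m a b c) \<cdot> Assoc V (H c d) (H b c) (H a b)"
  using vcategory by (simp add: vcategory_def)

lemma m_unit:
  "\<lbrakk>a \<in> Ob; b \<in> Ob\<rbrakk> \<Longrightarrow> m a b b \<cdot> (VId C b \<rhd> H a b) = LUnit V (H a b)"
  "\<lbrakk>a \<in> Ob; b \<in> Ob\<rbrakk> \<Longrightarrow> m a a b \<cdot> (H a b \<lhd> VId C a) = RUnit V (H a b)"
  using vcategory by (simp_all add: vcategory_def)

abbreviation act where
  "act F a b \<equiv> uncurry_arr V (VMap F a) (VMap F b) (VAct F a b)"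

definition is_action :: "('c \<Rightarrow> 'o) \<Rightarrow> ('c \<Rightarrow> 'c \<Rightarrow> 'm) \<Rightarrow> bool" where
  "is_action X u \<longleftrightarrow> (\<forall>a \<in> Ob. X a \<in> Obj V) \<and> (\<forall>a \<in> Ob. \<forall>b \<in> Ob. u a b \<in> Hom V (H a b \<otimes> X a) (X b)) \<and>
     (\<forall>a \<in> Ob. \<forall>b \<in> Ob. \<forall>c \<in> Ob.
        u a c \<cdot> (m a b c \<rhd> X a) = u b c \<cdot> (H b c \<lhd> u a b) \<cdot> Assoc V (H b c) (H a b) (X a)) \<and>
     (\<forall>a \<in> Ob. u a a \<cdot> (VId C a \<rhd> X a) = LUnit V (X a))"

text \<open>Both functor axioms compare arrows into an internal hom, so uncurrying them loses
  nothing. The uncurried form no longer mentions the composition of \<open>self_vcat\<close> and is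
  the one used from here on.\<close>

lemma vfunctor_iff:
  "vfunctor V C (self_vcat V) F \<longleftrightarrow>
     VMap F \<in> extensional Ob \<and> VAct F \<in> extensional Ob \<and> (\<forall>a \<in> Ob. VAct F a \<in> extensional Ob) \<and>
     (\<forall>a \<in> Ob. \<forall>b \<in> Ob. VAct F a b \<in> Hom V (H a b) (IHom V (VMap F a) (VMap F b))) \<and>
     is_action (VMap F) (act F)"
proof -
  have comp: "VAct F a c \<cdot> m a b c = VComp (self_vcat V) (VMap F a) (VMap F b) (VMap F c) \<cdot>
        (VAct F b c \<boxtimes> VAct F a b) \<longleftrightarrow>
      act F a c \<cdot> (m a b c \<rhd> VMap F a) =
        act F b c \<cdot> (H b c \<lhd> act F a b) \<cdot> Assoc V (H b c) (H a b) (VMap F a)"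
    if X: "\<forall>a \<in> Ob. VMap F a \<in> Obj V"
      and A: "\<forall>a \<in> Ob. \<forall>b \<in> Ob. VAct F a b \<in> Hom V (H a b) (IHom V (VMap F a) (VMap F b))"
      and [simp]: "a \<in> Ob" "b \<in> Ob" "c \<in> Ob" for a b c
  proof -
    let ?x = "VMap F a" and ?y = "VMap F b" and ?z = "VMap F c"
    have [simp]: "?x \<in> Obj V" "?y \<in> Obj V" "?z \<in> Obj V"
      "\<And>a b. \<lbrakk>a \<in> Ob; b \<in> Ob\<rbrakk> \<Longrightarrow> VAct F a b \<in> Arr V"
      "\<And>a b. \<lbrakk>a \<in> Ob; b \<in> Ob\<rbrakk> \<Longrightarrow> Dom V (VAct F a b) = H a b"
      "\<And>a b. \<lbrakk>a \<in> Ob; b \<in> Ob\<rbrakk> \<Longrightarrow> Cod V (VAct F a b) = IHom V (VMap F a) (VMap F b)"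
      using X A by simp_all
    let ?E = "Eval V ?y ?z \<cdot> (IHom V ?y ?z \<lhd> Eval V ?x ?y) \<cdot> Assoc V (IHom V ?y ?z) (IHom V ?x ?y) ?x"
    let ?c = "curry_arr V (IHom V ?y ?z \<otimes> IHom V ?x ?y) ?x ?z ?E"
    have "uncurry_arr V ?x ?z (?c \<cdot> (VAct F b c \<boxtimes> VAct F a b)) =
        ?E \<cdot> ((VAct F b c \<boxtimes> VAct F a b) \<rhd> ?x)"
      by (subst uncurry_comp) simp_all
    also have "\<dots> = Eval V ?y ?z \<cdot> (VAct F b c \<boxtimes> act F a b) \<cdot> Assoc V (H b c) (H a b) ?x"
      by (simp add: assoc_natural ten_comp_r uncurry_arr_def)
    also have "\<dots> = (Eval V ?y ?z \<cdot> (VAct F b c \<boxtimes> act F a b)) \<cdot> Assoc V (H b c) (H a b) ?x"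
      by simp
    also have "\<dots> = act F b c \<cdot> (H b c \<lhd> act F a b) \<cdot> Assoc V (H b c) (H a b) ?x"
      by (subst uncurry_ten) simp_all
    finally have R: "uncurry_arr V ?x ?z (?c \<cdot> (VAct F b c \<boxtimes> VAct F a b)) =
        act F b c \<cdot> (H b c \<lhd> act F a b) \<cdot> Assoc V (H b c) (H a b) ?x" .
    have L: "uncurry_arr V ?x ?z (VAct F a c \<cdot> m a b c) = act F a c \<cdot> (m a b c \<rhd> ?x)"
      by (subst uncurry_comp) simp_all
    have "VAct F a c \<cdot> m a b c = ?c \<cdot> (VAct F b c \<boxtimes> VAct F a b) \<longleftrightarrow>
        uncurry_arr V ?x ?z (VAct F a c \<cdot> m a b c) =
        uncurry_arr V ?x ?z (?c \<cdot> (VAct F b c \<boxtimes> VAct F a b))"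
      by (intro uncurry_eq_iff) simp_all
    then show ?thesis unfolding R L by (simp add: self_vcat_def)
  qed
  have unit: "VAct F a a \<cdot> VId C a = VId (self_vcat V) (VMap F a) \<longleftrightarrow>
      act F a a \<cdot> (VId C a \<rhd> VMap F a) = LUnit V (VMap F a)"
    if X: "\<forall>a \<in> Ob. VMap F a \<in> Obj V"
      and A: "\<forall>a \<in> Ob. \<forall>b \<in> Ob. VAct F a b \<in> Hom V (H a b) (IHom V (VMap F a) (VMap F b))"
      and [simp]: "a \<in> Ob" for a
  proof -
    let ?x = "VMap F a" and ?c = "curry_arr V (Unit V) (VMap F a) (VMap F a) (LUnit V (VMap F a))"
    have [simp]: "?x \<in> Obj V" "VAct F a a \<in> Arr V" "Dom V (VAct F a a) = H a a"
      "Cod V (VAct F a a) = IHom V ?x ?x" using X A by simp_all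
    have "VAct F a a \<cdot> VId C a = ?c \<longleftrightarrow>
        uncurry_arr V ?x ?x (VAct F a a \<cdot> VId C a) = uncurry_arr V ?x ?x ?c"
      by (intro uncurry_eq_iff) simp_all
    also have "uncurry_arr V ?x ?x (VAct F a a \<cdot> VId C a) = act F a a \<cdot> (VId C a \<rhd> ?x)"
      by (subst uncurry_comp) simp_all
    finally show ?thesis by (simp add: self_vcat_def)
  qed
  have sv: "VObj (self_vcat V) = Obj V" "VHom (self_vcat V) = IHom V" by (simp_all add: self_vcat_def)
  show ?thesis
  \<comment> \<open>The equivalences \<open>comp\<close> and \<open>unit\<close> presuppose well
    typed data; without it both sides are false.\<close>
  proof (cases "(\<forall>a \<in> Ob. VMap F a \<in> Obj V) \<and>
      (\<forall>a \<in> Ob. \<forall>b \<in> Ob. VAct F a b \<in> Hom V (H a b) (IHom V (VMap F a) (VMap F b)))")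
    case True
    then have XA: "\<forall>a \<in> Ob. VMap F a \<in> Obj V"
      "\<forall>a \<in> Ob. \<forall>b \<in> Ob. VAct F a b \<in> Hom V (H a b) (IHom V (VMap F a) (VMap F b))" by blast+
    have aH: "\<forall>a \<in> Ob. \<forall>b \<in> Ob. act F a b \<in> Hom V (H a b \<otimes> VMap F a) (VMap F b)"
      using XA by auto
    show ?thesis
      unfolding vfunctor_def is_action_def sv using XA aH comp[OF XA] unit[OF XA]
      by (simp del: Hom_iff cong: ball_cong)
  next
    case False
    then show ?thesis unfolding vfunctor_def is_action_def sv by blast
  qed
qed

lemma Obj_M: "X \<in> Obj M \<longleftrightarrow> vfunctor V C (self_vcat V) X"
  by (simp add: vfun_cat_def)

lemma M_simps:
  "Arr M = {t. vnatural V C t}" "Dom M = NDom" "Cod M = NCod"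
  by (simp_all add: vfun_cat_def)

lemma functor_simps [simp]:
  assumes "X \<in> Obj M" "a \<in> Ob"
  shows "VMap X a \<in> Obj V" "b \<in> Ob \<Longrightarrow> VAct X a b \<in> Arr V" "b \<in> Ob \<Longrightarrow> Dom V (VAct X a b) = H a b"
    "b \<in> Ob \<Longrightarrow> Cod V (VAct X a b) = IHom V (VMap X a) (VMap X b)"
  using assms unfolding Obj_M vfunctor_iff is_action_def by simp_all

lemma act_simps [simp]:
  assumes "X \<in> Obj M" "a \<in> Ob" "b \<in> Ob"
  shows "act X a b \<in> Arr V" "Dom V (act X a b) = H a b \<otimes> VMap X a" "Cod V (act X a b) = VMap X b"
  using assms by simp_all

lemma act_assoc:
  "\<lbrakk>X \<in> Obj M; a \<in> Ob; b \<in> Ob; c \<in> Ob\<rbrakk> \<Longrightarrow> act X a c \<cdot> (m a b c \<rhd> VMap X a) =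
     act X b c \<cdot> (H b c \<lhd> act X a b) \<cdot> Assoc V (H b c) (H a b) (VMap X a)"
  unfolding Obj_M vfunctor_iff is_action_def by simp

lemma act_unit:
  "\<lbrakk>X \<in> Obj M; a \<in> Ob\<rbrakk> \<Longrightarrow> act X a a \<cdot> (VId C a \<rhd> VMap X a) = LUnit V (VMap X a)"
  unfolding Obj_M vfunctor_iff is_action_def by simp

text \<open>Module laws are checked on an unrestricted family of actions; restriction and currying
  only bring it into the format that \<open>vfunctor\<close> demands.\<close>

definition mkfun :: "('c \<Rightarrow> 'o) \<Rightarrow> ('c \<Rightarrow> 'c \<Rightarrow> 'm) \<Rightarrow> ('c, 'o, 'm) vfun" where
  "mkfun X u = \<lparr>VMap = (\<lambda>a \<in> Ob. X a), VAct = (\<lambda>a \<in> Ob. \<lambda>b \<in> Ob. curry_arr V (H a b) (X a) (X b) (u a b))\<rparr>"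

lemma VMap_mkfun [simp]: "a \<in> Ob \<Longrightarrow> VMap (mkfun X u) a = X a"
  by (simp add: mkfun_def)

lemma mkfun:
  assumes "is_action X u"
  shows mkfun_Obj: "mkfun X u \<in> Obj M" and act_mkfun: "\<lbrakk>a \<in> Ob; b \<in> Ob\<rbrakk> \<Longrightarrow> act (mkfun X u) a b = u a b"
proof -
  have u: "\<forall>a \<in> Ob. X a \<in> Obj V" "\<forall>a \<in> Ob. \<forall>b \<in> Ob. u a b \<in> Hom V (H a b \<otimes> X a) (X b)"
    using assms unfolding is_action_def by blast+
  have *: "uncurry_arr V (X a) (X b) (VAct (mkfun X u) a b) = u a b" if "a \<in> Ob" "b \<in> Ob" for a b
    using u that by (simp add: mkfun_def)
  show "act (mkfun X u) a b = u a b" if "a \<in> Ob" "b \<in> Ob" for a b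
    using *[OF that] that by simp
  have "is_action (VMap (mkfun X u)) (act (mkfun X u))"
    using assms * unfolding is_action_def by (simp del: Hom_iff)
  then show "mkfun X u \<in> Obj M"
    unfolding Obj_M vfunctor_iff using u by (simp add: mkfun_def)
qed

text \<open>Each side of V-naturality is an arrow into \<open>[F a, G b]\<close>; its uncurrying is
  one path around the usual square of module maps.\<close>

lemma vnatural_iff:
  "vnatural V C t \<longleftrightarrow> NDom t \<in> Obj M \<and> NCod t \<in> Obj M \<and> NMap t \<in> extensional Ob \<and>
     (\<forall>a \<in> Ob. NMap t a \<in> Hom V (VMap (NDom t) a) (VMap (NCod t) a)) \<and>
     (\<forall>a \<in> Ob. \<forall>b \<in> Ob. NMap t b \<cdot> act (NDom t) a b = act (NCod t) a b \<cdot> (H a b \<lhd> NMap t a))"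
proof -
  have "IHomA V (Idn V (VMap X a)) s \<cdot> VAct X a b = IHomA V r (Idn V (VMap Y b)) \<cdot> VAct Y a b \<longleftrightarrow>
      s \<cdot> act X a b = act Y a b \<cdot> (H a b \<lhd> r)"
    if [simp]: "X \<in> Obj M" "Y \<in> Obj M" "a \<in> Ob" "b \<in> Ob"
      and r: "r \<in> Hom V (VMap X a) (VMap Y a)" and s: "s \<in> Hom V (VMap X b) (VMap Y b)" for X Y a b r s
  proof -
    let ?x = "VMap X a" and ?x' = "VMap X b" and ?y = "VMap Y a" and ?y' = "VMap Y b"
    have [simp]: "r \<in> Arr V" "Dom V r = ?x" "Cod V r = ?y" "s \<in> Arr V" "Dom V s = ?x'" "Cod V s = ?y'"
      using r s by simp_all
    have "uncurry_arr V ?x ?y' (IHomA V (Idn V ?x) s \<cdot> VAct X a b) = (s \<cdot> Eval V ?x ?x') \<cdot> (VAct X a b \<rhd> ?x)"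
      unfolding IHomA_def by (subst uncurry_comp) simp_all
    also have "\<dots> = s \<cdot> act X a b" by (simp add: uncurry_arr_def)
    finally have 1: "uncurry_arr V ?x ?y' (IHomA V (Idn V ?x) s \<cdot> VAct X a b) = s \<cdot> act X a b" .
    have "uncurry_arr V ?x ?y' (IHomA V r (Idn V ?y') \<cdot> VAct Y a b) =
        (Eval V ?y ?y' \<cdot> (IHom V ?y ?y' \<lhd> r)) \<cdot> (VAct Y a b \<rhd> ?x)"
      unfolding IHomA_def by (subst uncurry_comp) simp_all
    also have "\<dots> = Eval V ?y ?y' \<cdot> (VAct Y a b \<boxtimes> r)" by (simp add: ten_comp)
    also have "\<dots> = act Y a b \<cdot> (H a b \<lhd> r)" by (subst uncurry_ten) simp_all
    finally have 2: "uncurry_arr V ?x ?y' (IHomA V r (Idn V ?y') \<cdot> VAct Y a b) = act Y a b \<cdot> (H a b \<lhd> r)" .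
    have A: "IHomA V (Idn V ?x) s \<in> Hom V (IHom V ?x ?x') (IHom V ?x ?y')"
      "IHomA V r (Idn V ?y') \<in> Hom V (IHom V ?y ?y') (IHom V ?x ?y')"
      unfolding IHomA_def by simp_all
    have "IHomA V (Idn V ?x) s \<cdot> VAct X a b = IHomA V r (Idn V ?y') \<cdot> VAct Y a b \<longleftrightarrow>
        uncurry_arr V ?x ?y' (IHomA V (Idn V ?x) s \<cdot> VAct X a b) =
        uncurry_arr V ?x ?y' (IHomA V r (Idn V ?y') \<cdot> VAct Y a b)"
      using A by (intro uncurry_eq_iff) simp_all
    then show ?thesis unfolding 1 2 .
  qed
  then show ?thesis unfolding vnatural_def Obj_M by (auto simp del: Hom_iff)
qed

lemma nt_simps [simp]:
  assumes "t \<in> Arr M"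
  shows "Dom M t \<in> Obj M" "Cod M t \<in> Obj M"
    "a \<in> Ob \<Longrightarrow> NMap t a \<in> Arr V" "a \<in> Ob \<Longrightarrow> Dom V (NMap t a) = VMap (Dom M t) a"
    "a \<in> Ob \<Longrightarrow> Cod V (NMap t a) = VMap (Cod M t) a"
  using assms unfolding M_simps by (simp_all add: vnatural_iff)

lemma natural:
  "\<lbrakk>t \<in> Arr M; a \<in> Ob; b \<in> Ob\<rbrakk> \<Longrightarrow>
     NMap t b \<cdot> act (Dom M t) a b = act (Cod M t) a b \<cdot> (H a b \<lhd> NMap t a)"
  unfolding M_simps by (simp add: vnatural_iff)

lemma nt_eqI:
  assumes "s \<in> Arr M" "t \<in> Arr M" "Dom M s = Dom M t" "Cod M s = Cod M t"
    "\<And>a. a \<in> Ob \<Longrightarrow> NMap s a = NMap t a"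
  shows "s = t"
proof -
  have "NMap s = NMap t"
    using assms(1,2,5) unfolding M_simps by (auto simp: vnatural_iff intro: extensionalityI)
  then show ?thesis using assms(3,4) unfolding M_simps by simp
qed

definition mknt :: "('c, 'o, 'm) vfun \<Rightarrow> ('c, 'o, 'm) vfun \<Rightarrow> ('c \<Rightarrow> 'm) \<Rightarrow> ('c, 'o, 'm) vnt" where
  "mknt X Y t = \<lparr>NDom = X, NCod = Y, NMap = restrict t Ob\<rparr>"

lemma NMap_mknt [simp]: "a \<in> Ob \<Longrightarrow> NMap (mknt X Y t) a = t a"
  by (simp add: mknt_def)

lemma mknt_Hom:
  assumes "X \<in> Obj M" "Y \<in> Obj M" "\<And>a. a \<in> Ob \<Longrightarrow> t a \<in> Hom V (VMap X a) (VMap Y a)"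
    "\<And>a b. \<lbrakk>a \<in> Ob; b \<in> Ob\<rbrakk> \<Longrightarrow> t b \<cdot> act X a b = act Y a b \<cdot> (H a b \<lhd> t a)"
  shows "mknt X Y t \<in> Hom M X Y"
proof -
  have "vnatural V C (mknt X Y t)"
    unfolding vnatural_iff using assms by (simp add: mknt_def)
  then show ?thesis unfolding Hom_iff M_simps by (simp add: mknt_def)
qed

lemma M_Idn: "Idn M X = mknt X X (\<lambda>a. Idn V (VMap X a))"
  and M_Comp: "g \<cdot>\<^bsub>M\<^esub> f = mknt (Dom M f) (Cod M g) (\<lambda>a. NMap g a \<cdot> NMap f a)"
  and M_Add: "g \<oplus>\<^bsub>M\<^esub> f = mknt (Dom M g) (Cod M g) (\<lambda>a. NMap g a \<oplus> NMap f a)"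
  by (simp_all add: vfun_cat_def mknt_def)

lemma NMap_simps [simp]:
  assumes "a \<in> Ob"
  shows "NMap (Idn M X) a = Idn V (VMap X a)" "NMap (g \<cdot>\<^bsub>M\<^esub> f) a = NMap g a \<cdot> NMap f a"
    "NMap (g \<oplus>\<^bsub>M\<^esub> f) a = NMap g a \<oplus> NMap f a"
  using assms by (simp_all add: M_Idn M_Comp M_Add)

lemma M_comp_Hom:
  assumes "f \<in> Arr M" "g \<in> Arr M" "Cod M f = Dom M g"
  shows "g \<cdot>\<^bsub>M\<^esub> f \<in> Hom M (Dom M f) (Cod M g)"
  unfolding M_Comp
proof (rule mknt_Hom)
  fix a b assume [simp]: "a \<in> Ob" "b \<in> Ob"
  have "(NMap g b \<cdot> NMap f b) \<cdot> act (Dom M f) a b = NMap g b \<cdot> (NMap f b \<cdot> act (Dom M f) a b)"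
    using assms by simp
  also have "\<dots> = (NMap g b \<cdot> act (Dom M g) a b) \<cdot> (H a b \<lhd> NMap f a)"
    unfolding natural[OF assms(1) \<open>a \<in> Ob\<close> \<open>b \<in> Ob\<close>] using assms by simp
  also have "\<dots> = act (Cod M g) a b \<cdot> (H a b \<lhd> (NMap g a \<cdot> NMap f a))"
    unfolding natural[OF assms(2) \<open>a \<in> Ob\<close> \<open>b \<in> Ob\<close>] using assms by (simp add: ten_comp)
  finally show "(NMap g b \<cdot> NMap f b) \<cdot> act (Dom M f) a b =
    act (Cod M g) a b \<cdot> (H a b \<lhd> (NMap g a \<cdot> NMap f a))" .
qed (use assms in auto)

lemma M_Idn_Hom: "X \<in> Obj M \<Longrightarrow> Idn M X \<in> Hom M X X"
  unfolding M_Idn by (rule mknt_Hom) simp_all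

lemma category_M: "category M"
  unfolding category_def
proof (intro conjI ballI impI)
  fix f assume f: "f \<in> Arr M"
  note I = M_Idn_Hom[of "Dom M f"] M_Idn_Hom[of "Cod M f"]
  show "f \<cdot>\<^bsub>M\<^esub> Idn M (Dom M f) = f"
    using f I M_comp_Hom[of "Idn M (Dom M f)" f] by (intro nt_eqI) simp_all
  show "Idn M (Cod M f) \<cdot>\<^bsub>M\<^esub> f = f"
    using f I M_comp_Hom[of f "Idn M (Cod M f)"] by (intro nt_eqI) simp_all
next
  fix f g h assume *: "f \<in> Arr M" "g \<in> Arr M" "h \<in> Arr M" "Cod M f = Dom M g \<and> Cod M g = Dom M h"
  show "(h \<cdot>\<^bsub>M\<^esub> g) \<cdot>\<^bsub>M\<^esub> f = h \<cdot>\<^bsub>M\<^esub> g \<cdot>\<^bsub>M\<^esub> f"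
    using * M_comp_Hom[of f g] M_comp_Hom[of g h] M_comp_Hom[of f "h \<cdot>\<^bsub>M\<^esub> g"]
      M_comp_Hom[of "g \<cdot>\<^bsub>M\<^esub> f" h]
    by (intro nt_eqI) simp_all
qed (use M_Idn_Hom M_comp_Hom in auto)

text \<open>The naturality square of a sum splits only because tensoring with a hom object is
  additive, which is \<open>whisker_add\<close>.\<close>

lemma M_add_Hom:
  assumes "f \<in> Hom M X Y" "g \<in> Hom M X Y"
  shows "f \<oplus>\<^bsub>M\<^esub> g \<in> Hom M X Y"
proof -
  have "mknt X Y (\<lambda>a. NMap f a \<oplus> NMap g a) \<in> Hom M X Y"
  proof (rule mknt_Hom)
    fix a b assume [simp]: "a \<in> Ob" "b \<in> Ob"
    show "(NMap f b \<oplus> NMap g b) \<cdot> act X a b = act Y a b \<cdot> (H a b \<lhd> (NMap f a \<oplus> NMap g a))"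
      using assms natural[of f a b] natural[of g a b]
      by (auto simp: comp_add_left comp_add_right whisker_add simp del: uncurry_simps)
  qed (use assms in auto)
  then show ?thesis using assms unfolding M_Add by simp
qed

definition zero_nt where "zero_nt X Y = mknt X Y (\<lambda>a. zero_arr V (VMap X a) (VMap Y a))"

lemma zero_nt_Hom: "\<lbrakk>X \<in> Obj M; Y \<in> Obj M\<rbrakk> \<Longrightarrow> zero_nt X Y \<in> Hom M X Y"
  unfolding zero_nt_def by (rule mknt_Hom) simp_all

lemma preadditive_M: "preadditive M"
  unfolding preadditive_def
proof (intro conjI category_M ballI)
  interpret M: Category M by unfold_locales (rule category_M)
  note A = M_add_Hom[simplified]
  {
    fix X Y f g assume *: "X \<in> Obj M" "Y \<in> Obj M" "f \<in> Hom M X Y" "g \<in> Hom M X Y"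
    show "f \<oplus>\<^bsub>M\<^esub> g \<in> Hom M X Y" using * by (intro M_add_Hom)
    show "f \<oplus>\<^bsub>M\<^esub> g = g \<oplus>\<^bsub>M\<^esub> f"
      by (rule nt_eqI) (use * A in \<open>auto intro: add_commute\<close>)
  }
  {
    fix X Y f g h assume *: "X \<in> Obj M" "Y \<in> Obj M" "f \<in> Hom M X Y" "g \<in> Hom M X Y" "h \<in> Hom M X Y"
    show "f \<oplus>\<^bsub>M\<^esub> g \<oplus>\<^bsub>M\<^esub> h = f \<oplus>\<^bsub>M\<^esub> (g \<oplus>\<^bsub>M\<^esub> h)"
      by (rule nt_eqI) (use * A in \<open>auto intro: add_assoc\<close>)
  }
  {
    fix X Y Z f g h assume *: "X \<in> Obj M" "Y \<in> Obj M" "Z \<in> Obj M"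
      "f \<in> Hom M X Y" "g \<in> Hom M Y Z" "h \<in> Hom M Y Z"
    show "(g \<oplus>\<^bsub>M\<^esub> h) \<cdot>\<^bsub>M\<^esub> f = (g \<cdot>\<^bsub>M\<^esub> f) \<oplus>\<^bsub>M\<^esub> (h \<cdot>\<^bsub>M\<^esub> f)"
      by (rule nt_eqI) (use * A in \<open>auto intro: comp_add_left\<close>)
  }
  {
    fix X Y Z f g h assume *: "X \<in> Obj M" "Y \<in> Obj M" "Z \<in> Obj M"
      "f \<in> Hom M X Y" "g \<in> Hom M X Y" "h \<in> Hom M Y Z"
    show "h \<cdot>\<^bsub>M\<^esub> (f \<oplus>\<^bsub>M\<^esub> g) = (h \<cdot>\<^bsub>M\<^esub> f) \<oplus>\<^bsub>M\<^esub> (h \<cdot>\<^bsub>M\<^esub> g)"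
      by (rule nt_eqI) (use * A in \<open>auto intro: comp_add_right\<close>)
  }
  fix X Y assume XY: "X \<in> Obj M" "Y \<in> Obj M"
  note z = zero_nt_Hom[OF XY]
  show "\<exists>z\<in>Hom M X Y. \<forall>f\<in>Hom M X Y. f \<oplus>\<^bsub>M\<^esub> z = f \<and> (\<exists>g\<in>Hom M X Y. f \<oplus>\<^bsub>M\<^esub> g = z)"
  proof (rule bexI[OF _ z], intro ballI conjI)
    fix f assume f: "f \<in> Hom M X Y"
    show "f \<oplus>\<^bsub>M\<^esub> zero_nt X Y = f"
      by (rule nt_eqI) (use f z A in \<open>auto simp: zero_nt_def\<close>)
    have n: "mknt X Y (\<lambda>a. neg (NMap f a)) \<in> Hom M X Y"
    proof (rule mknt_Hom)
      fix a b assume [simp]: "a \<in> Ob" "b \<in> Ob"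
      \<comment> \<open>Additivity again: whiskering sends \<open>neg\<close> to an additive
        inverse, and these are unique.\<close>
      have "(H a b \<lhd> NMap f a) \<oplus> (H a b \<lhd> neg (NMap f a)) = zero_arr V (H a b \<otimes> VMap X a) (H a b \<otimes> VMap Y a)"
        using f by (subst whisker_add[symmetric]) auto
      then have "H a b \<lhd> neg (NMap f a) = neg (H a b \<lhd> NMap f a)"
        using f by (intro neg_unique[symmetric]) auto
      then show "neg (NMap f b) \<cdot> act X a b = act Y a b \<cdot> (H a b \<lhd> neg (NMap f a))"
        using f natural[of f a b] by (auto simp: comp_neg neg_comp simp del: uncurry_simps)
    qed (use f XY in auto)
    show "\<exists>g\<in>Hom M X Y. f \<oplus>\<^bsub>M\<^esub> g = zero_nt X Y"
      by (intro bexI[OF _ n] nt_eqI) (use f n z A in \<open>auto simp: zero_nt_def\<close>)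
  qed
qed

end

sublocale Enriched \<subseteq> M: Preadditive "vfun_cat V C"
  by (rule PreadditiveI) (rule preadditive_M)

context Enriched
begin

lemma zero_M: 
  assumes "X \<in> Obj M" "Y \<in> Obj M"
  shows "zero_arr M X Y = zero_nt X Y"
proof -
  note z = zero_nt_Hom[OF assms]
  have "zero_nt X Y \<oplus>\<^bsub>M\<^esub> zero_nt X Y = zero_nt X Y"
    by (rule nt_eqI) (use z assms in \<open>auto simp: zero_nt_def\<close>)
  then show ?thesis using M.self_add_zero[of "zero_nt X Y"] z by simp
qed

lemma NMap_zero [simp]:
  "\<lbrakk>X \<in> Obj M; Y \<in> Obj M; a \<in> Ob\<rbrakk> \<Longrightarrow> NMap (zero_arr M X Y) a = zero_arr V (VMap X a) (VMap Y a)"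
  by (simp add: zero_M zero_nt_def)

end

context Closed_monoidal
begin

lemma whisker_left_comp:
  "\<lbrakk>c \<in> Obj V; f \<in> Arr V; g \<in> Arr V; Cod V f = Dom V g\<rbrakk> \<Longrightarrow> c \<lhd> (g \<cdot> f) = (c \<lhd> g) \<cdot> (c \<lhd> f)"
  and whisker_right_comp:
  "\<lbrakk>c \<in> Obj V; f \<in> Arr V; g \<in> Arr V; Cod V f = Dom V g\<rbrakk> \<Longrightarrow> (g \<cdot> f) \<rhd> c = (g \<rhd> c) \<cdot> (f \<rhd> c)"
  by (simp_all add: ten_comp)

lemma whisker_exchange:
  "\<lbrakk>f \<in> Arr V; g \<in> Arr V; Dom V f = x; Cod V f = y; Dom V g = z; Cod V g = w\<rbrakk> \<Longrightarrow>
     (y \<lhd> g) \<cdot> (f \<rhd> z) = (f \<rhd> w) \<cdot> (x \<lhd> g)"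
  by (auto simp: ten_comp)

end


section \<open>Free and cofree functors\<close>

context Enriched
begin

abbreviation (input) P where "P a v \<equiv> vtensor V C (vrep V C a) v"

lemma vrep_mkfun: "vrep V C a = mkfun (\<lambda>c. H a c) (\<lambda>c d. m a c d)"
  by (simp add: vrep_def mkfun_def)

lemma vrep_action: "a \<in> Ob \<Longrightarrow> is_action (\<lambda>c. H a c) (\<lambda>c d. m a c d)"
  unfolding is_action_def by (simp add: m_assoc m_unit)

lemma vrep_simps [simp]:
  assumes "a \<in> Ob"
  shows "vrep V C a \<in> Obj M" "c \<in> Ob \<Longrightarrow> VMap (vrep V C a) c = H a c"
  using mkfun_Obj[OF vrep_action[OF assms]] by (simp_all add: vrep_mkfun)

lemma vrep_act: "\<lbrakk>a \<in> Ob; c \<in> Ob; d \<in> Ob\<rbrakk> \<Longrightarrow> act (vrep V C a) c d = m a c d"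
  unfolding vrep_mkfun by (rule act_mkfun[OF vrep_action])

lemma vtensor_mkfun:
  "vtensor V C X v = mkfun (\<lambda>c. VMap X c \<otimes> v) (\<lambda>c d. (act X c d \<rhd> v) \<cdot> \<alpha>' (H c d) (VMap X c) v)"
  by (simp add: vtensor_def mkfun_def)

text \<open>The object \<open>v\<close> is a mere spectator of the action of \<open>X\<close>;
  beyond the module laws of \<open>X\<close> only coherence of associators and unitors
  enters.\<close>

lemma vtensor_action:
  assumes X: "X \<in> Obj M" and v [simp]: "v \<in> Obj V"
  shows "is_action (\<lambda>c. VMap X c \<otimes> v) (\<lambda>c d. (act X c d \<rhd> v) \<cdot> \<alpha>' (H c d) (VMap X c) v)"
  unfolding is_action_def
proof (intro conjI ballI)
  fix c d e assume [simp]: "c \<in> Ob" "d \<in> Ob" "e \<in> Ob"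
  note [simp] = X
  let ?p = "H d e" and ?q = "H c d" and ?s = "VMap X c" and ?t = "VMap X d"
  have A: "act X i j \<in> Arr V" "Dom V (act X i j) = H i j \<otimes> VMap X i" "Cod V (act X i j) = VMap X j"
    if "i \<in> Ob" "j \<in> Ob" for i j using that by simp_all
  have "((act X c e \<rhd> v) \<cdot> \<alpha>' (H c e) ?s v) \<cdot> (m c d e \<rhd> (?s \<otimes> v)) =
      (act X c e \<rhd> v) \<cdot> ((m c d e \<rhd> ?s) \<rhd> v) \<cdot> \<alpha>' (?p \<otimes> ?q) ?s v"
    by (simp add: assoc_inv_natural_left)
  also have "\<dots> = ((act X c e \<cdot> (m c d e \<rhd> ?s)) \<rhd> v) \<cdot> \<alpha>' (?p \<otimes> ?q) ?s v"
    by (simp add: ten_comp_r)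
  also have "\<dots> = (act X d e \<rhd> v) \<cdot> ((?p \<lhd> act X c d) \<rhd> v) \<cdot> (Assoc V ?p ?q ?s \<rhd> v) \<cdot> \<alpha>' (?p \<otimes> ?q) ?s v"
    by (simp add: act_assoc ten_comp_r)
  also have "\<dots> = (act X d e \<rhd> v) \<cdot> ((?p \<lhd> act X c d) \<rhd> v) \<cdot> \<alpha>' ?p (?q \<otimes> ?s) v \<cdot> (?p \<lhd> \<alpha>' ?q ?s v) \<cdot>
      Assoc V ?p ?q (?s \<otimes> v)"
    by (simp add: pentagon_inv)
  also have "\<dots> = (act X d e \<rhd> v) \<cdot> (\<alpha>' ?p ?t v \<cdot> (?p \<lhd> (act X c d \<rhd> v))) \<cdot> (?p \<lhd> \<alpha>' ?q ?s v) \<cdot>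
      Assoc V ?p ?q (?s \<otimes> v)"
    using assoc_inv_natural[of "Idn V ?p" "act X c d" "Idn V v" ?p ?t v] by simp
  also have "\<dots> = ((act X d e \<rhd> v) \<cdot> \<alpha>' ?p ?t v) \<cdot>
      (?p \<lhd> ((act X c d \<rhd> v) \<cdot> \<alpha>' ?q ?s v)) \<cdot> Assoc V ?p ?q (?s \<otimes> v)"
    by (simp add: whisker_left_comp)
  finally show "((act X c e \<rhd> v) \<cdot> \<alpha>' (H c e) ?s v) \<cdot> (m c d e \<rhd> (?s \<otimes> v)) =
    ((act X d e \<rhd> v) \<cdot> \<alpha>' ?p ?t v) \<cdot> (?p \<lhd> ((act X c d \<rhd> v) \<cdot> \<alpha>' ?q ?s v)) \<cdot> Assoc V ?p ?q (?s \<otimes> v)" .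
next
  fix c assume [simp]: "c \<in> Ob"
  note [simp] = X
  let ?s = "VMap X c"
  have "((act X c c \<rhd> v) \<cdot> \<alpha>' (H c c) ?s v) \<cdot> (VId C c \<rhd> (?s \<otimes> v)) =
      (act X c c \<rhd> v) \<cdot> ((VId C c \<rhd> ?s) \<rhd> v) \<cdot> \<alpha>' (Unit V) ?s v"
    by (simp add: assoc_inv_natural_left)
  also have "\<dots> = ((act X c c \<cdot> (VId C c \<rhd> ?s)) \<rhd> v) \<cdot> \<alpha>' (Unit V) ?s v"
    by (simp add: ten_comp_r)
  also have "\<dots> = LUnit V (?s \<otimes> v)" by (simp add: act_unit LUnit_ten_inv)
  finally show "((act X c c \<rhd> v) \<cdot> \<alpha>' (H c c) ?s v) \<cdot> (VId C c \<rhd> (?s \<otimes> v)) = LUnit V (?s \<otimes> v)" .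
qed (use X in auto)

lemma P_simps [simp]:
  assumes "a \<in> Ob" "v \<in> Obj V"
  shows "P a v \<in> Obj M" "c \<in> Ob \<Longrightarrow> VMap (P a v) c = H a c \<otimes> v"
  using mkfun_Obj[OF vtensor_action[of "vrep V C a" v]] assms by (simp_all add: vtensor_mkfun)

lemma P_act:
  "\<lbrakk>a \<in> Ob; v \<in> Obj V; c \<in> Ob; d \<in> Ob\<rbrakk> \<Longrightarrow> act (P a v) c d = (m a c d \<rhd> v) \<cdot> \<alpha>' (H c d) (H a c) v"
  unfolding vtensor_mkfun[of "vrep V C a"]
  by (subst act_mkfun[OF vtensor_action]) (use vrep_act[of a c d] in simp_all)

text \<open>Informally \<open>(g, x) \<mapsto> g (t x)\<close>: the module map out of the free
  functor determined by \<open>t\<close>.\<close>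

definition yoneda where
  "yoneda a v X t = mknt (P a v) X (\<lambda>c. act X a c \<cdot> (H a c \<lhd> t))"

text \<open>The universal element \<open>x \<mapsto> (1, x)\<close> of the free functor at
  \<open>a\<close>.\<close>

definition P_unit where "P_unit a v = (VId C a \<rhd> v) \<cdot> LUnit_inv v"

lemma P_unit_simps [simp]:
  "\<lbrakk>a \<in> Ob; v \<in> Obj V\<rbrakk> \<Longrightarrow> P_unit a v \<in> Arr V"
  "\<lbrakk>a \<in> Ob; v \<in> Obj V\<rbrakk> \<Longrightarrow> Dom V (P_unit a v) = v"
  "\<lbrakk>a \<in> Ob; v \<in> Obj V\<rbrakk> \<Longrightarrow> Cod V (P_unit a v) = H a a \<otimes> v"
  by (simp_all add: P_unit_def)

lemma NMap_yoneda: "c \<in> Ob \<Longrightarrow> NMap (yoneda a v X t) c = act X a c \<cdot> (H a c \<lhd> t)"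
  by (simp add: yoneda_def)

lemma yoneda_Hom:
  assumes a [simp]: "a \<in> Ob" and X [simp]: "X \<in> Obj M" and t: "t \<in> Hom V v (VMap X a)"
  shows "yoneda a v X t \<in> Hom M (P a v) X"
  unfolding yoneda_def
proof (rule mknt_Hom)
  have [simp]: "t \<in> Arr V" "Dom V t = v" "Cod V t = VMap X a" using t by simp_all
  have v [simp]: "v \<in> Obj V" using Dom_Obj[of t] by simp
  show "P a v \<in> Obj M" by simp
  fix c d assume [simp]: "c \<in> Ob" "d \<in> Ob"
  show "act X a c \<cdot> (H a c \<lhd> t) \<in> Hom V (VMap (P a v) c) (VMap X c)" by simp
  let ?HH = "H c d \<otimes> H a c"
  have "(act X a d \<cdot> (H a d \<lhd> t)) \<cdot> act (P a v) c d =
      act X a d \<cdot> (H a d \<lhd> t) \<cdot> (m a c d \<rhd> v) \<cdot> \<alpha>' (H c d) (H a c) v"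
    by (subst P_act) simp_all
  also have "\<dots> = (act X a d \<cdot> (m a c d \<rhd> VMap X a)) \<cdot> (?HH \<lhd> t) \<cdot> \<alpha>' (H c d) (H a c) v"
    by (simp add: ten_comp_r del: ten_Idn)
  also have "\<dots> = act X c d \<cdot> (H c d \<lhd> act X a c) \<cdot>
      (Assoc V (H c d) (H a c) (VMap X a) \<cdot> (?HH \<lhd> t)) \<cdot> \<alpha>' (H c d) (H a c) v"
    by (simp add: act_assoc)
  also have "\<dots> = act X c d \<cdot> (H c d \<lhd> act X a c) \<cdot> (H c d \<lhd> (H a c \<lhd> t))"
    by (simp add: assoc_natural_right)
  also have "\<dots> = act X c d \<cdot> (H c d \<lhd> (act X a c \<cdot> (H a c \<lhd> t)))"
    by (simp add: whisker_left_comp)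
  finally show "(act X a d \<cdot> (H a d \<lhd> t)) \<cdot> act (P a v) c d =
    act X c d \<cdot> (H c d \<lhd> (act X a c \<cdot> (H a c \<lhd> t)))" .
qed simp

lemma yoneda_unit:
  assumes a [simp]: "a \<in> Ob" and X [simp]: "X \<in> Obj M" and t: "t \<in> Hom V v (VMap X a)"
  shows "NMap (yoneda a v X t) a \<cdot> P_unit a v = t"
proof -
  have [simp]: "t \<in> Arr V" "Dom V t = v" "Cod V t = VMap X a" using t by simp_all
  have v [simp]: "v \<in> Obj V" using Dom_Obj[of t] by simp
  have "NMap (yoneda a v X t) a \<cdot> P_unit a v = act X a a \<cdot> (H a a \<lhd> t) \<cdot> (VId C a \<rhd> v) \<cdot> LUnit_inv v"
    by (simp add: NMap_yoneda P_unit_def)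
  also have "\<dots> = (act X a a \<cdot> (VId C a \<rhd> VMap X a)) \<cdot> (Unit V \<lhd> t) \<cdot> LUnit_inv v"
    by (simp add: ten_comp_r)
  also have "\<dots> = (LUnit V (VMap X a) \<cdot> (Unit V \<lhd> t)) \<cdot> LUnit_inv v"
    by (simp add: act_unit)
  also have "\<dots> = t" by (simp add: LUnit_natural)
  finally show ?thesis .
qed

text \<open>Informally \<open>g (1, x) = (g, x)\<close>: the universal element generates the free
  functor. This rests on the right unit law of \<open>C\<close> and the triangle.\<close>

lemma P_act_unit:
  assumes [simp]: "a \<in> Ob" "v \<in> Obj V" "c \<in> Ob"
  shows "act (P a v) a c \<cdot> (H a c \<lhd> P_unit a v) = Idn V (H a c \<otimes> v)"
proof -
  have "act (P a v) a c \<cdot> (H a c \<lhd> P_unit a v) =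
      (m a a c \<rhd> v) \<cdot> (\<alpha>' (H a c) (H a a) v \<cdot> (H a c \<lhd> (VId C a \<rhd> v))) \<cdot> (H a c \<lhd> LUnit_inv v)"
    by (subst P_act) (simp_all add: P_unit_def whisker_left_comp)
  also have "\<dots> = (m a a c \<rhd> v) \<cdot> ((H a c \<lhd> VId C a) \<rhd> v) \<cdot> \<alpha>' (H a c) (Unit V) v \<cdot> (H a c \<lhd> LUnit_inv v)"
    using assoc_inv_natural[of "Idn V (H a c)" "VId C a" "Idn V v" "H a c" "H a a" v] by simp
  also have "\<dots> = ((RUnit V (H a c) \<rhd> v) \<cdot> \<alpha>' (H a c) (Unit V) v) \<cdot> (H a c \<lhd> LUnit_inv v)"
    by (simp add: ten_comp_r m_unit)
  also have "\<dots> = Idn V (H a c \<otimes> v)" by (simp add: triangle_inv ten_comp)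
  finally show ?thesis .
qed

lemma P_expand:
  assumes a [simp]: "a \<in> Ob" and v [simp]: "v \<in> Obj V" and s: "s \<in> Arr M" "Dom M s = P a v"
    and c [simp]: "c \<in> Ob"
  shows "NMap s c = act (Cod M s) a c \<cdot> (H a c \<lhd> (NMap s a \<cdot> P_unit a v))"
proof -
  note [simp] = s
  have "act (Cod M s) a c \<cdot> (H a c \<lhd> (NMap s a \<cdot> P_unit a v)) =
      (act (Cod M s) a c \<cdot> (H a c \<lhd> NMap s a)) \<cdot> (H a c \<lhd> P_unit a v)"
    by (simp add: whisker_left_comp)
  also have "\<dots> = (NMap s c \<cdot> act (P a v) a c) \<cdot> (H a c \<lhd> P_unit a v)"
    using natural[OF s(1), of a c] by simp
  also have "\<dots> = NMap s c \<cdot> (act (P a v) a c \<cdot> (H a c \<lhd> P_unit a v))"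
    by (subst comp_assoc) simp_all
  also have "\<dots> = NMap s c" unfolding P_act_unit[OF a v c] by simp
  finally show ?thesis ..
qed

text \<open>Reduces an equation of transformations out of a free functor to one equation in V; this
  is the test behind the cowedge condition and behind \<open>into_S\<close>.\<close>

lemma P_cancel:
  assumes "a \<in> Ob" "v \<in> Obj V" "s \<in> Arr M" "t \<in> Arr M" "Dom M s = P a v" "Dom M t = P a v"
    "Cod M s = Cod M t" "NMap s a \<cdot> P_unit a v = NMap t a \<cdot> P_unit a v"
  shows "s = t"
proof (rule nt_eqI)
  fix c assume c: "c \<in> Ob"
  show "NMap s c = NMap t c"
    using P_expand[OF assms(1-3,5) c] P_expand[OF assms(1,2,4,6) c] assms(7,8) by simp
qed (use assms in auto)

lemma yoneda_eqI:
  assumes "a \<in> Ob" "s \<in> Hom M (P a v) X" "t \<in> Hom V v (VMap X a)" "NMap s a \<cdot> P_unit a v = t"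
  shows "s = yoneda a v X t"
proof -
  have X: "X \<in> Obj M" using M.Cod_Obj[of s] assms(2) unfolding Hom_iff by metis
  have v: "v \<in> Obj V" using Dom_Obj[of t] assms(3) unfolding Hom_iff by metis
  show ?thesis
    by (rule P_cancel[OF assms(1) v])
      (use assms yoneda_Hom[OF assms(1) X assms(3)] yoneda_unit[OF assms(1) X assms(3)] in auto)
qed

section \<open>Cofree functors\<close>

abbreviation (input) I where "I b v \<equiv> vcorep V C b v"

text \<open>The action of \<open>vcorep\<close> before its outer currying, so that
  \<open>is_action\<close> can be checked on it.\<close>

definition corep_act where
  "corep_act b v c d = curry_arr V (H c d \<otimes> IHom V (H c b) v) (H d b) v
     (Eval V (H c b) v \<cdot> (IHom V (H c b) v \<lhd> (m c d b \<cdot> Sym V (H c d) (H d b))) \<cdot>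
        Assoc V (IHom V (H c b) v) (H c d) (H d b) \<cdot> (Sym V (H c d) (IHom V (H c b) v) \<rhd> H d b))"

lemma corep_act_simps [simp]:
  assumes "b \<in> Ob" "v \<in> Obj V" "c \<in> Ob" "d \<in> Ob"
  shows "corep_act b v c d \<in> Arr V" "Dom V (corep_act b v c d) = H c d \<otimes> IHom V (H c b) v"
    "Cod V (corep_act b v c d) = IHom V (H d b) v"
  using assms by (simp_all add: corep_act_def)

text \<open>Informally \<open>(g, (f, \<phi>)) \<mapsto> \<phi> (g f)\<close>. With evaluation on
  the left the arguments already stand in the right order, so \<open>sym_rotate\<close> absorbs the
  symmetries of the definition and only an associator remains.\<close>

lemma leval_corep_act:
  assumes [simp]: "b \<in> Ob" "v \<in> Obj V" "c \<in> Ob" "d \<in> Ob"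
  shows "leval (H d b) v \<cdot> (H d b \<lhd> corep_act b v c d) =
    leval (H c b) v \<cdot> (m c d b \<rhd> IHom V (H c b) v) \<cdot> \<alpha>' (H d b) (H c d) (IHom V (H c b) v)"
proof -
  let ?x = "H d b" and ?y = "H c d" and ?z = "IHom V (H c b) v"
  have "leval ?x v \<cdot> (?x \<lhd> corep_act b v c d) =
      (Eval V (H c b) v \<cdot> (?z \<lhd> (m c d b \<cdot> Sym V ?y ?x)) \<cdot> Assoc V ?z ?y ?x \<cdot> (Sym V ?y ?z \<rhd> ?x)) \<cdot>
        Sym V ?x (?y \<otimes> ?z)"
    by (subst leval_uncurry) (simp_all add: corep_act_def)
  also have "\<dots> = Eval V (H c b) v \<cdot> (?z \<lhd> m c d b) \<cdot>
      ((?z \<lhd> Sym V ?y ?x) \<cdot> Assoc V ?z ?y ?x \<cdot> (Sym V ?y ?z \<rhd> ?x) \<cdot> Sym V ?x (?y \<otimes> ?z))"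
    by (simp add: whisker_left_comp)
  also have "\<dots> = Eval V (H c b) v \<cdot> ((?z \<lhd> m c d b) \<cdot> Sym V (?x \<otimes> ?y) ?z) \<cdot> \<alpha>' ?x ?y ?z"
    by (subst sym_rotate) simp_all
  also have "(?z \<lhd> m c d b) \<cdot> Sym V (?x \<otimes> ?y) ?z = Sym V (H c b) ?z \<cdot> (m c d b \<rhd> ?z)"
    by (subst sym_natural) simp_all
  finally show ?thesis by (simp add: leval_def)
qed

lemma leval_corep_act_r:
  assumes [simp]: "b \<in> Ob" "v \<in> Obj V" "c \<in> Ob" "d \<in> Ob"
    and k: "k \<in> Arr V" "Cod V k = H d b \<otimes> (H c d \<otimes> IHom V (H c b) v)"
  shows "leval (H d b) v \<cdot> (H d b \<lhd> corep_act b v c d) \<cdot> k =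
    leval (H c b) v \<cdot> (m c d b \<rhd> IHom V (H c b) v) \<cdot> \<alpha>' (H d b) (H c d) (IHom V (H c b) v) \<cdot> k"
  using comp_reassoc[OF leval_corep_act[OF assms(1-4)], of k] k by simp

text \<open>Evaluated at \<open>g\<close>, the two sides of associativity are
  \<open>\<phi> (g (p q))\<close> and \<open>\<phi> ((g p) q)\<close>; associativity of composition
  and the pentagon make them agree.\<close>

lemma corep_action:
  assumes [simp]: "b \<in> Ob" "v \<in> Obj V"
  shows "is_action (\<lambda>c. IHom V (H c b) v) (corep_act b v)"
  unfolding is_action_def
proof (intro conjI ballI)
  fix c d e assume [simp]: "c \<in> Ob" "d \<in> Ob" "e \<in> Ob"
  let ?x = "H e b" and ?p = "H d e" and ?q = "H c d"
  let ?Ic = "IHom V (H c b) v" and ?Id = "IHom V (H d b) v"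
  let ?w = "corep_act b v"
  show "?w c e \<cdot> (m c d e \<rhd> ?Ic) = ?w d e \<cdot> (?p \<lhd> ?w c d) \<cdot> Assoc V ?p ?q ?Ic"
  proof (rule leval_inject[of _ _ ?x v])
    have "leval ?x v \<cdot> (?x \<lhd> (?w c e \<cdot> (m c d e \<rhd> ?Ic))) =
        leval ?x v \<cdot> (?x \<lhd> ?w c e) \<cdot> (?x \<lhd> (m c d e \<rhd> ?Ic))"
      by (simp add: whisker_left_comp)
    also have "\<dots> = leval (H c b) v \<cdot> (m c e b \<rhd> ?Ic) \<cdot> \<alpha>' ?x (H c e) ?Ic \<cdot> (?x \<lhd> (m c d e \<rhd> ?Ic))"
      by (subst leval_corep_act_r) simp_all
    also have "\<dots> = leval (H c b) v \<cdot> (m c e b \<rhd> ?Ic) \<cdot> ((?x \<lhd> m c d e) \<rhd> ?Ic) \<cdot> \<alpha>' ?x (?p \<otimes> ?q) ?Ic"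
      by (simp add: assoc_inv_natural)
    finally have L: "leval ?x v \<cdot> (?x \<lhd> (?w c e \<cdot> (m c d e \<rhd> ?Ic))) =
        leval (H c b) v \<cdot> (m c e b \<rhd> ?Ic) \<cdot> ((?x \<lhd> m c d e) \<rhd> ?Ic) \<cdot> \<alpha>' ?x (?p \<otimes> ?q) ?Ic" .
    have "leval ?x v \<cdot> (?x \<lhd> (?w d e \<cdot> (?p \<lhd> ?w c d) \<cdot> Assoc V ?p ?q ?Ic)) =
        leval ?x v \<cdot> (?x \<lhd> ?w d e) \<cdot> (?x \<lhd> (?p \<lhd> ?w c d)) \<cdot> (?x \<lhd> Assoc V ?p ?q ?Ic)"
      by (simp add: whisker_left_comp)
    also have "\<dots> = leval (H d b) v \<cdot> (m d e b \<rhd> ?Id) \<cdot>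
        (\<alpha>' ?x ?p ?Id \<cdot> (?x \<lhd> (?p \<lhd> ?w c d))) \<cdot> (?x \<lhd> Assoc V ?p ?q ?Ic)"
      by (subst leval_corep_act_r) simp_all
    also have "\<dots> = leval (H d b) v \<cdot> ((m d e b \<rhd> ?Id) \<cdot> ((?x \<otimes> ?p) \<lhd> ?w c d)) \<cdot>
        \<alpha>' ?x ?p (?q \<otimes> ?Ic) \<cdot> (?x \<lhd> Assoc V ?p ?q ?Ic)"
      using assoc_inv_natural[of "Idn V ?x" "Idn V ?p" "?w c d" ?x ?p ?Id] by simp
    also have "(m d e b \<rhd> ?Id) \<cdot> ((?x \<otimes> ?p) \<lhd> ?w c d) = (H d b \<lhd> ?w c d) \<cdot> (m d e b \<rhd> (?q \<otimes> ?Ic))"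
      by (rule whisker_exchange[symmetric]) simp_all
    also have "leval (H d b) v \<cdot> ((H d b \<lhd> ?w c d) \<cdot> (m d e b \<rhd> (?q \<otimes> ?Ic))) \<cdot>
          \<alpha>' ?x ?p (?q \<otimes> ?Ic) \<cdot> (?x \<lhd> Assoc V ?p ?q ?Ic) =
        leval (H d b) v \<cdot> (H d b \<lhd> ?w c d) \<cdot> (m d e b \<rhd> (?q \<otimes> ?Ic)) \<cdot>
          \<alpha>' ?x ?p (?q \<otimes> ?Ic) \<cdot> (?x \<lhd> Assoc V ?p ?q ?Ic)"
      by simp
    also have "\<dots> = leval (H c b) v \<cdot> (m c d b \<rhd> ?Ic) \<cdot> (\<alpha>' (H d b) ?q ?Ic \<cdot> (m d e b \<rhd> (?q \<otimes> ?Ic))) \<cdot>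
        \<alpha>' ?x ?p (?q \<otimes> ?Ic) \<cdot> (?x \<lhd> Assoc V ?p ?q ?Ic)"
      by (subst leval_corep_act_r) simp_all
    also have "\<dots> = leval (H c b) v \<cdot> ((m c d b \<cdot> (m d e b \<rhd> ?q)) \<rhd> ?Ic) \<cdot> \<alpha>' (?x \<otimes> ?p) ?q ?Ic \<cdot>
        \<alpha>' ?x ?p (?q \<otimes> ?Ic) \<cdot> (?x \<lhd> Assoc V ?p ?q ?Ic)"
      by (simp add: assoc_inv_natural_left whisker_right_comp)
    also have "\<dots> = leval (H c b) v \<cdot> (m c e b \<rhd> ?Ic) \<cdot> ((?x \<lhd> m c d e) \<rhd> ?Ic) \<cdot>
        ((Assoc V ?x ?p ?q \<rhd> ?Ic) \<cdot> \<alpha>' (?x \<otimes> ?p) ?q ?Ic \<cdot>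
        \<alpha>' ?x ?p (?q \<otimes> ?Ic) \<cdot> (?x \<lhd> Assoc V ?p ?q ?Ic))"
      by (simp add: m_assoc whisker_right_comp)
    also have "\<dots> = leval (H c b) v \<cdot> (m c e b \<rhd> ?Ic) \<cdot> ((?x \<lhd> m c d e) \<rhd> ?Ic) \<cdot> \<alpha>' ?x (?p \<otimes> ?q) ?Ic"
      by (subst pentagon_inv') simp_all
    finally show "leval ?x v \<cdot> (?x \<lhd> (?w c e \<cdot> (m c d e \<rhd> ?Ic))) =
        leval ?x v \<cdot> (?x \<lhd> (?w d e \<cdot> (?p \<lhd> ?w c d) \<cdot> Assoc V ?p ?q ?Ic))" unfolding L ..
  qed simp_all
next
  fix c assume [simp]: "c \<in> Ob"
  let ?x = "H c b" and ?Ic = "IHom V (H c b) v"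
  show "corep_act b v c c \<cdot> (VId C c \<rhd> ?Ic) = LUnit V ?Ic"
  proof (rule leval_inject[of _ _ ?x v])
    have "leval ?x v \<cdot> (?x \<lhd> (corep_act b v c c \<cdot> (VId C c \<rhd> ?Ic))) =
        leval ?x v \<cdot> (?x \<lhd> corep_act b v c c) \<cdot> (?x \<lhd> (VId C c \<rhd> ?Ic))"
      by (simp add: whisker_left_comp)
    also have "\<dots> = leval ?x v \<cdot> (m c c b \<rhd> ?Ic) \<cdot> \<alpha>' ?x (H c c) ?Ic \<cdot> (?x \<lhd> (VId C c \<rhd> ?Ic))"
      by (subst leval_corep_act_r) simp_all
    also have "\<dots> = leval ?x v \<cdot> ((m c c b \<cdot> (?x \<lhd> VId C c)) \<rhd> ?Ic) \<cdot> \<alpha>' ?x (Unit V) ?Ic"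
      by (simp add: assoc_inv_natural whisker_right_comp)
    also have "\<dots> = leval ?x v \<cdot> (?x \<lhd> LUnit V ?Ic)"
      by (simp add: m_unit triangle_inv)
    finally show "leval ?x v \<cdot> (?x \<lhd> (corep_act b v c c \<cdot> (VId C c \<rhd> ?Ic))) = leval ?x v \<cdot> (?x \<lhd> LUnit V ?Ic)" .
  qed simp_all
qed simp_all

lemma vcorep_mkfun: "I b v = mkfun (\<lambda>c. IHom V (H c b) v) (corep_act b v)"
  by (simp add: vcorep_def mkfun_def corep_act_def)

lemma I_simps [simp]:
  assumes "b \<in> Ob" "v \<in> Obj V"
  shows "I b v \<in> Obj M" "c \<in> Ob \<Longrightarrow> VMap (I b v) c = IHom V (H c b) v"
  using mkfun_Obj[OF corep_action] assms by (simp_all add: vcorep_mkfun)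

lemma I_act: "\<lbrakk>b \<in> Ob; v \<in> Obj V; c \<in> Ob; d \<in> Ob\<rbrakk> \<Longrightarrow> act (I b v) c d = corep_act b v c d"
  unfolding vcorep_mkfun by (rule act_mkfun[OF corep_action])

text \<open>Informally \<open>y \<mapsto> (g \<mapsto> t (g y))\<close>: the module map into the
  cofree functor determined by \<open>t\<close>.\<close>

definition coyoneda where
  "coyoneda b v Y t = mknt Y (I b v) (\<lambda>c. lcurry (VMap Y c) (H c b) v (t \<cdot> act Y c b))"

text \<open>Evaluation at the identity, \<open>\<phi> \<mapsto> \<phi> 1\<close>.\<close>

definition I_counit where
  "I_counit b v = leval (H b b) v \<cdot> (VId C b \<rhd> IHom V (H b b) v) \<cdot> LUnit_inv (IHom V (H b b) v)"

lemma I_counit_simps [simp]: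
  "\<lbrakk>b \<in> Ob; v \<in> Obj V\<rbrakk> \<Longrightarrow> I_counit b v \<in> Arr V"
  "\<lbrakk>b \<in> Ob; v \<in> Obj V\<rbrakk> \<Longrightarrow> Dom V (I_counit b v) = IHom V (H b b) v"
  "\<lbrakk>b \<in> Ob; v \<in> Obj V\<rbrakk> \<Longrightarrow> Cod V (I_counit b v) = v"
  by (simp_all add: I_counit_def)

lemma NMap_coyoneda:
  "c \<in> Ob \<Longrightarrow> NMap (coyoneda b v Y t) c = lcurry (VMap Y c) (H c b) v (t \<cdot> act Y c b)"
  by (simp add: coyoneda_def)

lemma coyoneda_Hom:
  assumes b [simp]: "b \<in> Ob" and Y [simp]: "Y \<in> Obj M" and t: "t \<in> Hom V (VMap Y b) v"
  shows "coyoneda b v Y t \<in> Hom M Y (I b v)"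
  unfolding coyoneda_def
proof (rule mknt_Hom)
  have [simp]: "t \<in> Arr V" "Dom V t = VMap Y b" "Cod V t = v" using t by simp_all
  have v [simp]: "v \<in> Obj V" using Cod_Obj[of t] by simp
  show "I b v \<in> Obj M" by simp
  let ?l = "\<lambda>c. lcurry (VMap Y c) (H c b) v (t \<cdot> act Y c b)"
  fix c d assume [simp]: "c \<in> Ob" "d \<in> Ob"
  show "?l c \<in> Hom V (VMap Y c) (VMap (I b v) c)" by simp
  let ?Ic = "IHom V (H c b) v"
  have "?l d \<cdot> act Y c d = corep_act b v c d \<cdot> (H c d \<lhd> ?l c)"
  proof (rule leval_inject[of _ _ "H d b" v])
    have "leval (H d b) v \<cdot> (H d b \<lhd> (corep_act b v c d \<cdot> (H c d \<lhd> ?l c))) =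
        leval (H d b) v \<cdot> (H d b \<lhd> corep_act b v c d) \<cdot> (H d b \<lhd> (H c d \<lhd> ?l c))"
      by (simp add: whisker_left_comp)
    also have "\<dots> = leval (H c b) v \<cdot> (m c d b \<rhd> ?Ic) \<cdot> \<alpha>' (H d b) (H c d) ?Ic \<cdot> (H d b \<lhd> (H c d \<lhd> ?l c))"
      by (subst leval_corep_act_r) simp_all
    also have "\<dots> = leval (H c b) v \<cdot> ((m c d b \<rhd> ?Ic) \<cdot> ((H d b \<otimes> H c d) \<lhd> ?l c)) \<cdot>
        \<alpha>' (H d b) (H c d) (VMap Y c)"
      using assoc_inv_natural[of "Idn V (H d b)" "Idn V (H c d)" "?l c" "H d b" "H c d" ?Ic] by simp
    also have "(m c d b \<rhd> ?Ic) \<cdot> ((H d b \<otimes> H c d) \<lhd> ?l c) = (H c b \<lhd> ?l c) \<cdot> (m c d b \<rhd> VMap Y c)"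
      by (rule whisker_exchange[symmetric]) simp_all
    also have "leval (H c b) v \<cdot> ((H c b \<lhd> ?l c) \<cdot> (m c d b \<rhd> VMap Y c)) \<cdot> \<alpha>' (H d b) (H c d) (VMap Y c) =
        (leval (H c b) v \<cdot> (H c b \<lhd> ?l c)) \<cdot> (m c d b \<rhd> VMap Y c) \<cdot> \<alpha>' (H d b) (H c d) (VMap Y c)"
      by (simp del: lcurry_simps(4))
    also have "\<dots> = t \<cdot> (act Y c b \<cdot> (m c d b \<rhd> VMap Y c)) \<cdot> \<alpha>' (H d b) (H c d) (VMap Y c)"
      by simp
    also have "\<dots> = t \<cdot> act Y d b \<cdot> (H d b \<lhd> act Y c d)"
      by (simp add: act_assoc)
    also have "\<dots> = leval (H d b) v \<cdot> (H d b \<lhd> (?l d \<cdot> act Y c d))"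
      using comp_reassoc[OF lcurry_simps(4)[of "VMap Y d" "H d b" v "t \<cdot> act Y d b"], of "H d b \<lhd> act Y c d"]
      by (simp add: whisker_left_comp)
    finally show "leval (H d b) v \<cdot> (H d b \<lhd> (?l d \<cdot> act Y c d)) =
        leval (H d b) v \<cdot> (H d b \<lhd> (corep_act b v c d \<cdot> (H c d \<lhd> ?l c)))" ..
  qed simp_all
  then show "?l d \<cdot> act Y c d = act (I b v) c d \<cdot> (H c d \<lhd> ?l c)"
    by (subst I_act) simp_all
qed simp

lemma coyoneda_counit:
  assumes b [simp]: "b \<in> Ob" and Y [simp]: "Y \<in> Obj M" and t: "t \<in> Hom V (VMap Y b) v"
  shows "I_counit b v \<cdot> NMap (coyoneda b v Y t) b = t"
proof -
  have [simp]: "t \<in> Arr V" "Dom V t = VMap Y b" "Cod V t = v" using t by simp_all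
  have v [simp]: "v \<in> Obj V" using Cod_Obj[of t] by simp
  let ?l = "lcurry (VMap Y b) (H b b) v (t \<cdot> act Y b b)" and ?I = "IHom V (H b b) v"
  have "I_counit b v \<cdot> NMap (coyoneda b v Y t) b =
      leval (H b b) v \<cdot> ((VId C b \<rhd> ?I) \<cdot> (Unit V \<lhd> ?l)) \<cdot> LUnit_inv (VMap Y b)"
    by (simp add: NMap_coyoneda I_counit_def LUnit_inv_natural)
  also have "(VId C b \<rhd> ?I) \<cdot> (Unit V \<lhd> ?l) = (H b b \<lhd> ?l) \<cdot> (VId C b \<rhd> VMap Y b)"
    by (rule whisker_exchange[symmetric]) simp_all
  also have "leval (H b b) v \<cdot> ((H b b \<lhd> ?l) \<cdot> (VId C b \<rhd> VMap Y b)) \<cdot> LUnit_inv (VMap Y b) =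
      (leval (H b b) v \<cdot> (H b b \<lhd> ?l)) \<cdot> (VId C b \<rhd> VMap Y b) \<cdot> LUnit_inv (VMap Y b)"
    by (simp del: lcurry_simps(4))
  also have "\<dots> = t \<cdot> (act Y b b \<cdot> (VId C b \<rhd> VMap Y b)) \<cdot> LUnit_inv (VMap Y b)"
    by simp
  also have "\<dots> = t" by (simp add: act_unit)
  finally show ?thesis .
qed

text \<open>Informally \<open>(g \<phi>) 1 = \<phi> g\<close>: acting by \<open>g\<close> and
  evaluating at the identity is evaluating at \<open>g\<close>, so the counit detects every value of
  \<open>\<phi>\<close>.\<close>

lemma I_counit_act:
  assumes [simp]: "b \<in> Ob" "v \<in> Obj V" "c \<in> Ob"
  shows "I_counit b v \<cdot> act (I b v) c b = leval (H c b) v"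
proof -
  let ?w = "corep_act b v c b" and ?Ib = "IHom V (H b b) v" and ?Ic = "IHom V (H c b) v"
  have "I_counit b v \<cdot> act (I b v) c b =
      leval (H b b) v \<cdot> ((VId C b \<rhd> ?Ib) \<cdot> (Unit V \<lhd> ?w)) \<cdot> LUnit_inv (H c b \<otimes> ?Ic)"
    by (subst I_act) (simp_all add: I_counit_def LUnit_inv_natural)
  also have "(VId C b \<rhd> ?Ib) \<cdot> (Unit V \<lhd> ?w) = (H b b \<lhd> ?w) \<cdot> (VId C b \<rhd> (H c b \<otimes> ?Ic))"
    by (rule whisker_exchange[symmetric]) simp_all
  also have "leval (H b b) v \<cdot> ((H b b \<lhd> ?w) \<cdot> (VId C b \<rhd> (H c b \<otimes> ?Ic))) \<cdot> LUnit_inv (H c b \<otimes> ?Ic) =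
      leval (H b b) v \<cdot> (H b b \<lhd> ?w) \<cdot> (VId C b \<rhd> (H c b \<otimes> ?Ic)) \<cdot> LUnit_inv (H c b \<otimes> ?Ic)"
    by simp
  also have "\<dots> = leval (H c b) v \<cdot> (m c b b \<rhd> ?Ic) \<cdot> (\<alpha>' (H b b) (H c b) ?Ic \<cdot> (VId C b \<rhd> (H c b \<otimes> ?Ic))) \<cdot>
      LUnit_inv (H c b \<otimes> ?Ic)"
    by (subst leval_corep_act_r) simp_all
  also have "\<dots> = leval (H c b) v \<cdot> ((m c b b \<cdot> (VId C b \<rhd> H c b)) \<rhd> ?Ic) \<cdot> \<alpha>' (Unit V) (H c b) ?Ic \<cdot>
      LUnit_inv (H c b \<otimes> ?Ic)"
    by (simp add: assoc_inv_natural_left whisker_right_comp)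
  also have "\<dots> = leval (H c b) v \<cdot> ((LUnit V (H c b) \<rhd> ?Ic) \<cdot> \<alpha>' (Unit V) (H c b) ?Ic) \<cdot>
      LUnit_inv (H c b \<otimes> ?Ic)"
    by (simp add: m_unit)
  also have "\<dots> = leval (H c b) v" by (simp add: LUnit_ten_inv)
  finally show ?thesis .
qed

lemma I_expand:
  assumes b [simp]: "b \<in> Ob" and v [simp]: "v \<in> Obj V" and w: "w \<in> Arr M" "Cod M w = I b v"
    and c [simp]: "c \<in> Ob"
  shows "leval (H c b) v \<cdot> (H c b \<lhd> NMap w c) = (I_counit b v \<cdot> NMap w b) \<cdot> act (Dom M w) c b"
proof -
  note [simp] = w
  have "(I_counit b v \<cdot> NMap w b) \<cdot> act (Dom M w) c b = I_counit b v \<cdot> (NMap w b \<cdot> act (Dom M w) c b)"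
    by simp
  also have "\<dots> = I_counit b v \<cdot> act (I b v) c b \<cdot> (H c b \<lhd> NMap w c)"
    using natural[OF w(1), of c b] by simp
  also have "\<dots> = leval (H c b) v \<cdot> (H c b \<lhd> NMap w c)"
    by (rule comp_reassoc[OF I_counit_act]) simp_all
  finally show ?thesis ..
qed

lemma I_cancel:
  assumes "b \<in> Ob" "v \<in> Obj V" "s \<in> Arr M" "t \<in> Arr M" "Cod M s = I b v" "Cod M t = I b v"
    "Dom M s = Dom M t" "I_counit b v \<cdot> NMap s b = I_counit b v \<cdot> NMap t b"
  shows "s = t"
proof (rule nt_eqI)
  fix c assume c: "c \<in> Ob"
  show "NMap s c = NMap t c"
    by (rule leval_inject[of _ _ "H c b" v])
      (use c assms I_expand[OF assms(1-3,5) c] I_expand[OF assms(1,2,4,6) c] in auto)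
qed (use assms in auto)

end

section \<open>The abelian category of enriched functors\<close>

lemma (in Preadditive) is_kernel_simps:
  assumes "is_kernel C f k"
  shows "f \<in> Arr C" "k \<in> Arr C" "Cod C k = Dom C f" "f \<cdot> k = zero_arr C (Dom C k) (Cod C f)"
  using assms by (simp_all add: is_kernel_def)

lemma (in Preadditive) is_cokernel_simps:
  assumes "is_cokernel C f q"
  shows "f \<in> Arr C" "q \<in> Arr C" "Dom C q = Cod C f" "q \<cdot> f = zero_arr C (Dom C f) (Cod C q)"
  using assms by (simp_all add: is_cokernel_def)

context Enriched
begin

text \<open>Two arrows into the domain at \<open>a\<close> become parallel transformations out of a
  free functor, which the mono separates.\<close>

lemma mono_pointwise:
  assumes f: "mono_arr M f" and a [simp]: "a \<in> Ob"
  shows "mono_arr V (NMap f a)"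
  unfolding mono_arr_def
proof (intro conjI ballI impI)
  note [simp] = M.mono_ArrD[OF f]
  show "NMap f a \<in> Arr V" by simp
  fix x g h
  assume x: "x \<in> Obj V" and g: "g \<in> Hom V x (Dom V (NMap f a))" and h: "h \<in> Hom V x (Dom V (NMap f a))"
    and eq: "NMap f a \<cdot> g = NMap f a \<cdot> h"
  let ?X = "Dom M f"
  have gh: "g \<in> Hom V x (VMap ?X a)" "h \<in> Hom V x (VMap ?X a)" using g h by simp_all
  note Y = yoneda_Hom[OF a _ gh(1)] yoneda_Hom[OF a _ gh(2)]
  note u = yoneda_unit[OF a _ gh(1)] yoneda_unit[OF a _ gh(2)]
  have "f \<cdot>\<^bsub>M\<^esub> yoneda a x ?X g = f \<cdot>\<^bsub>M\<^esub> yoneda a x ?X h"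
    by (rule P_cancel[OF a x]) (use Y u x eq in simp_all)
  then have e: "yoneda a x ?X g = yoneda a x ?X h"
    by (rule M.mono_cancel[OF f]) (use Y in simp_all)
  show "g = h" using u(1) unfolding e u(2)[OF M.Dom_Obj[OF M.mono_ArrD[OF f]]] by simp
qed

text \<open>The dual test with cofree functors; it does not presuppose that cokernels of
  transformations exist.\<close>

lemma epi_pointwise:
  assumes f: "epi_arr M f" and a [simp]: "a \<in> Ob"
  shows "epi_arr V (NMap f a)"
  unfolding epi_arr_def
proof (intro conjI ballI impI)
  note [simp] = M.epi_ArrD[OF f]
  show "NMap f a \<in> Arr V" by simp
  fix x g h
  assume x: "x \<in> Obj V" and g: "g \<in> Hom V (Cod V (NMap f a)) x" and h: "h \<in> Hom V (Cod V (NMap f a)) x"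
    and eq: "g \<cdot> NMap f a = h \<cdot> NMap f a"
  let ?Y = "Cod M f"
  have gh: "g \<in> Hom V (VMap ?Y a) x" "h \<in> Hom V (VMap ?Y a) x" using g h by simp_all
  note Y = coyoneda_Hom[OF a _ gh(1)] coyoneda_Hom[OF a _ gh(2)]
  note u = coyoneda_counit[OF a _ gh(1)] coyoneda_counit[OF a _ gh(2)]
  have *: "I_counit a x \<cdot> NMap (coyoneda a x ?Y k) a \<cdot> NMap f a = k \<cdot> NMap f a"
    if "k \<in> Hom V (VMap ?Y a) x" for k
    by (rule comp_reassoc[OF coyoneda_counit[OF a _ that]])
      (use coyoneda_Hom[OF a _ that] x in simp_all)
  have "coyoneda a x ?Y g \<cdot>\<^bsub>M\<^esub> f = coyoneda a x ?Y h \<cdot>\<^bsub>M\<^esub> f"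
    by (rule I_cancel[OF a x]) (use Y *[OF gh(1)] *[OF gh(2)] x eq in simp_all)
  then have e: "coyoneda a x ?Y g = coyoneda a x ?Y h"
    by (rule M.epi_cancel[OF f]) (use Y in simp_all)
  show "g = h" using u(1) unfolding e u(2)[OF M.Cod_Obj[OF M.epi_ArrD[OF f]]] by simp
qed

lemma mono_pointwiseI:
  assumes f: "f \<in> Arr M" and mono: "\<And>a. a \<in> Ob \<Longrightarrow> mono_arr V (NMap f a)"
  shows "mono_arr M f"
  unfolding mono_arr_def
proof (intro conjI ballI impI f nt_eqI)
  fix X g h a
  assume g: "g \<in> Hom M X (Dom M f)" and h: "h \<in> Hom M X (Dom M f)"
    and eq: "f \<cdot>\<^bsub>M\<^esub> g = f \<cdot>\<^bsub>M\<^esub> h" and a: "a \<in> Ob"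
  have "NMap (f \<cdot>\<^bsub>M\<^esub> g) a = NMap (f \<cdot>\<^bsub>M\<^esub> h) a" unfolding eq ..
  then have e: "NMap f a \<cdot> NMap g a = NMap f a \<cdot> NMap h a" using a by simp
  show "NMap g a = NMap h a"
    by (rule mono_cancel[OF mono[OF a] e]) (use f g h a in auto)
qed auto

lemma epi_pointwiseI:
  assumes f: "f \<in> Arr M" and epi: "\<And>a. a \<in> Ob \<Longrightarrow> epi_arr V (NMap f a)"
  shows "epi_arr M f"
  unfolding epi_arr_def
proof (intro conjI ballI impI f nt_eqI)
  fix X g h a
  assume g: "g \<in> Hom M (Cod M f) X" and h: "h \<in> Hom M (Cod M f) X"
    and eq: "g \<cdot>\<^bsub>M\<^esub> f = h \<cdot>\<^bsub>M\<^esub> f" and a: "a \<in> Ob"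
  have "NMap (g \<cdot>\<^bsub>M\<^esub> f) a = NMap (h \<cdot>\<^bsub>M\<^esub> f) a" unfolding eq ..
  then have e: "NMap g a \<cdot> NMap f a = NMap h a \<cdot> NMap f a" using a by simp
  show "NMap g a = NMap h a"
    by (rule epi_cancel[OF epi[OF a] e]) (use f g h a in auto)
qed auto

text \<open>The pointwise factorizations form a transformation because naturality can be checked
  after the monos \<open>NMap k b\<close>.\<close>

lemma kernel_pointwiseI:
  assumes f: "f \<in> Arr M" and k: "k \<in> Arr M" "Cod M k = Dom M f"
    and ker: "\<And>a. a \<in> Ob \<Longrightarrow> is_kernel V (NMap f a) (NMap k a)"
  shows "is_kernel M f k"
proof (rule M.kernelI[OF f mono_pointwiseI[OF k(1) kernel_mono[OF ker]] k(2)])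
  note [simp] = f k
  show "f \<cdot>\<^bsub>M\<^esub> k = zero_arr M (Dom M k) (Cod M f)"
    by (rule nt_eqI) (use is_kernel_simps(4)[OF ker] in simp_all)
  fix h assume h [simp]: "h \<in> Arr M" "Cod M h = Dom M f" and fh: "f \<cdot>\<^bsub>M\<^esub> h = zero_arr M (Dom M h) (Cod M f)"
  have "\<exists>u. u \<in> Hom V (VMap (Dom M h) a) (VMap (Dom M k) a) \<and> NMap k a \<cdot> u = NMap h a" if a: "a \<in> Ob" for a
  proof -
    have "NMap (f \<cdot>\<^bsub>M\<^esub> h) a = zero_arr V (VMap (Dom M h) a) (VMap (Cod M f) a)"
      unfolding fh using a by simp
    then show ?thesis
      using kernel_factor[OF ker[OF a], of "NMap h a"] a by auto
  qed
  then obtain u where u: "\<And>a. a \<in> Ob \<Longrightarrow> u a \<in> Hom V (VMap (Dom M h) a) (VMap (Dom M k) a)"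
    and ku: "\<And>a. a \<in> Ob \<Longrightarrow> NMap k a \<cdot> u a = NMap h a" by metis
  have "mknt (Dom M h) (Dom M k) u \<in> Hom M (Dom M h) (Dom M k)"
  proof (rule mknt_Hom)
    fix a b assume [simp]: "a \<in> Ob" "b \<in> Ob"
    have [simp]: "u a \<in> Arr V" "Dom V (u a) = VMap (Dom M h) a" "Cod V (u a) = VMap (Dom M k) a"
      if "a \<in> Ob" for a using u[OF that] by simp_all
    show "u b \<cdot> act (Dom M h) a b = act (Dom M k) a b \<cdot> (H a b \<lhd> u a)"
    proof (rule mono_cancel[OF kernel_mono[OF ker[of b]]])
      have "NMap k b \<cdot> u b \<cdot> act (Dom M h) a b = NMap h b \<cdot> act (Dom M h) a b"
        by (rule comp_reassoc[OF ku]) simp_all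
      also have "\<dots> = act (Dom M f) a b \<cdot> (H a b \<lhd> (NMap k a \<cdot> u a))"
        using natural[OF h(1), of a b] by (simp add: ku)
      also have "\<dots> = (act (Dom M f) a b \<cdot> (H a b \<lhd> NMap k a)) \<cdot> (H a b \<lhd> u a)"
        by (simp add: whisker_left_comp)
      also have "\<dots> = (NMap k b \<cdot> act (Dom M k) a b) \<cdot> (H a b \<lhd> u a)"
        using natural[OF k(1), of a b] by simp
      also have "\<dots> = NMap k b \<cdot> act (Dom M k) a b \<cdot> (H a b \<lhd> u a)" by simp
      finally show "NMap k b \<cdot> u b \<cdot> act (Dom M h) a b = NMap k b \<cdot> act (Dom M k) a b \<cdot> (H a b \<lhd> u a)" .
    qed simp_all
  qed (use u in auto)
  moreover from this have "k \<cdot>\<^bsub>M\<^esub> mknt (Dom M h) (Dom M k) u = h"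
    by (intro nt_eqI) (use ku in auto)
  ultimately show "\<exists>u. u \<in> Arr M \<and> Dom M u = Dom M h \<and> Cod M u = Dom M k \<and> k \<cdot>\<^bsub>M\<^esub> u = h" by auto
qed simp_all

text \<open>The one-element case of \<open>whisker_jointly_epi\<close>: tensoring is a left
  adjoint.\<close>

lemma whisker_epi:
  assumes "epi_arr V e" "c \<in> Obj V"
  shows "epi_arr V (c \<lhd> e)"
  unfolding epi_arr_def
proof (intro conjI ballI impI)
  note [simp] = epi_ArrD[OF assms(1)]
  show "c \<lhd> e \<in> Arr V" using assms by simp
  fix x f g assume *: "f \<in> Hom V (Cod V (c \<lhd> e)) x" "g \<in> Hom V (Cod V (c \<lhd> e)) x"
    "f \<cdot> (c \<lhd> e) = g \<cdot> (c \<lhd> e)"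
  show "f = g"
  proof (rule whisker_jointly_epi[where I = "{()}" and q = "\<lambda>_. e" and Q = "Cod V e" and c = c])
    fix u v assume uv: "u \<in> Arr V" "v \<in> Arr V" "Dom V u = Cod V e" "Dom V v = Cod V e" "Cod V u = Cod V v"
      "\<And>i. i \<in> {()} \<Longrightarrow> u \<cdot> e = v \<cdot> e"
    show "u = v" by (rule epi_cancel[OF assms(1) uv(6)[OF singletonI] uv(1,2,5,3,4)])
  next
    show "f \<in> Arr V" "g \<in> Arr V" "Dom V f = c \<otimes> Cod V e" "Dom V g = c \<otimes> Cod V e" "Cod V f = Cod V g"
      using *(1,2) assms(2) by simp_all
    show "f \<cdot> (c \<lhd> e) = g \<cdot> (c \<lhd> e)" by (rule *(3))
  qed (use assms in simp_all)
qed

text \<open>Dual to \<open>kernel_pointwiseI\<close>, except that naturality is checked by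
  precomposing with \<open>H a b \<lhd> NMap q a\<close>, which is epi by
  \<open>whisker_epi\<close>.\<close>

lemma cokernel_pointwiseI:
  assumes f: "f \<in> Arr M" and q: "q \<in> Arr M" "Dom M q = Cod M f"
    and coker: "\<And>a. a \<in> Ob \<Longrightarrow> is_cokernel V (NMap f a) (NMap q a)"
  shows "is_cokernel M f q"
proof (rule M.cokernelI[OF f epi_pointwiseI[OF q(1) cokernel_epi[OF coker]] q(2)])
  note [simp] = f q
  show "q \<cdot>\<^bsub>M\<^esub> f = zero_arr M (Dom M f) (Cod M q)"
    by (rule nt_eqI) (use is_cokernel_simps(4)[OF coker] in simp_all)
  fix h assume h [simp]: "h \<in> Arr M" "Dom M h = Cod M f" and fh: "h \<cdot>\<^bsub>M\<^esub> f = zero_arr M (Dom M f) (Cod M h)"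
  have "\<exists>u. u \<in> Hom V (VMap (Cod M q) a) (VMap (Cod M h) a) \<and> u \<cdot> NMap q a = NMap h a" if a: "a \<in> Ob" for a
  proof -
    have "NMap (h \<cdot>\<^bsub>M\<^esub> f) a = zero_arr V (VMap (Dom M f) a) (VMap (Cod M h) a)"
      unfolding fh using a by simp
    then show ?thesis
      using cokernel_factor[OF coker[OF a], of "NMap h a"] a by auto
  qed
  then obtain u where u: "\<And>a. a \<in> Ob \<Longrightarrow> u a \<in> Hom V (VMap (Cod M q) a) (VMap (Cod M h) a)"
    and uq: "\<And>a. a \<in> Ob \<Longrightarrow> u a \<cdot> NMap q a = NMap h a" by metis
  have "mknt (Cod M q) (Cod M h) u \<in> Hom M (Cod M q) (Cod M h)"
  proof (rule mknt_Hom)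
    fix a b assume [simp]: "a \<in> Ob" "b \<in> Ob"
    have [simp]: "u a \<in> Arr V" "Dom V (u a) = VMap (Cod M q) a" "Cod V (u a) = VMap (Cod M h) a"
      if "a \<in> Ob" for a using u[OF that] by simp_all
    show "u b \<cdot> act (Cod M q) a b = act (Cod M h) a b \<cdot> (H a b \<lhd> u a)"
    proof (rule epi_cancel[OF whisker_epi[OF cokernel_epi[OF coker[of a]], of "H a b"]])
      have "(u b \<cdot> act (Cod M q) a b) \<cdot> (H a b \<lhd> NMap q a) = u b \<cdot> (act (Cod M q) a b \<cdot> (H a b \<lhd> NMap q a))"
        by simp
      also have "\<dots> = u b \<cdot> NMap q b \<cdot> act (Cod M f) a b"
        using natural[OF q(1), of a b] by simp
      also have "\<dots> = NMap h b \<cdot> act (Cod M f) a b"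
        by (rule comp_reassoc[OF uq]) simp_all
      also have "\<dots> = act (Cod M h) a b \<cdot> (H a b \<lhd> (u a \<cdot> NMap q a))"
        using natural[OF h(1), of a b] by (simp add: uq)
      also have "\<dots> = (act (Cod M h) a b \<cdot> (H a b \<lhd> u a)) \<cdot> (H a b \<lhd> NMap q a)"
        by (simp add: whisker_left_comp)
      finally show "(u b \<cdot> act (Cod M q) a b) \<cdot> (H a b \<lhd> NMap q a) =
        (act (Cod M h) a b \<cdot> (H a b \<lhd> u a)) \<cdot> (H a b \<lhd> NMap q a)" .
    qed simp_all
  qed (use u in auto)
  moreover from this have "mknt (Cod M q) (Cod M h) u \<cdot>\<^bsub>M\<^esub> q = h"
    by (intro nt_eqI) (use uq in auto)
  ultimately show "\<exists>u. u \<in> Arr M \<and> Dom M u = Cod M q \<and> Cod M u = Cod M h \<and> u \<cdot>\<^bsub>M\<^esub> q = h" by auto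
qed simp_all

text \<open>A jointly monic family closed under the actions inherits an action, whose laws hold
  since they hold after each \<open>k i\<close>. Index sets of size zero, one and two give the zero
  object, kernels and products.\<close>

lemma subfunctor_exists:
  assumes X: "\<And>i. i \<in> J \<Longrightarrow> X i \<in> Obj M" and K: "\<And>a. a \<in> Ob \<Longrightarrow> K a \<in> Obj V"
    and k: "\<And>i a. \<lbrakk>i \<in> J; a \<in> Ob\<rbrakk> \<Longrightarrow> k i a \<in> Hom V (K a) (VMap (X i) a)"
    and joint: "\<And>a u v. \<lbrakk>a \<in> Ob; u \<in> Arr V; v \<in> Arr V; Cod V u = K a; Cod V v = K a; Dom V u = Dom V v;
      \<And>i. i \<in> J \<Longrightarrow> k i a \<cdot> u = k i a \<cdot> v\<rbrakk> \<Longrightarrow> u = v"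
    and factor: "\<And>a b. \<lbrakk>a \<in> Ob; b \<in> Ob\<rbrakk> \<Longrightarrow> \<exists>u \<in> Hom V (H a b \<otimes> K a) (K b). \<forall>i \<in> J.
      k i b \<cdot> u = act (X i) a b \<cdot> (H a b \<lhd> k i a)"
  shows "\<exists>F \<in> Obj M. (\<forall>a \<in> Ob. VMap F a = K a) \<and> (\<forall>i \<in> J. mknt F (X i) (k i) \<in> Hom M F (X i))"
proof -
  obtain u where u: "\<And>a b. \<lbrakk>a \<in> Ob; b \<in> Ob\<rbrakk> \<Longrightarrow> u a b \<in> Hom V (H a b \<otimes> K a) (K b)"
    and ku: "\<And>a b i. \<lbrakk>a \<in> Ob; b \<in> Ob; i \<in> J\<rbrakk> \<Longrightarrow> k i b \<cdot> u a b = act (X i) a b \<cdot> (H a b \<lhd> k i a)"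
    using factor by metis
  have [simp]: "u a b \<in> Arr V" "Dom V (u a b) = H a b \<otimes> K a" "Cod V (u a b) = K b"
    if "a \<in> Ob" "b \<in> Ob" for a b using u[OF that] by simp_all
  have [simp]: "k i a \<in> Arr V" "Dom V (k i a) = K a" "Cod V (k i a) = VMap (X i) a"
    if "i \<in> J" "a \<in> Ob" for i a using k[OF that] by simp_all
  note [simp] = K X
  have A: "is_action K u"
    unfolding is_action_def
  proof (intro conjI ballI)
    fix a b c assume [simp]: "a \<in> Ob" "b \<in> Ob" "c \<in> Ob"
    show "u a c \<cdot> (m a b c \<rhd> K a) = u b c \<cdot> (H b c \<lhd> u a b) \<cdot> Assoc V (H b c) (H a b) (K a)"
    proof (rule joint[of c])
      fix i assume [simp]: "i \<in> J"
      let ?X = "X i" and ?HH = "H b c \<otimes> H a b"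
      have "k i c \<cdot> u a c \<cdot> (m a b c \<rhd> K a) = (act ?X a c \<cdot> (H a c \<lhd> k i a)) \<cdot> (m a b c \<rhd> K a)"
        by (rule comp_reassoc[OF ku]) simp_all
      also have "\<dots> = (act ?X a c \<cdot> (m a b c \<rhd> VMap ?X a)) \<cdot> (?HH \<lhd> k i a)"
        using whisker_exchange[of "m a b c" "k i a"] by simp
      also have "\<dots> = act ?X b c \<cdot> (H b c \<lhd> act ?X a b) \<cdot> Assoc V (H b c) (H a b) (VMap ?X a) \<cdot> (?HH \<lhd> k i a)"
        by (simp add: act_assoc)
      also have "\<dots> = act ?X b c \<cdot> (H b c \<lhd> (act ?X a b \<cdot> (H a b \<lhd> k i a))) \<cdot> Assoc V (H b c) (H a b) (K a)"
        by (simp add: assoc_natural_right whisker_left_comp)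
      also have "\<dots> = act ?X b c \<cdot> (H b c \<lhd> (k i b \<cdot> u a b)) \<cdot> Assoc V (H b c) (H a b) (K a)"
        by (simp add: ku)
      also have "\<dots> = (act ?X b c \<cdot> (H b c \<lhd> k i b)) \<cdot> (H b c \<lhd> u a b) \<cdot> Assoc V (H b c) (H a b) (K a)"
        by (simp add: whisker_left_comp)
      also have "\<dots> = (k i c \<cdot> u b c) \<cdot> (H b c \<lhd> u a b) \<cdot> Assoc V (H b c) (H a b) (K a)"
        by (simp add: ku)
      finally show "k i c \<cdot> u a c \<cdot> (m a b c \<rhd> K a) =
        k i c \<cdot> u b c \<cdot> (H b c \<lhd> u a b) \<cdot> Assoc V (H b c) (H a b) (K a)" by simp
    qed simp_all
  next
    fix a assume [simp]: "a \<in> Ob"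
    show "u a a \<cdot> (VId C a \<rhd> K a) = LUnit V (K a)"
    proof (rule joint[of a])
      fix i assume [simp]: "i \<in> J"
      let ?X = "X i"
      have "k i a \<cdot> u a a \<cdot> (VId C a \<rhd> K a) = (act ?X a a \<cdot> (H a a \<lhd> k i a)) \<cdot> (VId C a \<rhd> K a)"
        by (rule comp_reassoc[OF ku]) simp_all
      also have "\<dots> = (act ?X a a \<cdot> (VId C a \<rhd> VMap ?X a)) \<cdot> (Unit V \<lhd> k i a)"
        using whisker_exchange[of "VId C a" "k i a"] by simp
      also have "\<dots> = k i a \<cdot> LUnit V (K a)" by (simp add: act_unit LUnit_natural)
      finally show "k i a \<cdot> u a a \<cdot> (VId C a \<rhd> K a) = k i a \<cdot> LUnit V (K a)" .
    qed simp_all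
  qed (use u K in auto)
  let ?F = "mkfun K u"
  have "mknt ?F (X i) (k i) \<in> Hom M ?F (X i)" if [simp]: "i \<in> J" for i
  proof (rule mknt_Hom)
    fix a b assume "a \<in> Ob" "b \<in> Ob"
    then show "k i b \<cdot> act ?F a b = act (X i) a b \<cdot> (H a b \<lhd> k i a)"
      by (subst act_mkfun[OF A]) (simp_all add: ku)
  qed (use mkfun_Obj[OF A] in auto)
  then show ?thesis using mkfun_Obj[OF A] by (intro bexI[of _ ?F]) auto
qed

text \<open>The action on \<open>Q\<close> has domain \<open>H a b \<otimes> Q a\<close>, to which
  the universal property of a cokernel or coproduct does not apply directly; so the factorization is
  required of the transposes, which start at \<open>Q a\<close>. The module laws are then tested on
  the whiskered family, which is still jointly epic.\<close>

lemma quotient_functor_exists: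
  assumes X: "\<And>i. i \<in> J \<Longrightarrow> X i \<in> Obj M" and Q: "\<And>a. a \<in> Ob \<Longrightarrow> Q a \<in> Obj V"
    and q: "\<And>i a. \<lbrakk>i \<in> J; a \<in> Ob\<rbrakk> \<Longrightarrow> q i a \<in> Hom V (VMap (X i) a) (Q a)"
    and joint: "\<And>a u v. \<lbrakk>a \<in> Ob; u \<in> Arr V; v \<in> Arr V; Dom V u = Q a; Dom V v = Q a; Cod V u = Cod V v;
      \<And>i. i \<in> J \<Longrightarrow> u \<cdot> q i a = v \<cdot> q i a\<rbrakk> \<Longrightarrow> u = v"
    and factor: "\<And>a b. \<lbrakk>a \<in> Ob; b \<in> Ob\<rbrakk> \<Longrightarrow> \<exists>u \<in> Hom V (Q a) (IHom V (H a b) (Q b)). \<forall>i \<in> J.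
      u \<cdot> q i a = lcurry (VMap (X i) a) (H a b) (Q b) (q i b \<cdot> act (X i) a b)"
  shows "\<exists>F \<in> Obj M. (\<forall>a \<in> Ob. VMap F a = Q a) \<and> (\<forall>i \<in> J. mknt (X i) F (q i) \<in> Hom M (X i) F)"
proof -
  obtain w where w: "\<And>a b. \<lbrakk>a \<in> Ob; b \<in> Ob\<rbrakk> \<Longrightarrow> w a b \<in> Hom V (Q a) (IHom V (H a b) (Q b))"
    and wq: "\<And>a b i. \<lbrakk>a \<in> Ob; b \<in> Ob; i \<in> J\<rbrakk> \<Longrightarrow>
      w a b \<cdot> q i a = lcurry (VMap (X i) a) (H a b) (Q b) (q i b \<cdot> act (X i) a b)"
    using factor by metis
  note [simp] = Q X
  have [simp]: "q i a \<in> Arr V" "Dom V (q i a) = VMap (X i) a" "Cod V (q i a) = Q a"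
    if "i \<in> J" "a \<in> Ob" for i a using q[OF that] by simp_all
  have [simp]: "w a b \<in> Arr V" "Dom V (w a b) = Q a" "Cod V (w a b) = IHom V (H a b) (Q b)"
    if "a \<in> Ob" "b \<in> Ob" for a b using w[OF that] by simp_all
  define u where "u a b = leval (H a b) (Q b) \<cdot> (H a b \<lhd> w a b)" for a b
  have [simp]: "u a b \<in> Arr V" "Dom V (u a b) = H a b \<otimes> Q a" "Cod V (u a b) = Q b"
    if "a \<in> Ob" "b \<in> Ob" for a b using that by (simp_all add: u_def)
  have uq: "u a b \<cdot> (H a b \<lhd> q i a) = q i b \<cdot> act (X i) a b" if "a \<in> Ob" "b \<in> Ob" "i \<in> J" for a b i
    using whisker_factor[of "q i b \<cdot> act (X i) a b" "H a b" "VMap (X i) a" "w a b" "q i a"] that wq[OF that]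
    by (simp add: u_def)
  have jointc: "f = g"
    if "c \<in> Obj V" "a \<in> Ob" "f \<in> Arr V" "g \<in> Arr V" "Dom V f = c \<otimes> Q a" "Dom V g = c \<otimes> Q a" "Cod V f = Cod V g"
      "\<And>i. i \<in> J \<Longrightarrow> f \<cdot> (c \<lhd> q i a) = g \<cdot> (c \<lhd> q i a)" for c a f g
    by (rule whisker_jointly_epi[where I = J and q = "\<lambda>i. q i a" and Q = "Q a" and c = c])
      (use that joint[OF that(2)] in auto)
  have A: "is_action Q u"
    unfolding is_action_def
  proof (intro conjI ballI)
    fix a b c assume [simp]: "a \<in> Ob" "b \<in> Ob" "c \<in> Ob"
    let ?HH = "H b c \<otimes> H a b"
    show "u a c \<cdot> (m a b c \<rhd> Q a) = u b c \<cdot> (H b c \<lhd> u a b) \<cdot> Assoc V (H b c) (H a b) (Q a)"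
    proof (rule jointc[of ?HH a])
      fix i assume [simp]: "i \<in> J"
      let ?X = "X i"
      have "(u a c \<cdot> (m a b c \<rhd> Q a)) \<cdot> (?HH \<lhd> q i a) = (u a c \<cdot> (H a c \<lhd> q i a)) \<cdot> (m a b c \<rhd> VMap ?X a)"
        using whisker_exchange[of "m a b c" "q i a"] by simp
      also have "\<dots> = q i c \<cdot> act ?X a c \<cdot> (m a b c \<rhd> VMap ?X a)"
        by (simp add: uq)
      also have "\<dots> = (q i c \<cdot> act ?X b c) \<cdot> (H b c \<lhd> act ?X a b) \<cdot> Assoc V (H b c) (H a b) (VMap ?X a)"
        by (simp add: act_assoc)
      also have "\<dots> = (u b c \<cdot> (H b c \<lhd> q i b)) \<cdot> (H b c \<lhd> act ?X a b) \<cdot> Assoc V (H b c) (H a b) (VMap ?X a)"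
        by (simp add: uq)
      also have "\<dots> = u b c \<cdot> (H b c \<lhd> (q i b \<cdot> act ?X a b)) \<cdot> Assoc V (H b c) (H a b) (VMap ?X a)"
        by (simp add: whisker_left_comp)
      also have "\<dots> = u b c \<cdot> (H b c \<lhd> (u a b \<cdot> (H a b \<lhd> q i a))) \<cdot> Assoc V (H b c) (H a b) (VMap ?X a)"
        by (simp add: uq)
      also have "\<dots> = u b c \<cdot> (H b c \<lhd> u a b) \<cdot> Assoc V (H b c) (H a b) (Q a) \<cdot> (?HH \<lhd> q i a)"
        by (simp add: assoc_natural_right whisker_left_comp)
      finally show "(u a c \<cdot> (m a b c \<rhd> Q a)) \<cdot> (?HH \<lhd> q i a) =
        (u b c \<cdot> (H b c \<lhd> u a b) \<cdot> Assoc V (H b c) (H a b) (Q a)) \<cdot> (?HH \<lhd> q i a)" by simp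
    qed simp_all
  next
    fix a assume [simp]: "a \<in> Ob"
    show "u a a \<cdot> (VId C a \<rhd> Q a) = LUnit V (Q a)"
    proof (rule jointc[of "Unit V" a])
      fix i assume [simp]: "i \<in> J"
      let ?X = "X i"
      have "(u a a \<cdot> (VId C a \<rhd> Q a)) \<cdot> (Unit V \<lhd> q i a) = (u a a \<cdot> (H a a \<lhd> q i a)) \<cdot> (VId C a \<rhd> VMap ?X a)"
        using whisker_exchange[of "VId C a" "q i a"] by simp
      also have "\<dots> = q i a \<cdot> act ?X a a \<cdot> (VId C a \<rhd> VMap ?X a)" by (simp add: uq)
      also have "\<dots> = LUnit V (Q a) \<cdot> (Unit V \<lhd> q i a)" by (simp add: act_unit LUnit_natural)
      finally show "(u a a \<cdot> (VId C a \<rhd> Q a)) \<cdot> (Unit V \<lhd> q i a) = LUnit V (Q a) \<cdot> (Unit V \<lhd> q i a)" .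
    qed simp_all
  qed (use Q in auto)
  let ?F = "mkfun Q u"
  have "mknt (X i) ?F (q i) \<in> Hom M (X i) ?F" if [simp]: "i \<in> J" for i
  proof (rule mknt_Hom)
    fix a b assume "a \<in> Ob" "b \<in> Ob"
    then show "q i b \<cdot> act (X i) a b = act ?F a b \<cdot> (H a b \<lhd> q i a)"
      by (subst act_mkfun[OF A]) (simp_all add: uq)
  qed (use mkfun_Obj[OF A] in auto)
  then show ?thesis using mkfun_Obj[OF A] by (intro bexI[of _ ?F]) auto
qed

end

context Enriched
begin

lemma kernel_M:
  assumes f: "f \<in> Arr M"
  obtains k where "is_kernel M f k" "\<And>a. a \<in> Ob \<Longrightarrow> is_kernel V (NMap f a) (NMap k a)"
proof -
  note [simp] = f
  have "\<exists>k. is_kernel V (NMap f a) k" if "a \<in> Ob" for a using kernel_exists that by simp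
  then obtain k where k: "\<And>a. a \<in> Ob \<Longrightarrow> is_kernel V (NMap f a) (k a)" by metis
  let ?K = "\<lambda>a. Dom V (k a)"
  have kA [simp]: "k a \<in> Arr V" "Cod V (k a) = VMap (Dom M f) a" if "a \<in> Ob" for a
    using is_kernel_simps[OF k[OF that]] that by simp_all
  have fk: "NMap f a \<cdot> k a = zero_arr V (?K a) (VMap (Cod M f) a)" if "a \<in> Ob" for a
    using is_kernel_simps[OF k[OF that]] that by simp
  have "\<exists>F \<in> Obj M. (\<forall>a \<in> Ob. VMap F a = ?K a) \<and>
      (\<forall>i \<in> {()}. mknt F (Dom M f) k \<in> Hom M F (Dom M f))"
  proof (rule subfunctor_exists[where k = "\<lambda>_. k"])
    fix a u v assume a: "a \<in> Ob" and uv: "u \<in> Arr V" "v \<in> Arr V" "Cod V u = ?K a" "Cod V v = ?K a"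
      "Dom V u = Dom V v" and eq: "\<And>i. i \<in> {()} \<Longrightarrow> k a \<cdot> u = k a \<cdot> v"
    show "u = v"
      by (rule mono_cancel[OF kernel_mono[OF k[OF a]] eq[OF singletonI] uv(1,2,5,3,4)])
  next
    fix a b assume [simp]: "a \<in> Ob" "b \<in> Ob"
    have "NMap f b \<cdot> act (Dom M f) a b \<cdot> (H a b \<lhd> k a) =
        (act (Cod M f) a b \<cdot> (H a b \<lhd> NMap f a)) \<cdot> (H a b \<lhd> k a)"
      by (rule comp_reassoc[OF natural[OF f]]) simp_all
    also have "\<dots> = act (Cod M f) a b \<cdot> (H a b \<lhd> (NMap f a \<cdot> k a))"
      by (simp add: whisker_left_comp)
    also have "\<dots> = zero_arr V (H a b \<otimes> ?K a) (VMap (Cod M f) b)"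
      by (simp add: fk)
    finally obtain u where "u \<in> Arr V" "Dom V u = H a b \<otimes> ?K a" "Cod V u = ?K b"
      "k b \<cdot> u = act (Dom M f) a b \<cdot> (H a b \<lhd> k a)"
      using kernel_factor[OF k[of b], of "act (Dom M f) a b \<cdot> (H a b \<lhd> k a)"] by auto
    then show "\<exists>u \<in> Hom V (H a b \<otimes> ?K a) (?K b). \<forall>i \<in> {()}.
        k b \<cdot> u = act (Dom M f) a b \<cdot> (H a b \<lhd> k a)" by auto
  qed simp_all
  then obtain F where F: "F \<in> Obj M" "mknt F (Dom M f) k \<in> Hom M F (Dom M f)" by auto
  show ?thesis
    by (rule that[of "mknt F (Dom M f) k"], rule kernel_pointwiseI) (use F k in auto)
qed

text \<open>The pointwise clause later shows that restriction preserves cokernels and that monos are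
  normal.\<close>

lemma cokernel_M:
  assumes f: "f \<in> Arr M"
  obtains q where "is_cokernel M f q" "\<And>a. a \<in> Ob \<Longrightarrow> is_cokernel V (NMap f a) (NMap q a)"
proof -
  note [simp] = f
  have "\<exists>q. is_cokernel V (NMap f a) q" if "a \<in> Ob" for a using cokernel_exists that by simp
  then obtain q where q: "\<And>a. a \<in> Ob \<Longrightarrow> is_cokernel V (NMap f a) (q a)" by metis
  let ?Q = "\<lambda>a. Cod V (q a)"
  have qA [simp]: "q a \<in> Arr V" "Dom V (q a) = VMap (Cod M f) a" if "a \<in> Ob" for a
    using is_cokernel_simps[OF q[OF that]] that by simp_all
  have qf: "q a \<cdot> NMap f a = zero_arr V (VMap (Dom M f) a) (?Q a)" if "a \<in> Ob" for a
    using is_cokernel_simps[OF q[OF that]] that by simp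
  have "\<exists>F \<in> Obj M. (\<forall>a \<in> Ob. VMap F a = ?Q a) \<and>
      (\<forall>i \<in> {()}. mknt (Cod M f) F q \<in> Hom M (Cod M f) F)"
  proof (rule quotient_functor_exists[where q = "\<lambda>_. q"])
    fix a u v assume a: "a \<in> Ob" and uv: "u \<in> Arr V" "v \<in> Arr V" "Dom V u = ?Q a" "Dom V v = ?Q a"
      "Cod V u = Cod V v" and eq: "\<And>i. i \<in> {()} \<Longrightarrow> u \<cdot> q a = v \<cdot> q a"
    show "u = v"
      by (rule epi_cancel[OF cokernel_epi[OF q[OF a]] eq[OF singletonI] uv(1,2,5,3,4)])
  next
    fix a b assume [simp]: "a \<in> Ob" "b \<in> Ob"
    let ?l = "lcurry (VMap (Cod M f) a) (H a b) (?Q b) (q b \<cdot> act (Cod M f) a b)"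
    have "(q b \<cdot> act (Cod M f) a b) \<cdot> (H a b \<lhd> NMap f a) = q b \<cdot> NMap f b \<cdot> act (Dom M f) a b"
      by (simp add: natural[OF f])
    also have "\<dots> = zero_arr V (VMap (Dom M f) b) (?Q b) \<cdot> act (Dom M f) a b"
      by (rule comp_reassoc[OF qf]) simp_all
    finally have "?l \<cdot> NMap f a = zero_arr V (VMap (Dom M f) a) (IHom V (H a b) (?Q b))"
      by (subst lcurry_comp) simp_all
    then obtain u where "u \<in> Arr V" "Dom V u = ?Q a" "Cod V u = IHom V (H a b) (?Q b)" "u \<cdot> q a = ?l"
      using cokernel_factor[OF q[of a], of ?l] by auto
    then show "\<exists>u \<in> Hom V (?Q a) (IHom V (H a b) (?Q b)). \<forall>i \<in> {()}. u \<cdot> q a = ?l" by auto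
  qed simp_all
  then obtain F where F: "F \<in> Obj M" "mknt (Cod M f) F q \<in> Hom M (Cod M f) F" by auto
  show ?thesis
    by (rule that[of "mknt (Cod M f) F q"], rule cokernel_pointwiseI) (use F q in auto)
qed

lemma zero_object_M: "zero_object M X \<longleftrightarrow> X \<in> Obj M \<and> (\<forall>a \<in> Ob. zero_object V (VMap X a))"
proof (intro iffI conjI ballI)
  assume z: "zero_object M X"
  then show X: "X \<in> Obj M" by (simp add: zero_object_def)
  fix a assume a: "a \<in> Ob"
  have "NMap (Idn M X) a = NMap (zero_arr M X X) a" using z by (simp add: M.zero_object_iff)
  then show "zero_object V (VMap X a)" using X a by (simp add: zero_object_iff)
next
  assume *: "X \<in> Obj M \<and> (\<forall>a \<in> Ob. zero_object V (VMap X a))"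
  then have "Idn M X = zero_arr M X X"
    by (intro nt_eqI) (simp_all add: zero_object_iff)
  then show "zero_object M X" using * by (simp add: M.zero_object_iff)
qed

lemma zero_object_M_exists: "\<exists>X. zero_object M X"
proof -
  obtain z where z: "zero_object V z" using abelian unfolding abelian_def by blast
  have [simp]: "z \<in> Obj V" using z by (simp add: zero_object_def)
  have "\<exists>F \<in> Obj M. (\<forall>a \<in> Ob. VMap F a = z) \<and>
      (\<forall>i \<in> {}. mknt F undefined (\<lambda>_. undefined) \<in> Hom M F undefined)"
  \<comment> \<open>Over the empty index set the conditions reduce to two: parallel arrows into
    \<open>z\<close> agree, and some arrow \<open>H a b \<otimes> z \<rightarrow> z\<close>
    exists.\<close>
  proof (rule subfunctor_exists[where J = "{}" and X = "\<lambda>_. undefined" and k = "\<lambda>_ _. undefined"])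
    fix a u v assume uv: "u \<in> Arr V" "v \<in> Arr V" "Cod V u = z" "Cod V v = z" "Dom V u = Dom V v"
    then show "u = v" using to_zero_object[OF z uv(1,3)] to_zero_object[OF z uv(2,4)] by simp
  next
    fix a b assume "a \<in> Ob" "b \<in> Ob"
    then have "zero_arr V (H a b \<otimes> z) z \<in> Hom V (H a b \<otimes> z) z" by simp
    then show "\<exists>u \<in> Hom V (H a b \<otimes> z) z. \<forall>i \<in> {}.
        undefined \<cdot> u = act undefined a b \<cdot> (H a b \<lhd> undefined)" by blast
  qed simp_all
  then show ?thesis using z unfolding zero_object_M by auto
qed

lemma product_M:
  assumes [simp]: "X \<in> Obj M" "Y \<in> Obj M"
  shows "\<exists>p \<pi>1 \<pi>2. is_binary_product M X Y p \<pi>1 \<pi>2"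
proof -
  have "\<exists>p \<pi>1 \<pi>2. is_binary_product V (VMap X a) (VMap Y a) p \<pi>1 \<pi>2" if "a \<in> Ob" for a
    using abelian that unfolding abelian_def by simp
  then obtain p \<pi>1 \<pi>2 where P: "\<And>a. a \<in> Ob \<Longrightarrow> is_binary_product V (VMap X a) (VMap Y a) (p a) (\<pi>1 a) (\<pi>2 a)"
    by metis
  have [simp]: "p a \<in> Obj V" "\<pi>1 a \<in> Arr V" "Dom V (\<pi>1 a) = p a" "Cod V (\<pi>1 a) = VMap X a"
    "\<pi>2 a \<in> Arr V" "Dom V (\<pi>2 a) = p a" "Cod V (\<pi>2 a) = VMap Y a" if "a \<in> Ob" for a
    using P[OF that] by (simp_all add: is_binary_product_def)
  have univ: "\<exists>!u. u \<in> Hom V w (p a) \<and> \<pi>1 a \<cdot> u = f \<and> \<pi>2 a \<cdot> u = g"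
    if "a \<in> Ob" "f \<in> Hom V w (VMap X a)" "g \<in> Hom V w (VMap Y a)" for a w f g
  proof -
    have "w \<in> Obj V" using Dom_Obj[of f] that(2) unfolding Hom_iff by metis
    then show ?thesis using P[OF that(1)] that(2,3) unfolding is_binary_product_def by blast
  qed
  let ?X = "\<lambda>i. if i then X else Y" and ?k = "\<lambda>i. if i then \<pi>1 else \<pi>2"
  have joint: "u = v" if a: "a \<in> Ob" and uv: "u \<in> Arr V" "v \<in> Arr V" "Cod V u = p a" "Cod V v = p a"
    "Dom V u = Dom V v" and e: "\<pi>1 a \<cdot> u = \<pi>1 a \<cdot> v" "\<pi>2 a \<cdot> u = \<pi>2 a \<cdot> v" for a u v
  proof -
    have "\<exists>!w. w \<in> Hom V (Dom V v) (p a) \<and> \<pi>1 a \<cdot> w = \<pi>1 a \<cdot> v \<and> \<pi>2 a \<cdot> w = \<pi>2 a \<cdot> v"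
      by (rule univ[OF a]) (use a uv in simp_all)
    then show ?thesis by (rule ex1_eqD) (use a uv e in simp_all)
  qed
  have "\<exists>F \<in> Obj M. (\<forall>a \<in> Ob. VMap F a = p a) \<and> (\<forall>i \<in> UNIV. mknt F (?X i) (?k i) \<in> Hom M F (?X i))"
  proof (rule subfunctor_exists)
    fix a u v assume a: "a \<in> Ob" and uv: "u \<in> Arr V" "v \<in> Arr V" "Cod V u = p a" "Cod V v = p a"
      "Dom V u = Dom V v" and eq: "\<And>i. i \<in> UNIV \<Longrightarrow> ?k i a \<cdot> u = ?k i a \<cdot> v"
    show "u = v" by (rule joint[OF a uv]) (use eq[of True] eq[of False] in simp_all)
  next
    fix a b assume [simp]: "a \<in> Ob" "b \<in> Ob"
    show "\<exists>u \<in> Hom V (H a b \<otimes> p a) (p b). \<forall>i \<in> UNIV. ?k i b \<cdot> u = act (?X i) a b \<cdot> (H a b \<lhd> ?k i a)"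
    proof -
      have "\<exists>!u. u \<in> Hom V (H a b \<otimes> p a) (p b) \<and> \<pi>1 b \<cdot> u = act X a b \<cdot> (H a b \<lhd> \<pi>1 a) \<and>
          \<pi>2 b \<cdot> u = act Y a b \<cdot> (H a b \<lhd> \<pi>2 a)"
        by (rule univ) simp_all
      then obtain u where u: "u \<in> Hom V (H a b \<otimes> p a) (p b)" "\<pi>1 b \<cdot> u = act X a b \<cdot> (H a b \<lhd> \<pi>1 a)"
          "\<pi>2 b \<cdot> u = act Y a b \<cdot> (H a b \<lhd> \<pi>2 a)" by blast
      show ?thesis
        by (rule bexI[OF _ u(1)]) (simp add: u(2,3))
    qed
  qed (simp_all split: if_splits)
  then obtain F where F: "F \<in> Obj M" "\<And>a. a \<in> Ob \<Longrightarrow> VMap F a = p a"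
    and "\<forall>i. mknt F (?X i) (?k i) \<in> Hom M F (?X i)" by blast
  then have F12: "mknt F X \<pi>1 \<in> Hom M F X" "mknt F Y \<pi>2 \<in> Hom M F Y"
    by (metis (mono_tags, lifting))+
  have "is_binary_product M X Y F (mknt F X \<pi>1) (mknt F Y \<pi>2)"
    unfolding is_binary_product_def
  proof (intro conjI F(1) F12 ballI)
    fix W f g assume W [simp]: "W \<in> Obj M" and f: "f \<in> Hom M W X" and g: "g \<in> Hom M W Y"
    have [simp]: "f \<in> Arr M" "Dom M f = W" "Cod M f = X" "g \<in> Arr M" "Dom M g = W" "Cod M g = Y"
      using f g by simp_all
    have "\<exists>u. u \<in> Hom V (VMap W a) (p a) \<and> \<pi>1 a \<cdot> u = NMap f a \<and> \<pi>2 a \<cdot> u = NMap g a" if "a \<in> Ob" for a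
      using univ[OF that, of "NMap f a" "VMap W a" "NMap g a"] that by auto
    then obtain u where u: "\<And>a. a \<in> Ob \<Longrightarrow> u a \<in> Hom V (VMap W a) (p a)"
      and u1: "\<And>a. a \<in> Ob \<Longrightarrow> \<pi>1 a \<cdot> u a = NMap f a" and u2: "\<And>a. a \<in> Ob \<Longrightarrow> \<pi>2 a \<cdot> u a = NMap g a"
      by metis
    have [simp]: "u a \<in> Arr V" "Dom V (u a) = VMap W a" "Cod V (u a) = p a" if "a \<in> Ob" for a
      using u[OF that] by simp_all
    have U: "mknt W F u \<in> Hom M W F"
    proof (rule mknt_Hom)
      fix a b assume [simp]: "a \<in> Ob" "b \<in> Ob"
      \<comment> \<open>One projection at a time, for an arbitrary \<open>k\<close>;
        \<open>joint\<close> then combines the two instances.\<close>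
      have *: "k b \<cdot> u b \<cdot> act W a b = k b \<cdot> act F a b \<cdot> (H a b \<lhd> u a)"
        if K: "mknt F Z k \<in> Hom M F Z" and h: "h \<in> Hom M W Z" and ku: "\<And>a. a \<in> Ob \<Longrightarrow> k a \<cdot> u a = NMap h a"
          and k [simp]: "\<And>a. a \<in> Ob \<Longrightarrow> k a \<in> Hom V (p a) (VMap Z a)" and Z [simp]: "Z \<in> Obj M" for Z k h
      proof -
        have [simp]: "k a \<in> Arr V" "Dom V (k a) = p a" "Cod V (k a) = VMap Z a" if "a \<in> Ob" for a
          using k[OF that] by simp_all
        have "k b \<cdot> u b \<cdot> act W a b = NMap h b \<cdot> act W a b"
          by (rule comp_reassoc[OF ku]) simp_all
        also have "\<dots> = act Z a b \<cdot> (H a b \<lhd> (k a \<cdot> u a))"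
          using natural[of h a b] h by (simp add: ku)
        also have "\<dots> = (act Z a b \<cdot> (H a b \<lhd> k a)) \<cdot> (H a b \<lhd> u a)"
          by (simp add: whisker_left_comp)
        also have "\<dots> = (k b \<cdot> act F a b) \<cdot> (H a b \<lhd> u a)"
          using natural[of "mknt F Z k" a b] K by simp
        also have "\<dots> = k b \<cdot> act F a b \<cdot> (H a b \<lhd> u a)" using F by simp
        finally show ?thesis .
      qed
      show "u b \<cdot> act W a b = act F a b \<cdot> (H a b \<lhd> u a)"
        by (rule joint[of b]) (use *[OF F12(1) f u1] *[OF F12(2) g u2] F in simp_all)
    qed (use F u in auto)
    show "\<exists>!u. u \<in> Hom M W F \<and> mknt F X \<pi>1 \<cdot>\<^bsub>M\<^esub> u = f \<and> mknt F Y \<pi>2 \<cdot>\<^bsub>M\<^esub> u = g"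
    proof (rule ex1I[of _ "mknt W F u"])
      show "mknt W F u \<in> Hom M W F \<and> mknt F X \<pi>1 \<cdot>\<^bsub>M\<^esub> mknt W F u = f \<and> mknt F Y \<pi>2 \<cdot>\<^bsub>M\<^esub> mknt W F u = g"
        using U F12 by (intro conjI nt_eqI) (simp_all add: u1 u2)
    next
      fix w assume w: "w \<in> Hom M W F \<and> mknt F X \<pi>1 \<cdot>\<^bsub>M\<^esub> w = f \<and> mknt F Y \<pi>2 \<cdot>\<^bsub>M\<^esub> w = g"
      show "w = mknt W F u"
      proof (rule nt_eqI)
        fix a assume a: "a \<in> Ob"
        have "NMap (mknt F X \<pi>1 \<cdot>\<^bsub>M\<^esub> w) a = NMap f a" "NMap (mknt F Y \<pi>2 \<cdot>\<^bsub>M\<^esub> w) a = NMap g a"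
          using w by simp_all
        then have "\<pi>1 a \<cdot> NMap w a = \<pi>1 a \<cdot> u a" "\<pi>2 a \<cdot> NMap w a = \<pi>2 a \<cdot> u a"
          using a by (simp_all add: u1 u2)
        then show "NMap w a = NMap (mknt W F u) a"
          using a w F by (auto intro!: joint[OF a])
      qed (use w U in auto)
    qed
  qed
  then show ?thesis by blast
qed

text \<open>A mono is pointwise mono, hence pointwise the kernel of its pointwise cokernel, and
  pointwise kernels are kernels; dually for epis.\<close>

lemma abelian_M: "abelian M"
  unfolding abelian_def
proof (intro conjI preadditive_M zero_object_M_exists ballI allI impI product_M)
  fix f assume "f \<in> Arr M"
  then show "\<exists>k. is_kernel M f k" "\<exists>q. is_cokernel M f q" by (meson kernel_M cokernel_M)+
next
  fix k assume k: "mono_arr M k"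
  obtain q where q: "is_cokernel M k q" "\<And>a. a \<in> Ob \<Longrightarrow> is_cokernel V (NMap k a) (NMap q a)"
    using cokernel_M[OF M.mono_ArrD[OF k]] by blast
  have "is_kernel M q k"
    by (rule kernel_pointwiseI)
      (use M.is_cokernel_simps[OF q(1)] mono_kernel_of_cokernel[OF mono_pointwise[OF k] q(2)] in simp_all)
  then show "\<exists>f. is_kernel M f k" by blast
next
  fix e assume e: "epi_arr M e"
  obtain k where k: "is_kernel M e k" "\<And>a. a \<in> Ob \<Longrightarrow> is_kernel V (NMap e a) (NMap k a)"
    using kernel_M[OF M.epi_ArrD[OF e]] by blast
  have "is_cokernel M k e"
    by (rule cokernel_pointwiseI)
      (use M.is_kernel_simps[OF k(1)] epi_cokernel_of_kernel[OF epi_pointwise[OF e] k(2)] in simp_all)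
  then show "\<exists>f. is_cokernel M f e" by blast
qed

text \<open>Naturality of the induced arrow is tested on the whiskered injections, which are still
  jointly epic.\<close>

lemma coproduct_pointwiseI:
  assumes X [simp]: "\<And>i. i \<in> J \<Longrightarrow> X i \<in> Obj M" and Q [simp]: "Q \<in> Obj M"
    and \<iota>: "\<And>i. i \<in> J \<Longrightarrow> \<iota> i \<in> Hom M (X i) Q"
    and cop: "\<And>a. a \<in> Ob \<Longrightarrow> is_coproduct V J (\<lambda>i. VMap (X i) a) (VMap Q a) (\<lambda>i. NMap (\<iota> i) a)"
  shows "is_coproduct M J X Q \<iota>"
  unfolding is_coproduct_def
proof (intro conjI ballI allI impI Q \<iota>)
  have [simp]: "\<iota> i \<in> Arr M" "Dom M (\<iota> i) = X i" "Cod M (\<iota> i) = Q" if "i \<in> J" for i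
    using \<iota>[OF that] by simp_all
  fix W f assume W [simp]: "W \<in> Obj M" and f: "\<forall>i \<in> J. f i \<in> Hom M (X i) W"
  have [simp]: "f i \<in> Arr M" "Dom M (f i) = X i" "Cod M (f i) = W" if "i \<in> J" for i
    using f that by simp_all
  have "\<exists>u. u \<in> Hom V (VMap Q a) (VMap W a) \<and> (\<forall>i \<in> J. u \<cdot> NMap (\<iota> i) a = NMap (f i) a)" if "a \<in> Ob" for a
  proof -
    obtain u where "u \<in> Arr V" "Dom V u = VMap Q a" "Cod V u = VMap W a"
        "\<And>i. i \<in> J \<Longrightarrow> u \<cdot> NMap (\<iota> i) a = NMap (f i) a"
      by (rule coproduct_lift[OF cop[OF \<open>a \<in> Ob\<close>], of "VMap W a" "\<lambda>i. NMap (f i) a"])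
        (use \<open>a \<in> Ob\<close> in simp_all)
    then show ?thesis by auto
  qed
  then obtain u where u: "\<And>a. a \<in> Ob \<Longrightarrow> u a \<in> Hom V (VMap Q a) (VMap W a)"
    and u\<iota>: "\<And>a i. \<lbrakk>a \<in> Ob; i \<in> J\<rbrakk> \<Longrightarrow> u a \<cdot> NMap (\<iota> i) a = NMap (f i) a" by metis
  have [simp]: "u a \<in> Arr V" "Dom V (u a) = VMap Q a" "Cod V (u a) = VMap W a" if "a \<in> Ob" for a
    using u[OF that] by simp_all
  have U: "mknt Q W u \<in> Hom M Q W"
  proof (rule mknt_Hom)
    fix a b assume [simp]: "a \<in> Ob" "b \<in> Ob"
    show "u b \<cdot> act Q a b = act W a b \<cdot> (H a b \<lhd> u a)"
    proof (rule whisker_jointly_epi[where I = J and q = "\<lambda>i. NMap (\<iota> i) a" and Q = "VMap Q a" and c = "H a b"])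
      fix u v assume "u \<in> Arr V" "v \<in> Arr V" "Dom V u = VMap Q a" "Dom V v = VMap Q a" "Cod V u = Cod V v"
        "\<And>i. i \<in> J \<Longrightarrow> u \<cdot> NMap (\<iota> i) a = v \<cdot> NMap (\<iota> i) a"
      then show "u = v" by (rule coproduct_cancel[OF cop[of a], rotated 1]) simp_all
    next
      fix i assume [simp]: "i \<in> J"
      have "(u b \<cdot> act Q a b) \<cdot> (H a b \<lhd> NMap (\<iota> i) a) = u b \<cdot> NMap (\<iota> i) b \<cdot> act (X i) a b"
        using natural[of "\<iota> i" a b] by simp
      also have "\<dots> = NMap (f i) b \<cdot> act (X i) a b"
        by (rule comp_reassoc[OF u\<iota>]) simp_all
      also have "\<dots> = act W a b \<cdot> (H a b \<lhd> (u a \<cdot> NMap (\<iota> i) a))"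
        using natural[of "f i" a b] by (simp add: u\<iota>)
      also have "\<dots> = (act W a b \<cdot> (H a b \<lhd> u a)) \<cdot> (H a b \<lhd> NMap (\<iota> i) a)"
        by (simp add: whisker_left_comp)
      finally show "(u b \<cdot> act Q a b) \<cdot> (H a b \<lhd> NMap (\<iota> i) a) =
        (act W a b \<cdot> (H a b \<lhd> u a)) \<cdot> (H a b \<lhd> NMap (\<iota> i) a)" .
    qed simp_all
  qed simp_all
  show "\<exists>!u. u \<in> Hom M Q W \<and> (\<forall>i \<in> J. u \<cdot>\<^bsub>M\<^esub> \<iota> i = f i)"
  proof (rule ex1I[of _ "mknt Q W u"])
    show "mknt Q W u \<in> Hom M Q W \<and> (\<forall>i \<in> J. mknt Q W u \<cdot>\<^bsub>M\<^esub> \<iota> i = f i)"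
      using U by (intro conjI ballI nt_eqI) (simp_all add: u\<iota>)
  next
    fix w assume w: "w \<in> Hom M Q W \<and> (\<forall>i \<in> J. w \<cdot>\<^bsub>M\<^esub> \<iota> i = f i)"
    show "w = mknt Q W u"
    proof (rule nt_eqI)
      fix a assume a [simp]: "a \<in> Ob"
      show "NMap w a = NMap (mknt Q W u) a"
      proof (rule coproduct_cancel[OF cop[OF a]])
        fix i assume i: "i \<in> J"
        have "NMap (w \<cdot>\<^bsub>M\<^esub> \<iota> i) a = NMap (f i) a" using w i by simp
        then show "NMap w a \<cdot> NMap (\<iota> i) a = NMap (mknt Q W u) a \<cdot> NMap (\<iota> i) a"
          using i by (simp add: u\<iota>)
      qed (use w in simp_all)
    qed (use w U in auto)
  qed
qed

lemma coproduct_M: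
  assumes cop: "\<And>Y. \<forall>i \<in> J. Y i \<in> Obj V \<Longrightarrow> \<exists>Q \<iota>. is_coproduct V J Y Q \<iota>"
    and X: "\<forall>i \<in> J. X i \<in> Obj M"
  obtains Q \<iota> where "Q \<in> Obj M" "\<And>i. i \<in> J \<Longrightarrow> \<iota> i \<in> Hom M (X i) Q"
    "\<And>a. a \<in> Ob \<Longrightarrow> is_coproduct V J (\<lambda>i. VMap (X i) a) (VMap Q a) (\<lambda>i. NMap (\<iota> i) a)"
proof -
  have [simp]: "X i \<in> Obj M" if "i \<in> J" for i using X that by simp
  have "\<exists>Q \<iota>. is_coproduct V J (\<lambda>i. VMap (X i) a) Q \<iota>" if "a \<in> Ob" for a
    by (rule cop) (use that in simp)
  then have "\<forall>a. \<exists>Q \<iota>. a \<in> Ob \<longrightarrow> is_coproduct V J (\<lambda>i. VMap (X i) a) Q \<iota>" by blast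
  from choice[OF this] obtain Q where
    "\<forall>a. \<exists>\<iota>. a \<in> Ob \<longrightarrow> is_coproduct V J (\<lambda>i. VMap (X i) a) (Q a) \<iota>" ..
  from choice[OF this] obtain q where
    q: "\<And>a. a \<in> Ob \<Longrightarrow> is_coproduct V J (\<lambda>i. VMap (X i) a) (Q a) (q a)" by blast
  note s = coproduct_simps[OF q]
  have "\<exists>F \<in> Obj M. (\<forall>a \<in> Ob. VMap F a = Q a) \<and> (\<forall>i \<in> J. mknt (X i) F (\<lambda>a. q a i) \<in> Hom M (X i) F)"
  proof (rule quotient_functor_exists[where q = "\<lambda>i a. q a i"])
    fix a u v assume a: "a \<in> Ob" and uv: "u \<in> Arr V" "v \<in> Arr V" "Dom V u = Q a" "Dom V v = Q a"
      "Cod V u = Cod V v" "\<And>i. i \<in> J \<Longrightarrow> u \<cdot> q a i = v \<cdot> q a i"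
    show "u = v" by (rule coproduct_cancel[OF q[OF a] uv])
  next
    fix a b assume [simp]: "a \<in> Ob" "b \<in> Ob"
    let ?l = "\<lambda>i. lcurry (VMap (X i) a) (H a b) (Q b) (q b i \<cdot> act (X i) a b)"
    have "?l i \<in> Hom V (VMap (X i) a) (IHom V (H a b) (Q b))" if "i \<in> J" for i
      using that s by simp
    then obtain u where "u \<in> Arr V" "Dom V u = Q a" "Cod V u = IHom V (H a b) (Q b)"
        "\<And>i. i \<in> J \<Longrightarrow> u \<cdot> q a i = ?l i"
      by (rule coproduct_lift[OF q[of a], of "IHom V (H a b) (Q b)" ?l, rotated 2]) (use s in simp_all)
    then show "\<exists>u \<in> Hom V (Q a) (IHom V (H a b) (Q b)). \<forall>i \<in> J. u \<cdot> q a i = ?l i"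
      by (intro bexI[of _ u] ballI) simp_all
  qed (use s in simp_all)
  then obtain F where F: "F \<in> Obj M" "\<And>a. a \<in> Ob \<Longrightarrow> VMap F a = Q a"
    "\<And>i. i \<in> J \<Longrightarrow> mknt (X i) F (\<lambda>a. q a i) \<in> Hom M (X i) F" by blast
  show ?thesis
  proof (rule that[of F "\<lambda>i. mknt (X i) F (\<lambda>a. q a i)"])
    fix a assume "a \<in> Ob"
    then show "is_coproduct V J (\<lambda>i. VMap (X i) a) (VMap F a) (\<lambda>i. NMap (mknt (X i) F (\<lambda>a. q a i)) a)"
      using q[of a] F(2) by simp
  qed (use F in auto)
qed

section \<open>Small hom sets and a generator\<close>

lemma NMap_extensional: "t \<in> Arr M \<Longrightarrow> NMap t \<in> extensional Ob"
  unfolding M_simps by (simp add: vnatural_iff)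

text \<open>With domain and codomain fixed, a transformation is its family of components, an element
  of a small dependent product.\<close>

lemma small_Hom_M:
  assumes \<kappa>: "universe \<kappa>" and Ob: "small \<kappa> Ob"
    and V: "\<And>x y. x \<in> Obj V \<Longrightarrow> y \<in> Obj V \<Longrightarrow> small \<kappa> (Hom V x y)"
    and X: "X \<in> Obj M" "Y \<in> Obj M"
  shows "small \<kappa> (Hom M X Y)"
proof (rule small_inj_on[of NMap])
  show "inj_on NMap (Hom M X Y)"
    by (rule inj_onI) (auto intro: nt_eqI)
  show "NMap ` Hom M X Y \<subseteq> Pi\<^sub>E Ob (\<lambda>a. Hom V (VMap X a) (VMap Y a))"
    by (auto simp: PiE_def NMap_extensional)
  show "small \<kappa> (Pi\<^sub>E Ob (\<lambda>a. Hom V (VMap X a) (VMap Y a)))"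
    by (rule small_PiE[OF \<kappa> Ob]) (use V X in simp)
qed

text \<open>Arrows from the coproduct of the \<open>P a u\<close> to \<open>X\<close> are families
  of arrows \<open>u \<rightarrow> X a\<close>, and \<open>u\<close> separates arrows in V.\<close>

lemma generator_M:
  assumes cop: "\<And>Y. \<forall>a \<in> Ob. Y a \<in> Obj V \<Longrightarrow> \<exists>Q \<iota>. is_coproduct V Ob Y Q \<iota>"
    and u: "is_generator V u"
  shows "\<exists>U. is_generator M U"
proof -
  have uO [simp]: "u \<in> Obj V" using u by (simp add: is_generator_def)
  obtain U \<iota> where U: "U \<in> Obj M" "\<And>a. a \<in> Ob \<Longrightarrow> \<iota> a \<in> Hom M (P a u) U"
    "\<And>a. a \<in> Ob \<Longrightarrow> is_coproduct V Ob (\<lambda>i. VMap (P i u) a) (VMap U a) (\<lambda>i. NMap (\<iota> i) a)"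
    using coproduct_M[OF cop, of "\<lambda>a. P a u"] by auto
  have C: "is_coproduct M Ob (\<lambda>a. P a u) U \<iota>"
    by (rule coproduct_pointwiseI) (use U in simp_all)
  have "is_generator M U"
    unfolding is_generator_def
  proof (intro conjI U(1) ballI impI)
    fix X Y f g assume XY [simp]: "X \<in> Obj M" "Y \<in> Obj M" and f: "f \<in> Hom M X Y" and g: "g \<in> Hom M X Y"
      and eq: "\<forall>h \<in> Hom M U X. f \<cdot>\<^bsub>M\<^esub> h = g \<cdot>\<^bsub>M\<^esub> h"
    have [simp]: "f \<in> Arr M" "Dom M f = X" "Cod M f = Y" "g \<in> Arr M" "Dom M g = X" "Cod M g = Y"
      using f g by simp_all
    show "f = g"
    proof (rule nt_eqI)
      fix a assume a [simp]: "a \<in> Ob"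
      have "NMap f a \<cdot> k = NMap g a \<cdot> k" if k: "k \<in> Hom V u (VMap X a)" for k
      proof -
        note y = yoneda_Hom[OF a XY(1) k]
        \<comment> \<open>Only the summand at \<open>a\<close> matters; on the other summands the
          arrow is extended by zero.\<close>
        let ?h = "\<lambda>i. if i = a then yoneda a u X k else zero_arr M (P i u) X"
        obtain h where h [simp]: "h \<in> Arr M" "Dom M h = U" "Cod M h = X"
          and hi: "\<And>i. i \<in> Ob \<Longrightarrow> h \<cdot>\<^bsub>M\<^esub> \<iota> i = ?h i"
          by (rule coproduct_lift[OF C, of X ?h]) (use y in simp_all)
        have ia: "\<iota> a \<in> Arr M" "Dom M (\<iota> a) = P a u" "Cod M (\<iota> a) = U" using U(2)[OF a] by simp_all
        have "f \<cdot>\<^bsub>M\<^esub> h \<cdot>\<^bsub>M\<^esub> \<iota> a = g \<cdot>\<^bsub>M\<^esub> h \<cdot>\<^bsub>M\<^esub> \<iota> a"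
          by (rule M.comp_reassoc[of f h "g \<cdot>\<^bsub>M\<^esub> h" "\<iota> a", THEN trans])
            (use eq ia in simp_all)
        then have "f \<cdot>\<^bsub>M\<^esub> yoneda a u X k = g \<cdot>\<^bsub>M\<^esub> yoneda a u X k" using hi[OF a] by simp
        then have "NMap (f \<cdot>\<^bsub>M\<^esub> yoneda a u X k) a = NMap (g \<cdot>\<^bsub>M\<^esub> yoneda a u X k) a" by simp
        then have "(NMap f a \<cdot> NMap (yoneda a u X k) a) \<cdot> P_unit a u =
            (NMap g a \<cdot> NMap (yoneda a u X k) a) \<cdot> P_unit a u" by simp
        then show ?thesis using y yoneda_unit[OF a XY(1) k] by simp
      qed
      then show "NMap f a = NMap g a"
        using u unfolding is_generator_def
        by (elim conjE ballE[of _ _ "VMap X a"] ballE[of _ _ "VMap Y a"]) auto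
    qed simp_all
  qed
  then show ?thesis by blast
qed

end

section \<open>Coends in abelian categories\<close>

lemma (in Abelian) coend_exists:
  assumes D: "\<forall>a \<in> A. D a \<in> Obj C"
    and l: "\<And>a b. \<lbrakk>a \<in> A; b \<in> A\<rbrakk> \<Longrightarrow> l a b \<in> Hom C (E a b) (D a)"
    and r: "\<And>a b. \<lbrakk>a \<in> A; b \<in> A\<rbrakk> \<Longrightarrow> r a b \<in> Hom C (E a b) (D b)"
    and cop1: "\<exists>P \<iota>. is_coproduct C A D P \<iota>"
    and cop2: "\<exists>P \<iota>. is_coproduct C (A \<times> A) (\<lambda>(a, b). E a b) P \<iota>"
  shows "\<exists>x \<omega>. is_coend C A D l r x \<omega>"
proof -
  obtain P \<iota> where P: "is_coproduct C A D P \<iota>" using cop1 by blast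
  obtain Q j where Q: "is_coproduct C (A \<times> A) (\<lambda>(a, b). E a b) Q j" using cop2 by blast
  note [simp] = coproduct_simps[OF P]
  have [simp]: "l a b \<in> Arr C" "Dom C (l a b) = E a b" "Cod C (l a b) = D a"
    "r a b \<in> Arr C" "Dom C (r a b) = E a b" "Cod C (r a b) = D b"
    "j (a, b) \<in> Arr C" "Dom C (j (a, b)) = E a b" "Cod C (j (a, b)) = Q"
    if "a \<in> A" "b \<in> A" for a b
    using l[OF that] r[OF that] coproduct_simps(2-4)[OF Q, of "(a, b)"] that by simp_all
  have [simp]: "Q \<in> Obj C" using coproduct_simps[OF Q] by simp
  \<comment> \<open>Additivity turns the coequalizer of the two arrows between coproducts into the
    cokernel of their difference.\<close>
  let ?f = "\<lambda>(a, b). (\<iota> a \<cdot> l a b) \<oplus> neg (\<iota> b \<cdot> r a b)"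
  obtain d where d [simp]: "d \<in> Arr C" "Dom C d = Q" "Cod C d = P"
    and dj0: "\<And>i. i \<in> A \<times> A \<Longrightarrow> d \<cdot> j i = ?f i"
    by (rule coproduct_lift[OF Q, of P ?f]) auto
  have dj: "d \<cdot> j (a, b) = (\<iota> a \<cdot> l a b) \<oplus> neg (\<iota> b \<cdot> r a b)" if "a \<in> A" "b \<in> A" for a b
    using dj0[of "(a, b)"] that by simp
  obtain q where q: "is_cokernel C d q" using cokernel_exists[OF d(1)] by blast
  note [simp] = is_cokernel_simps(1-3)[OF q]
  note qd = is_cokernel_simps(4)[OF q]
  have diff: "g \<cdot> (d \<cdot> j (a, b)) = (g \<cdot> \<iota> a \<cdot> l a b) \<oplus> neg (g \<cdot> \<iota> b \<cdot> r a b)"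
    if "a \<in> A" "b \<in> A" "g \<in> Arr C" "Dom C g = P" for a b g
    using that by (simp add: dj comp_add_right comp_neg)
  have "is_coend C A D l r (Cod C q) (\<lambda>a. q \<cdot> \<iota> a)"
    unfolding is_coend_def is_cowedge_def
  proof (intro conjI ballI allI impI)
    fix a b assume ab: "a \<in> A" "b \<in> A"
    have "q \<cdot> (d \<cdot> j (a, b)) = zero_arr C (E a b) (Cod C q)"
      using ab comp_reassoc[OF qd, of "j (a, b)"] by simp
    then have "(q \<cdot> \<iota> a \<cdot> l a b) \<oplus> neg (q \<cdot> \<iota> b \<cdot> r a b) = zero_arr C (E a b) (Cod C q)"
      using ab diff[of a b q] by simp
    then have "q \<cdot> \<iota> a \<cdot> l a b = q \<cdot> \<iota> b \<cdot> r a b"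
      using ab by (subst eq_iff_diff_zero[symmetric]) simp_all
    then show "(q \<cdot> \<iota> a) \<cdot> l a b = (q \<cdot> \<iota> b) \<cdot> r a b" using ab by simp
  next
    fix w \<psi> assume *: "w \<in> Obj C \<and> (\<forall>a\<in>A. \<psi> a \<in> Hom C (D a) w) \<and>
      (\<forall>a\<in>A. \<forall>b\<in>A. \<psi> a \<cdot> l a b = \<psi> b \<cdot> r a b)"
    have p: "\<psi> a \<in> Arr C" "Dom C (\<psi> a) = D a" "Cod C (\<psi> a) = w" if "a \<in> A" for a
      using * that by simp_all
    have pe: "\<psi> a \<cdot> l a b = \<psi> b \<cdot> r a b" if "a \<in> A" "b \<in> A" for a b using * that by blast
    obtain g where g: "g \<in> Arr C" "Dom C g = P" "Cod C g = w" and gi: "\<And>a. a \<in> A \<Longrightarrow> g \<cdot> \<iota> a = \<psi> a"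
      by (rule coproduct_lift[OF P, of w \<psi>]) (use * in simp_all)
    have gl: "g \<cdot> \<iota> a \<cdot> k = \<psi> a \<cdot> k" if "a \<in> A" "k \<in> Arr C" "Cod C k = D a" for a k
      using that g by (intro comp_reassoc[OF gi]) simp_all
    have "g \<cdot> d = zero_arr C Q w"
    proof (rule coproduct_cancel[OF Q])
      fix i assume "i \<in> A \<times> A"
      then obtain a b where i [simp]: "i = (a, b)" and [simp]: "a \<in> A" "b \<in> A" by blast
      have "(g \<cdot> d) \<cdot> j i = (g \<cdot> \<iota> a \<cdot> l a b) \<oplus> neg (g \<cdot> \<iota> b \<cdot> r a b)"
        using diff[of a b g] g by simp
      also have "\<dots> = zero_arr C (E a b) w"
        using g p[of b] pe[of a b] by (simp add: gl)
      finally show "(g \<cdot> d) \<cdot> j i = zero_arr C Q w \<cdot> j i" using * by simp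
    qed (use g * in simp_all)
    then obtain u where u: "u \<in> Arr C" "Dom C u = Cod C q" "Cod C u = w" "u \<cdot> q = g"
      using cokernel_factor[OF q, of g] g by auto
    show "\<exists>!u. u \<in> Hom C (Cod C q) w \<and> (\<forall>a\<in>A. u \<cdot> q \<cdot> \<iota> a = \<psi> a)"
    proof (rule ex1I[of _ u])
      show "u \<in> Hom C (Cod C q) w \<and> (\<forall>a\<in>A. u \<cdot> q \<cdot> \<iota> a = \<psi> a)"
        using u gi comp_reassoc[OF u(4)] by simp
      fix v assume v: "v \<in> Hom C (Cod C q) w \<and> (\<forall>a\<in>A. v \<cdot> q \<cdot> \<iota> a = \<psi> a)"
      then have v1: "v \<in> Arr C" "Dom C v = Cod C q" "Cod C v = w" by simp_all
      have "v \<cdot> q = g"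
        by (rule coproduct_cancel[OF P]) (use v v1 g gi in simp_all)
      then have "v \<cdot> q = u \<cdot> q" using u(4) by simp
      then show "v = u"
        by (rule epi_cancel[OF cokernel_epi[OF q]]) (use u(1-3) v1 in simp_all)
    qed
  qed simp_all
  then show ?thesis by blast
qed

context Enriched
begin

lemma iso_pointwiseI:
  assumes t: "t \<in> Arr M" and iso: "\<And>a. a \<in> Ob \<Longrightarrow> iso_arr V (NMap t a)"
  shows "iso_arr M t"
proof -
  note [simp] = t
  note i = inv_arr_simps[OF iso]
  let ?s = "mknt (Cod M t) (Dom M t) (\<lambda>a. inv_arr V (NMap t a))"
  have s: "?s \<in> Hom M (Cod M t) (Dom M t)"
  proof (rule mknt_Hom)
    fix a b assume [simp]: "a \<in> Ob" "b \<in> Ob"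
    note [simp] = i[of a] i[of b]
    show "inv_arr V (NMap t b) \<cdot> act (Cod M t) a b = act (Dom M t) a b \<cdot> (H a b \<lhd> inv_arr V (NMap t a))"
    proof (rule mono_cancel[OF iso_mono[OF iso[of b]]])
      have "NMap t b \<cdot> act (Dom M t) a b \<cdot> (H a b \<lhd> inv_arr V (NMap t a)) =
          (act (Cod M t) a b \<cdot> (H a b \<lhd> NMap t a)) \<cdot> (H a b \<lhd> inv_arr V (NMap t a))"
        by (rule comp_reassoc[OF natural[OF t]]) simp_all
      also have "\<dots> = act (Cod M t) a b" by (simp add: ten_comp)
      also have "\<dots> = NMap t b \<cdot> inv_arr V (NMap t b) \<cdot> act (Cod M t) a b"
        using comp_reassoc[OF i(6)[of b], of "act (Cod M t) a b"] by simp
      finally show "NMap t b \<cdot> inv_arr V (NMap t b) \<cdot> act (Cod M t) a b =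
        NMap t b \<cdot> act (Dom M t) a b \<cdot> (H a b \<lhd> inv_arr V (NMap t a))" ..
    qed simp_all
  qed (use i in simp_all)
  show ?thesis
  proof (rule M.iso_arrI[of _ ?s])
    show "?s \<cdot>\<^bsub>M\<^esub> t = Idn M (Dom M t)" "t \<cdot>\<^bsub>M\<^esub> ?s = Idn M (Cod M t)"
      by (rule nt_eqI; use s i in simp)+
  qed (use s in simp_all)
qed

lemma P_unit_natural:
  assumes [simp]: "a \<in> Ob" and f [simp]: "f \<in> Arr V"
  shows "(H a a \<lhd> f) \<cdot> P_unit a (Dom V f) = P_unit a (Cod V f) \<cdot> f"
proof -
  have "(H a a \<lhd> f) \<cdot> P_unit a (Dom V f) = ((H a a \<lhd> f) \<cdot> (VId C a \<rhd> Dom V f)) \<cdot> LUnit_inv (Dom V f)"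
    by (simp add: P_unit_def)
  also have "(H a a \<lhd> f) \<cdot> (VId C a \<rhd> Dom V f) = (VId C a \<rhd> Cod V f) \<cdot> (Unit V \<lhd> f)"
    by (rule whisker_exchange) simp_all
  finally show ?thesis by (simp add: P_unit_def LUnit_inv_natural)
qed

text \<open>The transformation is the Yoneda one given by \<open>f\<close> followed by the universal
  element, and so inherits naturality from \<open>yoneda_Hom\<close>.\<close>

lemma vtensor_arr_Hom:
  assumes a [simp]: "a \<in> Ob" and f [simp]: "f \<in> Arr V"
  shows "vtensor_arr V C (vrep V C a) f \<in> Hom M (P a (Dom V f)) (P a (Cod V f))"
proof -
  let ?v = "Dom V f" and ?w = "Cod V f"
  have t: "P_unit a ?w \<cdot> f \<in> Hom V ?v (VMap (P a ?w) a)" by simp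
  have "act (P a ?w) a c \<cdot> (H a c \<lhd> (P_unit a ?w \<cdot> f)) = H a c \<lhd> f" if [simp]: "c \<in> Ob" for c
  proof -
    have "act (P a ?w) a c \<cdot> (H a c \<lhd> (P_unit a ?w \<cdot> f)) =
        (act (P a ?w) a c \<cdot> (H a c \<lhd> P_unit a ?w)) \<cdot> (H a c \<lhd> f)"
      by (simp add: whisker_left_comp)
    also have "\<dots> = H a c \<lhd> f" by (subst P_act_unit) simp_all
    finally show ?thesis .
  qed
  then have "yoneda a ?v (P a ?w) (P_unit a ?w \<cdot> f) = vtensor_arr V C (vrep V C a) f"
    unfolding yoneda_def mknt_def vtensor_arr_def by (auto intro!: restrict_ext)
  then show ?thesis using yoneda_Hom[OF a _ t] by simp
qed

text \<open>In this form the arrow is known through its composite with \<open>I_counit\<close>,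
  which is what \<open>I_cancel\<close> compares.\<close>

lemma vcorep_arr_eq:
  assumes b [simp]: "b \<in> Ob" and f [simp]: "f \<in> Arr V"
  shows "vcorep_arr V C b f =
    coyoneda b (Cod V f) (I b (Dom V f)) (f \<cdot> I_counit b (Dom V f))"
proof -
  let ?v = "Dom V f" and ?w = "Cod V f"
  have "lcurry (VMap (I b ?v) c) (H c b) ?w ((f \<cdot> I_counit b ?v) \<cdot> act (I b ?v) c b) =
      IHomA V (Idn V (H c b)) f" if [simp]: "c \<in> Ob" for c
  proof -
    have "(f \<cdot> I_counit b ?v) \<cdot> act (I b ?v) c b = f \<cdot> (I_counit b ?v \<cdot> act (I b ?v) c b)"
      by (subst comp_assoc) simp_all
    also have "\<dots> = f \<cdot> leval (H c b) ?v" by (subst I_counit_act) simp_all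
    finally have "(f \<cdot> I_counit b ?v) \<cdot> act (I b ?v) c b = f \<cdot> leval (H c b) ?v" .
    then show ?thesis by (simp add: lcurry_def IHomA_def leval_def)
  qed
  then show ?thesis
    unfolding coyoneda_def mknt_def vcorep_arr_def by (auto intro!: restrict_ext)
qed

end

section \<open>Restriction and its right adjoint\<close>

locale Restriction = Enriched V C for V :: "('o, 'm) csmcat" (structure) and C :: "('c, 'o, 'm) vcat" +
  fixes \<kappa> :: "'k rel" and A :: "'c set"
  assumes univ: "universe \<kappa>" and groth: "grothendieck \<kappa> V" and small_Ob: "small \<kappa> (VObj C)"
    and A: "A \<subseteq> VObj C"
begin

lemma A_Ob [simp]: "a \<in> A \<Longrightarrow> a \<in> Ob"
  using A by blast

lemma full_vsubcat_simps [simp]: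
  "VObj (full_vsubcat C A) = A" "VHom (full_vsubcat C A) = VHom C"
  "VComp (full_vsubcat C A) = VComp C" "VId (full_vsubcat C A) = VId C"
  by (simp_all add: full_vsubcat_def)

lemma vcategory_full_vsubcat: "vcategory V (full_vsubcat C A)"
  using vcategory unfolding vcategory_def by (simp del: Hom_iff)

end

text \<open>The theory of enriched functors is instantiated at \<open>A\<close> as well. The
  rewrites give both instances literally the same hom objects and composition, so that facts about
  free functors over \<open>C\<close> and over \<open>A\<close> combine.\<close>

sublocale Restriction \<subseteq> N: Enriched V "full_vsubcat C A"
  rewrites "VObj (full_vsubcat C A) = A" and "VHom (full_vsubcat C A) = VHom C"
    and "VComp (full_vsubcat C A) = VComp C" and "VId (full_vsubcat C A) = VId C"
  by unfold_locales (simp_all add: vcategory_full_vsubcat)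

context Restriction
begin

abbreviation N where "N \<equiv> vfun_cat V (full_vsubcat C A)"

abbreviation r where "r \<equiv> restriction_functor A"

lemma small_Hom_V: "\<lbrakk>x \<in> Obj V; y \<in> Obj V\<rbrakk> \<Longrightarrow> small \<kappa> (Hom V x y)"
  using groth by (simp add: grothendieck_def del: Hom_iff)

lemma coproducts_V:
  assumes "small \<kappa> (J :: 'i set)" "\<forall>i \<in> J. X i \<in> Obj V"
  shows "\<exists>Q \<iota>. is_coproduct V J X Q \<iota>"
  by (rule coproducts_any_index[OF univ _ assms]) (use groth in \<open>simp add: grothendieck_def\<close>)

lemma small_A: "small \<kappa> A"
  using small_subset[OF A small_Ob] .

lemma coproducts_M:
  assumes "small \<kappa> (J :: 'i set)" "\<forall>i \<in> J. X i \<in> Obj M"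
  shows "\<exists>Q \<iota>. is_coproduct M J X Q \<iota>"
proof -
  obtain Q \<iota> where "Q \<in> Obj M" "\<And>i. i \<in> J \<Longrightarrow> \<iota> i \<in> Hom M (X i) Q"
    "\<And>a. a \<in> Ob \<Longrightarrow> is_coproduct V J (\<lambda>i. VMap (X i) a) (VMap Q a) (\<lambda>i. NMap (\<iota> i) a)"
    by (rule coproduct_M[OF coproducts_V[OF assms(1)] assms(2)]) blast+
  then have "is_coproduct M J X Q \<iota>"
    using assms(2) by (intro coproduct_pointwiseI) auto
  then show ?thesis by blast
qed

lemma VMap_restrict [simp]: "a \<in> A \<Longrightarrow> VMap (restrict_vfun A X) a = VMap X a"
  and VAct_restrict [simp]: "\<lbrakk>a \<in> A; b \<in> A\<rbrakk> \<Longrightarrow> VAct (restrict_vfun A X) a b = VAct X a b"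
  by (simp_all add: restrict_vfun_def)

lemma restrict_Obj [simp]:
  assumes "X \<in> Obj M"
  shows "restrict_vfun A X \<in> Obj N"
  unfolding N.Obj_M N.vfunctor_iff N.is_action_def
  using assms act_assoc[OF assms] act_unit[OF assms]
  by (auto simp: restrict_vfun_def)

lemma FObj_r [simp]: "FObj r X = restrict_vfun A X"
  by (simp add: restriction_functor_def)

lemma FArr_r: "t \<in> Arr M \<Longrightarrow> FArr r t =
    N.mknt (restrict_vfun A (Dom M t)) (restrict_vfun A (Cod M t)) (NMap t)"
  by (simp add: restriction_functor_def N.mknt_def M_simps)

lemma NMap_r [simp]: "\<lbrakk>t \<in> Arr M; a \<in> A\<rbrakk> \<Longrightarrow> NMap (FArr r t) a = NMap t a"
  by (simp add: FArr_r)

lemma FArr_r_Hom: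
  assumes "t \<in> Arr M"
  shows "FArr r t \<in> Hom N (restrict_vfun A (Dom M t)) (restrict_vfun A (Cod M t))"
  unfolding FArr_r[OF assms]
  by (rule N.mknt_Hom) (use assms natural[OF assms] in simp_all)

lemma functor_r: "is_functor M N r"
  unfolding is_functor_def
proof (intro conjI ballI impI)
  fix X assume X: "X \<in> Obj M"
  show "FArr r (Idn M X) = Idn N (FObj r X)"
    using X FArr_r_Hom[of "Idn M X"] by (intro N.nt_eqI) simp_all
next
  fix f g assume "f \<in> Arr M" "g \<in> Arr M" "Cod M f = Dom M g"
  then show "FArr r (g \<cdot>\<^bsub>M\<^esub> f) = FArr r g \<cdot>\<^bsub>N\<^esub> FArr r f"
    using FArr_r_Hom[of f] FArr_r_Hom[of g] FArr_r_Hom[of "g \<cdot>\<^bsub>M\<^esub> f"]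
    by (intro N.nt_eqI) simp_all
qed (use FArr_r_Hom in auto)

lemmas r_simps [simp] = FArr_in[OF functor_r] Dom_FArr[OF functor_r] Cod_FArr[OF functor_r]

lemma additive_r: "additive_functor M N r"
  unfolding additive_functor_def
proof (intro conjI functor_r ballI)
  fix X Y f g assume "X \<in> Obj M" "Y \<in> Obj M" "f \<in> Hom M X Y" "g \<in> Hom M X Y"
  then show "FArr r (f \<oplus>\<^bsub>M\<^esub> g) = FArr r f \<oplus>\<^bsub>N\<^esub> FArr r g"
    by (intro N.nt_eqI) auto
qed

lemma N_P_unit [simp]: "N.P_unit = P_unit"
  by (simp add: fun_eq_iff N.P_unit_def P_unit_def)

text \<open>This is an equality and not just an isomorphism, since a full subcategory shares hom
  objects and composition.\<close>

lemma restrict_P: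
  assumes a: "a \<in> A"
  shows "restrict_vfun A (P a v) = vtensor V (full_vsubcat C A) (vrep V (full_vsubcat C A) a) v"
  unfolding restrict_vfun_def vtensor_def vrep_def
  by (auto intro!: restrict_ext)

lemma right_universal:
  assumes H: "F \<in> Obj N"
  shows "\<exists>R \<epsilon>. R \<in> Obj M \<and> \<epsilon> \<in> Hom N (FObj r R) F \<and>
    (\<forall>Y \<in> Obj M. \<forall>f \<in> Hom N (FObj r Y) F. \<exists>!g. g \<in> Hom M Y R \<and> \<epsilon> \<cdot>\<^bsub>N\<^esub> FArr r g = f)"
proof -
  obtain u where u: "is_generator V u" using groth unfolding grothendieck_def by blast
  obtain U where U: "is_generator M U"
    using generator_M[OF coproducts_V[OF small_Ob] u] by blast
  show ?thesis
  proof (rule special_adjoint_functor_theorem[OF AbelianI[OF abelian_M] _ additive_r _ _ _ _ _ U H])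
    show "Preadditive N" by unfold_locales
    show "small \<kappa> (Hom M x y)" if "x \<in> Obj M" "y \<in> Obj M" for x y
      by (rule small_Hom_M[OF univ small_Ob small_Hom_V that])
    show "small \<kappa> (Hom N x y)" if "x \<in> Obj N" "y \<in> Obj N" for x y
      by (rule N.small_Hom_M[OF univ small_A small_Hom_V that])
  next
    \<comment> \<open>The adjoint functor theorem takes coproducts indexed by hom sets, hence by
      sets of transformations. Restriction preserves them because they are computed pointwise on
      both sides.\<close>
    fix J :: "('c, 'o, 'm) vnt set" and X
    assume J: "small \<kappa> J" and X: "\<forall>i \<in> J. X i \<in> Obj M"
    obtain Q \<iota> where Q: "Q \<in> Obj M" "\<And>i. i \<in> J \<Longrightarrow> \<iota> i \<in> Hom M (X i) Q"
      "\<And>a. a \<in> Ob \<Longrightarrow> is_coproduct V J (\<lambda>i. VMap (X i) a) (VMap Q a) (\<lambda>i. NMap (\<iota> i) a)"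
      by (rule coproduct_M[OF coproducts_V[OF J] X]) blast+
    have "is_coproduct M J X Q \<iota>"
      using X Q by (intro coproduct_pointwiseI) auto
    moreover have "is_coproduct N J (\<lambda>i. FObj r (X i)) (FObj r Q) (\<lambda>i. FArr r (\<iota> i))"
    proof (rule N.coproduct_pointwiseI)
      fix a assume a: "a \<in> A"
      have "is_coproduct V J (\<lambda>i. VMap (FObj r (X i)) a) (VMap (FObj r Q) a) f" 
        if "is_coproduct V J (\<lambda>i. VMap (X i) a) (VMap Q a) f" for f
        using that a by simp
      moreover have "is_coproduct V J Y Z (\<lambda>i. NMap (FArr r (\<iota> i)) a)"
        if "is_coproduct V J Y Z (\<lambda>i. NMap (\<iota> i) a)" for Y Z
        using that Q(2) a unfolding is_coproduct_def by simp
      ultimately show "is_coproduct V J (\<lambda>i. VMap (FObj r (X i)) a) (VMap (FObj r Q) a)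
          (\<lambda>i. NMap (FArr r (\<iota> i)) a)" using Q(3)[of a] a by simp
    qed (use X Q in auto)
    ultimately show "\<exists>P \<iota>. is_coproduct M J X P \<iota> \<and>
        is_coproduct N J (\<lambda>i. FObj r (X i)) (FObj r P) (\<lambda>i. FArr r (\<iota> i))" by blast
  next
    fix f assume f: "f \<in> Arr M"
    obtain q where q: "is_cokernel M f q" "\<And>a. a \<in> Ob \<Longrightarrow> is_cokernel V (NMap f a) (NMap q a)"
      using cokernel_M[OF f] by blast
    have "is_cokernel N (FArr r f) (FArr r q)"
      by (rule N.cokernel_pointwiseI) (use M.is_cokernel_simps[OF q(1)] q(2) in simp_all)
    then show "\<exists>q. is_cokernel M f q \<and> is_cokernel N (FArr r f) (FArr r q)" using q(1) by blast
  next
    fix e assume e: "epi_arr M e"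
    show "epi_arr N (FArr r e)"
      by (rule N.epi_pointwiseI) (use M.epi_ArrD[OF e] epi_pointwise[OF e] in simp_all)
  qed
qed

text \<open>Object and counit are chosen together, since the universal property ties them to each
  other.\<close>

definition R_pair where
  "R_pair F = (SOME p. fst p \<in> Obj M \<and> snd p \<in> Hom N (FObj r (fst p)) F \<and>
    (\<forall>Y \<in> Obj M. \<forall>f \<in> Hom N (FObj r Y) F. \<exists>!g. g \<in> Hom M Y (fst p) \<and> snd p \<cdot>\<^bsub>N\<^esub> FArr r g = f))"

abbreviation RO where "RO F \<equiv> fst (R_pair F)"

abbreviation \<epsilon> where "\<epsilon> F \<equiv> snd (R_pair F)"

lemma R_pair:
  assumes "F \<in> Obj N"
  shows "RO F \<in> Obj M \<and> \<epsilon> F \<in> Hom N (FObj r (RO F)) F \<and>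
    (\<forall>Y \<in> Obj M. \<forall>f \<in> Hom N (FObj r Y) F. \<exists>!g. g \<in> Hom M Y (RO F) \<and> \<epsilon> F \<cdot>\<^bsub>N\<^esub> FArr r g = f)"
proof -
  obtain R e where *: "R \<in> Obj M \<and> e \<in> Hom N (FObj r R) F \<and>
    (\<forall>Y \<in> Obj M. \<forall>f \<in> Hom N (FObj r Y) F. \<exists>!g. g \<in> Hom M Y R \<and> e \<cdot>\<^bsub>N\<^esub> FArr r g = f)"
    using right_universal[OF assms] by blast
  show ?thesis unfolding R_pair_def by (rule someI[of _ "(R, e)"]) (use * in simp)
qed

end

sublocale Restriction \<subseteq> R: Universal_to "vfun_cat V (full_vsubcat C A)" "vfun_cat V C"
    "restriction_functor A" "\<lambda>F. fst (R_pair F)" "\<lambda>F. snd (R_pair F)"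
  by unfold_locales (use R_pair functor_r in blast)+

context Restriction
begin

text \<open>For \<open>a\<close> in \<open>A\<close> an arrow from \<open>v\<close> to
  \<open>RO F\<close> at \<open>a\<close> is a transformation
  \<open>P a v \<rightarrow> RO F\<close>, hence one from the restriction of \<open>P a v\<close> to
  \<open>F\<close>; that restriction is free again, so this is an arrow from \<open>v\<close> to
  \<open>F\<close> at \<open>a\<close>.\<close>

lemma counit_iso:
  assumes F [simp]: "F \<in> Obj N"
  shows "iso_arr N (\<epsilon> F)"
proof (rule N.iso_pointwiseI)
  show [simp]: "\<epsilon> F \<in> Arr N" by simp
  fix a assume a [simp]: "a \<in> A"
  let ?e = "NMap (\<epsilon> F) a"
  have e [simp]: "?e \<in> Arr V" "Dom V ?e = VMap (RO F) a" "Cod V ?e = VMap F a" by simp_all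
  have mono: "mono_arr V ?e"
    unfolding mono_arr_def
  proof (intro conjI ballI impI e(1))
    fix v k k' assume v [simp]: "v \<in> Obj V" and k0: "k \<in> Hom V v (Dom V ?e)" "k' \<in> Hom V v (Dom V ?e)"
      and eq: "?e \<cdot> k = ?e \<cdot> k'"
    have k: "k \<in> Hom V v (VMap (RO F) a)" "k' \<in> Hom V v (VMap (RO F) a)" using k0 by simp_all
    have y: "yoneda a v (RO F) k \<in> Hom M (P a v) (RO F)" "yoneda a v (RO F) k' \<in> Hom M (P a v) (RO F)"
      by (rule yoneda_Hom; use k in simp)+
    have yu: "NMap (yoneda a v (RO F) k) a \<cdot> P_unit a v = k" "NMap (yoneda a v (RO F) k') a \<cdot> P_unit a v = k'"
      by (rule yoneda_unit; use k in simp)+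
    have "\<epsilon> F \<cdot>\<^bsub>N\<^esub> FArr r (yoneda a v (RO F) k) = \<epsilon> F \<cdot>\<^bsub>N\<^esub> FArr r (yoneda a v (RO F) k')"
      by (rule N.P_cancel[of a v]) (use y yu eq in \<open>simp_all add: restrict_P\<close>)
    then have "yoneda a v (RO F) k = yoneda a v (RO F) k'"
      by (rule R.counit_cancel[rotated -1]) (use y in simp_all)
    then show "k = k'" using yu by metis
  qed
  let ?v = "VMap F a"
  have i: "Idn V ?v \<in> Hom V ?v (VMap F a)" by simp
  have f: "N.yoneda a ?v F (Idn V ?v) \<in> Hom N (FObj r (P a ?v)) F"
    using N.yoneda_Hom[OF a F i] by (simp add: restrict_P)
  \<comment> \<open>The generic case \<open>v = F a\<close>: the arrow \<open>?s\<close>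
    corresponding to the identity is a section of the component, and a mono with a section is
    invertible.\<close>
  let ?g = "R.colift F (P a ?v) (N.yoneda a ?v F (Idn V ?v))"
  have g: "?g \<in> Hom M (P a ?v) (RO F)" "\<epsilon> F \<cdot>\<^bsub>N\<^esub> FArr r ?g = N.yoneda a ?v F (Idn V ?v)"
    using R.colift[OF F _ f] by simp_all
  let ?s = "NMap ?g a \<cdot> P_unit a ?v"
  have s: "?s \<in> Hom V ?v (VMap (RO F) a)" using g(1) by simp
  have "NMap (\<epsilon> F \<cdot>\<^bsub>N\<^esub> FArr r ?g) a \<cdot> P_unit a ?v = Idn V ?v"
    using N.yoneda_unit[OF a F i] unfolding g(2) by simp
  then have es: "?e \<cdot> ?s = Idn V ?v" using g(1) by simp
  have "?s \<cdot> ?e = Idn V (VMap (RO F) a)"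
  proof (rule mono_cancel[OF mono])
    have "?e \<cdot> ?s \<cdot> ?e = Idn V ?v \<cdot> ?e" by (rule comp_reassoc[OF es]) (use s in simp_all)
    then show "?e \<cdot> ?s \<cdot> ?e = ?e \<cdot> Idn V (VMap (RO F) a)" by simp
  qed (use s in simp_all)
  then show "iso_arr V ?e" using s es by (intro iso_arrI[of _ ?s]) simp_all
qed

end

section \<open>The left Kan extension\<close>

context Restriction
begin

text \<open>
  By the Yoneda lemma, cowedges under \<open>C(a,-) \<oslash> F a\<close> correspond to natural transformations
  \<open>F \<rightarrow> rW\<close>.
\<close>

lemma lan_left_eq:
  assumes F: "F \<in> Obj N" and [simp]: "a \<in> A" "b \<in> A"
  shows "lan_left V C F a b =
    yoneda b (H a b \<otimes> VMap F a) (P a (VMap F a)) (Idn V (H a b \<otimes> VMap F a))"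
proof -
  have [simp]: "VMap F a \<in> Obj V" using N.functor_simps(1)[OF F] by simp
  have "act (P a (VMap F a)) b c \<cdot> (H b c \<lhd> Idn V (H a b \<otimes> VMap F a)) =
      (m a b c \<rhd> VMap F a) \<cdot> \<alpha>' (H b c) (H a b) (VMap F a)" if [simp]: "c \<in> Ob" for c
    by (subst P_act) simp_all
  then show ?thesis
    unfolding lan_left_def yoneda_def mknt_def by (auto intro!: restrict_ext)
qed

lemma lan_right_eq:
  assumes F [simp]: "F \<in> Obj N" and [simp]: "a \<in> A" "b \<in> A"
  shows "lan_right V C F a b =
    yoneda b (H a b \<otimes> VMap F a) (P b (VMap F b)) (P_unit b (VMap F b) \<cdot> act F a b)"
proof -
  have [simp]: "VMap F a \<in> Obj V" "VMap F b \<in> Obj V" using N.functor_simps(1)[OF F] by simp_all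
  have "act (P b (VMap F b)) b c \<cdot> (H b c \<lhd> (P_unit b (VMap F b) \<cdot> act F a b)) = H b c \<lhd> act F a b"
    if [simp]: "c \<in> Ob" for c
  proof -
    have "act (P b (VMap F b)) b c \<cdot> (H b c \<lhd> (P_unit b (VMap F b) \<cdot> act F a b)) =
        (act (P b (VMap F b)) b c \<cdot> (H b c \<lhd> P_unit b (VMap F b))) \<cdot> (H b c \<lhd> act F a b)"
      by (simp add: whisker_left_comp)
    also have "\<dots> = H b c \<lhd> act F a b" by (subst P_act_unit) simp_all
    finally show ?thesis .
  qed
  then show ?thesis
    unfolding lan_right_def yoneda_def mknt_def by (auto intro!: restrict_ext)
qed

text \<open>Both arrows leave a free functor, so their values at its universal element carry all of
  the coend condition: the identity for the first, the action of \<open>F\<close> followed by the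
  universal element for the second.\<close>

lemma lan_Hom:
  assumes F [simp]: "F \<in> Obj N" and [simp]: "a \<in> A" "b \<in> A"
  shows "lan_left V C F a b \<in> Hom M (P b (H a b \<otimes> VMap F a)) (P a (VMap F a))"
    and "lan_right V C F a b \<in> Hom M (P b (H a b \<otimes> VMap F a)) (P b (VMap F b))"
    and "NMap (lan_left V C F a b) b \<cdot> P_unit b (H a b \<otimes> VMap F a) = Idn V (H a b \<otimes> VMap F a)"
    and "NMap (lan_right V C F a b) b \<cdot> P_unit b (H a b \<otimes> VMap F a) = P_unit b (VMap F b) \<cdot> act F a b"
proof -
  have [simp]: "VMap F a \<in> Obj V" "VMap F b \<in> Obj V" using N.functor_simps(1)[OF F] by simp_all
  have 1: "Idn V (H a b \<otimes> VMap F a) \<in> Hom V (H a b \<otimes> VMap F a) (VMap (P a (VMap F a)) b)" by simp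
  have 2: "P_unit b (VMap F b) \<cdot> act F a b \<in> Hom V (H a b \<otimes> VMap F a) (VMap (P b (VMap F b)) b)"
    by simp
  show "lan_left V C F a b \<in> Hom M (P b (H a b \<otimes> VMap F a)) (P a (VMap F a))"
    "NMap (lan_left V C F a b) b \<cdot> P_unit b (H a b \<otimes> VMap F a) = Idn V (H a b \<otimes> VMap F a)"
    unfolding lan_left_eq[OF assms] by (rule yoneda_Hom[OF _ _ 1] yoneda_unit[OF _ _ 1]; simp)+
  show "lan_right V C F a b \<in> Hom M (P b (H a b \<otimes> VMap F a)) (P b (VMap F b))"
    "NMap (lan_right V C F a b) b \<cdot> P_unit b (H a b \<otimes> VMap F a) = P_unit b (VMap F b) \<cdot> act F a b"
    unfolding lan_right_eq[OF assms] by (rule yoneda_Hom[OF _ _ 2] yoneda_unit[OF _ _ 2]; simp)+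
qed

text \<open>Both composites leave the free functor on \<open>H a b \<otimes> VMap F a\<close> at
  \<open>b\<close>, so they are compared on its universal element. There the condition is the
  naturality square of the transposed legs.\<close>

lemma cowedge_iff:
  assumes F [simp]: "F \<in> Obj N" and [simp]: "a \<in> A" "b \<in> A"
    and f: "f \<in> Hom M (P a (VMap F a)) W" and g: "g \<in> Hom M (P b (VMap F b)) W"
  shows "f \<cdot>\<^bsub>M\<^esub> lan_left V C F a b = g \<cdot>\<^bsub>M\<^esub> lan_right V C F a b \<longleftrightarrow>
    act W a b \<cdot> (H a b \<lhd> (NMap f a \<cdot> P_unit a (VMap F a))) =
    (NMap g b \<cdot> P_unit b (VMap F b)) \<cdot> act F a b"
proof -
  have [simp]: "VMap F a \<in> Obj V" "VMap F b \<in> Obj V" using N.functor_simps(1)[OF F] by simp_all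
  let ?v = "H a b \<otimes> VMap F a" and ?l = "lan_left V C F a b" and ?r = "lan_right V C F a b"
  note h = lan_Hom[OF F \<open>a \<in> A\<close> \<open>b \<in> A\<close>]
  have [simp]: "f \<in> Arr M" "Dom M f = P a (VMap F a)" "Cod M f = W"
    "g \<in> Arr M" "Dom M g = P b (VMap F b)" "Cod M g = W"
    "?l \<in> Arr M" "Dom M ?l = P b ?v" "Cod M ?l = P a (VMap F a)"
    "?r \<in> Arr M" "Dom M ?r = P b ?v" "Cod M ?r = P b (VMap F b)"
    using f g h by simp_all
  have "NMap (f \<cdot>\<^bsub>M\<^esub> ?l) b \<cdot> P_unit b ?v = NMap f b \<cdot> (NMap ?l b \<cdot> P_unit b ?v)" by simp
  also have "\<dots> = NMap f b" unfolding h(3) by simp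
  also have "\<dots> = act W a b \<cdot> (H a b \<lhd> (NMap f a \<cdot> P_unit a (VMap F a)))"
    by (subst P_expand[of a "VMap F a"]) simp_all
  finally have 1: "NMap (f \<cdot>\<^bsub>M\<^esub> ?l) b \<cdot> P_unit b ?v =
      act W a b \<cdot> (H a b \<lhd> (NMap f a \<cdot> P_unit a (VMap F a)))" .
  have "NMap (g \<cdot>\<^bsub>M\<^esub> ?r) b \<cdot> P_unit b ?v = NMap g b \<cdot> (NMap ?r b \<cdot> P_unit b ?v)" by simp
  also have "\<dots> = (NMap g b \<cdot> P_unit b (VMap F b)) \<cdot> act F a b" unfolding h(4) by simp
  finally have 2: "NMap (g \<cdot>\<^bsub>M\<^esub> ?r) b \<cdot> P_unit b ?v =
      (NMap g b \<cdot> P_unit b (VMap F b)) \<cdot> act F a b" .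
  have "f \<cdot>\<^bsub>M\<^esub> ?l = g \<cdot>\<^bsub>M\<^esub> ?r \<longleftrightarrow> NMap (f \<cdot>\<^bsub>M\<^esub> ?l) b \<cdot> P_unit b ?v = NMap (g \<cdot>\<^bsub>M\<^esub> ?r) b \<cdot> P_unit b ?v"
  proof
    assume "NMap (f \<cdot>\<^bsub>M\<^esub> ?l) b \<cdot> P_unit b ?v = NMap (g \<cdot>\<^bsub>M\<^esub> ?r) b \<cdot> P_unit b ?v"
    then show "f \<cdot>\<^bsub>M\<^esub> ?l = g \<cdot>\<^bsub>M\<^esub> ?r" by (rule P_cancel[of b ?v, rotated -1]) simp_all
  qed (simp only:)
  then show ?thesis unfolding 1 2 .
qed

lemma left_coend_exists:
  assumes F [simp]: "F \<in> Obj N"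
  shows "\<exists>x \<omega>. is_coend M A (\<lambda>a. P a (VMap F a)) (lan_left V C F) (lan_right V C F) x \<omega>"
proof -
  interpret AM: Abelian M by (rule AbelianI[OF abelian_M])
  have [simp]: "VMap F a \<in> Obj V" if "a \<in> A" for a using N.functor_simps(1)[OF F that] .
  show ?thesis
  proof (rule AM.coend_exists)
    show "\<exists>Q \<iota>. is_coproduct M A (\<lambda>a. P a (VMap F a)) Q \<iota>"
      by (rule coproducts_M[OF small_A]) simp
    show "\<exists>Q \<iota>. is_coproduct M (A \<times> A) (\<lambda>(a, b). P b (H a b \<otimes> VMap F a)) Q \<iota>"
      by (rule coproducts_M[OF small_Times[OF univ small_A small_A]]) auto
  qed (use lan_Hom[OF F] in auto)
qed

definition L_pair where
  "L_pair F = (SOME p. is_coend M A (\<lambda>a. P a (VMap F a)) (lan_left V C F) (lan_right V C F) (fst p) (snd p))"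

abbreviation LO where "LO F \<equiv> fst (L_pair F)"

abbreviation \<omega> where "\<omega> F \<equiv> snd (L_pair F)"

text \<open>The transposes of the coend legs; the cowedge condition is exactly naturality of this
  family.\<close>

definition \<eta> where "\<eta> F = N.mknt F (restrict_vfun A (LO F)) (\<lambda>a. NMap (\<omega> F a) a \<cdot> P_unit a (VMap F a))"

lemma L_coend:
  assumes F: "F \<in> Obj N"
  shows "is_coend M A (\<lambda>a. P a (VMap F a)) (lan_left V C F) (lan_right V C F) (LO F) (\<omega> F)"
proof -
  obtain x w where *: "is_coend M A (\<lambda>a. P a (VMap F a)) (lan_left V C F) (lan_right V C F) x w"
    using left_coend_exists[OF F] by blast
  show ?thesis unfolding L_pair_def
    by (rule someI[where P = "\<lambda>p. is_coend M A (\<lambda>a. P a (VMap F a)) (lan_left V C F) (lan_right V C F)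
      (fst p) (snd p)" and x = "(x, w)"]) (simp only: fst_conv snd_conv *)
qed

lemma LO_Obj: "F \<in> Obj N \<Longrightarrow> LO F \<in> Obj M"
  using L_coend unfolding is_coend_def is_cowedge_def by blast

lemma omega_Hom: "F \<in> Obj N \<Longrightarrow> a \<in> A \<Longrightarrow> \<omega> F a \<in> Hom M (P a (VMap F a)) (LO F)"
  using L_coend unfolding is_coend_def is_cowedge_def by blast

lemma omega_cowedge:
  "F \<in> Obj N \<Longrightarrow> a \<in> A \<Longrightarrow> b \<in> A \<Longrightarrow>
     \<omega> F a \<cdot>\<^bsub>M\<^esub> lan_left V C F a b = \<omega> F b \<cdot>\<^bsub>M\<^esub> lan_right V C F a b"
  using L_coend unfolding is_coend_def is_cowedge_def by blast

lemma eta_Hom: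
  assumes F [simp]: "F \<in> Obj N"
  shows "\<eta> F \<in> Hom N F (FObj r (LO F))"
  unfolding \<eta>_def FObj_r
proof (rule N.mknt_Hom)
  have v [simp]: "VMap F a \<in> Obj V" if "a \<in> A" for a using N.functor_simps(1)[OF F that] .
  show "restrict_vfun A (LO F) \<in> Obj N" using LO_Obj[OF F] by simp
  have w: "\<omega> F a \<in> Arr M" "Dom M (\<omega> F a) = P a (VMap F a)" "Cod M (\<omega> F a) = LO F" if "a \<in> A" for a
    using omega_Hom[OF F that] by simp_all
  fix a assume a [simp]: "a \<in> A"
  show "NMap (\<omega> F a) a \<cdot> P_unit a (VMap F a) \<in> Hom V (VMap F a) (VMap (restrict_vfun A (LO F)) a)"
    using w[OF a] by simp
  fix b assume b [simp]: "b \<in> A"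
  show "(NMap (\<omega> F b) b \<cdot> P_unit b (VMap F b)) \<cdot> act F a b =
    act (restrict_vfun A (LO F)) a b \<cdot> (H a b \<lhd> (NMap (\<omega> F a) a \<cdot> P_unit a (VMap F a)))"
    using cowedge_iff[OF F a b omega_Hom[OF F a] omega_Hom[OF F b]] omega_cowedge[OF F a b] by simp
qed simp

lemma NMap_eta: "a \<in> A \<Longrightarrow> NMap (\<eta> F) a = NMap (\<omega> F a) a \<cdot> P_unit a (VMap F a)"
  by (simp add: \<eta>_def)

lemma left_universal:
  assumes F [simp]: "F \<in> Obj N" and W [simp]: "W \<in> Obj M" and f: "f \<in> Hom N F (FObj r W)"
  shows "\<exists>!g. g \<in> Hom M (LO F) W \<and> FArr r g \<cdot>\<^bsub>N\<^esub> \<eta> F = f"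
proof -
  have fA [simp]: "f \<in> Arr N" "Dom N f = F" "Cod N f = restrict_vfun A W" using f by simp_all
  have v [simp]: "VMap F a \<in> Obj V" if "a \<in> A" for a using N.functor_simps(1)[OF F that] .
  have w [simp]: "\<omega> F a \<in> Arr M" "Dom M (\<omega> F a) = P a (VMap F a)" "Cod M (\<omega> F a) = LO F" if "a \<in> A" for a
    using omega_Hom[OF F that] by simp_all
  have f_Hom: "NMap f a \<in> Hom V (VMap F a) (VMap W a)" if "a \<in> A" for a
    using that by simp
  \<comment> \<open>The cowedge that corresponds to \<open>f\<close> under the Yoneda lemma.\<close>
  let ?\<psi> = "\<lambda>a. yoneda a (VMap F a) W (NMap f a)"
  have \<psi>: "?\<psi> a \<in> Hom M (P a (VMap F a)) W" "NMap (?\<psi> a) a \<cdot> P_unit a (VMap F a) = NMap f a" if "a \<in> A" for a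
    using yoneda_Hom[OF _ W f_Hom[OF that]] yoneda_unit[OF _ W f_Hom[OF that]] that by simp_all
  have cow: "is_cowedge M A (\<lambda>a. P a (VMap F a)) (lan_left V C F) (lan_right V C F) W ?\<psi>"
    unfolding is_cowedge_def
  proof (intro conjI ballI W)
    fix a assume a: "a \<in> A"
    show "?\<psi> a \<in> Hom M (P a (VMap F a)) W" by (rule \<psi>(1)[OF a])
    fix b assume b: "b \<in> A"
    show "?\<psi> a \<cdot>\<^bsub>M\<^esub> lan_left V C F a b = ?\<psi> b \<cdot>\<^bsub>M\<^esub> lan_right V C F a b"
      unfolding cowedge_iff[OF F a b \<psi>(1)[OF a] \<psi>(1)[OF b]] \<psi>(2)[OF a] \<psi>(2)[OF b]
      using N.natural[OF fA(1) a b] a b by simp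
  qed
  have "\<exists>!g. g \<in> Hom M (LO F) W \<and> (\<forall>a \<in> A. g \<cdot>\<^bsub>M\<^esub> \<omega> F a = ?\<psi> a)"
    using L_coend[OF F] cow unfolding is_coend_def by blast
  moreover have "(\<forall>a \<in> A. g \<cdot>\<^bsub>M\<^esub> \<omega> F a = ?\<psi> a) \<longleftrightarrow> FArr r g \<cdot>\<^bsub>N\<^esub> \<eta> F = f" if g: "g \<in> Hom M (LO F) W" for g
  proof
    have [simp]: "g \<in> Arr M" "Dom M g = LO F" "Cod M g = W" using g by simp_all
    have e [simp]: "\<eta> F \<in> Arr N" "Dom N (\<eta> F) = F" "Cod N (\<eta> F) = restrict_vfun A (LO F)"
      using eta_Hom[OF F] by simp_all
    \<comment> \<open>Transposing the legs of \<open>g \<cdot> \<omega> F\<close> yields the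
      restriction of \<open>g\<close> composed with the unit, so factoring the cowedge and factoring
      \<open>f\<close> are the same condition on \<open>g\<close>.\<close>
    have key: "NMap (g \<cdot>\<^bsub>M\<^esub> \<omega> F a) a \<cdot> P_unit a (VMap F a) = NMap (FArr r g \<cdot>\<^bsub>N\<^esub> \<eta> F) a" if "a \<in> A" for a
      using that by (simp add: NMap_eta)
    {
      assume *: "\<forall>a \<in> A. g \<cdot>\<^bsub>M\<^esub> \<omega> F a = ?\<psi> a"
      show "FArr r g \<cdot>\<^bsub>N\<^esub> \<eta> F = f"
      proof (rule N.nt_eqI)
        fix a assume a: "a \<in> A"
        show "NMap (FArr r g \<cdot>\<^bsub>N\<^esub> \<eta> F) a = NMap f a"
          unfolding key[OF a, symmetric] using * a \<psi>(2)[OF a] by simp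
      qed simp_all
    }
    assume *: "FArr r g \<cdot>\<^bsub>N\<^esub> \<eta> F = f"
    show "\<forall>a \<in> A. g \<cdot>\<^bsub>M\<^esub> \<omega> F a = ?\<psi> a"
    proof
      fix a assume a: "a \<in> A"
      have "NMap (g \<cdot>\<^bsub>M\<^esub> \<omega> F a) a \<cdot> P_unit a (VMap F a) = NMap f a" unfolding key[OF a] * ..
      then show "g \<cdot>\<^bsub>M\<^esub> \<omega> F a = ?\<psi> a"
        using a by (intro yoneda_eqI[OF _ _ f_Hom[OF a]]) simp_all
    qed
  qed
  ultimately show ?thesis by (simp cong: conj_cong del: Hom_iff)
qed

end

sublocale Restriction \<subseteq> L: Universal_from "vfun_cat V (full_vsubcat C A)" "vfun_cat V C"
    "restriction_functor A" "\<lambda>F. fst (L_pair F)" \<eta>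
  by unfold_locales (use LO_Obj eta_Hom left_universal functor_r in blast)+

context Restriction
begin

text \<open>Naturality of the coend legs in \<open>F\<close> is, after transposition, naturality of
  the unit.\<close>

lemma left_kan_extension: "is_left_kan_extension V C A L.ladj"
  unfolding is_left_kan_extension_def
proof (intro conjI L.functor_ladj exI[of _ \<omega>] ballI)
  fix F assume "F \<in> Obj N"
  then show "is_coend M A (\<lambda>a. P a (VMap F a)) (lan_left V C F) (lan_right V C F) (FObj L.ladj F) (\<omega> F)"
    using L_coend by simp
next
  fix t a assume t [simp]: "t \<in> Arr N" and a [simp]: "a \<in> A"
  let ?F = "Dom N t" and ?G = "Cod N t"
  have d: "NDom t = ?F" "NCod t = ?G" by (simp_all add: vfun_cat_def)
  have v [simp]: "VMap ?F a \<in> Obj V" "VMap ?G a \<in> Obj V" by simp_all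
  have w [simp]: "\<omega> F a \<in> Arr M" "Dom M (\<omega> F a) = P a (VMap F a)" "Cod M (\<omega> F a) = LO F" if "F \<in> Obj N" for F
    using omega_Hom[OF that a] by simp_all
  let ?v = "vtensor_arr V C (vrep V C a) (NMap t a)"
  have vt [simp]: "?v \<in> Arr M" "Dom M ?v = P a (VMap ?F a)" "Cod M ?v = P a (VMap ?G a)"
    using vtensor_arr_Hom[of a "NMap t a"] by simp_all
  have vm: "NMap ?v a = H a a \<lhd> NMap t a" by (simp add: vtensor_arr_def)
  have "NMap (FArr L.ladj t) a \<cdot> NMap (\<omega> ?F a) a \<cdot> P_unit a (VMap ?F a) =
      NMap (FArr r (FArr L.ladj t) \<cdot>\<^bsub>N\<^esub> \<eta> ?F) a" by (simp add: NMap_eta del: L.ladj_arr(4))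
  also have "\<dots> = (NMap (\<omega> ?G a) a \<cdot> P_unit a (VMap ?G a)) \<cdot> NMap t a"
    by (subst L.ladj_arr(4)[OF t]) (simp add: NMap_eta)
  also have "\<dots> = NMap (\<omega> ?G a) a \<cdot> (P_unit a (VMap ?G a) \<cdot> NMap t a)" by simp
  also have "P_unit a (VMap ?G a) \<cdot> NMap t a = (H a a \<lhd> NMap t a) \<cdot> P_unit a (VMap ?F a)"
    using P_unit_natural[of a "NMap t a"] by simp
  finally show "FArr L.ladj t \<cdot>\<^bsub>M\<^esub> \<omega> (NDom t) a = \<omega> (NCod t) a \<cdot>\<^bsub>M\<^esub> ?v"
    unfolding d by (intro P_cancel[of a "VMap ?F a"]) (simp_all add: vm)
qed

section \<open>The right Kan extension\<close>

text \<open>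
  The iso \<open>(W \<otimes> y) \<otimes> z \<cong> y \<otimes> (z \<otimes> W)\<close> reorders the arguments in the wedge condition for the right
  Kan extension.
\<close>

lemma ran_left_curry:
  assumes [simp]: "w \<in> Obj V" "y \<in> Obj V" "z \<in> Obj V" "x \<in> Obj V" "x' \<in> Obj V"
    and u [simp]: "u \<in> Arr V" "Dom V u = y \<otimes> x" "Cod V u = x'"
    and g [simp]: "g \<in> Arr V" "Dom V g = w" "Cod V g = IHom V z x"
  shows "(u \<cdot> (y \<lhd> Eval V z x) \<cdot> Assoc V y (IHom V z x) z \<cdot> (Sym V (IHom V z x) y \<rhd> z)) \<cdot> ((g \<rhd> y) \<rhd> z) =
    (u \<cdot> (y \<lhd> (leval z x \<cdot> (z \<lhd> g)))) \<cdot> (Assoc V y z w \<cdot> Sym V w (y \<otimes> z) \<cdot> Assoc V w y z)"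
proof -
  let ?I = "IHom V z x"
  have s: "Sym V ?I y \<cdot> (g \<rhd> y) = (y \<lhd> g) \<cdot> Sym V w y"
    using sym_natural[of g "Idn V y" ?I y] by simp
  have "(u \<cdot> (y \<lhd> Eval V z x) \<cdot> Assoc V y ?I z \<cdot> (Sym V ?I y \<rhd> z)) \<cdot> ((g \<rhd> y) \<rhd> z) =
      u \<cdot> (y \<lhd> Eval V z x) \<cdot> Assoc V y ?I z \<cdot> ((Sym V ?I y \<cdot> (g \<rhd> y)) \<rhd> z)"
    by (simp add: whisker_right_comp)
  also have "\<dots> = u \<cdot> (y \<lhd> Eval V z x) \<cdot> (Assoc V y ?I z \<cdot> ((y \<lhd> g) \<rhd> z)) \<cdot> (Sym V w y \<rhd> z)"
    unfolding s by (simp add: whisker_right_comp)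
  also have "Assoc V y ?I z \<cdot> ((y \<lhd> g) \<rhd> z) = (y \<lhd> (g \<rhd> z)) \<cdot> Assoc V y w z"
    using assoc_natural[of "Idn V y" g "Idn V z" y ?I z] by simp
  also have "u \<cdot> (y \<lhd> Eval V z x) \<cdot> ((y \<lhd> (g \<rhd> z)) \<cdot> Assoc V y w z) \<cdot> (Sym V w y \<rhd> z) =
      u \<cdot> (y \<lhd> uncurry_arr V z x g) \<cdot> Assoc V y w z \<cdot> (Sym V w y \<rhd> z)"
    by (simp add: uncurry_arr_def whisker_left_comp)
  also have "\<dots> = u \<cdot> (y \<lhd> (leval z x \<cdot> (z \<lhd> g))) \<cdot> ((y \<lhd> Sym V w z) \<cdot> Assoc V y w z \<cdot> (Sym V w y \<rhd> z))"
    by (simp add: uncurry_leval whisker_left_comp)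
  finally show ?thesis unfolding hexagon[OF assms(1-3), symmetric] by simp
qed

text \<open>Written with the same reordering of arguments as in \<open>ran_left_curry\<close>, so
  that it cancels from the wedge condition.\<close>

lemma ran_right_curry:
  assumes [simp]: "w \<in> Obj V" "y \<in> Obj V" "z \<in> Obj V" "k \<in> Obj V" "x \<in> Obj V"
    and n [simp]: "n \<in> Arr V" "Dom V n = y \<otimes> z" "Cod V n = k"
    and g [simp]: "g \<in> Arr V" "Dom V g = w" "Cod V g = IHom V k x"
  shows "(Eval V k x \<cdot> (IHom V k x \<lhd> n) \<cdot> Assoc V (IHom V k x) y z) \<cdot> ((g \<rhd> y) \<rhd> z) =
    ((leval k x \<cdot> (k \<lhd> g)) \<cdot> (n \<rhd> w) \<cdot> \<alpha>' y z w) \<cdot> (Assoc V y z w \<cdot> Sym V w (y \<otimes> z) \<cdot> Assoc V w y z)"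
proof -
  let ?I = "IHom V k x"
  have "(Eval V k x \<cdot> (?I \<lhd> n) \<cdot> Assoc V ?I y z) \<cdot> ((g \<rhd> y) \<rhd> z) =
      Eval V k x \<cdot> (?I \<lhd> n) \<cdot> (Assoc V ?I y z \<cdot> ((g \<rhd> y) \<rhd> z))" by simp
  also have "Assoc V ?I y z \<cdot> ((g \<rhd> y) \<rhd> z) = (g \<rhd> (y \<otimes> z)) \<cdot> Assoc V w y z"
    using assoc_natural[of g "Idn V y" "Idn V z" ?I y z] by simp
  also have "Eval V k x \<cdot> (?I \<lhd> n) \<cdot> ((g \<rhd> (y \<otimes> z)) \<cdot> Assoc V w y z) =
      (Eval V k x \<cdot> (g \<rhd> k)) \<cdot> (w \<lhd> n) \<cdot> Assoc V w y z"
    by (simp add: ten_comp_r)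
  also have "Eval V k x \<cdot> (g \<rhd> k) = leval k x \<cdot> (k \<lhd> g) \<cdot> Sym V w k"
    using uncurry_leval[of g k x] by (simp add: uncurry_arr_def)
  also have "(leval k x \<cdot> (k \<lhd> g) \<cdot> Sym V w k) \<cdot> (w \<lhd> n) \<cdot> Assoc V w y z =
      leval k x \<cdot> (k \<lhd> g) \<cdot> (Sym V w k \<cdot> (w \<lhd> n)) \<cdot> Assoc V w y z" by simp
  also have "Sym V w k \<cdot> (w \<lhd> n) = (n \<rhd> w) \<cdot> Sym V w (y \<otimes> z)"
    using sym_natural[of "Idn V w" n w k] by simp
  finally show ?thesis by simp
qed

text \<open>An isomorphism composed of coherence arrows; being epi is the form in which it gets
  cancelled on the right.\<close>

lemma epi_rotate:
  assumes [simp]: "w \<in> Obj V" "y \<in> Obj V" "z \<in> Obj V"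
  shows "epi_arr V (Assoc V y z w \<cdot> Sym V w (y \<otimes> z) \<cdot> Assoc V w y z)"
  by (rule iso_epi, rule iso_arrI[of _ "\<alpha>' w y z \<cdot> Sym V (y \<otimes> z) w \<cdot> \<alpha>' y z w"]) simp_all

text \<open>The structure arrows of the end are curried twice; both layers are removed at once, and
  the arrows \<open>g\<close> and \<open>g'\<close> move inside as whiskerings.\<close>

lemma curry_curry_eq_iff:
  assumes [simp]: "i \<in> Obj V" "j \<in> Obj V" "w \<in> Obj V" "y \<in> Obj V" "z \<in> Obj V" "x \<in> Obj V"
    and f [simp]: "f \<in> Arr V" "Dom V f = (i \<otimes> y) \<otimes> z" "Cod V f = x"
    and f' [simp]: "f' \<in> Arr V" "Dom V f' = (j \<otimes> y) \<otimes> z" "Cod V f' = x"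
    and g [simp]: "g \<in> Arr V" "Dom V g = w" "Cod V g = i"
    and g' [simp]: "g' \<in> Arr V" "Dom V g' = w" "Cod V g' = j"
  shows "curry_arr V i y (IHom V z x) (curry_arr V (i \<otimes> y) z x f) \<cdot> g =
      curry_arr V j y (IHom V z x) (curry_arr V (j \<otimes> y) z x f') \<cdot> g' \<longleftrightarrow>
    f \<cdot> ((g \<rhd> y) \<rhd> z) = f' \<cdot> ((g' \<rhd> y) \<rhd> z)"
proof -
  have "curry_arr V i y (IHom V z x) (curry_arr V (i \<otimes> y) z x f) \<cdot> g =
      curry_arr V j y (IHom V z x) (curry_arr V (j \<otimes> y) z x f') \<cdot> g' \<longleftrightarrow>
      curry_arr V (i \<otimes> y) z x f \<cdot> (g \<rhd> y) = curry_arr V (j \<otimes> y) z x f' \<cdot> (g' \<rhd> y)"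
    by (subst uncurry_eq_iff[of _ _ y "IHom V z x"]) (simp_all add: uncurry_comp)
  also have "\<dots> \<longleftrightarrow> f \<cdot> ((g \<rhd> y) \<rhd> z) = f' \<cdot> ((g' \<rhd> y) \<rhd> z)"
    by (subst uncurry_eq_iff[of _ _ z x]) (simp_all add: uncurry_comp)
  finally show ?thesis .
qed

text \<open>Uncurried at \<open>c\<close> and freed of the reordering, the wedge condition is the
  naturality square of the transposed legs, precomposed with the whiskered action of
  \<open>H c a\<close> on \<open>W\<close>. Taking \<open>c = a\<close> and inserting the identity
  recovers the square; the converse is composition.\<close>

lemma wedge_iff:
  assumes F [simp]: "F \<in> Obj N" and a [simp]: "a \<in> A" and b [simp]: "b \<in> A"
    and f: "f \<in> Hom M W (I a (VMap F a))" and g: "g \<in> Hom M W (I b (VMap F b))"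
  shows "ran_left V C F a b \<cdot>\<^bsub>M\<^esub> f = ran_right V C F a b \<cdot>\<^bsub>M\<^esub> g \<longleftrightarrow>
    act F a b \<cdot> (H a b \<lhd> (I_counit a (VMap F a) \<cdot> NMap f a)) =
    (I_counit b (VMap F b) \<cdot> NMap g b) \<cdot> act W a b"
proof -
  have v [simp]: "VMap F a \<in> Obj V" "VMap F b \<in> Obj V" using N.functor_simps(1)[OF F] by simp_all
  have fg [simp]: "f \<in> Arr M" "Dom M f = W" "Cod M f = I a (VMap F a)"
    "g \<in> Arr M" "Dom M g = W" "Cod M g = I b (VMap F b)"
    using f g by simp_all
  have W [simp]: "W \<in> Obj M" using M.Dom_Obj[of f] by (simp del: M.Dom_Obj)
  let ?t = "I_counit a (VMap F a) \<cdot> NMap f a" and ?s = "I_counit b (VMap F b) \<cdot> NMap g b"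
  have c: "NMap (ran_left V C F a b) c \<cdot> NMap f c = NMap (ran_right V C F a b) c \<cdot> NMap g c \<longleftrightarrow>
      act F a b \<cdot> (H a b \<lhd> ?t) \<cdot> (H a b \<lhd> act W c a) = ?s \<cdot> act W a b \<cdot> (H a b \<lhd> act W c a)"
    if [simp]: "c \<in> Ob" for c
  proof -
    let ?w = "VMap W c" and ?y = "H a b" and ?z = "H c a"
    let ?rot = "Assoc V ?y ?z ?w \<cdot> Sym V ?w (?y \<otimes> ?z) \<cdot> Assoc V ?w ?y ?z"
    let ?Ia = "IHom V ?z (VMap F a)" and ?Ib = "IHom V (H c b) (VMap F b)"
    let ?X = "act F a b \<cdot> (?y \<lhd> Eval V ?z (VMap F a)) \<cdot> Assoc V ?y ?Ia ?z \<cdot> (Sym V ?Ia ?y \<rhd> ?z)"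
    let ?Y = "Eval V (H c b) (VMap F b) \<cdot> (?Ib \<lhd> m c a b) \<cdot> Assoc V ?Ib ?y ?z"
    have X: "NMap (ran_left V C F a b) c =
        curry_arr V ?Ia ?y (IHom V ?z (VMap F b)) (curry_arr V (?Ia \<otimes> ?y) ?z (VMap F b) ?X)"
      by (simp only: ran_left_def vnt.select_convs restrict_apply' that)
    have Y: "NMap (ran_right V C F a b) c =
        curry_arr V ?Ib ?y (IHom V ?z (VMap F b)) (curry_arr V (?Ib \<otimes> ?y) ?z (VMap F b) ?Y)"
      by (simp only: ran_right_def vnt.select_convs restrict_apply' that)
    have Xr: "?X \<cdot> ((NMap f c \<rhd> ?y) \<rhd> ?z) =
        (act F a b \<cdot> (?y \<lhd> (leval ?z (VMap F a) \<cdot> (?z \<lhd> NMap f c)))) \<cdot> ?rot"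
      by (rule ran_left_curry) simp_all
    have Yr: "?Y \<cdot> ((NMap g c \<rhd> ?y) \<rhd> ?z) =
        ((leval (H c b) (VMap F b) \<cdot> (H c b \<lhd> NMap g c)) \<cdot> (m c a b \<rhd> ?w) \<cdot> \<alpha>' ?y ?z ?w) \<cdot> ?rot"
      by (rule ran_right_curry) simp_all
    have ep: "epi_arr V ?rot" by (rule epi_rotate) simp_all
    have "NMap (ran_left V C F a b) c \<cdot> NMap f c = NMap (ran_right V C F a b) c \<cdot> NMap g c \<longleftrightarrow>
        (act F a b \<cdot> (?y \<lhd> (leval ?z (VMap F a) \<cdot> (?z \<lhd> NMap f c)))) \<cdot> ?rot =
        ((leval (H c b) (VMap F b) \<cdot> (H c b \<lhd> NMap g c)) \<cdot> (m c a b \<rhd> ?w) \<cdot> \<alpha>' ?y ?z ?w) \<cdot> ?rot"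
      unfolding X Y Xr[symmetric] Yr[symmetric]
      by (rule curry_curry_eq_iff[of ?Ia ?Ib ?w]) simp_all
    also have "\<dots> \<longleftrightarrow> act F a b \<cdot> (?y \<lhd> (leval ?z (VMap F a) \<cdot> (?z \<lhd> NMap f c))) =
        (leval (H c b) (VMap F b) \<cdot> (H c b \<lhd> NMap g c)) \<cdot> (m c a b \<rhd> ?w) \<cdot> \<alpha>' ?y ?z ?w"
      (is "?A \<cdot> _ = ?B \<cdot> _ \<longleftrightarrow> _")
    proof
      assume "?A \<cdot> ?rot = ?B \<cdot> ?rot"
      then show "?A = ?B" by (rule epi_cancel[OF ep]) simp_all
    qed (simp only:)
    also have "leval ?z (VMap F a) \<cdot> (?z \<lhd> NMap f c) = ?t \<cdot> act W c a"
      using I_expand[of a "VMap F a" f c] by simp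
    also have "leval (H c b) (VMap F b) \<cdot> (H c b \<lhd> NMap g c) = ?s \<cdot> act W c b"
      using I_expand[of b "VMap F b" g c] by simp
    also have "(?s \<cdot> act W c b) \<cdot> (m c a b \<rhd> ?w) \<cdot> \<alpha>' ?y ?z ?w = 
        ?s \<cdot> (act W c b \<cdot> (m c a b \<rhd> ?w)) \<cdot> \<alpha>' ?y ?z ?w" by simp
    also have "\<dots> = ?s \<cdot> act W a b \<cdot> (?y \<lhd> act W c a)"
      by (simp add: act_assoc)
    finally show ?thesis by (simp add: whisker_left_comp)
  qed
  \<comment> \<open>Composition in \<open>vfun_cat\<close> is componentwise by definition, so the
    equation splits over \<open>c\<close> without appeal to naturality of \<open>ran_left\<close>
    and \<open>ran_right\<close>.\<close>
  have "ran_left V C F a b \<cdot>\<^bsub>M\<^esub> f = ran_right V C F a b \<cdot>\<^bsub>M\<^esub> g \<longleftrightarrow>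
      (\<forall>c \<in> Ob. NMap (ran_left V C F a b) c \<cdot> NMap f c = NMap (ran_right V C F a b) c \<cdot> NMap g c)"
  proof -
    have d: "Dom M f = Dom M g" "Cod M (ran_left V C F a b) = Cod M (ran_right V C F a b)"
      by simp (simp add: vfun_cat_def ran_left_def ran_right_def)
    show ?thesis unfolding M_Comp d mknt_def
      by (auto simp: restrict_def fun_eq_iff)
  qed
  also have "\<dots> \<longleftrightarrow> act F a b \<cdot> (H a b \<lhd> ?t) = ?s \<cdot> act W a b"
  proof
    assume "\<forall>c \<in> Ob. NMap (ran_left V C F a b) c \<cdot> NMap f c = NMap (ran_right V C F a b) c \<cdot> NMap g c"
    then have e: "act F a b \<cdot> (H a b \<lhd> ?t) \<cdot> (H a b \<lhd> act W a a) = ?s \<cdot> act W a b \<cdot> (H a b \<lhd> act W a a)"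
      using c[of a] by simp
    \<comment> \<open>Inserting the identity of \<open>a\<close>: a section of the whiskered action
      at \<open>c = a\<close>.\<close>
    let ?k = "H a b \<lhd> ((VId C a \<rhd> VMap W a) \<cdot> LUnit_inv (VMap W a))"
    have "(H a b \<lhd> act W a a) \<cdot> ?k = H a b \<lhd> ((act W a a \<cdot> (VId C a \<rhd> VMap W a)) \<cdot> LUnit_inv (VMap W a))"
      by (simp add: whisker_left_comp)
    also have "\<dots> = Idn V (H a b \<otimes> VMap W a)" by (simp add: act_unit)
    finally have k: "(H a b \<lhd> act W a a) \<cdot> ?k = Idn V (H a b \<otimes> VMap W a)" .
    have "(act F a b \<cdot> (H a b \<lhd> ?t) \<cdot> (H a b \<lhd> act W a a)) \<cdot> ?k =
        (?s \<cdot> act W a b \<cdot> (H a b \<lhd> act W a a)) \<cdot> ?k" unfolding e ..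
    then have "(act F a b \<cdot> (H a b \<lhd> ?t)) \<cdot> ((H a b \<lhd> act W a a) \<cdot> ?k) =
        (?s \<cdot> act W a b) \<cdot> ((H a b \<lhd> act W a a) \<cdot> ?k)" by simp
    then show "act F a b \<cdot> (H a b \<lhd> ?t) = ?s \<cdot> act W a b" unfolding k by simp
  next
    assume e: "act F a b \<cdot> (H a b \<lhd> ?t) = ?s \<cdot> act W a b"
    show "\<forall>c \<in> Ob. NMap (ran_left V C F a b) c \<cdot> NMap f c = NMap (ran_right V C F a b) c \<cdot> NMap g c"
    proof
      fix c assume [simp]: "c \<in> Ob"
      have "(act F a b \<cdot> (H a b \<lhd> ?t)) \<cdot> (H a b \<lhd> act W c a) = (?s \<cdot> act W a b) \<cdot> (H a b \<lhd> act W c a)"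
        unfolding e ..
      then show "NMap (ran_left V C F a b) c \<cdot> NMap f c = NMap (ran_right V C F a b) c \<cdot> NMap g c"
        by (subst c) simp_all
    qed
  qed
  finally show ?thesis .
qed

end

context Restriction
begin

text \<open>The legs that will exhibit the abstract right adjoint as an end.\<close>

definition ran_unit where "ran_unit F b = coyoneda b (VMap F b) (RO F) (NMap (\<epsilon> F) b)"

lemma ran_unit:
  assumes F [simp]: "F \<in> Obj N" and b [simp]: "b \<in> A"
  shows "ran_unit F b \<in> Hom M (RO F) (I b (VMap F b))"
    and "I_counit b (VMap F b) \<cdot> NMap (ran_unit F b) b = NMap (\<epsilon> F) b"
proof -
  have e: "NMap (\<epsilon> F) b \<in> Hom V (VMap (RO F) b) (VMap F b)" by simp
  show "ran_unit F b \<in> Hom M (RO F) (I b (VMap F b))"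
    "I_counit b (VMap F b) \<cdot> NMap (ran_unit F b) b = NMap (\<epsilon> F) b"
    unfolding ran_unit_def by (rule coyoneda_Hom[OF _ _ e] coyoneda_counit[OF _ _ e]; simp)+
qed

text \<open>By \<open>wedge_iff\<close>, wedges with vertex \<open>W\<close> are transformations
  from the restriction of \<open>W\<close> to \<open>F\<close>, and \<open>RO F\<close> represents
  those.\<close>

lemma right_end:
  assumes F [simp]: "F \<in> Obj N"
  shows "is_end M A (\<lambda>b. I b (VMap F b)) (ran_left V C F) (ran_right V C F) (RO F) (ran_unit F)"
  unfolding is_end_def is_wedge_def
proof (intro conjI ballI allI impI)
  show "RO F \<in> Obj M" by simp
  have v [simp]: "VMap F a \<in> Obj V" if "a \<in> A" for a using N.functor_simps(1)[OF F that] .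
  fix a assume a: "a \<in> A"
  show "ran_unit F a \<in> Hom M (RO F) (I a (VMap F a))" by (rule ran_unit(1)[OF F a])
  fix b assume b: "b \<in> A"
  show "ran_left V C F a b \<cdot>\<^bsub>M\<^esub> ran_unit F a = ran_right V C F a b \<cdot>\<^bsub>M\<^esub> ran_unit F b"
    unfolding wedge_iff[OF F a b ran_unit(1)[OF F a] ran_unit(1)[OF F b]] ran_unit(2)[OF F a]
      ran_unit(2)[OF F b]
    using N.natural[of "\<epsilon> F" a b] a b by simp
next
  have v [simp]: "VMap F a \<in> Obj V" if "a \<in> A" for a using N.functor_simps(1)[OF F that] .
  fix W \<psi> assume *: "W \<in> Obj M \<and> (\<forall>a\<in>A. \<psi> a \<in> Hom M W (I a (VMap F a))) \<and>
    (\<forall>a\<in>A. \<forall>b\<in>A. ran_left V C F a b \<cdot>\<^bsub>M\<^esub> \<psi> a = ran_right V C F a b \<cdot>\<^bsub>M\<^esub> \<psi> b)"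
  then have W [simp]: "W \<in> Obj M" and \<psi>: "\<And>a. a \<in> A \<Longrightarrow> \<psi> a \<in> Hom M W (I a (VMap F a))"
    and we: "\<And>a b. \<lbrakk>a \<in> A; b \<in> A\<rbrakk> \<Longrightarrow> ran_left V C F a b \<cdot>\<^bsub>M\<^esub> \<psi> a = ran_right V C F a b \<cdot>\<^bsub>M\<^esub> \<psi> b" by blast+
  have [simp]: "\<psi> a \<in> Arr M" "Dom M (\<psi> a) = W" "Cod M (\<psi> a) = I a (VMap F a)" if "a \<in> A" for a
    using \<psi>[OF that] by simp_all
  \<comment> \<open>The transposed legs of the given wedge; \<open>wedge_iff\<close> makes them a
    transformation.\<close>
  let ?t = "\<lambda>a. I_counit a (VMap F a) \<cdot> NMap (\<psi> a) a"
  let ?f = "N.mknt (restrict_vfun A W) F ?t"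
  have f: "?f \<in> Hom N (restrict_vfun A W) F"
  proof (rule N.mknt_Hom)
    fix a b assume ab: "a \<in> A" "b \<in> A"
    show "?t b \<cdot> act (restrict_vfun A W) a b = act F a b \<cdot> (H a b \<lhd> ?t a)"
      using wedge_iff[OF F ab \<psi>[OF ab(1)] \<psi>[OF ab(2)]] we[OF ab] ab by simp
  qed simp_all
  have "\<exists>!u. u \<in> Hom M W (RO F) \<and> \<epsilon> F \<cdot>\<^bsub>N\<^esub> FArr r u = ?f"
    by (rule R.universal) (use f in simp_all)
  moreover have "\<epsilon> F \<cdot>\<^bsub>N\<^esub> FArr r u = ?f \<longleftrightarrow> (\<forall>a\<in>A. ran_unit F a \<cdot>\<^bsub>M\<^esub> u = \<psi> a)" if u: "u \<in> Hom M W (RO F)" for u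
  proof
    have u' [simp]: "u \<in> Arr M" "Dom M u = W" "Cod M u = RO F" using u by simp_all
    have w [simp]: "ran_unit F a \<in> Arr M" "Dom M (ran_unit F a) = RO F"
      "Cod M (ran_unit F a) = I a (VMap F a)" if "a \<in> A" for a using ran_unit(1)[OF F that] by simp_all
    have key: "I_counit a (VMap F a) \<cdot> NMap (ran_unit F a \<cdot>\<^bsub>M\<^esub> u) a = NMap (\<epsilon> F \<cdot>\<^bsub>N\<^esub> FArr r u) a" if "a \<in> A" for a
      using that comp_reassoc[OF ran_unit(2)[OF F that], of "NMap u a"] by simp
    {
      assume e: "\<epsilon> F \<cdot>\<^bsub>N\<^esub> FArr r u = ?f"
      show "\<forall>a\<in>A. ran_unit F a \<cdot>\<^bsub>M\<^esub> u = \<psi> a"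
      proof
        fix a assume a: "a \<in> A"
        have "I_counit a (VMap F a) \<cdot> NMap (ran_unit F a \<cdot>\<^bsub>M\<^esub> u) a = ?t a"
          unfolding key[OF a] e using a by simp
        then show "ran_unit F a \<cdot>\<^bsub>M\<^esub> u = \<psi> a"
          by (rule I_cancel[of a "VMap F a", rotated -1]) (use a in simp_all)
      qed
    }
    assume e: "\<forall>a\<in>A. ran_unit F a \<cdot>\<^bsub>M\<^esub> u = \<psi> a"
    show "\<epsilon> F \<cdot>\<^bsub>N\<^esub> FArr r u = ?f"
    proof (rule N.nt_eqI)
      fix a assume a: "a \<in> A"
      show "NMap (\<epsilon> F \<cdot>\<^bsub>N\<^esub> FArr r u) a = NMap ?f a"
        unfolding key[OF a, symmetric] using e a by simp
    qed (use f in simp_all)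
  qed
  ultimately show "\<exists>!u. u \<in> Hom M W (RO F) \<and> (\<forall>a\<in>A. ran_unit F a \<cdot>\<^bsub>M\<^esub> u = \<psi> a)"
    by (simp cong: conj_cong del: Hom_iff)
qed

text \<open>After composing with \<open>I_counit\<close>, naturality of the end legs in
  \<open>F\<close> becomes naturality of the counit \<open>\<epsilon>\<close>.\<close>

lemma right_kan_extension: "is_right_kan_extension V C A R.radj"
  unfolding is_right_kan_extension_def
proof (intro conjI R.functor_radj exI[of _ ran_unit] ballI)
  fix F assume "F \<in> Obj N"
  then show "is_end M A (\<lambda>b. I b (VMap F b)) (ran_left V C F) (ran_right V C F) (FObj R.radj F) (ran_unit F)"
    using right_end by simp
next
  fix t b assume t [simp]: "t \<in> Arr N" and b [simp]: "b \<in> A"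
  let ?F = "Dom N t" and ?G = "Cod N t"
  let ?v = "VMap ?F b" and ?w = "VMap ?G b"
  have d: "NDom t = ?F" "NCod t = ?G" by (simp_all add: vfun_cat_def)
  have u [simp]: "ran_unit F b \<in> Arr M" "Dom M (ran_unit F b) = RO F"
    "Cod M (ran_unit F b) = I b (VMap F b)" if "F \<in> Obj N" for F using ran_unit(1)[OF that b] by simp_all
  have k: "NMap t b \<cdot> I_counit b ?v \<in> Hom V (VMap (I b ?v) b) ?w" by simp
  let ?c = "vcorep_arr V C b (NMap t b)"
  have ce: "?c = coyoneda b ?w (I b ?v) (NMap t b \<cdot> I_counit b ?v)"
    using vcorep_arr_eq[of b "NMap t b"] by simp
  have c [simp]: "?c \<in> Arr M" "Dom M ?c = I b ?v" "Cod M ?c = I b ?w"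
    using coyoneda_Hom[OF _ _ k] unfolding ce by simp_all
  have cc: "I_counit b ?w \<cdot> NMap ?c b = NMap t b \<cdot> I_counit b ?v"
    unfolding ce by (rule coyoneda_counit[OF _ _ k]) simp_all
  have "I_counit b ?w \<cdot> NMap (ran_unit ?G b) b \<cdot> NMap (FArr R.radj t) b =
      NMap (\<epsilon> ?G) b \<cdot> NMap (FArr R.radj t) b"
    by (rule comp_reassoc[OF ran_unit(2)]) simp_all
  also have "\<dots> = NMap (\<epsilon> ?G \<cdot>\<^bsub>N\<^esub> FArr r (FArr R.radj t)) b" by (simp del: R.radj_arr(4))
  also have "\<dots> = NMap t b \<cdot> NMap (\<epsilon> ?F) b" by (subst R.radj_arr(4)[OF t]) simp
  also have "\<dots> = NMap t b \<cdot> I_counit b ?v \<cdot> NMap (ran_unit ?F b) b" by (simp add: ran_unit(2))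
  also have "\<dots> = I_counit b ?w \<cdot> NMap ?c b \<cdot> NMap (ran_unit ?F b) b"
    using comp_reassoc[OF cc, of "NMap (ran_unit ?F b) b"] by simp
  finally have "I_counit b ?w \<cdot> NMap (ran_unit ?G b) b \<cdot> NMap (FArr R.radj t) b =
    I_counit b ?w \<cdot> NMap ?c b \<cdot> NMap (ran_unit ?F b) b" .
  then show "ran_unit (NCod t) b \<cdot>\<^bsub>M\<^esub> FArr R.radj t = ?c \<cdot>\<^bsub>M\<^esub> ran_unit (NDom t) b"
    unfolding d by (intro I_cancel[of b ?w]) simp_all
qed


section \<open>The localizing subcategory\<close>

abbreviation S where "S \<equiv> vanishing V C A"

lemma S_iff: "Y \<in> S \<longleftrightarrow> Y \<in> Obj M \<and> (\<forall>a \<in> A. zero_object V (VMap Y a))"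
  by (simp add: vanishing_def)

lemma S_zero:
  "\<lbrakk>Y \<in> S; f \<in> Arr V; Dom V f = VMap Y a; a \<in> A\<rbrakk> \<Longrightarrow> f = zero_arr V (VMap Y a) (Cod V f)"
  "\<lbrakk>Y \<in> S; f \<in> Arr V; Cod V f = VMap Y a; a \<in> A\<rbrakk> \<Longrightarrow> f = zero_arr V (Dom V f) (VMap Y a)"
  unfolding S_iff using from_zero_object[of "VMap Y a" f] to_zero_object[of "VMap Y a" f] by auto

lemma S_I:
  assumes Y: "Y \<in> Obj M" and z: "\<And>a. a \<in> A \<Longrightarrow> Idn V (VMap Y a) = zero_arr V (VMap Y a) (VMap Y a)"
  shows "Y \<in> S"
  unfolding S_iff zero_object_iff using assms by simp

text \<open>Under the Yoneda lemma the identity of \<open>VMap Y a\<close> is a transformation out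
  of a free functor. Together with \<open>into_S\<close> this describes \<open>S\<close> by
  orthogonality: free functors at objects of \<open>A\<close> admit only zero arrows into its
  members.\<close>

lemma S_I_P:
  assumes Y [simp]: "Y \<in> Obj M"
    and z: "\<And>a h. \<lbrakk>a \<in> A; h \<in> Hom M (P a (VMap Y a)) Y\<rbrakk> \<Longrightarrow> h = zero_arr M (P a (VMap Y a)) Y"
  shows "Y \<in> S"
proof (rule S_I[OF Y])
  fix a assume a [simp]: "a \<in> A"
  let ?v = "VMap Y a"
  have i: "Idn V ?v \<in> Hom V ?v ?v" by simp
  let ?h = "yoneda a ?v Y (Idn V ?v)"
  have "NMap ?h a \<cdot> P_unit a ?v = Idn V ?v" by (rule yoneda_unit[OF _ Y i]) simp
  moreover have "?h = zero_arr M (P a ?v) Y" by (rule z[OF a yoneda_Hom[OF _ Y i]]) simp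
  ultimately show "Idn V ?v = zero_arr V ?v ?v" by simp
qed

lemma into_S:
  assumes "Y \<in> S" and [simp]: "a \<in> A" "v \<in> Obj V" and h: "h \<in> Hom M (P a v) Y"
  shows "h = zero_arr M (P a v) Y"
proof (rule P_cancel[of a v])
  have Y [simp]: "Y \<in> Obj M" using assms(1) by (simp add: S_iff)
  have "NMap h a = zero_arr V (H a a \<otimes> v) (VMap Y a)"
    using S_zero(2)[OF assms(1), of "NMap h a" a] h by simp
  then show "NMap h a \<cdot> P_unit a v = NMap (zero_arr M (P a v) Y) a \<cdot> P_unit a v" by simp
qed (use h assms(1) in \<open>auto simp: S_iff\<close>)

text \<open>An orthogonality argument: a mono loses no nonzero arrow out of a free functor.
  Extensions and products are treated in the same way.\<close>

lemma S_sub: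
  assumes k: "mono_arr M k" and S: "Cod M k \<in> S"
  shows "Dom M k \<in> S"
proof (rule S_I_P)
  note [simp] = M.mono_ArrD[OF k]
  show "Dom M k \<in> Obj M" by simp
  fix a h assume a [simp]: "a \<in> A" and h: "h \<in> Hom M (P a (VMap (Dom M k) a)) (Dom M k)"
  have "k \<cdot>\<^bsub>M\<^esub> h = zero_arr M (P a (VMap (Dom M k) a)) (Cod M k)"
    by (rule into_S[OF S]) (use h in simp_all)
  then show "h = zero_arr M (P a (VMap (Dom M k) a)) (Dom M k)"
    using M.mono_zero[OF k, of h] h by simp
qed

text \<open>An epi is pointwise epi, and an epi that is zero has a zero codomain.\<close>

lemma S_quot:
  assumes e: "epi_arr M e" and S: "Dom M e \<in> S"
  shows "Cod M e \<in> S"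
proof (rule S_I)
  note [simp] = M.epi_ArrD[OF e]
  show "Cod M e \<in> Obj M" by simp
  fix a assume a [simp]: "a \<in> A"
  let ?y = "VMap (Cod M e) a"
  have "NMap e a = zero_arr V (VMap (Dom M e) a) ?y"
    using S_zero(1)[OF S, of "NMap e a" a] by simp
  then show "Idn V ?y = zero_arr V ?y ?y"
    using epi_zero[OF epi_pointwise[OF e], of a "Idn V ?y"] by simp
qed

lemma S_ext:
  assumes fg: "short_exact M f g" and S: "Dom M f \<in> S" "Cod M g \<in> S"
  shows "Cod M f \<in> S"
proof (rule S_I_P)
  have k: "is_kernel M g f" using fg by (simp add: short_exact_def)
  note [simp] = M.is_kernel_simps(1-3)[OF k]
  show "Cod M f \<in> Obj M" using M.is_kernel_simps(2)[OF k] by (intro M.Cod_Obj)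
  fix a h assume a [simp]: "a \<in> A" and h: "h \<in> Hom M (P a (VMap (Cod M f) a)) (Cod M f)"
  let ?v = "VMap (Cod M f) a"
  have v [simp]: "?v \<in> Obj V" by simp
  have gh: "g \<cdot>\<^bsub>M\<^esub> h = zero_arr M (P a ?v) (Cod M g)"
    by (rule into_S[OF S(2)]) (use h in simp_all)
  obtain u where u: "u \<in> Arr M" "Dom M u = Dom M h" "Cod M u = Dom M f" "f \<cdot>\<^bsub>M\<^esub> u = h"
    by (rule M.kernel_factor[OF k, of h]) (use h gh in simp_all)
  have "u = zero_arr M (P a ?v) (Dom M f)"
    by (rule into_S[OF S(1)]) (use u h in simp_all)
  then show "h = zero_arr M (P a ?v) (Cod M f)" using u(4) by simp
qed

text \<open>A coproduct controls arrows out of it, so the test is made with a cofree functor: the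
  transformation that transposes to the identity of \<open>VMap Q a\<close> vanishes on every
  summand.\<close>

lemma S_coproduct:
  assumes Q: "is_coproduct M J X Q \<iota>" and X: "\<forall>i \<in> J. X i \<in> S"
  shows "Q \<in> S"
proof (rule S_I)
  note s [simp] = coproduct_simps[OF Q]
  show "Q \<in> Obj M" by simp
  fix a assume a [simp]: "a \<in> A"
  let ?v = "VMap Q a"
  have i: "Idn V ?v \<in> Hom V (VMap Q a) ?v" by simp
  let ?w = "coyoneda a ?v Q (Idn V ?v)"
  have w: "?w \<in> Hom M Q (I a ?v)" by (rule coyoneda_Hom[OF _ _ i]) simp_all
  have c: "I_counit a ?v \<cdot> NMap ?w a = Idn V ?v" by (rule coyoneda_counit[OF _ _ i]) simp_all
  have "?w = zero_arr M Q (I a ?v)"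
  proof (rule M.coproduct_cancel[OF Q])
    fix j assume j: "j \<in> J"
    have "X j \<in> Obj M" using X j by (simp add: S_iff)
    have "NMap (\<iota> j) a = zero_arr V (VMap (X j) a) ?v"
      using S_zero(1)[of "X j" "NMap (\<iota> j) a" a] X j by simp
    then show "?w \<cdot>\<^bsub>M\<^esub> \<iota> j = zero_arr M Q (I a ?v) \<cdot>\<^bsub>M\<^esub> \<iota> j"
      using w j \<open>X j \<in> Obj M\<close> by (intro I_cancel[of a ?v]) simp_all
  qed (use w in simp_all)
  then show "Idn V ?v = zero_arr V ?v ?v" using c by simp
qed

lemma S_product:
  assumes S: "x \<in> S" "y \<in> S" and p: "is_binary_product M x y p \<pi>1 \<pi>2"
  shows "p \<in> S"
proof (rule S_I_P)
  have P [simp]: "p \<in> Obj M" "\<pi>1 \<in> Arr M" "Dom M \<pi>1 = p" "Cod M \<pi>1 = x"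
    "\<pi>2 \<in> Arr M" "Dom M \<pi>2 = p" "Cod M \<pi>2 = y"
    using p by (simp_all add: is_binary_product_def)
  show "p \<in> Obj M" by simp
  have xy [simp]: "x \<in> Obj M" "y \<in> Obj M" using S by (simp_all add: S_iff)
  fix a h assume a [simp]: "a \<in> A" and h: "h \<in> Hom M (P a (VMap p a)) p"
  let ?P = "P a (VMap p a)"
  have e: "\<pi>1 \<cdot>\<^bsub>M\<^esub> h = zero_arr M ?P x" "\<pi>2 \<cdot>\<^bsub>M\<^esub> h = zero_arr M ?P y"
    by (rule into_S[OF S(1)] into_S[OF S(2)]; use h in simp)+
  have "\<forall>w \<in> Obj M. \<forall>f \<in> Hom M w x. \<forall>g \<in> Hom M w y.
        \<exists>!u. u \<in> Hom M w p \<and> \<pi>1 \<cdot>\<^bsub>M\<^esub> u = f \<and> \<pi>2 \<cdot>\<^bsub>M\<^esub> u = g"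
    using p unfolding is_binary_product_def by blast
  moreover have "?P \<in> Obj M" "zero_arr M ?P x \<in> Hom M ?P x" "zero_arr M ?P y \<in> Hom M ?P y" by simp_all
  ultimately have "\<exists>!u. u \<in> Hom M ?P p \<and> \<pi>1 \<cdot>\<^bsub>M\<^esub> u = zero_arr M ?P x \<and> \<pi>2 \<cdot>\<^bsub>M\<^esub> u = zero_arr M ?P y"
    by blast
  then show "h = zero_arr M ?P p" by (rule ex1_eqD) (use h e in simp_all)
qed

lemma localizing_S: "localizing \<kappa> M S"
  unfolding localizing_def
  using S_sub S_quot S_ext S_coproduct by (auto simp: S_iff[THEN iffD1])

abbreviation B where "B \<equiv> full_subcat M S"

lemma abelian_B: "abelian B"
proof -
  interpret AM: Abelian M by (rule AbelianI[OF abelian_M])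
  obtain z where z: "zero_object M z" using zero_object_M_exists by blast
  then have "z \<in> S" using zero_object_M[of z] by (simp add: S_iff)
  then show ?thesis
    by (rule AM.abelian_full_subcat[OF z]) (use S_sub S_quot S_product in blast)+
qed

lemma B_simps: "Obj B = S"
  by (auto simp: S_iff)

lemma inclusion_simps [simp]: "FObj inclusion_functor x = x" "FArr inclusion_functor f = f"
  by (simp_all add: inclusion_functor_def)

lemma inclusion_additive: "additive_functor B M inclusion_functor"
  unfolding additive_functor_def is_functor_def by (auto simp: S_iff)

lemma Hom_B: "x \<in> S \<Longrightarrow> y \<in> S \<Longrightarrow> Hom B x y = Hom M x y"
  by (rule Hom_full_subcat)

text \<open>A functor in \<open>S\<close> restricts to zero objects, which leaves one arrow at most
  in either direction. It is used to compare transposes.\<close>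

lemma restrict_S_zero:
  assumes "Y \<in> S" and f: "f \<in> Arr N" "g \<in> Arr N" "Dom N f = Dom N g" "Cod N f = Cod N g"
    and "Cod N g = restrict_vfun A Y \<or> Dom N g = restrict_vfun A Y"
  shows "f = g"
proof (rule N.nt_eqI[OF f])
  fix a assume a: "a \<in> A"
  have z: "zero_object V (VMap Y a)" using assms(1) a by (simp add: S_iff)
  show "NMap f a = NMap g a"
    using assms(6)
  proof
    assume "Cod N g = restrict_vfun A Y"
    then show ?thesis
      using to_zero_object[OF z, of "NMap f a"] to_zero_object[OF z, of "NMap g a"] f a by simp
  next
    assume "Dom N g = restrict_vfun A Y"
    then show ?thesis
      using from_zero_object[OF z, of "NMap f a"] from_zero_object[OF z, of "NMap g a"] f a by simp
  qed
qed

section \<open>The two adjoints of the inclusion\<close>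

definition lan_counit where
  "lan_counit Y = L.lift (restrict_vfun A Y) Y (Idn N (restrict_vfun A Y))"

definition ran_adj_unit where
  "ran_adj_unit Y = R.colift (restrict_vfun A Y) Y (Idn N (restrict_vfun A Y))"

text \<open>The unit of the left adjoint of the inclusion; the object part of that adjoint is read
  off as its codomain.\<close>

definition iL_unit where "iL_unit Y = (SOME q. is_cokernel M (lan_counit Y) q)"

definition iR_counit where "iR_counit Y = (SOME k. is_kernel M (ran_adj_unit Y) k)"

lemma lan_counit:
  assumes [simp]: "Y \<in> Obj M"
  shows "lan_counit Y \<in> Arr M" "Dom M (lan_counit Y) = LO (restrict_vfun A Y)"
    "Cod M (lan_counit Y) = Y" 
    "FArr r (lan_counit Y) \<cdot>\<^bsub>N\<^esub> \<eta> (restrict_vfun A Y) = Idn N (restrict_vfun A Y)"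
  unfolding lan_counit_def by simp_all

lemma ran_adj_unit:
  assumes [simp]: "Y \<in> Obj M"
  shows "ran_adj_unit Y \<in> Arr M" "Cod M (ran_adj_unit Y) = RO (restrict_vfun A Y)"
    "Dom M (ran_adj_unit Y) = Y" 
    "\<epsilon> (restrict_vfun A Y) \<cdot>\<^bsub>N\<^esub> FArr r (ran_adj_unit Y) = Idn N (restrict_vfun A Y)"
  unfolding ran_adj_unit_def by simp_all

lemma iL_unit: "Y \<in> Obj M \<Longrightarrow> is_cokernel M (lan_counit Y) (iL_unit Y)"
  unfolding iL_unit_def using abelian_M lan_counit(1)[of Y] unfolding abelian_def by (metis someI_ex)

lemma iR_counit: "Y \<in> Obj M \<Longrightarrow> is_kernel M (ran_adj_unit Y) (iR_counit Y)"
  unfolding iR_counit_def using abelian_M ran_adj_unit(1)[of Y] unfolding abelian_def by (metis someI_ex)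

text \<open>By a triangle identity the counit is a split epi at each \<open>a\<close> in
  \<open>A\<close>, so the cokernel arrow is zero there; being pointwise epi as well, it forces its
  codomain to vanish.\<close>

lemma iL_unit_S:
  assumes Y [simp]: "Y \<in> Obj M"
  shows "Cod M (iL_unit Y) \<in> S"
proof (rule S_I)
  let ?q = "iL_unit Y" and ?e = "lan_counit Y" and ?F = "restrict_vfun A Y"
  note q = iL_unit[OF Y] and e [simp] = lan_counit(1-3)[OF Y]
  note [simp] = M.is_cokernel_simps(1-3)[OF q]
  show "Cod M ?q \<in> Obj M" by simp
  fix a assume a [simp]: "a \<in> A"
  have "NMap (FArr r ?e \<cdot>\<^bsub>N\<^esub> \<eta> ?F) a = Idn V (VMap Y a)"
    unfolding lan_counit(4)[OF Y] by simp
  then have ee: "NMap ?e a \<cdot> NMap (\<eta> ?F) a = Idn V (VMap Y a)" by simp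
  have "NMap (?q \<cdot>\<^bsub>M\<^esub> ?e) a = zero_arr V (VMap (LO ?F) a) (VMap (Cod M ?q) a)"
    unfolding M.is_cokernel_simps(4)[OF q] by simp
  then have qe: "NMap ?q a \<cdot> NMap ?e a = zero_arr V (VMap (LO ?F) a) (VMap (Cod M ?q) a)" by simp
  have "NMap ?q a = NMap ?q a \<cdot> (NMap ?e a \<cdot> NMap (\<eta> ?F) a)" unfolding ee by simp
  also have "\<dots> = zero_arr V (VMap (LO ?F) a) (VMap (Cod M ?q) a) \<cdot> NMap (\<eta> ?F) a"
    by (rule comp_reassoc[OF qe]) simp_all
  finally have "NMap ?q a = zero_arr V (VMap Y a) (VMap (Cod M ?q) a)" by simp
  then show "Idn V (VMap (Cod M ?q) a) = zero_arr V (VMap (Cod M ?q) a) (VMap (Cod M ?q) a)"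
    using epi_zero[OF epi_pointwise[OF M.cokernel_epi[OF q]], of a "Idn V (VMap (Cod M ?q) a)"] by simp
qed

text \<open>A triangle identity of the right adjunction makes the unit a split mono at each
  \<open>a\<close> in \<open>A\<close>, so the kernel arrow is both zero and mono there.\<close>

lemma iR_counit_S:
  assumes Y [simp]: "Y \<in> Obj M"
  shows "Dom M (iR_counit Y) \<in> S"
proof (rule S_I)
  let ?k = "iR_counit Y" and ?e = "ran_adj_unit Y" and ?F = "restrict_vfun A Y"
  note k = iR_counit[OF Y] and e [simp] = ran_adj_unit(1-3)[OF Y]
  note [simp] = M.is_kernel_simps(1-3)[OF k]
  show "Dom M ?k \<in> Obj M" by simp
  fix a assume a [simp]: "a \<in> A"
  have "NMap (\<epsilon> ?F \<cdot>\<^bsub>N\<^esub> FArr r ?e) a = Idn V (VMap Y a)"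
    unfolding ran_adj_unit(4)[OF Y] by simp
  then have ee: "NMap (\<epsilon> ?F) a \<cdot> NMap ?e a = Idn V (VMap Y a)" by simp
  have "NMap (?e \<cdot>\<^bsub>M\<^esub> ?k) a = zero_arr V (VMap (Dom M ?k) a) (VMap (RO ?F) a)"
    unfolding M.is_kernel_simps(4)[OF k] by simp
  then have ek: "NMap ?e a \<cdot> NMap ?k a = zero_arr V (VMap (Dom M ?k) a) (VMap (RO ?F) a)" by simp
  have "NMap (\<epsilon> ?F) a \<cdot> NMap ?e a \<cdot> NMap ?k a = Idn V (VMap Y a) \<cdot> NMap ?k a"
    by (rule comp_reassoc[OF ee]) simp_all
  then have "NMap ?k a = zero_arr V (VMap (Dom M ?k) a) (VMap Y a)" unfolding ek by simp
  then show "Idn V (VMap (Dom M ?k) a) = zero_arr V (VMap (Dom M ?k) a) (VMap (Dom M ?k) a)"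
    using mono_zero[OF mono_pointwise[OF M.kernel_mono[OF k]], of a "Idn V (VMap (Dom M ?k) a)"] by simp
qed

lemma category_B: "category B"
  by (rule M.category_full_subcat)

text \<open>An arrow from \<open>Y\<close> to a member \<open>W\<close> of \<open>S\<close> kills
  the counit, because the composite transposes to an arrow into the restriction of \<open>W\<close>,
  which is zero; so it factors uniquely through the cokernel.\<close>

lemma iL_universal: "Universal_from M B inclusion_functor (\<lambda>Y. Cod M (iL_unit Y)) iL_unit"
proof (intro Universal_from.intro Category.intro category_M category_B Universal_from_axioms.intro)
  show "is_functor B M inclusion_functor"
    using inclusion_additive by (simp add: additive_functor_def)
  fix Y assume Y [simp]: "Y \<in> Obj M"
  note q = iL_unit[OF Y] and e [simp] = lan_counit(1-3)[OF Y]
  note [simp] = M.is_cokernel_simps(1-3)[OF q]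
  show "Cod M (iL_unit Y) \<in> Obj B" using iL_unit_S by simp
  show "iL_unit Y \<in> Hom M Y (FObj inclusion_functor (Cod M (iL_unit Y)))" by simp
  fix W f assume WB: "W \<in> Obj B" and f0: "f \<in> Hom M Y (FObj inclusion_functor W)"
  have W: "W \<in> S" using WB by simp
  have Wo [simp]: "W \<in> Obj M" using W by (simp add: S_iff)
  have f [simp]: "f \<in> Arr M" "Dom M f = Y" "Cod M f = W" using f0 by simp_all
  have "f \<cdot>\<^bsub>M\<^esub> lan_counit Y = zero_arr M (LO (restrict_vfun A Y)) W"
  proof (rule L.unit_cancel[of _ _ "restrict_vfun A Y"])
    show "FArr r (f \<cdot>\<^bsub>M\<^esub> lan_counit Y) \<cdot>\<^bsub>N\<^esub> \<eta> (restrict_vfun A Y) =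
      FArr r (zero_arr M (LO (restrict_vfun A Y)) W) \<cdot>\<^bsub>N\<^esub> \<eta> (restrict_vfun A Y)"
      by (rule restrict_S_zero[OF W]) (simp_all del: L.r_simps(6) R.r_simps(6))
  qed simp_all
  then have "\<exists>!u. u \<in> Hom M (Cod M (iL_unit Y)) W \<and> u \<cdot>\<^bsub>M\<^esub> iL_unit Y = f"
    using M.cokernel_ex1[OF q, of f] by simp
  then show "\<exists>!g. g \<in> Hom B (Cod M (iL_unit Y)) W \<and> FArr inclusion_functor g \<cdot>\<^bsub>M\<^esub> iL_unit Y = f"
    using W iL_unit_S[OF Y] by (simp add: Hom_B del: Hom_iff)
qed

text \<open>The composite transposes to an arrow out of the restriction of \<open>Dom M f\<close>,
  which is zero.\<close>

lemma ran_adj_unit_comp_zero: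
  assumes Y [simp]: "Y \<in> Obj M" and f [simp]: "f \<in> Arr M" "Cod M f = Y" and W: "Dom M f \<in> S"
  shows "ran_adj_unit Y \<cdot>\<^bsub>M\<^esub> f = zero_arr M (Dom M f) (RO (restrict_vfun A Y))"
proof (rule R.counit_cancel[of _ _ "restrict_vfun A Y"])
  note e [simp] = ran_adj_unit(1-3)[OF Y]
  show "\<epsilon> (restrict_vfun A Y) \<cdot>\<^bsub>N\<^esub> FArr r (ran_adj_unit Y \<cdot>\<^bsub>M\<^esub> f) =
    \<epsilon> (restrict_vfun A Y) \<cdot>\<^bsub>N\<^esub> FArr r (zero_arr M (Dom M f) (RO (restrict_vfun A Y)))"
    by (rule restrict_S_zero[OF W]) (simp_all del: L.r_simps(6) R.r_simps(6))
qed (use ran_adj_unit[OF Y] in simp_all)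

text \<open>Every subobject lying in \<open>S\<close> is killed by the unit and hence factors
  through its kernel; so the right adjoint of the inclusion is the torsion functor.\<close>

lemma iR_largest:
  assumes Y [simp]: "Y \<in> Obj M"
  shows "is_largest_subobject_in M S Y (Dom M (iR_counit Y)) (iR_counit Y)"
  unfolding is_largest_subobject_in_def
proof (intro conjI allI impI)
  note k = iR_counit[OF Y] and e [simp] = ran_adj_unit(1-3)[OF Y]
  note [simp] = M.is_kernel_simps(1-3)[OF k]
  show "Dom M (iR_counit Y) \<in> S" by (rule iR_counit_S[OF Y])
  show "mono_arr M (iR_counit Y)" by (rule M.kernel_mono[OF k])
  show "iR_counit Y \<in> Hom M (Dom M (iR_counit Y)) Y" by simp
  fix s assume s: "mono_arr M s \<and> Cod M s = Y \<and> Dom M s \<in> S"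
  then have sA: "s \<in> Arr M" "Cod M s = Y" "Dom M s \<in> S" using M.mono_ArrD by blast+
  obtain u where "u \<in> Arr M" "Dom M u = Dom M s" "Cod M u = Dom M (iR_counit Y)" "iR_counit Y \<cdot>\<^bsub>M\<^esub> u = s"
    by (rule M.kernel_factor[OF k, of s]) (use sA ran_adj_unit_comp_zero[OF Y sA] in simp_all)
  then show "\<exists>u \<in> Hom M (Dom M s) (Dom M (iR_counit Y)). iR_counit Y \<cdot>\<^bsub>M\<^esub> u = s" by auto
qed

lemma iR_universal: "Universal_to M B inclusion_functor (\<lambda>Y. Dom M (iR_counit Y)) iR_counit"
proof (intro Universal_to.intro Category.intro category_M category_B Universal_to_axioms.intro)
  show "is_functor B M inclusion_functor"
    using inclusion_additive by (simp add: additive_functor_def)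
  fix Y assume Y [simp]: "Y \<in> Obj M"
  note k = iR_counit[OF Y] and e [simp] = ran_adj_unit(1-3)[OF Y]
  note [simp] = M.is_kernel_simps(1-3)[OF k]
  show "Dom M (iR_counit Y) \<in> Obj B" using iR_counit_S by simp
  show "iR_counit Y \<in> Hom M (FObj inclusion_functor (Dom M (iR_counit Y))) Y" by simp
  fix W f assume WB: "W \<in> Obj B" and f0: "f \<in> Hom M (FObj inclusion_functor W) Y"
  have W: "W \<in> S" using WB by simp
  have Wo [simp]: "W \<in> Obj M" using W by (simp add: S_iff)
  have f [simp]: "f \<in> Arr M" "Dom M f = W" "Cod M f = Y" using f0 by simp_all
  have "ran_adj_unit Y \<cdot>\<^bsub>M\<^esub> f = zero_arr M W (RO (restrict_vfun A Y))"
    using ran_adj_unit_comp_zero[of Y f] W by simp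
  then have "\<exists>!u. u \<in> Hom M W (Dom M (iR_counit Y)) \<and> iR_counit Y \<cdot>\<^bsub>M\<^esub> u = f"
    using M.kernel_ex1[OF k, of f] by simp
  then show "\<exists>!g. g \<in> Hom B W (Dom M (iR_counit Y)) \<and> iR_counit Y \<cdot>\<^bsub>M\<^esub> FArr inclusion_functor g = f"
    using W iR_counit_S[OF Y] by (simp add: Hom_B del: Hom_iff)
qed

lemma kernel_of_r:
  "{x \<in> Obj M. \<exists>b \<in> Obj B. isomorphic M (FObj inclusion_functor b) x} =
   {x \<in> Obj M. zero_object N (FObj r x)}"
proof -
  have 1: "zero_object N (FObj r x) \<longleftrightarrow> x \<in> S" if "x \<in> Obj M" for x
    using that by (simp add: N.zero_object_M S_iff)
  have 2: "(\<exists>b \<in> S. isomorphic M b x) \<longleftrightarrow> x \<in> S" if x: "x \<in> Obj M" for x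
  proof
    assume "\<exists>b \<in> S. isomorphic M b x"
    then obtain b f where "b \<in> S" "f \<in> Hom M b x" "iso_arr M f" unfolding isomorphic_def by blast
    \<comment> \<open>Closure under isomorphism is a special case of closure under
      quotients.\<close>
    then show "x \<in> S" using S_quot[OF M.iso_epi[of f]] by simp
  next
    assume "x \<in> S"
    moreover have "iso_arr M (Idn M x)"
      by (rule M.iso_arrI[of _ "Idn M x"]) (use x in simp_all)
    ultimately show "\<exists>b \<in> S. isomorphic M b x"
      unfolding isomorphic_def using x by (intro bexI[of _ x] bexI[of _ "Idn M x"]) simp_all
  qed
  show ?thesis unfolding B_simps inclusion_simps(1) using 1 2 by blast
qed

lemma recollement_exists:
  "\<exists>iL iR rL rR. recollement M B N inclusion_functor iL iR r rL rR \<and>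
     is_left_kan_extension V C A rL \<and> is_right_kan_extension V C A rR \<and> is_torsion_functor M S iR"
proof -
  interpret iL: Universal_from M B inclusion_functor "\<lambda>Y. Cod M (iL_unit Y)" iL_unit
    by (rule iL_universal)
  interpret iR: Universal_to M B inclusion_functor "\<lambda>Y. Dom M (iR_counit Y)" iR_counit
    by (rule iR_universal)
  have PB: "Preadditive B" by (rule PreadditiveI[OF M.preadditive_full_subcat])
  have PM: "Preadditive M" and PN: "Preadditive N" by unfold_locales
  \<comment> \<open>Full faithfulness of the left Kan extension is drawn from the counit of the
    right one.\<close>
  have eta_iso: "iso_arr N (\<eta> F)" if "F \<in> Obj N" for F
    by (rule unit_iso_of_counit_iso[OF L.Universal_from_axioms R.Universal_to_axioms counit_iso that])
  have "recollement M B N inclusion_functor iL.ladj iR.radj r L.ladj R.radj"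
    unfolding recollement_def
  proof (intro conjI)
    show "additive_functor M B iL.ladj"
      by (rule additive_ladj[OF iL_universal PM PB inclusion_additive])
    show "additive_functor M B iR.radj"
      by (rule additive_radj[OF iR_universal PM PB inclusion_additive])
    show "additive_functor N M L.ladj"
      by (rule additive_ladj[OF L.Universal_from_axioms PN PM additive_r])
    show "additive_functor N M R.radj"
      by (rule additive_radj[OF R.Universal_to_axioms PN PM additive_r])
    show "fully_faithful B M inclusion_functor"
      unfolding fully_faithful_def by (simp add: Hom_B inclusion_functor_def bij_betw_def del: Hom_iff)
    show "fully_faithful N M L.ladj" by (rule L.fully_faithful_ladj[OF eta_iso])
    show "fully_faithful N M R.radj" by (rule R.fully_faithful_radj[OF counit_iso])
  qed (rule abelian_M abelian_B N.abelian_M inclusion_additive additive_r iL.left_adjoint_ladj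
      iR.left_adjoint_radj L.left_adjoint_ladj R.left_adjoint_radj kernel_of_r)+
  moreover have "is_torsion_functor M S iR.radj"
    unfolding is_torsion_functor_def
  proof (intro conjI iR.functor_radj exI[of _ iR_counit] ballI)
    fix x assume "x \<in> Obj M"
    then show "is_largest_subobject_in M S x (FObj iR.radj x) (iR_counit x)"
      unfolding iR.FObj_radj by (rule iR_largest)
  next
    fix f assume "f \<in> Arr M"
    then show "iR_counit (Cod M f) \<cdot>\<^bsub>M\<^esub> FArr iR.radj f = f \<cdot>\<^bsub>M\<^esub> iR_counit (Dom M f)"
      using iR.radj_arr(4)[of f] by simp
  qed
  ultimately show ?thesis using left_kan_extension right_kan_extension by blast
qed

end

theorem theorem1:
  fixes \<kappa> :: "'k rel"
    and V :: "('o, 'm) csmcat"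
    and C :: "('c, 'o, 'm) vcat"
    and A :: "'c set"
  assumes "universe \<kappa>"
    and "grothendieck \<kappa> V"
    and "closed_symmetric_monoidal V"
    and "vcategory V C"
    and "small \<kappa> (VObj C)"
    and "A \<subseteq> VObj C"
  shows "localizing \<kappa> (vfun_cat V C) (vanishing V C A) \<and>
    (\<exists>iL iR rL rR.
       recollement (vfun_cat V C)
         (full_subcat (vfun_cat V C) (vanishing V C A))
         (vfun_cat V (full_vsubcat C A))
         inclusion_functor iL iR (restriction_functor A) rL rR \<and>
       is_left_kan_extension V C A rL \<and>
       is_right_kan_extension V C A rR \<and>
       is_torsion_functor (vfun_cat V C) (vanishing V C A) iR)"
proof -
  have ab: "abelian V" using assms(2) by (simp add: grothendieck_def)
  then interpret Abelian V by (rule AbelianI)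
  interpret Restriction V C \<kappa> A
    by unfold_locales (use assms in simp_all)
  show ?thesis using localizing_S recollement_exists by blast
qed

end
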